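(* Let $X$ be an algebra for the operad $\mathcal{C}_2$ of little 2-cubes. Then the fundamental 2-groupoid $\Pi_2X$ has the structure of a braided monoidal bicategory.
   Context: Let $J=(0,1)$. The little 2-cubes operad $\mathcal{C}_2$ has as $\mathcal{C}_2(k)$ the space of $k$-tuples of embeddings $J^2\to J^2$ of the form $\alpha_1\times\alpha_2$ with $\alpha_i(t)=(y_i-x_i)t+x_i$, $0\le x_i<y_i\le1$, with pairwise disjoint images; $\mathcal{C}_2(0)$ is a point; operad multiplication is composition of maps and $\Sigma_k$ permutes the entries. Algebras are in (based) spaces in the usual sense: compatible maps $\mathcal{C}_2(k)\times X^k\to X$, the basepoint being given by $\mathcal{C}_2(0)$. For a space $X$, $\Pi_2X$ is the bicategory with objects the points of $X$, 1-cells the paths $[0,1]\to X$ (composed by concatenation at double speed, identities constant paths), 2-cells the homotopy classes, rel boundary, of endpoint-fixing homotopies between paths, with the usual reparametrization constraints. **Monoidal bicategories.** All notions are weak unless stated. A monoidal bicategory is a one-object tricategory in algebraic form: a bicategory $B$ with a functor $\otimes:B\times B\to B$ (written as juxtaposition), a unit $I$, adjoint equivalences $a:(xy)z\to x(yz)$, $l:Ix\to x$, $r:xI\to x$ (pseudonatural), and invertible modifications $\pi,\mu,\lambda,\rho$ satisfying the tricategory axioms. The right adjoint of an adjoint equivalence $f$ is written $f^{\bullet}$; 2-cells are replaced by their mates without change of name. **Braided monoidal bicategories.** A braiding on $B$ consists of an adjoint equivalence $R:\otimes\Rightarrow\otimes\circ\tau$ in $\mathbf{Bicat}(B\times B,B)$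 ($\tau$ interchanges the factors), with components $R_{A,B}:AB\to BA$, and invertible modifications with components $R_{(A|B,C)}:(1R_{A,C})\circ a\circ(R_{A,B}1)\Rightarrow a\circ R_{A,BC}\circ a$ (1-cells $(AB)C\to B(CA)$) and $R_{(A,B|C)}:(R_{A,C}1)\circ a^{\bullet}\circ(1R_{B,C})\Rightarrow a^{\bullet}\circ R_{AB,C}\circ a^{\bullet}$ (1-cells $A(BC)\to(CA)B$), satisfying the following four equations between pasted 2-cells for all objects $A,B,C,D$. Associativity 1-cells $a,a^{\bullet}$ are suppressed below; they are inserted where needed, and the remaining regions of the pastings are filled with the canonical invertible cells of the structure ((mates of) $\pi$, pseudonaturality of $a,a^{\bullet},R$, functoriality of $\otimes$, units and counits of the adjoint equivalences). (1) From $(AB)(CD)$ to $((DA)B)C$: the composite $(R_{A,D}11)(1R_{B,D}1)(11R_{C,D})\Rightarrow(R_{A,D}1)(1R_{BC,D})\Rightarrow R_{ABC,D}$ given by $1\otimes R_{(B,C|D)}$ then $R_{(A,BC|D)}$ equals the composite through $(R_{AB,D}1)(1R_{C,D})$ given by $R_{(A,B|D)}\otimes1$ then $R_{(AB,C|D)}$. (2) From $(AB)(CD)$ to $(BC)(DA)$: the composite $(11R_{A,D})(1R_{A,C}1)(R_{A,B}11)\Rightarrow(1R_{A,CD})(R_{A,B}1)\Rightarrow R_{A,BCD}$ given by $1\otimes R_{(A|C,D)}$ then $R_{(A|B,CD)}$ equals the composite through $(1R_{A,D})(R_{A,BC}1)$ given by $R_{(A|B,C)}\otimes1$ then $R_{(A|BC,D)}$.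 (3) From $(A(BC))D$ to $C((DA)B)$: the composite $(1R_{A,D}1)(11R_{B,D})(R_{A,C}11)(1R_{B,C}1)\Rightarrow(1R_{AB,D})(R_{AB,C}1)\Rightarrow R_{AB,CD}$ given by $1\otimes R_{(A,B|D)}$ and $R_{(A,B|C)}\otimes1$, then $R_{(AB|C,D)}$, equals the composite which first interchanges $(11R_{B,D})(R_{A,C}11)\cong(R_{A,C}11)(11R_{B,D})$, then applies $R_{(A|C,D)}\otimes1$ and $1\otimes R_{(B|C,D)}$ to reach $(R_{A,CD}1)(1R_{B,CD})$, then applies $R_{(A,B|CD)}$. (4) From $(AB)C$ to $C(BA)$: the composite $(R_{B,C}1)(1R_{A,C})(R_{A,B}1)\Rightarrow(R_{B,C}1)R_{A,BC}\cong R_{A,CB}(1R_{B,C})\Rightarrow(1R_{A,B})(R_{A,C}1)(1R_{B,C})$ given by $R_{(A|B,C)}$, pseudonaturality of $R$, $R_{(A|C,B)}^{-1}$ equals the composite $(R_{B,C}1)(1R_{A,C})(R_{A,B}1)\Rightarrow R_{BA,C}(R_{A,B}1)\cong(1R_{A,B})R_{AB,C}\Rightarrow(1R_{A,B})(R_{A,C}1)(1R_{B,C})$ given by $R_{(B,A|C)}$, pseudonaturality of $R$, $R_{(A,B|C)}^{-1}$. A braided monoidal bicategory is a monoidal bicategory with a braiding. *)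

theory Defs
  imports "HOL-Analysis.Analysis"
begin

section \<open>Bicategories\<close>

text \<open>Composition of 1-cells and 2-cells is written in the applicative order throughout:
  \<open>Comp B g f\<close> is \<open>f\<close> followed by \<open>g\<close>.\<close>

record ('o, 'm, 'c) bicat =
  Ob :: "'o set"
  Ar :: "'m set"
  Cells :: "'c set"
  Src :: "'m \<Rightarrow> 'o"
  Trg :: "'m \<Rightarrow> 'o"
  Src2 :: "'c \<Rightarrow> 'm"
  Trg2 :: "'c \<Rightarrow> 'm"
  Id1 :: "'o \<Rightarrow> 'm"
  Comp :: "'m \<Rightarrow> 'm \<Rightarrow> 'm"
  Id2 :: "'m \<Rightarrow> 'c"
  VComp :: "'c \<Rightarrow> 'c \<Rightarrow> 'c"
  HComp :: "'c \<Rightarrow> 'c \<Rightarrow> 'c"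
  Assoc :: "'m \<Rightarrow> 'm \<Rightarrow> 'm \<Rightarrow> 'c"
  LUnit :: "'m \<Rightarrow> 'c"
  RUnit :: "'m \<Rightarrow> 'c"

definition in1 :: "('o, 'm, 'c) bicat \<Rightarrow> 'm \<Rightarrow> 'o \<Rightarrow> 'o \<Rightarrow> bool" where
  "in1 B f x y \<longleftrightarrow> f \<in> Ar B \<and> Src B f = x \<and> Trg B f = y"

definition in2 :: "('o, 'm, 'c) bicat \<Rightarrow> 'c \<Rightarrow> 'm \<Rightarrow> 'm \<Rightarrow> bool" where
  "in2 B \<alpha> f g \<longleftrightarrow> \<alpha> \<in> Cells B \<and> Src2 B \<alpha> = f \<and> Trg2 B \<alpha> = g"

definition inverse2 :: "('o, 'm, 'c) bicat \<Rightarrow> 'c \<Rightarrow> 'c \<Rightarrow> bool" where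
  "inverse2 B \<alpha> \<beta> \<longleftrightarrow> in2 B \<beta> (Trg2 B \<alpha>) (Src2 B \<alpha>) \<and>
     VComp B \<beta> \<alpha> = Id2 B (Src2 B \<alpha>) \<and> VComp B \<alpha> \<beta> = Id2 B (Trg2 B \<alpha>)"

definition iso2 :: "('o, 'm, 'c) bicat \<Rightarrow> 'c \<Rightarrow> 'm \<Rightarrow> 'm \<Rightarrow> bool" where
  "iso2 B \<alpha> f g \<longleftrightarrow> in2 B \<alpha> f g \<and> (\<exists>\<beta>. inverse2 B \<alpha> \<beta>)"

definition Inv2 :: "('o, 'm, 'c) bicat \<Rightarrow> 'c \<Rightarrow> 'c" where
  "Inv2 B \<alpha> = (THE \<beta>. inverse2 B \<alpha> \<beta>)"

locale bicategory =
  fixes B :: "('o, 'm, 'c) bicat"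
  assumes Ar_Ob: "f \<in> Ar B \<Longrightarrow> Src B f \<in> Ob B \<and> Trg B f \<in> Ob B"
    and Cells_Ar: "\<alpha> \<in> Cells B \<Longrightarrow> Src2 B \<alpha> \<in> Ar B \<and> Trg2 B \<alpha> \<in> Ar B"
    and Cells_parallel: "\<alpha> \<in> Cells B \<Longrightarrow>
      Src B (Src2 B \<alpha>) = Src B (Trg2 B \<alpha>) \<and> Trg B (Src2 B \<alpha>) = Trg B (Trg2 B \<alpha>)"
    and Id1_in: "x \<in> Ob B \<Longrightarrow> in1 B (Id1 B x) x x"
    and Comp_in: "\<lbrakk>in1 B f x y; in1 B g y z\<rbrakk> \<Longrightarrow> in1 B (Comp B g f) x z"
    and Id2_in: "f \<in> Ar B \<Longrightarrow> in2 B (Id2 B f) f f"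
    and VComp_in: "\<lbrakk>in2 B \<alpha> f g; in2 B \<beta> g h\<rbrakk> \<Longrightarrow> in2 B (VComp B \<beta> \<alpha>) f h"
    and VComp_id: "in2 B \<alpha> f g \<Longrightarrow> VComp B \<alpha> (Id2 B f) = \<alpha> \<and> VComp B (Id2 B g) \<alpha> = \<alpha>"
    and VComp_assoc: "\<lbrakk>in2 B \<alpha> f g; in2 B \<beta> g h; in2 B \<gamma> h k\<rbrakk> \<Longrightarrow>
      VComp B (VComp B \<gamma> \<beta>) \<alpha> = VComp B \<gamma> (VComp B \<beta> \<alpha>)"
    and HComp_in: "\<lbrakk>in2 B \<alpha> f f'; in2 B \<beta> g g'; Trg B f = Src B g\<rbrakk> \<Longrightarrow>
      in2 B (HComp B \<beta> \<alpha>) (Comp B g f) (Comp B g' f')"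
    and HComp_id: "\<lbrakk>in1 B f x y; in1 B g y z\<rbrakk> \<Longrightarrow>
      HComp B (Id2 B g) (Id2 B f) = Id2 B (Comp B g f)"
    and interchange: "\<lbrakk>in2 B \<alpha> f f'; in2 B \<alpha>' f' f''; in2 B \<beta> g g'; in2 B \<beta>' g' g'';
        Trg B f = Src B g\<rbrakk> \<Longrightarrow>
      HComp B (VComp B \<beta>' \<beta>) (VComp B \<alpha>' \<alpha>) = VComp B (HComp B \<beta>' \<alpha>') (HComp B \<beta> \<alpha>)"
    and Assoc_iso: "\<lbrakk>in1 B f w x; in1 B g x y; in1 B h y z\<rbrakk> \<Longrightarrow>
      iso2 B (Assoc B h g f) (Comp B (Comp B h g) f) (Comp B h (Comp B g f))"
    and LUnit_iso: "in1 B f x y \<Longrightarrow> iso2 B (LUnit B f) (Comp B (Id1 B y) f) f"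
    and RUnit_iso: "in1 B f x y \<Longrightarrow> iso2 B (RUnit B f) (Comp B f (Id1 B x)) f"
    and Assoc_natural: "\<lbrakk>in2 B \<alpha> f f'; in2 B \<beta> g g'; in2 B \<gamma> h h';
        Trg B f = Src B g; Trg B g = Src B h\<rbrakk> \<Longrightarrow>
      VComp B (Assoc B h' g' f') (HComp B (HComp B \<gamma> \<beta>) \<alpha>) =
      VComp B (HComp B \<gamma> (HComp B \<beta> \<alpha>)) (Assoc B h g f)"
    and LUnit_natural: "in2 B \<alpha> f f' \<Longrightarrow>
      VComp B (LUnit B f') (HComp B (Id2 B (Id1 B (Trg B f))) \<alpha>) = VComp B \<alpha> (LUnit B f)"
    and RUnit_natural: "in2 B \<alpha> f f' \<Longrightarrow>
      VComp B (RUnit B f') (HComp B \<alpha> (Id2 B (Id1 B (Src B f)))) = VComp B \<alpha> (RUnit B f)"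
    and pentagon: "\<lbrakk>in1 B f v w; in1 B g w x; in1 B h x y; in1 B k y z\<rbrakk> \<Longrightarrow>
      VComp B (Assoc B k h (Comp B g f)) (Assoc B (Comp B k h) g f) =
      VComp B (HComp B (Id2 B k) (Assoc B h g f))
        (VComp B (Assoc B k (Comp B h g) f) (HComp B (Assoc B k h g) (Id2 B f)))"
    and triangle: "\<lbrakk>in1 B f x y; in1 B g y z\<rbrakk> \<Longrightarrow>
      VComp B (HComp B (Id2 B g) (LUnit B f)) (Assoc B g (Id1 B y) f) =
      HComp B (RUnit B g) (Id2 B f)"

definition prod_bicat ::
  "('o, 'm, 'c) bicat \<Rightarrow> ('p, 'n, 'd) bicat \<Rightarrow> ('o \<times> 'p, 'm \<times> 'n, 'c \<times> 'd) bicat"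
  (infixr "\<times>\<^sub>b" 80) where
  "B \<times>\<^sub>b C = \<lparr>
     Ob = Ob B \<times> Ob C,
     Ar = Ar B \<times> Ar C,
     Cells = Cells B \<times> Cells C,
     Src = map_prod (Src B) (Src C),
     Trg = map_prod (Trg B) (Trg C),
     Src2 = map_prod (Src2 B) (Src2 C),
     Trg2 = map_prod (Trg2 B) (Trg2 C),
     Id1 = map_prod (Id1 B) (Id1 C),
     Comp = (\<lambda>(g, g') (f, f'). (Comp B g f, Comp C g' f')),
     Id2 = map_prod (Id2 B) (Id2 C),
     VComp = (\<lambda>(\<beta>, \<beta>') (\<alpha>, \<alpha>'). (VComp B \<beta> \<alpha>, VComp C \<beta>' \<alpha>')),
     HComp = (\<lambda>(\<beta>, \<beta>') (\<alpha>, \<alpha>'). (HComp B \<beta> \<alpha>, HComp C \<beta>' \<alpha>')),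
     Assoc = (\<lambda>(h, h') (g, g') (f, f'). (Assoc B h g f, Assoc C h' g' f')),
     LUnit = map_prod (LUnit B) (LUnit C),
     RUnit = map_prod (RUnit B) (RUnit C)\<rparr>"


section \<open>Pasting\<close>

text \<open>A path of 1-cells is a start object together with a list of 1-cells in the order in which
  they are traversed; \<open>pcomp\<close> is its composite, bracketed as
  \<open>((k \<circ> h) \<circ> g) \<circ> f\<close> with \<open>f\<close> traversed first.
  A pasting cell \<open>PC x fs \<alpha> gs\<close> is a 2-cell \<open>\<alpha>\<close> from the composite of \<open>fs\<close> to the composite of \<open>gs\<close>,
  both starting at \<open>x\<close>.  By coherence for bicategories the result of a pasting does not depend on
  this choice of brackets.\<close>

fun pcomp :: "('o, 'm, 'c) bicat \<Rightarrow> 'o \<Rightarrow> 'm list \<Rightarrow> 'm" where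
  "pcomp B x [] = Id1 B x"
| "pcomp B x [f] = f"
| "pcomp B x (f # g # fs) = Comp B (pcomp B (Trg B f) (g # fs)) f"

definition path_end :: "('o, 'm, 'c) bicat \<Rightarrow> 'o \<Rightarrow> 'm list \<Rightarrow> 'o" where
  "path_end B x fs = (if fs = [] then x else Trg B (last fs))"

text \<open>The coherence cell from \<open>pcomp gs \<circ> pcomp fs\<close> to \<open>pcomp (fs @ gs)\<close>.\<close>

fun pcat :: "('o, 'm, 'c) bicat \<Rightarrow> 'o \<Rightarrow> 'm list \<Rightarrow> 'm list \<Rightarrow> 'c" where
  "pcat B x [] gs = RUnit B (pcomp B x gs)"
| "pcat B x [f] gs =
    (if gs = [] then LUnit B f else Id2 B (Comp B (pcomp B (Trg B f) gs) f))"
| "pcat B x (f # g # fs) gs =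
    VComp B (HComp B (pcat B (Trg B f) (g # fs) gs) (Id2 B f))
      (Inv2 B (Assoc B (pcomp B (path_end B x (f # g # fs)) gs)
        (pcomp B (Trg B f) (g # fs)) f))"

datatype ('o, 'm, 'c) pcell =
  PC (org: 'o) (top_path: "'m list") (cell: 'c) (bot_path: "'m list")

definition iso_pcell :: "('o, 'm, 'c) bicat \<Rightarrow> ('o, 'm, 'c) pcell \<Rightarrow> bool" where
  "iso_pcell B L \<longleftrightarrow> iso2 B (cell L) (pcomp B (org L) (top_path L)) (pcomp B (org L) (bot_path L))"

definition pid :: "('o, 'm, 'c) bicat \<Rightarrow> 'o \<Rightarrow> 'm list \<Rightarrow> ('o, 'm, 'c) pcell" where
  "pid B x fs = PC x fs (Id2 B (pcomp B x fs)) fs"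

definition pinv :: "('o, 'm, 'c) bicat \<Rightarrow> ('o, 'm, 'c) pcell \<Rightarrow> ('o, 'm, 'c) pcell" where
  "pinv B L = PC (org L) (bot_path L) (Inv2 B (cell L)) (top_path L)"

text \<open>The coherence cell from \<open>(pcomp qs \<circ> pcomp fs) \<circ> pcomp ps\<close> to \<open>pcomp (ps @ fs @ qs)\<close>.\<close>

definition pcat3 :: "('o, 'm, 'c) bicat \<Rightarrow> 'o \<Rightarrow> 'm list \<Rightarrow> 'm list \<Rightarrow> 'm list \<Rightarrow> 'c" where
  "pcat3 B x ps fs qs =
    VComp B (pcat B x ps (fs @ qs))
      (HComp B (pcat B (path_end B x ps) fs qs) (Id2 B (pcomp B x ps)))"

definition whisker ::
  "('o, 'm, 'c) bicat \<Rightarrow> 'm list \<Rightarrow> ('o, 'm, 'c) pcell \<Rightarrow> 'm list \<Rightarrow> ('o, 'm, 'c) pcell" where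
  "whisker B ps L qs =
    (let x = (if ps = [] then org L else Src B (hd ps));
         y = org L;
         z = path_end B y (top_path L)
     in PC x (ps @ top_path L @ qs)
          (VComp B (pcat3 B x ps (bot_path L) qs)
            (VComp B
              (HComp B (HComp B (Id2 B (pcomp B z qs)) (cell L)) (Id2 B (pcomp B x ps)))
              (Inv2 B (pcat3 B x ps (top_path L) qs))))
          (ps @ bot_path L @ qs))"

text \<open>\<open>paste B x fs [(n\<^sub>1, L\<^sub>1), (n\<^sub>2, L\<^sub>2), \<dots>]\<close> starts with the path \<open>fs\<close> and successively applies
  the cells \<open>L\<^sub>i\<close> to the current path, \<open>L\<^sub>i\<close> acting on the segment which begins after
  the first \<open>n\<^sub>i\<close> 1-cells.  It is only meaningful if that segment is the top path of \<open>L\<^sub>i\<close>.\<close>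

definition paste_step ::
  "('o, 'm, 'c) bicat \<Rightarrow> ('o, 'm, 'c) pcell \<Rightarrow> nat \<times> ('o, 'm, 'c) pcell \<Rightarrow> ('o, 'm, 'c) pcell" where
  "paste_step B M s =
    (case s of (n, L) \<Rightarrow>
      let W = whisker B (take n (bot_path M)) L (drop (n + length (top_path L)) (bot_path M))
      in PC (org M) (top_path M) (VComp B (cell W) (cell M)) (bot_path W))"

definition paste ::
  "('o, 'm, 'c) bicat \<Rightarrow> 'o \<Rightarrow> 'm list \<Rightarrow> (nat \<times> ('o, 'm, 'c) pcell) list \<Rightarrow> ('o, 'm, 'c) pcell" where
  "paste B x fs steps = foldl (paste_step B) (pid B x fs) steps"

text \<open>A pair of pasting cells is a pasting cell in the product if the lengths of the paths agree.\<close>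

fun pair_pcell ::
  "('o, 'm, 'c) pcell \<Rightarrow> ('p, 'n, 'd) pcell \<Rightarrow> ('o \<times> 'p, 'm \<times> 'n, 'c \<times> 'd) pcell" where
  "pair_pcell (PC x fs \<alpha> gs) (PC y hs \<beta> ks) = PC (x, y) (zip fs hs) (\<alpha>, \<beta>) (zip gs ks)"

text \<open>The interchange \<open>h \<circ> 1 \<cong> 1 \<circ> h\<close>, i.e. the naturality cell at \<open>h\<close> of an identity
  transformation.\<close>

definition slide_id :: "('o, 'm, 'c) bicat \<Rightarrow> 'm \<Rightarrow> ('o, 'm, 'c) pcell" where
  "slide_id B h =
    PC (Src B h) [Id1 B (Src B h), h] (VComp B (Inv2 B (LUnit B h)) (RUnit B h))
      [h, Id1 B (Trg B h)]"


section \<open>Pseudofunctors\<close>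

record ('o, 'm, 'c, 'p, 'n, 'd) pfunctor =
  F0 :: "'o \<Rightarrow> 'p"
  F1 :: "'m \<Rightarrow> 'n"
  F2 :: "'c \<Rightarrow> 'd"
  Fcomp :: "'m \<Rightarrow> 'm \<Rightarrow> 'd"
  Fid :: "'o \<Rightarrow> 'd"

locale pseudofunctor =
  fixes B :: "('o, 'm, 'c) bicat" and C :: "('p, 'n, 'd) bicat"
    and F :: "('o, 'm, 'c, 'p, 'n, 'd) pfunctor"
  assumes F0_in: "x \<in> Ob B \<Longrightarrow> F0 F x \<in> Ob C"
    and F1_in: "in1 B f x y \<Longrightarrow> in1 C (F1 F f) (F0 F x) (F0 F y)"
    and F2_in: "in2 B \<alpha> f g \<Longrightarrow> in2 C (F2 F \<alpha>) (F1 F f) (F1 F g)"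
    and F2_id: "f \<in> Ar B \<Longrightarrow> F2 F (Id2 B f) = Id2 C (F1 F f)"
    and F2_comp: "\<lbrakk>in2 B \<alpha> f g; in2 B \<beta> g h\<rbrakk> \<Longrightarrow>
      F2 F (VComp B \<beta> \<alpha>) = VComp C (F2 F \<beta>) (F2 F \<alpha>)"
    and Fcomp_iso: "\<lbrakk>in1 B f x y; in1 B g y z\<rbrakk> \<Longrightarrow>
      iso2 C (Fcomp F g f) (Comp C (F1 F g) (F1 F f)) (F1 F (Comp B g f))"
    and Fid_iso: "x \<in> Ob B \<Longrightarrow> iso2 C (Fid F x) (Id1 C (F0 F x)) (F1 F (Id1 B x))"
    and Fcomp_natural: "\<lbrakk>in2 B \<alpha> f f'; in2 B \<beta> g g'; Trg B f = Src B g\<rbrakk> \<Longrightarrow>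
      VComp C (F2 F (HComp B \<beta> \<alpha>)) (Fcomp F g f) =
      VComp C (Fcomp F g' f') (HComp C (F2 F \<beta>) (F2 F \<alpha>))"
    and Fcomp_assoc: "\<lbrakk>in1 B f w x; in1 B g x y; in1 B h y z\<rbrakk> \<Longrightarrow>
      VComp C (F2 F (Assoc B h g f))
        (VComp C (Fcomp F (Comp B h g) f) (HComp C (Fcomp F h g) (Id2 C (F1 F f)))) =
      VComp C (Fcomp F h (Comp B g f))
        (VComp C (HComp C (Id2 C (F1 F h)) (Fcomp F g f)) (Assoc C (F1 F h) (F1 F g) (F1 F f)))"
    and Fid_left: "in1 B f x y \<Longrightarrow>
      VComp C (F2 F (LUnit B f))
        (VComp C (Fcomp F (Id1 B y) f) (HComp C (Fid F y) (Id2 C (F1 F f)))) = LUnit C (F1 F f)"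
    and Fid_right: "in1 B f x y \<Longrightarrow>
      VComp C (F2 F (RUnit B f))
        (VComp C (Fcomp F f (Id1 B x)) (HComp C (Id2 C (F1 F f)) (Fid F x))) = RUnit C (F1 F f)"

definition pf_id :: "('o, 'm, 'c) bicat \<Rightarrow> ('o, 'm, 'c, 'o, 'm, 'c) pfunctor" where
  "pf_id B = \<lparr>F0 = (\<lambda>x. x), F1 = (\<lambda>f. f), F2 = (\<lambda>\<alpha>. \<alpha>),
     Fcomp = (\<lambda>g f. Id2 B (Comp B g f)), Fid = (\<lambda>x. Id2 B (Id1 B x))\<rparr>"

definition pf_comp ::
  "('q, 'k, 'e) bicat \<Rightarrow> ('p, 'n, 'd, 'q, 'k, 'e) pfunctor \<Rightarrow> ('o, 'm, 'c, 'p, 'n, 'd) pfunctor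
    \<Rightarrow> ('o, 'm, 'c, 'q, 'k, 'e) pfunctor" where
  "pf_comp D G F = \<lparr>F0 = (\<lambda>x. F0 G (F0 F x)), F1 = (\<lambda>f. F1 G (F1 F f)), F2 = (\<lambda>\<alpha>. F2 G (F2 F \<alpha>)),
     Fcomp = (\<lambda>g f. VComp D (F2 G (Fcomp F g f)) (Fcomp G (F1 F g) (F1 F f))),
     Fid = (\<lambda>x. VComp D (F2 G (Fid F x)) (Fid G (F0 F x)))\<rparr>"

definition pf_prod ::
  "('o, 'm, 'c, 'p, 'n, 'd) pfunctor \<Rightarrow> ('o2, 'm2, 'c2, 'p2, 'n2, 'd2) pfunctor
    \<Rightarrow> ('o \<times> 'o2, 'm \<times> 'm2, 'c \<times> 'c2, 'p \<times> 'p2, 'n \<times> 'n2, 'd \<times> 'd2) pfunctor" where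
  "pf_prod F G = \<lparr>F0 = map_prod (F0 F) (F0 G), F1 = map_prod (F1 F) (F1 G),
     F2 = map_prod (F2 F) (F2 G),
     Fcomp = (\<lambda>(g, g') (f, f'). (Fcomp F g f, Fcomp G g' f')),
     Fid = map_prod (Fid F) (Fid G)\<rparr>"

definition pf_swap ::
  "('o, 'm, 'c) bicat \<Rightarrow> ('o \<times> 'o, 'm \<times> 'm, 'c \<times> 'c, 'o \<times> 'o, 'm \<times> 'm, 'c \<times> 'c) pfunctor" where
  "pf_swap B = \<lparr>F0 = prod.swap, F1 = prod.swap, F2 = prod.swap,
     Fcomp = (\<lambda>(g, g') (f, f'). (Id2 B (Comp B g' f'), Id2 B (Comp B g f))),
     Fid = (\<lambda>(x, y). (Id2 B (Id1 B y), Id2 B (Id1 B x)))\<rparr>"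

definition pf_reassoc ::
  "('o, 'm, 'c) bicat \<Rightarrow>
    ('o \<times> 'o \<times> 'o, 'm \<times> 'm \<times> 'm, 'c \<times> 'c \<times> 'c,
     ('o \<times> 'o) \<times> 'o, ('m \<times> 'm) \<times> 'm, ('c \<times> 'c) \<times> 'c) pfunctor" where
  "pf_reassoc B = \<lparr>F0 = (\<lambda>(x, y, z). ((x, y), z)), F1 = (\<lambda>(f, g, h). ((f, g), h)),
     F2 = (\<lambda>(\<alpha>, \<beta>, \<gamma>). ((\<alpha>, \<beta>), \<gamma>)),
     Fcomp = (\<lambda>(f', g', h') (f, g, h).
       ((Id2 B (Comp B f' f), Id2 B (Comp B g' g)), Id2 B (Comp B h' h))),
     Fid = (\<lambda>(x, y, z). ((Id2 B (Id1 B x), Id2 B (Id1 B y)), Id2 B (Id1 B z)))\<rparr>"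

text \<open>The pseudofunctors \<open>x \<mapsto> (A, x)\<close> and \<open>x \<mapsto> (x, A)\<close>.\<close>

definition pf_pairl ::
  "('o, 'm, 'c) bicat \<Rightarrow> 'o \<Rightarrow> ('o, 'm, 'c, 'o \<times> 'o, 'm \<times> 'm, 'c \<times> 'c) pfunctor" where
  "pf_pairl B A = \<lparr>F0 = (\<lambda>x. (A, x)), F1 = (\<lambda>f. (Id1 B A, f)), F2 = (\<lambda>\<alpha>. (Id2 B (Id1 B A), \<alpha>)),
     Fcomp = (\<lambda>g f. (LUnit B (Id1 B A), Id2 B (Comp B g f))),
     Fid = (\<lambda>x. (Id2 B (Id1 B A), Id2 B (Id1 B x)))\<rparr>"

definition pf_pairr ::
  "('o, 'm, 'c) bicat \<Rightarrow> 'o \<Rightarrow> ('o, 'm, 'c, 'o \<times> 'o, 'm \<times> 'm, 'c \<times> 'c) pfunctor" where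
  "pf_pairr B A = \<lparr>F0 = (\<lambda>x. (x, A)), F1 = (\<lambda>f. (f, Id1 B A)), F2 = (\<lambda>\<alpha>. (\<alpha>, Id2 B (Id1 B A))),
     Fcomp = (\<lambda>g f. (Id2 B (Comp B g f), LUnit B (Id1 B A))),
     Fid = (\<lambda>x. (Id2 B (Id1 B x), Id2 B (Id1 B A)))\<rparr>"

text \<open>The coherence cell from the composite of the images of \<open>fs\<close> to the image of the composite,
  and the image of a pasting cell under a pseudofunctor into \<open>C\<close>.\<close>

fun pf_path ::
  "('o, 'm, 'c) bicat \<Rightarrow> ('p, 'n, 'd) bicat \<Rightarrow> ('o, 'm, 'c, 'p, 'n, 'd) pfunctor
    \<Rightarrow> 'o \<Rightarrow> 'm list \<Rightarrow> 'd" where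
  "pf_path B C F x [] = Fid F x"
| "pf_path B C F x [f] = Id2 C (F1 F f)"
| "pf_path B C F x (f # g # fs) =
    VComp C (Fcomp F (pcomp B (Trg B f) (g # fs)) f)
      (HComp C (pf_path B C F (Trg B f) (g # fs)) (Id2 C (F1 F f)))"

definition pf_image ::
  "('o, 'm, 'c) bicat \<Rightarrow> ('p, 'n, 'd) bicat \<Rightarrow> ('o, 'm, 'c, 'p, 'n, 'd) pfunctor
    \<Rightarrow> ('o, 'm, 'c) pcell \<Rightarrow> ('p, 'n, 'd) pcell" where
  "pf_image B C F L =
    PC (F0 F (org L)) (map (F1 F) (top_path L))
      (VComp C (Inv2 C (pf_path B C F (org L) (bot_path L)))
        (VComp C (F2 F (cell L)) (pf_path B C F (org L) (top_path L))))
      (map (F1 F) (bot_path L))"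


section \<open>Pseudonatural transformations and modifications\<close>

text \<open>For \<open>\<sigma> : F \<Rightarrow> G\<close> and \<open>f : x \<rightarrow> y\<close> the naturality cell \<open>tnat \<sigma> f\<close> is a 2-cell
  \<open>G f \<circ> \<sigma>\<^sub>x \<Rightarrow> \<sigma>\<^sub>y \<circ> F f\<close>; \<open>tsquare\<close> is this cell as a pasting cell from the path
  \<open>[\<sigma>\<^sub>x, G f]\<close> to the path \<open>[F f, \<sigma>\<^sub>y]\<close>.\<close>

record ('o, 'm, 'n, 'd) ptrans =
  tcomp :: "'o \<Rightarrow> 'n"
  tnat :: "'m \<Rightarrow> 'd"

definition tsquare ::
  "('o, 'm, 'c) bicat \<Rightarrow> ('o, 'm, 'c, 'p, 'n, 'd) pfunctor \<Rightarrow> ('o, 'm, 'c, 'p, 'n, 'd) pfunctor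
    \<Rightarrow> ('o, 'm, 'n, 'd) ptrans \<Rightarrow> 'm \<Rightarrow> ('p, 'n, 'd) pcell" where
  "tsquare B F G \<sigma> f =
    PC (F0 F (Src B f)) [tcomp \<sigma> (Src B f), F1 G f] (tnat \<sigma> f) [F1 F f, tcomp \<sigma> (Trg B f)]"

locale pseudonatural =
  fixes B :: "('o, 'm, 'c) bicat" and C :: "('p, 'n, 'd) bicat"
    and F G :: "('o, 'm, 'c, 'p, 'n, 'd) pfunctor" and \<sigma> :: "('o, 'm, 'n, 'd) ptrans"
  assumes tcomp_in: "x \<in> Ob B \<Longrightarrow> in1 C (tcomp \<sigma> x) (F0 F x) (F0 G x)"
    and tnat_iso: "in1 B f x y \<Longrightarrow>
      iso2 C (tnat \<sigma> f) (Comp C (F1 G f) (tcomp \<sigma> x)) (Comp C (tcomp \<sigma> y) (F1 F f))"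
    and tnat_natural: "\<lbrakk>in1 B f x y; in2 B \<alpha> f g\<rbrakk> \<Longrightarrow>
      VComp C (tnat \<sigma> g) (HComp C (F2 G \<alpha>) (Id2 C (tcomp \<sigma> x))) =
      VComp C (HComp C (Id2 C (tcomp \<sigma> y)) (F2 F \<alpha>)) (tnat \<sigma> f)"
    and tnat_comp: "\<lbrakk>in1 B f x y; in1 B g y z\<rbrakk> \<Longrightarrow>
      paste C (F0 F x) [tcomp \<sigma> x, F1 G f, F1 G g]
        [(1, PC (F0 G x) [F1 G f, F1 G g] (Fcomp G g f) [F1 G (Comp B g f)]),
         (0, tsquare B F G \<sigma> (Comp B g f))] =
      paste C (F0 F x) [tcomp \<sigma> x, F1 G f, F1 G g]
        [(0, tsquare B F G \<sigma> f),
         (1, tsquare B F G \<sigma> g),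
         (0, PC (F0 F x) [F1 F f, F1 F g] (Fcomp F g f) [F1 F (Comp B g f)])]"
    and tnat_id: "x \<in> Ob B \<Longrightarrow>
      paste C (F0 F x) [tcomp \<sigma> x]
        [(1, PC (F0 G x) [] (Fid G x) [F1 G (Id1 B x)]), (0, tsquare B F G \<sigma> (Id1 B x))] =
      paste C (F0 F x) [tcomp \<sigma> x]
        [(0, PC (F0 F x) [] (Fid F x) [F1 F (Id1 B x)])]"

text \<open>\<open>inv_modification B C G ss ts \<Gamma>\<close>: the invertible 2-cells \<open>\<Gamma> x\<close> form a modification between
  two composites \<open>\<sigma>\<^sub>1, \<dots>, \<sigma>\<^sub>n\<close> and \<open>\<tau>\<^sub>1, \<dots>, \<tau>\<^sub>m\<close> of pseudonatural transformations with common
  source and target pseudofunctors.  The lists \<open>ss\<close> and \<open>ts\<close> are the lists of the naturality squares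
  of the \<open>\<sigma>\<^sub>i\<close> and the \<open>\<tau>\<^sub>j\<close>, and \<open>G\<close> is the action of the target pseudofunctor on 1-cells;
  the naturality cell of a composite slides \<open>G f\<close> past its factors, the last one first.\<close>

definition slides :: "('m \<Rightarrow> ('p, 'n, 'd) pcell) list \<Rightarrow> 'm \<Rightarrow> (nat \<times> ('p, 'n, 'd) pcell) list" where
  "slides ss f = rev (List.enumerate 0 (map (\<lambda>s. s f) ss))"

definition inv_modification ::
  "('o, 'm, 'c) bicat \<Rightarrow> ('p, 'n, 'd) bicat \<Rightarrow> ('m \<Rightarrow> 'n)
    \<Rightarrow> ('m \<Rightarrow> ('p, 'n, 'd) pcell) list \<Rightarrow> ('m \<Rightarrow> ('p, 'n, 'd) pcell) list
    \<Rightarrow> ('o \<Rightarrow> ('p, 'n, 'd) pcell) \<Rightarrow> bool" where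
  "inv_modification B C G ss ts \<Gamma> \<longleftrightarrow>
    (\<forall>x\<in>Ob B. iso_pcell C (\<Gamma> x)) \<and>
    (\<forall>f\<in>Ar B. let x = Src B f; y = Trg B f; start = top_path (\<Gamma> x) @ [G f] in
      paste C (org (\<Gamma> x)) start (slides ss f @ [(1, \<Gamma> y)]) =
      paste C (org (\<Gamma> x)) start ((0, \<Gamma> x) # slides ts f))"

text \<open>An adjoint equivalence \<open>fwd \<stileturn> bwd\<close> in the bicategory of pseudofunctors from \<open>B\<close> to \<open>C\<close>,
  with unit \<open>1 \<Rightarrow> bwd \<circ> fwd\<close> and counit \<open>fwd \<circ> bwd \<Rightarrow> 1\<close>.\<close>

record ('o, 'm, 'n, 'd) adj_equiv =
  fwd :: "('o, 'm, 'n, 'd) ptrans"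
  bwd :: "('o, 'm, 'n, 'd) ptrans"
  unit_at :: "'o \<Rightarrow> 'd"
  counit_at :: "'o \<Rightarrow> 'd"

definition unit_pcell ::
  "('o, 'm, 'c, 'p, 'n, 'd) pfunctor \<Rightarrow> ('o, 'm, 'n, 'd) adj_equiv \<Rightarrow> 'o \<Rightarrow> ('p, 'n, 'd) pcell" where
  "unit_pcell F E x = PC (F0 F x) [] (unit_at E x) [tcomp (fwd E) x, tcomp (bwd E) x]"

definition counit_pcell ::
  "('o, 'm, 'c, 'p, 'n, 'd) pfunctor \<Rightarrow> ('o, 'm, 'n, 'd) adj_equiv \<Rightarrow> 'o \<Rightarrow> ('p, 'n, 'd) pcell" where
  "counit_pcell G E x = PC (F0 G x) [tcomp (bwd E) x, tcomp (fwd E) x] (counit_at E x) []"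

locale adjoint_equivalence =
  fixes B :: "('o, 'm, 'c) bicat" and C :: "('p, 'n, 'd) bicat"
    and F G :: "('o, 'm, 'c, 'p, 'n, 'd) pfunctor" and E :: "('o, 'm, 'n, 'd) adj_equiv"
  assumes source: "pseudofunctor B C F"
    and target: "pseudofunctor B C G"
    and forward: "pseudonatural B C F G (fwd E)"
    and backward: "pseudonatural B C G F (bwd E)"
    and unit_modification:
      "inv_modification B C (F1 F) [] [tsquare B F G (fwd E), tsquare B G F (bwd E)] (unit_pcell F E)"
    and counit_modification:
      "inv_modification B C (F1 G) [tsquare B G F (bwd E), tsquare B F G (fwd E)] [] (counit_pcell G E)"
    and triangle_fwd: "x \<in> Ob B \<Longrightarrow>
      paste C (F0 F x) [tcomp (fwd E) x] [(0, unit_pcell F E x), (1, counit_pcell G E x)] =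
      pid C (F0 F x) [tcomp (fwd E) x]"
    and triangle_bwd: "x \<in> Ob B \<Longrightarrow>
      paste C (F0 G x) [tcomp (bwd E) x] [(1, unit_pcell F E x), (0, counit_pcell G E x)] =
      pid C (F0 G x) [tcomp (bwd E) x]"


section \<open>Monoidal bicategories\<close>

record ('o, 'm, 'c) monoidal_data =
  Tensor :: "('o \<times> 'o, 'm \<times> 'm, 'c \<times> 'c, 'o, 'm, 'c) pfunctor"
  Unit :: 'o
  AssocE :: "('o \<times> 'o \<times> 'o, 'm \<times> 'm \<times> 'm, 'm, 'c) adj_equiv"
  LUnitE :: "('o, 'm, 'm, 'c) adj_equiv"
  RUnitE :: "('o, 'm, 'm, 'c) adj_equiv"
  PiM :: "'o \<Rightarrow> 'o \<Rightarrow> 'o \<Rightarrow> 'o \<Rightarrow> 'c"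
  MuM :: "'o \<Rightarrow> 'o \<Rightarrow> 'c"
  LambdaM :: "'o \<Rightarrow> 'o \<Rightarrow> 'c"
  RhoM :: "'o \<Rightarrow> 'o \<Rightarrow> 'c"

locale monoidal_structure =
  fixes B :: "('o, 'm, 'c) bicat" and M :: "('o, 'm, 'c) monoidal_data"
begin

abbreviation ten0 :: "'o \<Rightarrow> 'o \<Rightarrow> 'o" (infixr "\<odot>" 75) where
  "x \<odot> y \<equiv> F0 (Tensor M) (x, y)"

abbreviation ten1 :: "'m \<Rightarrow> 'm \<Rightarrow> 'm" (infixr "\<otimes>" 75) where
  "f \<otimes> g \<equiv> F1 (Tensor M) (f, g)"

abbreviation I :: 'o where "I \<equiv> Unit M"

abbreviation id1 :: "'o \<Rightarrow> 'm" ("\<iota>") where "\<iota> \<equiv> Id1 B"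

abbreviation inv :: "('o, 'm, 'c) pcell \<Rightarrow> ('o, 'm, 'c) pcell" where
  "inv \<equiv> pinv B"

definition tenl :: "'o \<Rightarrow> ('o, 'm, 'c, 'o, 'm, 'c) pfunctor" where
  "tenl x = pf_comp B (Tensor M) (pf_pairl B x)"

definition tenr :: "'o \<Rightarrow> ('o, 'm, 'c, 'o, 'm, 'c) pfunctor" where
  "tenr x = pf_comp B (Tensor M) (pf_pairr B x)"

text \<open>\<open>x \<rhd> L\<close> and \<open>L \<lhd> x\<close> are the pasting cells written \<open>1\<^sub>x L\<close> and \<open>L 1\<^sub>x\<close> in the literature;
  \<open>K \<boxtimes> L\<close> is the tensor product of pasting cells (with paths of equal length).\<close>

definition lwh :: "'o \<Rightarrow> ('o, 'm, 'c) pcell \<Rightarrow> ('o, 'm, 'c) pcell" (infixr "\<rhd>" 70) where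
  "x \<rhd> L = pf_image B B (tenl x) L"

definition rwh :: "('o, 'm, 'c) pcell \<Rightarrow> 'o \<Rightarrow> ('o, 'm, 'c) pcell" (infixl "\<lhd>" 70) where
  "L \<lhd> x = pf_image B B (tenr x) L"

definition tenp :: "('o, 'm, 'c) pcell \<Rightarrow> ('o, 'm, 'c) pcell \<Rightarrow> ('o, 'm, 'c) pcell"
    (infixr "\<boxtimes>" 70) where
  "K \<boxtimes> L = pf_image (B \<times>\<^sub>b B) B (Tensor M) (pair_pcell K L)"

abbreviation B3 where "B3 \<equiv> B \<times>\<^sub>b (B \<times>\<^sub>b B)"
abbreviation B4 where "B4 \<equiv> B \<times>\<^sub>b (B \<times>\<^sub>b (B \<times>\<^sub>b B))"

text \<open>\<open>(x, y, z) \<mapsto> (xy)z\<close> and \<open>(x, y, z) \<mapsto> x(yz)\<close>\<close>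

definition lbr :: "('o \<times> 'o \<times> 'o, 'm \<times> 'm \<times> 'm, 'c \<times> 'c \<times> 'c, 'o, 'm, 'c) pfunctor" where
  "lbr = pf_comp B (Tensor M)
     (pf_comp (B \<times>\<^sub>b B) (pf_prod (Tensor M) (pf_id B)) (pf_reassoc B))"

definition rbr :: "('o \<times> 'o \<times> 'o, 'm \<times> 'm \<times> 'm, 'c \<times> 'c \<times> 'c, 'o, 'm, 'c) pfunctor" where
  "rbr = pf_comp B (Tensor M) (pf_prod (pf_id B) (Tensor M))"

text \<open>\<open>a\<close> and its right adjoint \<open>b\<close>, i.e. \<open>a\<^sup>\<bullet>\<close>; likewise \<open>l\<close> and \<open>r\<close>, \<open>rb\<close> with \<open>rb\<close> for
  \<open>r\<^sup>\<bullet>\<close>.\<close>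

definition a :: "'o \<Rightarrow> 'o \<Rightarrow> 'o \<Rightarrow> 'm" where "a x y z = tcomp (fwd (AssocE M)) (x, y, z)"
definition b :: "'o \<Rightarrow> 'o \<Rightarrow> 'o \<Rightarrow> 'm" where "b x y z = tcomp (bwd (AssocE M)) (x, y, z)"
definition l :: "'o \<Rightarrow> 'm" where "l x = tcomp (fwd (LUnitE M)) x"
definition rb :: "'o \<Rightarrow> 'm" where "rb x = tcomp (bwd (RUnitE M)) x"

text \<open>\<open>\<eta>\<close> is a cell from \<open>[]\<close> to \<open>[a, b]\<close>, and \<open>\<epsilon>\<close> one from \<open>[b, a]\<close> to \<open>[]\<close>.\<close>

definition \<eta> :: "'o \<Rightarrow> 'o \<Rightarrow> 'o \<Rightarrow> ('o, 'm, 'c) pcell" where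
  "\<eta> x y z = unit_pcell lbr (AssocE M) (x, y, z)"
definition \<epsilon> :: "'o \<Rightarrow> 'o \<Rightarrow> 'o \<Rightarrow> ('o, 'm, 'c) pcell" where
  "\<epsilon> x y z = counit_pcell rbr (AssocE M) (x, y, z)"

definition nat_a :: "'m \<Rightarrow> 'm \<Rightarrow> 'm \<Rightarrow> ('o, 'm, 'c) pcell" where
  "nat_a f g h = tsquare B3 lbr rbr (fwd (AssocE M)) (f, g, h)"
definition nat_b :: "'m \<Rightarrow> 'm \<Rightarrow> 'm \<Rightarrow> ('o, 'm, 'c) pcell" where
  "nat_b f g h = tsquare B3 rbr lbr (bwd (AssocE M)) (f, g, h)"
definition nat_l :: "'m \<Rightarrow> ('o, 'm, 'c) pcell" where
  "nat_l f = tsquare B (tenl I) (pf_id B) (fwd (LUnitE M)) f"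
definition nat_rb :: "'m \<Rightarrow> ('o, 'm, 'c) pcell" where
  "nat_rb f = tsquare B (pf_id B) (tenr I) (bwd (RUnitE M)) f"

abbreviation sl :: "'m \<Rightarrow> ('o, 'm, 'c) pcell" where "sl \<equiv> slide_id B"

text \<open>The unit constraints of the tensor product, as cells \<open>(1\<^sub>x 1\<^sub>y) f \<Rightarrow> 1\<^bsub>xy\<^esub> f\<close> and
  \<open>f (1\<^sub>x 1\<^sub>y) \<Rightarrow> f 1\<^bsub>xy\<^esub>\<close>.\<close>

definition fuse_l :: "'o \<Rightarrow> 'o \<Rightarrow> 'm \<Rightarrow> ('o, 'm, 'c) pcell" where
  "fuse_l x y f = PC ((x \<odot> y) \<odot> Src B f) [(\<iota> x \<otimes> \<iota> y) \<otimes> f]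
     (F2 (Tensor M) (Inv2 B (Fid (Tensor M) (x, y)), Id2 B f)) [\<iota> (x \<odot> y) \<otimes> f]"

definition fuse_r :: "'m \<Rightarrow> 'o \<Rightarrow> 'o \<Rightarrow> ('o, 'm, 'c) pcell" where
  "fuse_r f x y = PC (Src B f \<odot> (x \<odot> y)) [f \<otimes> (\<iota> x \<otimes> \<iota> y)]
     (F2 (Tensor M) (Id2 B f, Inv2 B (Fid (Tensor M) (x, y)))) [f \<otimes> \<iota> (x \<odot> y)]"

definition \<pi> :: "'o \<Rightarrow> 'o \<Rightarrow> 'o \<Rightarrow> 'o \<Rightarrow> ('o, 'm, 'c) pcell" where
  "\<pi> x y z w = PC (((x \<odot> y) \<odot> z) \<odot> w)
     [a x y z \<otimes> \<iota> w, a x (y \<odot> z) w, \<iota> x \<otimes> a y z w]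
     (PiM M x y z w)
     [a (x \<odot> y) z w, a x y (z \<odot> w)]"

definition \<mu> :: "'o \<Rightarrow> 'o \<Rightarrow> ('o, 'm, 'c) pcell" where
  "\<mu> x y = PC (x \<odot> y) [rb x \<otimes> \<iota> y, a x I y, \<iota> x \<otimes> l y] (MuM M x y) []"

definition lam :: "'o \<Rightarrow> 'o \<Rightarrow> ('o, 'm, 'c) pcell" where
  "lam x y = PC ((I \<odot> x) \<odot> y) [l x \<otimes> \<iota> y] (LambdaM M x y) [a I x y, l (x \<odot> y)]"

definition rho :: "'o \<Rightarrow> 'o \<Rightarrow> ('o, 'm, 'c) pcell" where
  "rho x y = PC (x \<odot> y) [\<iota> x \<otimes> rb y] (RhoM M x y) [rb (x \<odot> y), a x y I]"

end

locale monoidal_bicategory = monoidal_structure B M + bicategory B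
  for B :: "('o, 'm, 'c) bicat" and M :: "('o, 'm, 'c) monoidal_data" +
  assumes tensor: "pseudofunctor (B \<times>\<^sub>b B) B (Tensor M)"
    and unit: "I \<in> Ob B"
    and assoc_equiv: "adjoint_equivalence B3 B lbr rbr (AssocE M)"
    and lunit_equiv: "adjoint_equivalence B B (tenl I) (pf_id B) (LUnitE M)"
    and runit_equiv: "adjoint_equivalence B B (tenr I) (pf_id B) (RUnitE M)"
    and pi_modification: "inv_modification B4 B
      (\<lambda>(f, g, h, k). f \<otimes> (g \<otimes> (h \<otimes> k)))
      [\<lambda>(f, g, h, k). nat_a f g h \<boxtimes> sl k,
       \<lambda>(f, g, h, k). nat_a f (g \<otimes> h) k,
       \<lambda>(f, g, h, k). sl f \<boxtimes> nat_a g h k]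
      [\<lambda>(f, g, h, k). nat_a (f \<otimes> g) h k,
       \<lambda>(f, g, h, k). nat_a f g (h \<otimes> k)]
      (\<lambda>(x, y, z, w). \<pi> x y z w)"
    and mu_modification: "inv_modification (B \<times>\<^sub>b B) B
      (\<lambda>(f, g). f \<otimes> g)
      [\<lambda>(f, g). nat_rb f \<boxtimes> sl g,
       \<lambda>(f, g). nat_a f (\<iota> I) g,
       \<lambda>(f, g). sl f \<boxtimes> nat_l g]
      []
      (\<lambda>(x, y). \<mu> x y)"
    and lambda_modification: "inv_modification (B \<times>\<^sub>b B) B
      (\<lambda>(f, g). f \<otimes> g)
      [\<lambda>(f, g). nat_l f \<boxtimes> sl g]
      [\<lambda>(f, g). nat_a (\<iota> I) f g,
       \<lambda>(f, g). nat_l (f \<otimes> g)]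
      (\<lambda>(x, y). lam x y)"
    and rho_modification: "inv_modification (B \<times>\<^sub>b B) B
      (\<lambda>(f, g). f \<otimes> (g \<otimes> \<iota> I))
      [\<lambda>(f, g). sl f \<boxtimes> nat_rb g]
      [\<lambda>(f, g). nat_rb (f \<otimes> g),
       \<lambda>(f, g). nat_a f g (\<iota> I)]
      (\<lambda>(x, y). rho x y)"
    \<comment> \<open>nonabelian 4-cocycle condition, from \<open>(((xy)z)w)v\<close> to \<open>x(y(z(wv)))\<close>\<close>
    and cocycle: "\<lbrakk>x \<in> Ob B; y \<in> Ob B; z \<in> Ob B; w \<in> Ob B; v \<in> Ob B\<rbrakk> \<Longrightarrow>
      let start = [(a x y z \<otimes> \<iota> w) \<otimes> \<iota> v, a x (y \<odot> z) w \<otimes> \<iota> v, (\<iota> x \<otimes> a y z w) \<otimes> \<iota> v,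
                   a x (y \<odot> (z \<odot> w)) v, \<iota> x \<otimes> a y (z \<odot> w) v, \<iota> x \<otimes> (\<iota> y \<otimes> a z w v)]
      in paste B ((((x \<odot> y) \<odot> z) \<odot> w) \<odot> v) start
          [(0, \<pi> x y z w \<lhd> v),
           (1, \<pi> x y (z \<odot> w) v),
           (2, nat_a (\<iota> x) (\<iota> y) (a z w v)),
           (2, fuse_l x y (a z w v)),
           (0, \<pi> (x \<odot> y) z w v)] =
         paste B ((((x \<odot> y) \<odot> z) \<odot> w) \<odot> v) start
          [(2, inv (nat_a (\<iota> x) (a y z w) (\<iota> v))),
           (3, x \<rhd> \<pi> y z w v),
           (1, \<pi> x (y \<odot> z) w v),
           (0, inv (nat_a (a x y z) (\<iota> w) (\<iota> v))),
           (1, fuse_r (a x y z) w v),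
           (1, \<pi> x y z (w \<odot> v))]"
    \<comment> \<open>left normalization, from \<open>(xy)z\<close> to \<open>x(yz)\<close>\<close>
    and left_normalization: "\<lbrakk>x \<in> Ob B; y \<in> Ob B; z \<in> Ob B\<rbrakk> \<Longrightarrow>
      let start = [(rb x \<otimes> \<iota> y) \<otimes> \<iota> z, a x I y \<otimes> \<iota> z, a x (I \<odot> y) z, \<iota> x \<otimes> a I y z,
                   \<iota> x \<otimes> l (y \<odot> z)]
      in paste B ((x \<odot> y) \<odot> z) start
          [(1, \<pi> x I y z),
           (0, inv (nat_a (rb x) (\<iota> y) (\<iota> z))),
           (1, fuse_r (rb x) y z),
           (1, \<mu> x (y \<odot> z))] =
         paste B ((x \<odot> y) \<odot> z) start
          [(3, inv (x \<rhd> lam y z)),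
           (2, nat_a (\<iota> x) (l y) (\<iota> z)),
           (0, \<mu> x y \<lhd> z)]"
    \<comment> \<open>right normalization, from \<open>(xy)z\<close> to \<open>x(yz)\<close>\<close>
    and right_normalization: "\<lbrakk>x \<in> Ob B; y \<in> Ob B; z \<in> Ob B\<rbrakk> \<Longrightarrow>
      let start = [(\<iota> x \<otimes> rb y) \<otimes> \<iota> z, a x (y \<odot> I) z, \<iota> x \<otimes> a y I z, \<iota> x \<otimes> (\<iota> y \<otimes> l z)]
      in paste B ((x \<odot> y) \<odot> z) start
          [(0, inv (nat_a (\<iota> x) (rb y) (\<iota> z))),
           (1, x \<rhd> \<mu> y z)] =
         paste B ((x \<odot> y) \<odot> z) start
          [(0, rho x y \<lhd> z),
           (1, \<pi> x y I z),
           (2, nat_a (\<iota> x) (\<iota> y) (l z)),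
           (2, fuse_l x y (l z)),
           (0, \<mu> (x \<odot> y) z)]"


section \<open>Braidings\<close>

record ('o, 'm, 'c) braiding_data =
  BraidE :: "('o \<times> 'o, 'm \<times> 'm, 'm, 'c) adj_equiv"
  Braid1 :: "'o \<Rightarrow> 'o \<Rightarrow> 'o \<Rightarrow> 'c"
  Braid2 :: "'o \<Rightarrow> 'o \<Rightarrow> 'o \<Rightarrow> 'c"

locale braided_structure = monoidal_structure B M
  for B :: "('o, 'm, 'c) bicat" and M :: "('o, 'm, 'c) monoidal_data" +
  fixes S :: "('o, 'm, 'c) braiding_data"
begin

definition R :: "'o \<Rightarrow> 'o \<Rightarrow> 'm" where "R x y = tcomp (fwd (BraidE S)) (x, y)"

definition nat_R :: "'m \<Rightarrow> 'm \<Rightarrow> ('o, 'm, 'c) pcell" where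
  "nat_R f g = tsquare (B \<times>\<^sub>b B) (Tensor M) (pf_comp B (Tensor M) (pf_swap B))
     (fwd (BraidE S)) (f, g)"

text \<open>\<open>R1 x y z\<close> is \<open>R\<^bsub>(x|y,z)\<^esub>\<close> and \<open>R2 x y z\<close> is \<open>R\<^bsub>(x,y|z)\<^esub>\<close>.\<close>

definition R1 :: "'o \<Rightarrow> 'o \<Rightarrow> 'o \<Rightarrow> ('o, 'm, 'c) pcell" where
  "R1 x y z = PC ((x \<odot> y) \<odot> z)
     [R x y \<otimes> \<iota> z, a y x z, \<iota> y \<otimes> R x z]
     (Braid1 S x y z)
     [a x y z, R x (y \<odot> z), a y z x]"

definition R2 :: "'o \<Rightarrow> 'o \<Rightarrow> 'o \<Rightarrow> ('o, 'm, 'c) pcell" where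
  "R2 x y z = PC (x \<odot> (y \<odot> z))
     [\<iota> x \<otimes> R y z, b x z y, R x z \<otimes> \<iota> y]
     (Braid2 S x y z)
     [b x y z, R (x \<odot> y) z, b z x y]"

text \<open>Mates of \<open>\<pi>\<close>:
  \<open>\<pi>1\<close> goes from \<open>x(y(zw))\<close> to \<open>((xy)z)w\<close>, \<open>\<pi>2\<close> from \<open>(xy)(zw)\<close> to \<open>(x(yz))w\<close>,
  \<open>\<pi>3\<close> from \<open>(xy)(zw)\<close> to \<open>x((yz)w)\<close>, and \<open>\<pi>4\<close> from \<open>(x(yz))w\<close> to \<open>(xy)(zw)\<close>.
  Their top and bottom paths are
  \<open>[1b, b, b1] \<Rightarrow> [b, b]\<close>, \<open>[b, a1] \<Rightarrow> [a, 1b, b]\<close>, \<open>[a, 1b] \<Rightarrow> [b, a1, a]\<close> and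
  \<open>[b1, a] \<Rightarrow> [a, 1a, b]\<close>.\<close>

definition \<pi>1 :: "'o \<Rightarrow> 'o \<Rightarrow> 'o \<Rightarrow> 'o \<Rightarrow> ('o, 'm, 'c) pcell" where
  "\<pi>1 x y z w = paste B (x \<odot> (y \<odot> (z \<odot> w)))
     [\<iota> x \<otimes> b y z w, b x (y \<odot> z) w, b x y z \<otimes> \<iota> w]
     [(0, inv (\<epsilon> x y (z \<odot> w))),
      (1, inv (\<epsilon> (x \<odot> y) z w)),
      (2, inv (\<pi> x y z w)),
      (4, inv (x \<rhd> \<eta> y z w)),
      (3, inv (\<eta> x (y \<odot> z) w)),
      (2, inv (\<eta> x y z \<lhd> w))]"

definition \<pi>2 :: "'o \<Rightarrow> 'o \<Rightarrow> 'o \<Rightarrow> 'o \<Rightarrow> ('o, 'm, 'c) pcell" where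
  "\<pi>2 x y z w = paste B ((x \<odot> y) \<odot> (z \<odot> w))
     [b (x \<odot> y) z w, a x y z \<otimes> \<iota> w]
     [(2, \<eta> x (y \<odot> z) w),
      (3, x \<rhd> \<eta> y z w),
      (1, \<pi> x y z w),
      (0, \<epsilon> (x \<odot> y) z w)]"

definition \<pi>3 :: "'o \<Rightarrow> 'o \<Rightarrow> 'o \<Rightarrow> 'o \<Rightarrow> ('o, 'm, 'c) pcell" where
  "\<pi>3 x y z w = paste B ((x \<odot> y) \<odot> (z \<odot> w))
     [a x y (z \<odot> w), \<iota> x \<otimes> b y z w]
     [(0, inv (\<epsilon> (x \<odot> y) z w)),
      (1, inv (\<pi> x y z w)),
      (3, inv (x \<rhd> \<eta> y z w))]"

definition \<pi>4 :: "'o \<Rightarrow> 'o \<Rightarrow> 'o \<Rightarrow> 'o \<Rightarrow> ('o, 'm, 'c) pcell" where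
  "\<pi>4 x y z w = paste B ((x \<odot> (y \<odot> z)) \<odot> w)
     [b x y z \<otimes> \<iota> w, a (x \<odot> y) z w]
     [(2, \<eta> x y (z \<odot> w)),
      (1, inv (\<pi> x y z w)),
      (0, \<epsilon> x y z \<lhd> w)]"

end

text \<open>In the four braiding axioms both pastings start with the composite of 1-cells \<open>start\<close>.\<close>

locale braided_monoidal_bicategory = braided_structure B M S + monoidal_bicategory B M
  for B :: "('o, 'm, 'c) bicat" and M :: "('o, 'm, 'c) monoidal_data"
    and S :: "('o, 'm, 'c) braiding_data" +
  assumes braid_equiv: "adjoint_equivalence (B \<times>\<^sub>b B) B
      (Tensor M) (pf_comp B (Tensor M) (pf_swap B)) (BraidE S)"
    and R1_modification: "inv_modification B3 B
      (\<lambda>(f, g, h). g \<otimes> (h \<otimes> f))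
      [\<lambda>(f, g, h). nat_R f g \<boxtimes> sl h,
       \<lambda>(f, g, h). nat_a g f h,
       \<lambda>(f, g, h). sl g \<boxtimes> nat_R f h]
      [\<lambda>(f, g, h). nat_a f g h,
       \<lambda>(f, g, h). nat_R f (g \<otimes> h),
       \<lambda>(f, g, h). nat_a g h f]
      (\<lambda>(x, y, z). R1 x y z)"
    and R2_modification: "inv_modification B3 B
      (\<lambda>(f, g, h). (h \<otimes> f) \<otimes> g)
      [\<lambda>(f, g, h). sl f \<boxtimes> nat_R g h,
       \<lambda>(f, g, h). nat_b f h g,
       \<lambda>(f, g, h). nat_R f h \<boxtimes> sl g]
      [\<lambda>(f, g, h). nat_b f g h,
       \<lambda>(f, g, h). nat_R (f \<otimes> g) h,
       \<lambda>(f, g, h). nat_b h f g]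
      (\<lambda>(x, y, z). R2 x y z)"
    \<comment> \<open>from \<open>(AB)(CD)\<close> to \<open>((DA)B)C\<close>\<close>
    and braid_1: "\<lbrakk>A \<in> Ob B; B' \<in> Ob B; C \<in> Ob B; D \<in> Ob B\<rbrakk> \<Longrightarrow>
      let start = [\<iota> (A \<odot> B') \<otimes> R C D, b (A \<odot> B') D C, a A B' D \<otimes> \<iota> C,
                   (\<iota> A \<otimes> R B' D) \<otimes> \<iota> C, b A D B' \<otimes> \<iota> C, (R A D \<otimes> \<iota> B') \<otimes> \<iota> C]
      in paste B ((A \<odot> B') \<odot> (C \<odot> D)) start
          [(0, inv (fuse_l A B' (R C D))),
           (1, \<pi>2 A B' D C),
           (0, inv (nat_a (\<iota> A) (\<iota> B') (R C D))),
           (3, nat_b (\<iota> A) (R B' D) (\<iota> C)),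
           (1, A \<rhd> R2 B' C D),
           (3, \<pi>1 A D B' C),
           (4, nat_b (R A D) (\<iota> B') (\<iota> C)),
           (4, fuse_r (R A D) B' C),
           (2, R2 A (B' \<odot> C) D),
           (0, inv (\<pi>2 A B' C D)),
           (1, inv (nat_R (a A B' C) (\<iota> D))),
           (3, inv (\<pi>1 D A B' C)),
           (2, inv (D \<rhd> \<eta> A B' C))] =
         paste B ((A \<odot> B') \<odot> (C \<odot> D)) start
          [(3, R2 A B' D \<lhd> C),
           (2, inv (\<eta> A B' D \<lhd> C)),
           (0, R2 (A \<odot> B') C D)]"
    \<comment> \<open>from \<open>(AB)(CD)\<close> to \<open>(BC)(DA)\<close>\<close>
    and braid_2: "\<lbrakk>A \<in> Ob B; B' \<in> Ob B; C \<in> Ob B; D \<in> Ob B\<rbrakk> \<Longrightarrow>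
      let start = [R A B' \<otimes> \<iota> (C \<odot> D), a B' A (C \<odot> D), \<iota> B' \<otimes> b A C D, \<iota> B' \<otimes> (R A C \<otimes> \<iota> D),
                   \<iota> B' \<otimes> a C A D, \<iota> B' \<otimes> (\<iota> C \<otimes> R A D), b B' C (D \<odot> A)]
      in paste B ((A \<odot> B') \<odot> (C \<odot> D)) start
          [(3, B' \<rhd> R1 A C D),
           (2, B' \<rhd> \<epsilon> A C D),
           (0, R1 A B' (C \<odot> D))] =
         paste B ((A \<odot> B') \<odot> (C \<odot> D)) start
          [(1, \<pi>3 B' A C D),
           (0, inv (fuse_r (R A B') C D)),
           (0, inv (nat_b (R A B') (\<iota> C) (\<iota> D))),
           (3, nat_a (\<iota> B') (R A C) (\<iota> D)),
           (1, R1 A B' C \<lhd> D),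
           (3, \<pi> B' C A D),
           (4, nat_a (\<iota> B') (\<iota> C) (R A D)),
           (4, fuse_l B' C (R A D)),
           (5, inv (\<eta> B' C (D \<odot> A))),
           (2, R1 A (B' \<odot> C) D),
           (0, inv (\<pi>3 A B' C D)),
           (1, inv (nat_R (\<iota> A) (b B' C D))),
           (2, \<pi>4 B' C D A)]"
    \<comment> \<open>from \<open>(A(BC))D\<close> to \<open>C((DA)B)\<close>\<close>
    and braid_3: "\<lbrakk>A \<in> Ob B; B' \<in> Ob B; C \<in> Ob B; D \<in> Ob B\<rbrakk> \<Longrightarrow>
      let start = [(\<iota> A \<otimes> R B' C) \<otimes> \<iota> D, b A C B' \<otimes> \<iota> D, (R A C \<otimes> \<iota> B') \<otimes> \<iota> D,
                   a (C \<odot> A) B' D, a C A (B' \<odot> D),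
                   \<iota> C \<otimes> (\<iota> A \<otimes> R B' D), \<iota> C \<otimes> b A D B', \<iota> C \<otimes> (R A D \<otimes> \<iota> B')]
      in paste B ((A \<odot> (B' \<odot> C)) \<odot> D) start
          [(5, C \<rhd> R2 A B' D),
           (0, R2 A B' C \<lhd> D),
           (3, inv (\<pi> C A B' D)),
           (2, \<epsilon> C A B' \<lhd> D),
           (3, inv (C \<rhd> \<eta> A B' D)),
           (1, R1 (A \<odot> B') C D)] =
         paste B ((A \<odot> (B' \<odot> C)) \<odot> D) start
          [(2, inv (nat_a (R A C) (\<iota> B') (\<iota> D))),
           (3, fuse_r (R A C) B' D),
           (4, nat_a (\<iota> C) (\<iota> A) (R B' D)),
           (4, fuse_l C A (R B' D)),
           (3, inv (sl (R A C)) \<boxtimes> sl (R B' D)),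
           (1, \<pi>4 A C B' D),
           (0, inv (nat_a (\<iota> A) (R B' C) (\<iota> D))),
           (4, inv (fuse_l A C (R B' D))),
           (3, nat_b (\<iota> A) (\<iota> C) (R B' D)),
           (6, \<pi>3 C A D B'),
           (5, inv (fuse_r (R A C) D B')),
           (5, inv (nat_b (R A C) (\<iota> D) (\<iota> B'))),
           (8, nat_a (\<iota> C) (R A D) (\<iota> B')),
           (1, A \<rhd> R1 B' C D),
           (6, R1 A C D \<lhd> B'),
           (4, inv (\<pi>1 A C D B')),
           (3, inv (A \<rhd> \<eta> C D B')),
           (4, \<epsilon> A C D \<lhd> B'),
           (2, R2 A B' (C \<odot> D)),
           (0, inv (\<pi>4 A B' C D)),
           (3, inv (\<pi>3 C D A B'))]"
    \<comment> \<open>from \<open>(AB)C\<close> to \<open>C(BA)\<close>\<close>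
    and braid_4: "\<lbrakk>A \<in> Ob B; B' \<in> Ob B; C \<in> Ob B\<rbrakk> \<Longrightarrow>
      let start = [R A B' \<otimes> \<iota> C, a B' A C, \<iota> B' \<otimes> R A C, b B' C A, R B' C \<otimes> \<iota> A, a C B' A]
      in paste B ((A \<odot> B') \<odot> C) start
          [(0, R1 A B' C),
           (2, inv (\<eta> B' C A)),
           (1, nat_R (\<iota> A) (R B' C)),
           (2, inv (\<epsilon> A C B')),
           (3, inv (R1 A C B'))] =
         paste B ((A \<odot> B') \<odot> C) start
          [(2, R2 B' A C),
           (1, inv (\<eta> B' A C)),
           (2, \<epsilon> C B' A),
           (0, inv (nat_R (R A B') (\<iota> C))),
           (0, \<eta> A B' C),
           (3, inv (\<epsilon> C A B')),
           (1, inv (R2 A B' C))]"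


section \<open>The fundamental 2-groupoid\<close>

text \<open>Paths and homotopies are functions on \<open>[0,1]\<close> and \<open>[0,1] \<times> [0,1]\<close>, made unique by the value
  \<open>undefined\<close> elsewhere.  A homotopy \<open>H (s, t)\<close> has homotopy parameter \<open>s\<close> and path parameter \<open>t\<close>.\<close>

definition paths :: "'a topology \<Rightarrow> (real \<Rightarrow> 'a) set" where
  "paths X = {p \<in> extensional {0..1}. pathin X p}"

definition path_homotopies :: "'a topology \<Rightarrow> (real \<times> real \<Rightarrow> 'a) set" where
  "path_homotopies X = {H \<in> extensional ({0..1} \<times> {0..1}).
     continuous_map (top_of_set ({0..1} \<times> {0..1})) X H \<and>
     (\<forall>s\<in>{0..1}. H (s, 0) = H (0, 0) \<and> H (s, 1) = H (0, 1))}"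

definition square_boundary :: "(real \<times> real) set" where
  "square_boundary = {0..1} \<times> {0..1} - {0<..<1} \<times> {0<..<1}"

definition hclass :: "'a topology \<Rightarrow> (real \<times> real \<Rightarrow> 'a) \<Rightarrow> (real \<times> real \<Rightarrow> 'a) set" where
  "hclass X H = {K \<in> path_homotopies X.
     homotopic_with (\<lambda>G. \<forall>z\<in>square_boundary. G z = H z)
       (top_of_set ({0..1} \<times> {0..1})) X H K}"

definition hrep :: "(real \<times> real \<Rightarrow> 'a) set \<Rightarrow> real \<times> real \<Rightarrow> 'a" where
  "hrep \<alpha> = (SOME H. H \<in> \<alpha>)"

abbreviation on_square :: "(real \<times> real \<Rightarrow> 'a) \<Rightarrow> real \<times> real \<Rightarrow> 'a" where
  "on_square H \<equiv> restrict H ({0..1} \<times> {0..1})"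

definition path_concat :: "(real \<Rightarrow> 'a) \<Rightarrow> (real \<Rightarrow> 'a) \<Rightarrow> real \<Rightarrow> 'a" where
  "path_concat g f = (\<lambda>t\<in>{0..1}. if t \<le> 1/2 then f (2 * t) else g (2 * t - 1))"

text \<open>\<open>reparam X p \<phi>\<close> is the class of the linear homotopy from \<open>p \<circ> \<phi>\<close> to \<open>p\<close>.\<close>

definition reparam :: "'a topology \<Rightarrow> (real \<Rightarrow> 'a) \<Rightarrow> (real \<Rightarrow> real) \<Rightarrow> (real \<times> real \<Rightarrow> 'a) set" where
  "reparam X p \<phi> = hclass X (on_square (\<lambda>(s, t). p ((1 - s) * \<phi> t + s * t)))"

definition Pi2 ::
  "'a topology \<Rightarrow> ('a, real \<Rightarrow> 'a, (real \<times> real \<Rightarrow> 'a) set) bicat" ("\<Pi>\<^sub>2") where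
  "Pi2 X = \<lparr>
     Ob = topspace X,
     Ar = paths X,
     Cells = hclass X ` path_homotopies X,
     Src = (\<lambda>p. p 0),
     Trg = (\<lambda>p. p 1),
     Src2 = (\<lambda>\<alpha>. \<lambda>t\<in>{0..1}. hrep \<alpha> (0, t)),
     Trg2 = (\<lambda>\<alpha>. \<lambda>t\<in>{0..1}. hrep \<alpha> (1, t)),
     Id1 = (\<lambda>x. \<lambda>t\<in>{0..1}. x),
     Comp = path_concat,
     Id2 = (\<lambda>p. hclass X (on_square (\<lambda>(s, t). p t))),
     VComp = (\<lambda>\<beta> \<alpha>. hclass X (on_square (\<lambda>(s, t).
       if s \<le> 1/2 then hrep \<alpha> (2 * s, t) else hrep \<beta> (2 * s - 1, t)))),
     HComp = (\<lambda>\<beta> \<alpha>. hclass X (on_square (\<lambda>(s, t).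
       if t \<le> 1/2 then hrep \<alpha> (s, 2 * t) else hrep \<beta> (s, 2 * t - 1)))),
     Assoc = (\<lambda>h g f. reparam X (path_concat h (path_concat g f))
       (\<lambda>t. if t \<le> 1/2 then t / 2 else if t \<le> 3/4 then t - 1/4 else 2 * t - 1)),
     LUnit = (\<lambda>f. reparam X f (\<lambda>t. min (2 * t) 1)),
     RUnit = (\<lambda>f. reparam X f (\<lambda>t. max (2 * t - 1) 0))\<rparr>"


section \<open>Little 2-cubes\<close>

text \<open>An affine map \<open>\<alpha>(t) = (y - x) t + x\<close> is given by the pair \<open>(x, y)\<close>, and \<open>\<alpha>\<^sub>1 \<times> \<alpha>\<^sub>2\<close> by the
  pair of the pairs for \<open>\<alpha>\<^sub>1\<close> and \<open>\<alpha>\<^sub>2\<close>.\<close>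

type_synonym cube = "(real \<times> real) \<times> (real \<times> real)"

definition affine_map :: "real \<times> real \<Rightarrow> real \<Rightarrow> real" where
  "affine_map = (\<lambda>(x, y) t. (y - x) * t + x)"

definition cube_map :: "cube \<Rightarrow> real \<times> real \<Rightarrow> real \<times> real" where
  "cube_map c = map_prod (affine_map (fst c)) (affine_map (snd c))"

definition open_square :: "(real \<times> real) set" where
  "open_square = {0<..<1} \<times> {0<..<1}"

definition little_cube :: "cube \<Rightarrow> bool" where
  "little_cube = (\<lambda>((x\<^sub>1, y\<^sub>1), (x\<^sub>2, y\<^sub>2)).
     0 \<le> x\<^sub>1 \<and> x\<^sub>1 < y\<^sub>1 \<and> y\<^sub>1 \<le> 1 \<and> 0 \<le> x\<^sub>2 \<and> x\<^sub>2 < y\<^sub>2 \<and> y\<^sub>2 \<le> 1)"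

definition cube_id :: cube where
  "cube_id = ((0, 1), (0, 1))"

definition cube_comp :: "cube \<Rightarrow> cube \<Rightarrow> cube" where
  "cube_comp c d =
    (map_prod (affine_map (fst c)) (affine_map (fst c)) (fst d),
     map_prod (affine_map (snd c)) (affine_map (snd c)) (snd d))"

lemma cube_map_id: "cube_map cube_id = id"
  by (auto simp: cube_map_def cube_id_def affine_map_def fun_eq_iff)

lemma cube_map_comp: "cube_map (cube_comp c d) = cube_map c \<circ> cube_map d"
  by (auto simp: cube_map_def cube_comp_def affine_map_def fun_eq_iff algebra_simps
      split: prod.splits)

lemma affine_map_eqD:
  assumes "\<And>t. t \<in> {0<..<1} \<Longrightarrow> affine_map p t = affine_map q t"
  shows "p = q"
  using assms[of "1/2"] assms[of "1/4"]
  by (cases p; cases q) (auto simp: affine_map_def field_simps)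

lemma cube_map_inject:
  assumes "\<And>z. z \<in> open_square \<Longrightarrow> cube_map c z = cube_map d z"
  shows "c = d"
proof (rule prod_eqI)
  show "fst c = fst d"
  proof (rule affine_map_eqD)
    fix t :: real assume "t \<in> {0<..<1}"
    then show "affine_map (fst c) t = affine_map (fst d) t"
      using assms[of "(t, 1/2)"] by (auto simp: cube_map_def open_square_def)
  qed
  show "snd c = snd d"
  proof (rule affine_map_eqD)
    fix t :: real assume "t \<in> {0<..<1}"
    then show "affine_map (snd c) t = affine_map (snd d) t"
      using assms[of "(1/2, t)"] by (auto simp: cube_map_def open_square_def)
  qed
qed

text \<open>The space of \<open>k\<close>-tuples, indexed by \<open>0, \<dots>, k - 1\<close>, as a subspace of \<open>\<real>\<^bsup>4k\<^esup>\<close>.\<close>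

definition little_cubes :: "nat \<Rightarrow> (nat \<Rightarrow> cube) topology" where
  "little_cubes k = subtopology (product_topology (\<lambda>_. euclidean) {..<k})
     {c. (\<forall>i<k. little_cube (c i)) \<and>
         (\<forall>i<k. \<forall>j<k. i \<noteq> j \<longrightarrow>
           cube_map (c i) ` open_square \<inter> cube_map (c j) ` open_square = {})}"

text \<open>A tuple of length \<open>j 0 + \<dots> + j (k - 1)\<close> is divided into consecutive blocks, the \<open>i\<close>-th one
  of length \<open>j i\<close>.  Position \<open>n\<close> lies in block \<open>block j n\<close>.\<close>

definition block_start :: "(nat \<Rightarrow> nat) \<Rightarrow> nat \<Rightarrow> nat" where
  "block_start j i = (\<Sum>l<i. j l)"

definition block :: "(nat \<Rightarrow> nat) \<Rightarrow> nat \<Rightarrow> nat" where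
  "block j n = (LEAST i. n < block_start j (Suc i))"

definition operad_comp ::
  "nat \<Rightarrow> (nat \<Rightarrow> nat) \<Rightarrow> (nat \<Rightarrow> cube) \<Rightarrow> (nat \<Rightarrow> nat \<Rightarrow> cube) \<Rightarrow> nat \<Rightarrow> cube" where
  "operad_comp k j c d = (\<lambda>n\<in>{..<block_start j k}.
     cube_comp (c (block j n)) (d (block j n) (n - block_start j (block j n))))"

text \<open>The base point of an algebra is \<open>\<theta> 0\<close> applied to the empty tuples, so no base point needs
  to be given separately.\<close>

locale little_2_cubes_algebra =
  fixes X :: "'a topology" and \<theta> :: "nat \<Rightarrow> (nat \<Rightarrow> cube) \<Rightarrow> (nat \<Rightarrow> 'a) \<Rightarrow> 'a"
  assumes action_continuous:
      "continuous_map (prod_topology (little_cubes k) (product_topology (\<lambda>_. X) {..<k})) X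
        (\<lambda>(c, x). \<theta> k c x)"
    and action_unit: "p \<in> topspace X \<Longrightarrow> \<theta> 1 (\<lambda>i\<in>{..<1}. cube_id) (\<lambda>i\<in>{..<1}. p) = p"
    and action_equivariant:
      "\<lbrakk>c \<in> topspace (little_cubes k); x \<in> topspace (product_topology (\<lambda>_. X) {..<k});
        \<sigma> permutes {..<k}\<rbrakk> \<Longrightarrow> \<theta> k (c \<circ> \<sigma>) (x \<circ> \<sigma>) = \<theta> k c x"
    and action_comp:
      "\<lbrakk>c \<in> topspace (little_cubes k); \<And>i. i < k \<Longrightarrow> d i \<in> topspace (little_cubes (j i));
        x \<in> topspace (product_topology (\<lambda>_. X) {..<block_start j k})\<rbrakk> \<Longrightarrow>
        \<theta> (block_start j k) (operad_comp k j c d) x =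
        \<theta> k c (\<lambda>i\<in>{..<k}. \<theta> (j i) (d i) (\<lambda>r\<in>{..<j i}. x (block_start j i + r)))"

end

theory Submission
  imports Defs
begin

text \<open>Two cubes side by side define the tensor product, which is a strict pseudofunctor.  Paths
  between configurations of cubes induce the associativity, unit and braiding equivalences, and
  homotopies between such paths induce the modifications.  The labels of the cubes may move along
  paths in \<open>X\<close>, so every cell occurring in an axiom is the image of a cell in a space of
  configurations.  The space of all configurations is not simply connected.  It becomes contractible,
  however, if the labels are ordered and a cube can pass from the left to the right of a later one
  only above it.  Since in each axiom every pair of objects is exchanged at most once, and always in
  the same direction, both sides lift to this space, where parallel 2-cells agree.\<close>

abbreviation (input) I1 :: "real set" where "I1 \<equiv> {0..1}"
abbreviation (input) I2 :: "(real \<times> real) set" where "I2 \<equiv> {0..1} \<times> {0..1}"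

lemma continuous_map_reparam:
  assumes "continuous_map (top_of_set A) W H" "continuous_on B k" "\<And>z. z \<in> B \<Longrightarrow> k z \<in> A"
  shows "continuous_map (top_of_set B) W (\<lambda>z. H (k z))"
proof -
  have "continuous_map (top_of_set B) (top_of_set A) k"
    using assms by (auto simp: continuous_map_in_subtopology)
  from continuous_map_compose[OF this assms(1)] show ?thesis by (simp add: o_def)
qed

lemma double_half: "a * 2 = 1 \<Longrightarrow> 2 * a = (1::real)"
  by simp

lemma continuous_map_glue:
  fixes u :: "'t::topological_space \<Rightarrow> real"
  assumes u: "continuous_on S u"
    and f: "continuous_map (top_of_set {z\<in>S. u z \<le> c}) W f"
    and g: "continuous_map (top_of_set {z\<in>S. c \<le> u z}) W g"
    and fg: "\<And>z. z \<in> S \<Longrightarrow> u z = c \<Longrightarrow> f z = g z"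
  shows "continuous_map (top_of_set S) W (\<lambda>z. if u z \<le> c then f z else g z)"
proof (rule continuous_map_cases_le)
  show "continuous_map (top_of_set S) euclideanreal u" using u by simp
  show "continuous_map (top_of_set S) euclideanreal (\<lambda>z. c)" by simp
  have "{x \<in> topspace (top_of_set S). u x \<le> c} = {z\<in>S. u z \<le> c}"
       "{x \<in> topspace (top_of_set S). c \<le> u x} = {z\<in>S. c \<le> u z}" by auto
  moreover have "S \<inter> {z\<in>S. u z \<le> c} = {z\<in>S. u z \<le> c}" "S \<inter> {z\<in>S. c \<le> u z} = {z\<in>S. c \<le> u z}" by auto
  ultimately show
    "continuous_map (subtopology (top_of_set S) {x \<in> topspace (top_of_set S). u x \<le> c}) W f"
    "continuous_map (subtopology (top_of_set S) {x \<in> topspace (top_of_set S). c \<le> u x}) W g"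
    using f g by (simp_all add: subtopology_subtopology)
qed (use fg in auto)

definition square ::
  "'w topology \<Rightarrow> (real \<times> real \<Rightarrow> 'w) \<Rightarrow> (real \<Rightarrow> 'w) \<Rightarrow> (real \<Rightarrow> 'w) \<Rightarrow> bool" where
  "square W H p q \<longleftrightarrow> continuous_map (top_of_set I2) W H \<and>
     (\<forall>t\<in>I1. H (0, t) = p t \<and> H (1, t) = q t) \<and> (\<forall>s\<in>I1. H (s, 0) = p 0 \<and> H (s, 1) = p 1)"

definition rel_homotopic ::
  "'w topology \<Rightarrow> (real \<times> real \<Rightarrow> 'w) \<Rightarrow> (real \<times> real \<Rightarrow> 'w) \<Rightarrow> bool" where
  "rel_homotopic W H K \<longleftrightarrow> (\<exists>G. continuous_map (top_of_set (I1 \<times> I2)) W G \<and>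
     (\<forall>z\<in>I2. G (0, z) = H z \<and> G (1, z) = K z) \<and>
     (\<forall>r\<in>I1. \<forall>z\<in>square_boundary. G (r, z) = H z))"

lemma square_boundary_iff:
  "(s, t) \<in> square_boundary \<longleftrightarrow> s \<in> I1 \<and> t \<in> I1 \<and> (s = 0 \<or> s = 1 \<or> t = 0 \<or> t = 1)"
  by (auto simp: square_boundary_def)

lemma square_boundaryE:
  assumes "z \<in> square_boundary"
  obtains t where "t \<in> I1" "z = (0, t)" | t where "t \<in> I1" "z = (1, t)"
    | s where "s \<in> I1" "z = (s, 0)" | s where "s \<in> I1" "z = (s, 1)"
  using assms by (cases z) (auto simp: square_boundary_iff)

lemma square_boundary_subset: "z \<in> square_boundary \<Longrightarrow> z \<in> I2"
  by (auto simp: square_boundary_def)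

lemma square_continuous: "square W H p q \<Longrightarrow> continuous_map (top_of_set I2) W H"
  by (simp add: square_def)

lemma square_endpoints:
  assumes "square W H p q" shows "q 0 = p 0 \<and> q 1 = p 1"
proof -
  have 1: "H (1, t) = q t" if "t \<in> I1" for t using assms that by (auto simp: square_def)
  have 2: "H (s, 0) = p 0 \<and> H (s, 1) = p 1" if "s \<in> I1" for s
    using assms that by (auto simp: square_def)
  show ?thesis using 1[of 0] 1[of 1] 2[of 1] by simp
qed

lemma square_boundary_eq:
  assumes "square W H p q" "square W K p q" "z \<in> square_boundary"
  shows "H z = K z"
  using assms(3) by (cases rule: square_boundaryE) (use assms(1,2) in \<open>auto simp: square_def\<close>)

lemma square_in_topspace: "square W H p q \<Longrightarrow> z \<in> I2 \<Longrightarrow> H z \<in> topspace W"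
  unfolding square_def continuous_map_def by auto

lemma square_cong:
  "square W H p q \<Longrightarrow> (\<And>z. z \<in> I2 \<Longrightarrow> H z = H' z) \<Longrightarrow> (\<And>t. t \<in> I1 \<Longrightarrow> p t = p' t) \<Longrightarrow>
    (\<And>t. t \<in> I1 \<Longrightarrow> q t = q' t) \<Longrightarrow> square W H' p' q'"
  unfolding square_def
  by (intro conjI) (auto elim!: continuous_map_eq)

lemma square_pathin:
  assumes "square W H p q" shows "pathin W p" "pathin W q"
proof -
  have "continuous_map (top_of_set I1) W (\<lambda>t. H (c, t))" if "c \<in> I1" for c
    using square_continuous[OF assms]
    by (rule continuous_map_reparam) (use that in \<open>auto intro!: continuous_intros\<close>)
  from this[of 0] this[of 1] show "pathin W p" "pathin W q"
    unfolding pathin_def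
    by (auto intro: continuous_map_eq[of _ W "\<lambda>t. H (0, t)"] continuous_map_eq[of _ W "\<lambda>t. H (1, t)"]
        simp: assms[unfolded square_def])
qed

lemma square_map:
  assumes "square W H p q" "continuous_map W X \<Psi>"
  shows "square X (\<Psi> \<circ> H) (\<lambda>t. \<Psi> (p t)) (\<lambda>t. \<Psi> (q t))"
  using assms continuous_map_compose[of "top_of_set I2" W H X \<Psi>] by (auto simp: square_def)

lemma rel_homotopic_refl:
  assumes "continuous_map (top_of_set I2) W H"
  shows "rel_homotopic W H H"
  unfolding rel_homotopic_def
  by (intro exI[of _ "\<lambda>x. H (snd x)"])
     (auto intro!: continuous_map_reparam[OF assms] continuous_intros)

lemma rel_homotopic_sym:
  assumes "rel_homotopic W H K"
  shows "rel_homotopic W K H"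
proof -
  obtain G where G: "continuous_map (top_of_set (I1 \<times> I2)) W G"
     "\<And>z. z\<in>I2 \<Longrightarrow> G (0, z) = H z" "\<And>z. z \<in> I2 \<Longrightarrow> G (1, z) = K z"
     "\<And>r z. r\<in>I1 \<Longrightarrow> z\<in>square_boundary \<Longrightarrow> G (r, z) = H z"
    using assms by (auto simp: rel_homotopic_def)
  have "H z = K z" if "z \<in> square_boundary" for z
    using G(3)[OF square_boundary_subset[OF that]] G(4)[OF _ that, of 1] by simp
  with G show ?thesis unfolding rel_homotopic_def
    by (intro exI[of _ "\<lambda>(r, z). G (1 - r, z)"])
       (auto simp: case_prod_unfold intro!: continuous_map_reparam[OF G(1)] continuous_intros)
qed

lemma rel_homotopic_trans:
  assumes "rel_homotopic W H K" "rel_homotopic W K L"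
  shows "rel_homotopic W H L"
proof -
  obtain G where G: "continuous_map (top_of_set (I1 \<times> I2)) W G"
     "\<And>z. z\<in>I2 \<Longrightarrow> G (0, z) = H z" "\<And>z. z \<in> I2 \<Longrightarrow> G (1, z) = K z"
     "\<And>r z. r\<in>I1 \<Longrightarrow> z\<in>square_boundary \<Longrightarrow> G (r, z) = H z"
    using assms by (auto simp: rel_homotopic_def)
  obtain F where F: "continuous_map (top_of_set (I1 \<times> I2)) W F"
     "\<And>z. z\<in>I2 \<Longrightarrow> F (0, z) = K z" "\<And>z. z \<in> I2 \<Longrightarrow> F (1, z) = L z"
     "\<And>r z. r\<in>I1 \<Longrightarrow> z\<in>square_boundary \<Longrightarrow> F (r, z) = K z"
    using assms by (auto simp: rel_homotopic_def)
  have HK: "H z = K z" if "z \<in> square_boundary" for z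
    using G(3)[OF square_boundary_subset[OF that]] G(4)[OF _ that, of 1] by simp
  define E where "E = (\<lambda>x. if fst x \<le> 1/2 then G (2 * fst x, snd x) else F (2 * fst x - 1, snd x))"
  have "continuous_map (top_of_set (I1 \<times> I2)) W E"
    unfolding E_def
    by (rule continuous_map_glue)
       (auto intro!: continuous_map_reparam[OF G(1)] continuous_map_reparam[OF F(1)] continuous_intros
         simp: G F double_half)
  then show ?thesis unfolding rel_homotopic_def
    by (intro exI[of _ E]) (use G F HK in \<open>auto simp: E_def\<close>)
qed

lemma rel_homotopic_boundary:
  assumes "rel_homotopic W H K" "z \<in> square_boundary"
  shows "H z = K z"
proof -
  obtain G where G: "\<And>z. z\<in>I2 \<Longrightarrow> G (1, z) = K z"
     "\<And>r z. r\<in>I1 \<Longrightarrow> z\<in>square_boundary \<Longrightarrow> G (r, z) = H z"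
    using assms(1) unfolding rel_homotopic_def by blast
  show ?thesis
    using G(1)[OF square_boundary_subset[OF assms(2)]] G(2)[OF _ assms(2), of 1] by simp
qed

lemma rel_homotopic_cong:
  "rel_homotopic W H K \<Longrightarrow> (\<And>z. z \<in> I2 \<Longrightarrow> H z = H' z) \<Longrightarrow> (\<And>z. z \<in> I2 \<Longrightarrow> K z = K' z) \<Longrightarrow>
    rel_homotopic W H' K'"
  unfolding rel_homotopic_def using square_boundary_subset by metis

lemma rel_homotopic_map:
  assumes "rel_homotopic W H K" "continuous_map W X \<Psi>"
  shows "rel_homotopic X (\<Psi> \<circ> H) (\<Psi> \<circ> K)"
proof -
  obtain G where "continuous_map (top_of_set (I1 \<times> I2)) W G"
     "\<forall>z\<in>I2. G (0, z) = H z \<and> G (1, z) = K z" "\<forall>r\<in>I1. \<forall>z\<in>square_boundary. G (r, z) = H z"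
    using assms by (auto simp: rel_homotopic_def)
  with continuous_map_compose[OF this(1) assms(2)] show ?thesis
    unfolding rel_homotopic_def by (intro exI[of _ "\<Psi> \<circ> G"]) auto
qed

subsection \<open>Fillers in contractible spaces\<close>

lemma contractible_contraction:
  assumes "contractible_space W"
  obtains h a where "continuous_map (prod_topology (top_of_set I1) W) W h"
    "\<And>x. h (0, x) = x" "\<And>x. h (1, x) = a"
  using assms unfolding contractible_space_def homotopic_with_def by auto

lemma continuous_map_contraction:
  assumes h: "continuous_map (prod_topology (top_of_set I1) W) W h"
    and f: "continuous_on D f" "\<And>z. z \<in> D \<Longrightarrow> f z \<in> I1" and g: "continuous_map (top_of_set D) W g"
  shows "continuous_map (top_of_set D) W (\<lambda>z. h (f z, g z))"
proof -
  have "continuous_map (top_of_set D) (prod_topology (top_of_set I1) W) (\<lambda>z. (f z, g z))"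
    using f g by (auto simp: continuous_map_pairwise o_def continuous_map_in_subtopology)
  from continuous_map_compose[OF this h] show ?thesis by (simp add: o_def)
qed

text \<open>The retraction \<open>push_out\<close> moves a collar of the boundary onto the boundary, and \<open>depth\<close> is 1
  outside the collar.  Contracting \<open>W\<close> with speed \<open>depth\<close> therefore turns any map on the square (or the interval)
  into one which depends only on its boundary values.\<close>

definition push_out :: "real \<Rightarrow> real \<Rightarrow> real" where
  "push_out n s = 1/2 + (s - 1/2) / max (1/2) n"

lemma push_out_in: "\<bar>2 * s - 1\<bar> \<le> n \<Longrightarrow> push_out n s \<in> I1"
  by (auto simp: push_out_def field_simps abs_if max_def split: if_splits)

lemma push_out_1 [simp]: "push_out 1 s = s"
  by (simp add: push_out_def)

definition sqnorm :: "real \<times> real \<Rightarrow> real" where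
  "sqnorm z = max \<bar>2 * fst z - 1\<bar> \<bar>2 * snd z - 1\<bar>"

definition depth :: "real \<Rightarrow> real" where "depth n = min 1 (2 * (1 - n))"

lemma depth_in: "n \<le> 1 \<Longrightarrow> depth n \<in> I1"
  by (auto simp: depth_def)

lemma sqnorm_le: "z \<in> I2 \<Longrightarrow> sqnorm z \<le> 1"
  by (auto simp: sqnorm_def)

lemma sqnorm_boundary: "z \<in> square_boundary \<Longrightarrow> sqnorm z = 1"
  by (cases rule: square_boundaryE) (auto simp: sqnorm_def)

lemma push_out_boundary:
  assumes "z \<in> I2" "depth (sqnorm z) \<noteq> 1"
  shows "(push_out (sqnorm z) (fst z), push_out (sqnorm z) (snd z)) \<in> square_boundary"
proof -
  obtain s t where z: "z = (s, t)" by (cases z)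
  have n: "sqnorm z > 1/2" using assms by (auto simp: depth_def)
  have *: "push_out (sqnorm z) s \<in> I1" "push_out (sqnorm z) t \<in> I1"
    by (rule push_out_in, simp add: z sqnorm_def)+
  have "push_out (sqnorm z) u = 0 \<or> push_out (sqnorm z) u = 1" if "\<bar>2 * u - 1\<bar> = sqnorm z" for u
    using n that by (auto simp: push_out_def field_simps abs_if split: if_splits)
  moreover have "\<bar>2 * s - 1\<bar> = sqnorm z \<or> \<bar>2 * t - 1\<bar> = sqnorm z" by (auto simp: z sqnorm_def max_def)
  ultimately show ?thesis using * unfolding z square_boundary_iff by auto
qed

lemma contractible_rel_homotopic:
  assumes W: "contractible_space W" and H: "square W H p q" and K: "square W K p q"
  shows "rel_homotopic W H K"
proof -
  obtain h a where h: "continuous_map (prod_topology (top_of_set I1) W) W h"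
    "\<And>x. h (0, x) = x" "\<And>x. h (1, x) = a"
    using contractible_contraction[OF W] by blast
  define \<pi> where "\<pi> = (\<lambda>z. (push_out (sqnorm z) (fst z), push_out (sqnorm z) (snd z)))"
  define C where "C = (\<lambda>H z. h (depth (sqnorm z), H (\<pi> z)))"
  have \<pi>: "\<pi> z \<in> I2" for z
    unfolding \<pi>_def by (auto simp: sqnorm_def simp del: atLeastAtMost_iff intro!: push_out_in)
  have cont: "continuous_on UNIV sqnorm" "continuous_on UNIV \<pi>" "continuous_on UNIV depth"
    unfolding sqnorm_def \<pi>_def push_out_def depth_def by (auto intro!: continuous_intros)
  have H_C: "rel_homotopic W H (C H)" if H: "continuous_map (top_of_set I2) W H" for H
    unfolding rel_homotopic_def
  proof (intro exI conjI ballI)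
    let ?G = "\<lambda>x. h (fst x * depth (sqnorm (snd x)), H ((1 - fst x) *\<^sub>R snd x + fst x *\<^sub>R \<pi> (snd x)))"
    show "continuous_map (top_of_set (I1 \<times> I2)) W ?G"
    proof (rule continuous_map_contraction[OF h(1)])
      show "continuous_on (I1 \<times> I2) (\<lambda>x. fst x * depth (sqnorm (snd x)))"
        by (intro continuous_intros continuous_on_compose2[OF cont(3)] continuous_on_compose2[OF cont(1)]) auto
      show "fst x * depth (sqnorm (snd x)) \<in> I1" if "x \<in> I1 \<times> I2" for x
        using that sqnorm_le[of "snd x"] depth_in[of "sqnorm (snd x)"]
        by (auto intro: mult_nonneg_nonneg mult_le_one)
      show "continuous_map (top_of_set (I1 \<times> I2)) W
         (\<lambda>x. H ((1 - fst x) *\<^sub>R snd x + fst x *\<^sub>R \<pi> (snd x)))"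
      proof (rule continuous_map_reparam[OF H])
        show "continuous_on (I1 \<times> I2) (\<lambda>x. (1 - fst x) *\<^sub>R snd x + fst x *\<^sub>R \<pi> (snd x))"
          by (intro continuous_intros continuous_on_compose2[OF cont(2)]) auto
        have "convex I2" by (intro convex_Times) auto
        then show "(1 - fst x) *\<^sub>R snd x + fst x *\<^sub>R \<pi> (snd x) \<in> I2" if "x \<in> I1 \<times> I2" for x
          by (rule convexD) (use that \<pi>[of "snd x"] in auto)
      qed
    qed
    fix z assume z: "z \<in> I2"
    show "?G (0, z) = H z" "?G (1, z) = C H z" by (simp_all add: h C_def)
  next
    fix r z assume "r \<in> I1" and z: "z \<in> square_boundary"
    have "\<pi> z = z" "depth (sqnorm z) = 0"
      using sqnorm_boundary[OF z] by (simp_all add: \<pi>_def depth_def)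
    then show "h (fst (r, z) * depth (sqnorm (snd (r, z))),
          H ((1 - fst (r, z)) *\<^sub>R snd (r, z) + fst (r, z) *\<^sub>R \<pi> (snd (r, z)))) = H z"
      by (simp add: h flip: scaleR_add_left)
  qed
  have "C H z = C K z" if "z \<in> I2" for z
  proof (cases "depth (sqnorm z) = 1")
    case True then show ?thesis by (simp add: C_def h)
  next
    case False
    then have "\<pi> z \<in> square_boundary" unfolding \<pi>_def using push_out_boundary that by blast
    then show ?thesis using square_boundary_eq[OF H K] by (simp add: C_def)
  qed
  then have "rel_homotopic W H (C K)"
    using rel_homotopic_cong[OF H_C[OF square_continuous[OF H]]] by auto
  then show ?thesis
    using rel_homotopic_trans rel_homotopic_sym H_C[OF square_continuous[OF K]] by blast
qed

definition vcat :: "(real \<times> real \<Rightarrow> 'w) \<Rightarrow> (real \<times> real \<Rightarrow> 'w) \<Rightarrow> real \<times> real \<Rightarrow> 'w" where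
  "vcat K H = (\<lambda>(s, t). if s \<le> 1/2 then H (2 * s, t) else K (2 * s - 1, t))"

definition hcat :: "(real \<times> real \<Rightarrow> 'w) \<Rightarrow> (real \<times> real \<Rightarrow> 'w) \<Rightarrow> real \<times> real \<Rightarrow> 'w" where
  "hcat K H = (\<lambda>(s, t). if t \<le> 1/2 then H (s, 2 * t) else K (s, 2 * t - 1))"

definition pcat1 :: "(real \<Rightarrow> 'w) \<Rightarrow> (real \<Rightarrow> 'w) \<Rightarrow> real \<Rightarrow> 'w" where
  "pcat1 g f = (\<lambda>t. if t \<le> 1/2 then f (2 * t) else g (2 * t - 1))"

lemma pcat1_ends [simp]: "pcat1 g f 0 = f 0" "pcat1 g f 1 = g 1"
  by (simp_all add: pcat1_def)

lemma pathin_pcat1: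
  assumes "pathin W f" "pathin W g" "f 1 = g 0"
  shows "pathin W (pcat1 g f)"
  unfolding pathin_def pcat1_def
  by (rule continuous_map_glue)
     (use assms in \<open>auto simp: pathin_def double_half intro!: continuous_map_reparam[OF assms(1)[unfolded pathin_def]]
        continuous_map_reparam[OF assms(2)[unfolded pathin_def]] continuous_intros\<close>)

lemma square_vcat:
  assumes "square W H p q" "square W K q r"
  shows "square W (vcat K H) p r"
  unfolding square_def
proof (intro conjI)
  have "continuous_map (top_of_set I2) W
    (\<lambda>z. if fst z \<le> 1/2 then H (2 * fst z, snd z) else K (2 * fst z - 1, snd z))"
    by (rule continuous_map_glue)
       (use assms in \<open>auto intro!: continuous_map_reparam[OF square_continuous[OF assms(1)]]
          continuous_map_reparam[OF square_continuous[OF assms(2)]]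
          continuous_intros simp: square_def double_half\<close>)
  then show "continuous_map (top_of_set I2) W (vcat K H)" by (simp add: vcat_def case_prod_unfold)
qed (use assms square_endpoints[OF assms(1)] in \<open>auto simp: square_def vcat_def\<close>)

lemma square_hcat:
  assumes "square W H p q" "square W K p' q'" "p 1 = p' 0"
  shows "square W (hcat K H) (pcat1 p' p) (pcat1 q' q)"
  unfolding square_def
proof (intro conjI)
  have "continuous_map (top_of_set I2) W
    (\<lambda>z. if snd z \<le> 1/2 then H (fst z, 2 * snd z) else K (fst z, 2 * snd z - 1))"
    by (rule continuous_map_glue)
       (use assms in \<open>auto intro!: continuous_map_reparam[OF square_continuous[OF assms(1)]]
          continuous_map_reparam[OF square_continuous[OF assms(2)]]
          continuous_intros simp: square_def double_half\<close>)
  then show "continuous_map (top_of_set I2) W (hcat K H)" by (simp add: hcat_def case_prod_unfold)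
qed (use assms in \<open>auto simp: square_def hcat_def pcat1_def\<close>)

lemma square_reverse: "square W H p q \<Longrightarrow> square W (\<lambda>(s, t). H (1 - s, t)) q p"
  using square_endpoints[of W H p q]
    continuous_map_reparam[of I2 W H I2 "\<lambda>z. (1 - fst z, snd z)",
      OF _ continuous_on_Pair[OF continuous_on_diff[OF continuous_on_const continuous_on_fst[OF continuous_on_id]]
        continuous_on_snd[OF continuous_on_id]]]
  unfolding square_def by (auto simp: case_prod_unfold)

lemma square_const: "pathin W p \<Longrightarrow> square W (\<lambda>(s, t). p t) p p"
  using continuous_map_reparam[of I1 W p I2 snd, OF _ continuous_on_snd[OF continuous_on_id]]
  unfolding square_def pathin_def by (auto simp: case_prod_unfold)

lemma contractible_square:
  assumes W: "contractible_space W" and p: "pathin W p" and q: "pathin W q"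
    and pq: "p 0 = q 0" "p 1 = q 1"
  shows "\<exists>H. square W H p q"
proof -
  obtain h a where h: "continuous_map (prod_topology (top_of_set I1) W) W h"
    "\<And>x. h (0, x) = x" "\<And>x. h (1, x) = a"
    using contractible_contraction[OF W] by blast
  define n where "n = (\<lambda>t::real. \<bar>2 * t - 1\<bar>)"
  define C where "C = (\<lambda>p t. h (depth (n t), p (push_out (n t) t)))"
  define H where "H = (\<lambda>p x. h (fst x * depth (n (snd x)),
    p ((1 - fst x) * snd x + fst x * push_out (n (snd x)) (snd x))))"
  have H: "square W (H p) p (C p)" if "pathin W p" for p
    unfolding square_def
  proof (intro conjI ballI)
    show "continuous_map (top_of_set I2) W (H p)"
      unfolding H_def
    proof (rule continuous_map_contraction[OF h(1)])
      show "continuous_on I2 (\<lambda>x. fst x * depth (n (snd x)))"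
        unfolding depth_def n_def by (intro continuous_intros)
      show "fst x * depth (n (snd x)) \<in> I1" if "x \<in> I2" for x
        using that depth_in[of "n (snd x)"] unfolding n_def
        by (fastforce intro: mult_nonneg_nonneg mult_le_one)
      show "continuous_map (top_of_set I2) W
         (\<lambda>x. p ((1 - fst x) * snd x + fst x * push_out (n (snd x)) (snd x)))"
      proof (rule continuous_map_reparam)
        show "continuous_map (top_of_set I1) W p" using that by (simp add: pathin_def)
        show "continuous_on I2 (\<lambda>x. (1 - fst x) * snd x + fst x * push_out (n (snd x)) (snd x))"
          unfolding push_out_def n_def by (intro continuous_intros) auto
        show "(1 - fst x) * snd x + fst x * push_out (n (snd x)) (snd x) \<in> I1" if "x \<in> I2" for x
          using convexD[of I1 "snd x" "push_out (n (snd x)) (snd x)" "1 - fst x" "fst x"]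
            that push_out_in[of "snd x" "n (snd x)"] by (auto simp: n_def)
      qed
    qed
    fix t assume "t \<in> I1"
    show "H p (0, t) = p t" "H p (1, t) = C p t" by (auto simp: H_def C_def h)
    fix s assume "s \<in> I1"
    show "H p (s, 0) = p 0" "H p (s, 1) = p 1"
      by (simp_all add: H_def h n_def depth_def)
  qed
  have "C p t = C q t" if "t \<in> I1" for t
  proof (cases "depth (n t) = 1")
    case True then show ?thesis by (simp add: C_def h)
  next
    case False
    then have "n t > 1/2" by (auto simp: depth_def)
    then have "push_out (n t) t = 0 \<or> push_out (n t) t = 1"
      using that by (auto simp: push_out_def n_def field_simps abs_if split: if_splits)
    then show ?thesis using pq by (auto simp: C_def)
  qed
  then have "square W (H p) p (C q)" using square_cong[OF H[OF p]] by auto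
  from square_vcat[OF this square_reverse[OF H[OF q]]] show ?thesis by blast
qed

abbreviation sqclass :: "'a topology \<Rightarrow> (real \<times> real \<Rightarrow> 'a) \<Rightarrow> (real \<times> real \<Rightarrow> 'a) set" where
  "sqclass X H \<equiv> hclass X (on_square H)"

lemma homotopic_with_boundary_iff:
  "homotopic_with (\<lambda>G. \<forall>z\<in>square_boundary. G z = H' z) (top_of_set I2) X H K \<longleftrightarrow> rel_homotopic X H K"
  if "\<And>z. z \<in> square_boundary \<Longrightarrow> H' z = H z"
  by (subst homotopic_with)
     (use that in \<open>auto simp: rel_homotopic_def square_boundary_subset\<close>)

lemma square_boundary_transfer:
  assumes "square X H p q" "continuous_map (top_of_set I2) X K"
    and "\<And>z. z \<in> square_boundary \<Longrightarrow> K z = H z"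
  shows "square X K p q"
proof -
  have "K (0, t) = H (0, t)" "K (1, t) = H (1, t)" "K (t, 0) = H (t, 0)" "K (t, 1) = H (t, 1)"
    if "t \<in> I1" for t
    using that by (intro assms(3); simp add: square_boundary_iff)+
  then show ?thesis using assms(1,2) unfolding square_def by metis
qed

lemma path_homotopies_iff:
  "H \<in> path_homotopies X \<longleftrightarrow> H \<in> extensional I2 \<and> square X H (\<lambda>t. H (0, t)) (\<lambda>t. H (1, t))"
  unfolding path_homotopies_def square_def by blast

lemma square_self: "square X H p q \<Longrightarrow> square X H (\<lambda>t. H (0, t)) (\<lambda>t. H (1, t))"
  unfolding square_def by simp

lemma mem_sqclass:
  assumes "square X H p q"
  shows "K \<in> sqclass X H \<longleftrightarrow> K \<in> extensional I2 \<and> square X K p q \<and> rel_homotopic X H K"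
proof -
  have "rel_homotopic X (on_square H) K \<longleftrightarrow> rel_homotopic X H K"
    using rel_homotopic_cong[of X "on_square H" K H K] rel_homotopic_cong[of X H K "on_square H" K]
    by auto
  moreover have "square X K p q" if "K \<in> path_homotopies X" "rel_homotopic X H K"
    by (rule square_boundary_transfer[OF assms])
       (use that rel_homotopic_boundary[OF that(2)] in \<open>auto simp: path_homotopies_iff intro: square_continuous\<close>)
  moreover have "K \<in> path_homotopies X" if "square X K p q" "K \<in> extensional I2"
    using that square_self[of X K p q] by (simp add: path_homotopies_iff)
  moreover have "K \<in> extensional I2" if "K \<in> path_homotopies X"
    using that by (simp add: path_homotopies_iff)
  ultimately show ?thesis
    using homotopic_with_boundary_iff[of "on_square H" "on_square H" X K] unfolding hclass_def by auto
qed

lemma sqclass_cong: "(\<And>z. z \<in> I2 \<Longrightarrow> H z = K z) \<Longrightarrow> sqclass X H = sqclass X K"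
  by (rule arg_cong[of _ _ "hclass X"]) (auto intro!: restrict_ext)

lemma sqclass_eqI:
  assumes "square X H p q" "rel_homotopic X H K"
  shows "sqclass X H = sqclass X K"
proof (cases "square X K p q")
  case True
  show ?thesis
    using mem_sqclass[OF assms(1)] mem_sqclass[OF True] assms(2)
      rel_homotopic_sym[of X] rel_homotopic_trans[of X] by blast
next
  case False
  have b: "K z = H z" if "z \<in> square_boundary" for z
    using rel_homotopic_boundary[OF assms(2) that] by simp
  obtain G where G: "continuous_map (top_of_set (I1 \<times> I2)) X G" "\<forall>z\<in>I2. G (1, z) = K z"
    using assms by (auto simp: rel_homotopic_def)
  have "continuous_map (top_of_set I2) X (\<lambda>z. G (1, z))"
    using G(1) by (rule continuous_map_reparam) (auto intro!: continuous_intros)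
  then have "continuous_map (top_of_set I2) X K" by (rule continuous_map_eq) (use G in auto)
  with b have "square X K p q" by (rule square_boundary_transfer[OF assms(1), rotated])
  with False show ?thesis by simp
qed

lemma hrep_sqclass:
  assumes "square X H p q"
  shows "square X (hrep (sqclass X H)) p q" "rel_homotopic X H (hrep (sqclass X H))"
    "hrep (sqclass X H) \<in> extensional I2"
proof -
  have "square X (on_square H) p q" by (rule square_cong[OF assms]) auto
  moreover have "rel_homotopic X H (on_square H)"
    by (rule rel_homotopic_cong[OF rel_homotopic_refl[OF square_continuous[OF assms]]]) auto
  ultimately have "on_square H \<in> sqclass X H"
    unfolding mem_sqclass[OF assms] by simp
  then have "hrep (sqclass X H) \<in> sqclass X H" unfolding hrep_def by (rule someI[of "\<lambda>K. K \<in> sqclass X H"])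
  then show "square X (hrep (sqclass X H)) p q" "rel_homotopic X H (hrep (sqclass X H))"
    "hrep (sqclass X H) \<in> extensional I2"
    unfolding mem_sqclass[OF assms] by auto
qed

lemma Pi2_simps [simp]:
  "Ob (Pi2 X) = topspace X" "Ar (Pi2 X) = paths X" "Cells (Pi2 X) = hclass X ` path_homotopies X"
  "Src (Pi2 X) f = f 0" "Trg (Pi2 X) f = f 1"
  "Id1 (Pi2 X) x = (\<lambda>t\<in>I1. x)" "Comp (Pi2 X) = path_concat"
  "Id2 (Pi2 X) f = sqclass X (\<lambda>(s, t). f t)"
  "LUnit (Pi2 X) f = reparam X f (\<lambda>t. min (2 * t) 1)"
  "RUnit (Pi2 X) f = reparam X f (\<lambda>t. max (2 * t - 1) 0)"
  by (simp_all add: Pi2_def)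

lemma cells_iff: "\<alpha> \<in> Cells (Pi2 X) \<longleftrightarrow> (\<exists>H p q. square X H p q \<and> \<alpha> = sqclass X H)"
proof
  assume "\<alpha> \<in> Cells (Pi2 X)"
  then obtain H where H: "H \<in> path_homotopies X" "\<alpha> = hclass X H" by auto
  then have "square X H (\<lambda>t. H (0, t)) (\<lambda>t. H (1, t))" "on_square H = H"
    by (simp_all add: path_homotopies_iff extensional_restrict)
  with H show "\<exists>H p q. square X H p q \<and> \<alpha> = sqclass X H" by metis
next
  assume "\<exists>H p q. square X H p q \<and> \<alpha> = sqclass X H"
  then obtain H p q where H: "square X H p q" "\<alpha> = sqclass X H" by blast
  have "square X (on_square H) p q" by (rule square_cong[OF H(1)]) auto
  then have "on_square H \<in> path_homotopies X"
    unfolding path_homotopies_iff using square_self[of X "on_square H" p q] by simp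
  with H show "\<alpha> \<in> Cells (Pi2 X)" by simp
qed

lemma Src2_sqclass: "square X H p q \<Longrightarrow> Src2 (Pi2 X) (sqclass X H) = restrict p I1"
  and Trg2_sqclass: "square X H p q \<Longrightarrow> Trg2 (Pi2 X) (sqclass X H) = restrict q I1"
  by (drule hrep_sqclass(1), simp add: Pi2_def square_def restrict_def fun_eq_iff)+

lemma in2_Pi2:
  "in2 (Pi2 X) \<alpha> f g \<longleftrightarrow>
     f \<in> extensional I1 \<and> g \<in> extensional I1 \<and> (\<exists>H. square X H f g \<and> \<alpha> = sqclass X H)"
proof
  assume L: "in2 (Pi2 X) \<alpha> f g"
  then obtain H p q where H: "square X H p q" "\<alpha> = sqclass X H"
    unfolding in2_def cells_iff by blast
  have "f = restrict p I1" "g = restrict q I1"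
    using L Src2_sqclass[OF H(1)] Trg2_sqclass[OF H(1)] H(2) unfolding in2_def by simp_all
  moreover have "square X H (restrict p I1) (restrict q I1)"
    by (rule square_cong[OF H(1)]) simp_all
  ultimately show "f \<in> extensional I1 \<and> g \<in> extensional I1 \<and> (\<exists>H. square X H f g \<and> \<alpha> = sqclass X H)"
    using H(2) by blast
next
  assume R: "f \<in> extensional I1 \<and> g \<in> extensional I1 \<and> (\<exists>H. square X H f g \<and> \<alpha> = sqclass X H)"
  then obtain H where H: "square X H f g" "\<alpha> = sqclass X H" by blast
  then have "Src2 (Pi2 X) \<alpha> = f" "Trg2 (Pi2 X) \<alpha> = g"
    using R Src2_sqclass[OF H(1)] Trg2_sqclass[OF H(1)] by (simp_all add: extensional_restrict)
  moreover have "\<alpha> \<in> Cells (Pi2 X)" unfolding cells_iff using H by blast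
  ultimately show "in2 (Pi2 X) \<alpha> f g" unfolding in2_def by blast
qed

lemma in2_Pi2_hrep:
  assumes "in2 (Pi2 X) \<alpha> f g"
  shows "square X (hrep \<alpha>) f g" "\<alpha> = sqclass X (hrep \<alpha>)"
proof -
  obtain H where H: "square X H f g" "\<alpha> = sqclass X H" using assms unfolding in2_Pi2 by blast
  show "square X (hrep \<alpha>) f g" "\<alpha> = sqclass X (hrep \<alpha>)"
    using hrep_sqclass(1)[OF H(1)] sqclass_eqI[OF H(1) hrep_sqclass(2)[OF H(1)]] by (simp_all add: H(2))
qed

lemma in1_Pi2: "in1 (Pi2 X) f x y \<longleftrightarrow> f \<in> extensional I1 \<and> pathin X f \<and> f 0 = x \<and> f 1 = y"
  by (auto simp: in1_def paths_def)

lemma rel_homotopic_vcat: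
  assumes H: "rel_homotopic X H H'" "square X H p q" and K: "rel_homotopic X K K'" "square X K q r"
  shows "rel_homotopic X (vcat K H) (vcat K' H')"
proof -
  obtain F where F: "continuous_map (top_of_set (I1 \<times> I2)) X F"
     "\<And>z. z\<in>I2 \<Longrightarrow> F (0, z) = H z \<and> F (1, z) = H' z" "\<And>r z. r\<in>I1 \<Longrightarrow> z\<in>square_boundary \<Longrightarrow> F (r, z) = H z"
    using H(1) by (auto simp: rel_homotopic_def)
  obtain G where G: "continuous_map (top_of_set (I1 \<times> I2)) X G"
     "\<And>z. z\<in>I2 \<Longrightarrow> G (0, z) = K z \<and> G (1, z) = K' z" "\<And>r z. r\<in>I1 \<Longrightarrow> z\<in>square_boundary \<Longrightarrow> G (r, z) = K z"
    using K(1) by (auto simp: rel_homotopic_def)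
  let ?E = "\<lambda>x. if fst (snd x) \<le> 1/2 then F (fst x, 2 * fst (snd x), snd (snd x))
    else G (fst x, 2 * fst (snd x) - 1, snd (snd x))"
  have "continuous_map (top_of_set (I1 \<times> I2)) X ?E"
    by (rule continuous_map_glue)
       (use H(2) K(2) in \<open>auto intro!: continuous_map_reparam[OF F(1)] continuous_map_reparam[OF G(1)] continuous_intros
         simp: F(3) G(3) double_half square_boundary_iff square_def\<close>)
  then show ?thesis unfolding rel_homotopic_def
    by (intro exI[of _ ?E] conjI) (auto simp: F(2,3) G(2,3) vcat_def square_boundary_iff)
qed

lemma rel_homotopic_hcat:
  assumes H: "rel_homotopic X H H'" "square X H p q" and K: "rel_homotopic X K K'" "square X K p' q'"
    and "p 1 = p' 0"
  shows "rel_homotopic X (hcat K H) (hcat K' H')"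
proof -
  obtain F where F: "continuous_map (top_of_set (I1 \<times> I2)) X F"
     "\<And>z. z\<in>I2 \<Longrightarrow> F (0, z) = H z \<and> F (1, z) = H' z" "\<And>r z. r\<in>I1 \<Longrightarrow> z\<in>square_boundary \<Longrightarrow> F (r, z) = H z"
    using H(1) by (auto simp: rel_homotopic_def)
  obtain G where G: "continuous_map (top_of_set (I1 \<times> I2)) X G"
     "\<And>z. z\<in>I2 \<Longrightarrow> G (0, z) = K z \<and> G (1, z) = K' z" "\<And>r z. r\<in>I1 \<Longrightarrow> z\<in>square_boundary \<Longrightarrow> G (r, z) = K z"
    using K(1) by (auto simp: rel_homotopic_def)
  let ?E = "\<lambda>x. if snd (snd x) \<le> 1/2 then F (fst x, fst (snd x), 2 * snd (snd x))
    else G (fst x, fst (snd x), 2 * snd (snd x) - 1)"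
  have "continuous_map (top_of_set (I1 \<times> I2)) X ?E"
    by (rule continuous_map_glue)
       (use H(2) K(2) \<open>p 1 = p' 0\<close> in \<open>auto intro!: continuous_map_reparam[OF F(1)] continuous_map_reparam[OF G(1)] continuous_intros
         simp: F(3) G(3) double_half square_boundary_iff square_def\<close>)
  then show ?thesis unfolding rel_homotopic_def
    by (intro exI[of _ ?E] conjI) (auto simp: F(2,3) G(2,3) hcat_def square_boundary_iff)
qed

lemma VComp_sqclass:
  assumes "square X H p q" "square X K q r"
  shows "VComp (Pi2 X) (sqclass X K) (sqclass X H) = sqclass X (vcat K H)"
proof -
  have "VComp (Pi2 X) (sqclass X K) (sqclass X H) = sqclass X (vcat (hrep (sqclass X K)) (hrep (sqclass X H)))"
    by (simp add: Pi2_def vcat_def)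
  also have "\<dots> = sqclass X (vcat K H)"
    using sqclass_eqI[OF square_vcat[OF assms] rel_homotopic_vcat[OF hrep_sqclass(2)[OF assms(1)] assms(1)
        hrep_sqclass(2)[OF assms(2)] assms(2)]] by simp
  finally show ?thesis .
qed

lemma HComp_sqclass:
  assumes "square X H p q" "square X K p' q'" "p 1 = p' 0"
  shows "HComp (Pi2 X) (sqclass X K) (sqclass X H) = sqclass X (hcat K H)"
proof -
  have "HComp (Pi2 X) (sqclass X K) (sqclass X H) = sqclass X (hcat (hrep (sqclass X K)) (hrep (sqclass X H)))"
    by (simp add: Pi2_def hcat_def)
  also have "\<dots> = sqclass X (hcat K H)"
    using sqclass_eqI[OF square_hcat[OF assms] rel_homotopic_hcat[OF hrep_sqclass(2)[OF assms(1)] assms(1)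
        hrep_sqclass(2)[OF assms(2)] assms(2,3)]] by simp
  finally show ?thesis .
qed

lemma rel_homotopic_segment:
  fixes K :: "'v::real_normed_vector \<Rightarrow> 'a"
  assumes "convex D" and K: "continuous_map (top_of_set D) X K"
    and "continuous_on I2 \<Phi>" "continuous_on I2 \<Phi>'"
    and "\<And>z. z \<in> I2 \<Longrightarrow> \<Phi> z \<in> D" "\<And>z. z \<in> I2 \<Longrightarrow> \<Phi>' z \<in> D"
    and "\<And>r z. r \<in> I1 \<Longrightarrow> z \<in> square_boundary \<Longrightarrow> K ((1 - r) *\<^sub>R \<Phi> z + r *\<^sub>R \<Phi>' z) = K (\<Phi> z)"
  shows "rel_homotopic X (\<lambda>z. K (\<Phi> z)) (\<lambda>z. K (\<Phi>' z))"
proof -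
  let ?G = "\<lambda>x. K ((1 - fst x) *\<^sub>R \<Phi> (snd x) + fst x *\<^sub>R \<Phi>' (snd x))"
  have "continuous_map (top_of_set (I1 \<times> I2)) X ?G"
  proof (rule continuous_map_reparam[OF K])
    show "continuous_on (I1 \<times> I2) (\<lambda>x. (1 - fst x) *\<^sub>R \<Phi> (snd x) + fst x *\<^sub>R \<Phi>' (snd x))"
      by (intro continuous_intros continuous_on_compose2[OF assms(3)] continuous_on_compose2[OF assms(4)]) auto
    show "(1 - fst x) *\<^sub>R \<Phi> (snd x) + fst x *\<^sub>R \<Phi>' (snd x) \<in> D" if "x \<in> I1 \<times> I2" for x
      by (rule convexD[OF assms(1)]) (use that assms(5,6) in auto)
  qed
  then show ?thesis unfolding rel_homotopic_def
    using assms(7) by (intro exI[of _ ?G]) auto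
qed

subsection \<open>Lifted cells\<close>

text \<open>\<open>cell_lift X W \<Psi> \<alpha> p q\<close>: the 2-cell \<open>\<alpha>\<close> of \<open>\<Pi>\<^sub>2 X\<close> is the image under \<open>\<Psi>\<close> of a homotopy from \<open>p\<close>
  to \<open>q\<close> in \<open>W\<close>.  For contractible \<open>W\<close> it is determined by \<open>p\<close> and \<open>q\<close>; all coherence equations
  follow from this.\<close>

definition push :: "('w \<Rightarrow> 'a) \<Rightarrow> (real \<Rightarrow> 'w) \<Rightarrow> real \<Rightarrow> 'a" where
  "push \<Psi> p = (\<lambda>t\<in>I1. \<Psi> (p t))"

lemma push_ends [simp]: "push \<Psi> p 0 = \<Psi> (p 0)" "push \<Psi> p 1 = \<Psi> (p 1)"
  by (simp_all add: push_def)

lemma push_pcat1: "push \<Psi> (pcat1 q p) = path_concat (push \<Psi> q) (push \<Psi> p)"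
  by (auto simp: push_def pcat1_def path_concat_def fun_eq_iff)

lemma push_extensional [simp]: "push \<Psi> p \<in> extensional I1"
  by (simp add: push_def)

lemma pathin_push: "continuous_map W X \<Psi> \<Longrightarrow> pathin W p \<Longrightarrow> pathin X (push \<Psi> p)"
  using continuous_map_compose[of "top_of_set I1" W p X \<Psi>]
  by (auto simp: push_def pathin_def elim: continuous_map_eq)

definition cell_lift :: "'a topology \<Rightarrow> 'w topology \<Rightarrow> ('w \<Rightarrow> 'a) \<Rightarrow> (real \<times> real \<Rightarrow> 'a) set
    \<Rightarrow> (real \<Rightarrow> 'w) \<Rightarrow> (real \<Rightarrow> 'w) \<Rightarrow> bool" where
  "cell_lift X W \<Psi> \<alpha> p q \<longleftrightarrow> (\<exists>H. square W H p q \<and> \<alpha> = sqclass X (\<Psi> \<circ> H))"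

lemma cell_lift_in2:
  assumes "continuous_map W X \<Psi>" "cell_lift X W \<Psi> \<alpha> p q"
  shows "in2 (Pi2 X) \<alpha> (push \<Psi> p) (push \<Psi> q)"
proof -
  obtain H where H: "square W H p q" "\<alpha> = sqclass X (\<Psi> \<circ> H)" using assms unfolding cell_lift_def by blast
  have "square X (\<Psi> \<circ> H) (push \<Psi> p) (push \<Psi> q)"
    by (rule square_cong[OF square_map[OF H(1) assms(1)]]) (auto simp: push_def)
  then show ?thesis unfolding in2_Pi2 using H(2) by auto
qed

lemma cell_lift_unique:
  assumes "continuous_map W X \<Psi>" "contractible_space W" "cell_lift X W \<Psi> \<alpha> p q" "cell_lift X W \<Psi> \<beta> p q"
  shows "\<alpha> = \<beta>"
proof -
  obtain H where H: "square W H p q" "\<alpha> = sqclass X (\<Psi> \<circ> H)" using assms unfolding cell_lift_def by blast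
  obtain K where K: "square W K p q" "\<beta> = sqclass X (\<Psi> \<circ> K)" using assms unfolding cell_lift_def by blast
  show ?thesis
    using sqclass_eqI[OF square_map[OF H(1) assms(1)]
        rel_homotopic_map[OF contractible_rel_homotopic[OF assms(2) H(1) K(1)] assms(1)]]
    by (simp add: H(2) K(2))
qed

lemma cell_lift_pathin: "cell_lift X W \<Psi> \<alpha> p q \<Longrightarrow> pathin W p \<and> pathin W q \<and> q 0 = p 0 \<and> q 1 = p 1"
  unfolding cell_lift_def using square_pathin square_endpoints by metis

lemma cell_lift_cong:
  assumes "cell_lift X W \<Psi> \<alpha> p q" "\<And>t. t \<in> I1 \<Longrightarrow> p t = p' t" "\<And>t. t \<in> I1 \<Longrightarrow> q t = q' t"
  shows "cell_lift X W \<Psi> \<alpha> p' q'"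
  using assms square_cong[of W _ p q] unfolding cell_lift_def by metis

lemma cell_lift_VComp:
  assumes "continuous_map W X \<Psi>" "cell_lift X W \<Psi> \<alpha> p q" "cell_lift X W \<Psi> \<beta> q r"
  shows "cell_lift X W \<Psi> (VComp (Pi2 X) \<beta> \<alpha>) p r"
proof -
  obtain H where H: "square W H p q" "\<alpha> = sqclass X (\<Psi> \<circ> H)" using assms unfolding cell_lift_def by blast
  obtain K where K: "square W K q r" "\<beta> = sqclass X (\<Psi> \<circ> K)" using assms unfolding cell_lift_def by blast
  have "VComp (Pi2 X) \<beta> \<alpha> = sqclass X (vcat (\<Psi> \<circ> K) (\<Psi> \<circ> H))"
    unfolding H(2) K(2) by (rule VComp_sqclass[OF square_map[OF H(1) assms(1)] square_map[OF K(1) assms(1)]])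
  also have "vcat (\<Psi> \<circ> K) (\<Psi> \<circ> H) = \<Psi> \<circ> vcat K H" by (auto simp: vcat_def fun_eq_iff)
  finally show ?thesis using square_vcat[OF H(1) K(1)] unfolding cell_lift_def by blast
qed

lemma cell_lift_HComp:
  assumes "continuous_map W X \<Psi>" "cell_lift X W \<Psi> \<alpha> p q" "cell_lift X W \<Psi> \<beta> p' q'" "p 1 = p' 0"
  shows "cell_lift X W \<Psi> (HComp (Pi2 X) \<beta> \<alpha>) (pcat1 p' p) (pcat1 q' q)"
proof -
  obtain H where H: "square W H p q" "\<alpha> = sqclass X (\<Psi> \<circ> H)" using assms unfolding cell_lift_def by blast
  obtain K where K: "square W K p' q'" "\<beta> = sqclass X (\<Psi> \<circ> K)" using assms unfolding cell_lift_def by blast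
  have "HComp (Pi2 X) \<beta> \<alpha> = sqclass X (hcat (\<Psi> \<circ> K) (\<Psi> \<circ> H))"
    unfolding H(2) K(2)
    by (rule HComp_sqclass[OF square_map[OF H(1) assms(1)] square_map[OF K(1) assms(1)]]) (simp add: assms(4))
  also have "hcat (\<Psi> \<circ> K) (\<Psi> \<circ> H) = \<Psi> \<circ> hcat K H" by (auto simp: hcat_def fun_eq_iff)
  finally show ?thesis using square_hcat[OF H(1) K(1) assms(4)] unfolding cell_lift_def by blast
qed

lemma cell_lift_Id2:
  assumes "pathin W p"
  shows "cell_lift X W \<Psi> (Id2 (Pi2 X) (push \<Psi> p)) p p"
  using square_const[OF assms] unfolding cell_lift_def
  by (intro exI[of _ "\<lambda>(s, t). p t"]) (auto simp: push_def intro!: sqclass_cong)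

lemma cell_lift_reparam:
  assumes "pathin W p" "continuous_on I1 \<phi>" "\<And>t. t \<in> I1 \<Longrightarrow> \<phi> t \<in> I1" "\<phi> 0 = 0" "\<phi> 1 = 1"
    and "\<And>t. t \<in> I1 \<Longrightarrow> p (\<phi> t) = q t"
  shows "cell_lift X W \<Psi> (reparam X (push \<Psi> p) \<phi>) q p"
proof -
  have I: "(1 - s) * \<phi> t + s * t \<in> I1" if "s \<in> I1" "t \<in> I1" for s t
    using convexD[of I1 "\<phi> t" t "1 - s" s] that assms(3)[OF that(2)] by auto
  have "continuous_map (top_of_set I2) W (\<lambda>z. p ((1 - fst z) * \<phi> (snd z) + fst z * snd z))"
  proof (rule continuous_map_reparam)
    show "continuous_map (top_of_set I1) W p" using assms(1) by (simp add: pathin_def)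
    show "continuous_on I2 (\<lambda>z. (1 - fst z) * \<phi> (snd z) + fst z * snd z)"
      by (intro continuous_intros continuous_on_compose2[OF assms(2)]) auto
  qed (use I in auto)
  moreover have "q 0 = p 0" "q 1 = p 1" using assms(6)[of 0] assms(6)[of 1] assms(4,5) by auto
  ultimately have "square W (\<lambda>(s, t). p ((1 - s) * \<phi> t + s * t)) q p"
    using assms(4-6) by (auto simp: square_def case_prod_unfold)
  then show ?thesis unfolding cell_lift_def reparam_def
    by (intro exI conjI) (assumption, use I in \<open>auto simp: push_def intro!: sqclass_cong\<close>)
qed

lemma cell_lift_LUnit:
  assumes "pathin W p"
  shows "cell_lift X W \<Psi> (LUnit (Pi2 X) (push \<Psi> p)) (pcat1 (\<lambda>t. p 1) p) p"
  unfolding Pi2_simps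
  by (rule cell_lift_reparam) (auto simp: pcat1_def assms intro!: continuous_intros)

lemma cell_lift_RUnit:
  assumes "pathin W p"
  shows "cell_lift X W \<Psi> (RUnit (Pi2 X) (push \<Psi> p)) (pcat1 p (\<lambda>t. p 0)) p"
  unfolding Pi2_simps
  by (rule cell_lift_reparam) (auto simp: pcat1_def assms max.absorb1 max.absorb2 intro!: continuous_intros)

definition assoc_reparam :: "real \<Rightarrow> real" where
  "assoc_reparam t = (if t \<le> 1/2 then t / 2 else if t \<le> 3/4 then t - 1/4 else 2 * t - 1)"

lemma Assoc_Pi2: "Assoc (Pi2 X) h g f = reparam X (path_concat h (path_concat g f)) assoc_reparam"
  by (simp add: Pi2_def assoc_reparam_def[abs_def])

lemma assoc_reparam_alt: "assoc_reparam t = max (min (t / 2) (1/4)) (max (t - 1/4) (2 * t - 1))" if "t \<in> I1"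
  using that by (auto simp: assoc_reparam_def max_def min_def)

lemma continuous_on_assoc_reparam: "continuous_on I1 assoc_reparam"
  by (rule continuous_on_eq[OF _ assoc_reparam_alt[symmetric]]) (auto intro!: continuous_intros)

lemma assoc_reparam_bounds: "t \<in> I1 \<Longrightarrow> assoc_reparam t \<in> I1" "assoc_reparam 0 = 0" "assoc_reparam 1 = 1"
  by (auto simp: assoc_reparam_def)

lemma pcat1_assoc: "pcat1 r (pcat1 q p) (assoc_reparam t) = pcat1 (pcat1 r q) p t"
  by (auto simp: pcat1_def assoc_reparam_def algebra_simps)

lemma cell_lift_Assoc:
  assumes "pathin W p" "pathin W q" "pathin W r" "p 1 = q 0" "q 1 = r 0"
  shows "cell_lift X W \<Psi> (Assoc (Pi2 X) (push \<Psi> r) (push \<Psi> q) (push \<Psi> p))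
    (pcat1 (pcat1 r q) p) (pcat1 r (pcat1 q p))"
  unfolding Assoc_Pi2 push_pcat1[symmetric]
  by (rule cell_lift_reparam) (use assms assoc_reparam_bounds continuous_on_assoc_reparam pcat1_assoc in
     \<open>auto intro!: pathin_pcat1\<close>)

lemma cell_lift_reverse: "cell_lift X W \<Psi> \<alpha> p q \<Longrightarrow> \<exists>\<beta>. cell_lift X W \<Psi> \<beta> q p"
  unfolding cell_lift_def using square_reverse by blast

lemma cell_lift_inverse2:
  assumes "continuous_map W X \<Psi>" "contractible_space W" "cell_lift X W \<Psi> \<alpha> p q" "cell_lift X W \<Psi> \<beta> q p"
  shows "inverse2 (Pi2 X) \<alpha> \<beta>"
proof -
  have "in2 (Pi2 X) \<alpha> (push \<Psi> p) (push \<Psi> q)" "in2 (Pi2 X) \<beta> (push \<Psi> q) (push \<Psi> p)"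
    using cell_lift_in2 assms by blast+
  moreover have "VComp (Pi2 X) \<beta> \<alpha> = Id2 (Pi2 X) (push \<Psi> p)"
    by (rule cell_lift_unique[OF assms(1,2) cell_lift_VComp[OF assms(1,3,4)] cell_lift_Id2]) (use cell_lift_pathin assms in blast)
  moreover have "VComp (Pi2 X) \<alpha> \<beta> = Id2 (Pi2 X) (push \<Psi> q)"
    by (rule cell_lift_unique[OF assms(1,2) cell_lift_VComp[OF assms(1,4,3)] cell_lift_Id2]) (use cell_lift_pathin assms in blast)
  ultimately show ?thesis by (simp add: inverse2_def in2_def)
qed

lemma cell_lift_iso2:
  assumes "continuous_map W X \<Psi>" "contractible_space W" "cell_lift X W \<Psi> \<alpha> p q"
  shows "iso2 (Pi2 X) \<alpha> (push \<Psi> p) (push \<Psi> q)"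
  unfolding iso2_def using cell_lift_in2 cell_lift_reverse[OF assms(3)] cell_lift_inverse2 assms by metis

lemma cell_lift_change:
  assumes "cell_lift X V \<Psi>' \<alpha> p q" "continuous_map V W \<Phi>" "\<And>v. v \<in> topspace V \<Longrightarrow> \<Psi>' v = \<Psi> (\<Phi> v)"
  shows "cell_lift X W \<Psi> \<alpha> (\<lambda>t. \<Phi> (p t)) (\<lambda>t. \<Phi> (q t))"
proof -
  obtain H where H: "square V H p q" "\<alpha> = sqclass X (\<Psi>' \<circ> H)" using assms unfolding cell_lift_def by blast
  have "\<alpha> = sqclass X (\<Psi> \<circ> (\<Phi> \<circ> H))"
    unfolding H(2) by (rule sqclass_cong) (use square_in_topspace[OF H(1)] assms(3) in auto)
  then show ?thesis using square_map[OF H(1) assms(2)] unfolding cell_lift_def by blast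
qed

lemma sqclass_reparam:
  assumes K: "square X K p q" and L: "square X L p' q'"
    and \<Phi>: "continuous_on I2 \<Phi>" "\<And>z. z \<in> I2 \<Longrightarrow> \<Phi> z \<in> I2" "\<And>z. z \<in> I2 \<Longrightarrow> L z = K (\<Phi> z)"
    and \<Phi>': "continuous_on I2 \<Phi>'" "\<And>z. z \<in> I2 \<Longrightarrow> \<Phi>' z \<in> I2" "\<And>z. z \<in> I2 \<Longrightarrow> M z = K (\<Phi>' z)"
    and v: "\<And>t. t \<in> I1 \<Longrightarrow> \<Phi> (0, t) = \<Phi>' (0, t)" "\<And>t. t \<in> I1 \<Longrightarrow> \<Phi> (1, t) = \<Phi>' (1, t)"
    and h: "\<And>s. s \<in> I1 \<Longrightarrow> snd (\<Phi> (s, 0)) = 0 \<and> snd (\<Phi>' (s, 0)) = 0"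
      "\<And>s. s \<in> I1 \<Longrightarrow> snd (\<Phi> (s, 1)) = 1 \<and> snd (\<Phi>' (s, 1)) = 1"
  shows "sqclass X L = sqclass X M"
proof (rule sqclass_eqI[OF L])
  have K0: "K z = p 0" if "z \<in> I2" "snd z = 0" for z
    using K that unfolding square_def by (cases z) auto
  have K1: "K z = p 1" if "z \<in> I2" "snd z = 1" for z
    using K that unfolding square_def by (cases z) auto
  have cvx: "convex I2" by (intro convex_Times) auto
  have "rel_homotopic X (\<lambda>z. K (\<Phi> z)) (\<lambda>z. K (\<Phi>' z))"
  proof (rule rel_homotopic_segment[OF cvx square_continuous[OF K] \<Phi>(1) \<Phi>'(1)])
    fix r :: real and z :: "real \<times> real" assume r: "r \<in> I1" and z: "z \<in> square_boundary"
    have zI: "z \<in> I2" using square_boundary_subset z by blast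
    have I: "(1 - r) *\<^sub>R \<Phi> z + r *\<^sub>R \<Phi>' z \<in> I2"
      by (rule convexD[OF cvx]) (use r zI \<Phi>(2) \<Phi>'(2) in auto)
    show "K ((1 - r) *\<^sub>R \<Phi> z + r *\<^sub>R \<Phi>' z) = K (\<Phi> z)"
      using z
    proof (cases rule: square_boundaryE)
      case (1 t)
      then have "\<Phi>' z = \<Phi> z" using v by simp
      then show ?thesis by (simp flip: scaleR_add_left)
    next
      case (2 t)
      then have "\<Phi>' z = \<Phi> z" using v by simp
      then show ?thesis by (simp flip: scaleR_add_left)
    next
      case (3 s)
      then show ?thesis using K0[OF I] K0[OF \<Phi>(2)[OF zI]] h(1)[of s] by simp
    next
      case (4 s)
      then show ?thesis using K1[OF I] K1[OF \<Phi>(2)[OF zI]] h(2)[of s] by simp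
    qed
  qed (use \<Phi> \<Phi>' in auto)
  then show "rel_homotopic X L M" by (rule rel_homotopic_cong) (use \<Phi> \<Phi>' in auto)
qed

definition lerp :: "real \<Rightarrow> real \<Rightarrow> real \<Rightarrow> real" where
  "lerp c u v = (1 - c) * u + c * v"

lemma lerp_in: "c \<in> I1 \<Longrightarrow> u \<in> I1 \<Longrightarrow> v \<in> I1 \<Longrightarrow> lerp c u v \<in> I1"
  using convexD[of I1 u v "1 - c" c] by (simp add: lerp_def)

lemma lerp_simps [simp]: "lerp 0 u v = u" "lerp 1 u v = v" "lerp c u u = u"
  by (simp_all add: lerp_def algebra_simps)

lemma square_reparam:
  assumes "pathin X f" "continuous_on I1 \<phi>" "\<And>t. t \<in> I1 \<Longrightarrow> \<phi> t \<in> I1" "\<phi> 0 = 0" "\<phi> 1 = 1"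
  shows "square X (\<lambda>(s, t). f (lerp s (\<phi> t) t)) (\<lambda>t. f (\<phi> t)) f"
proof -
  have "continuous_map (top_of_set I2) X (\<lambda>z. f (lerp (fst z) (\<phi> (snd z)) (snd z)))"
  proof (rule continuous_map_reparam)
    show "continuous_map (top_of_set I1) X f" using assms(1) by (simp add: pathin_def)
    show "continuous_on I2 (\<lambda>z. lerp (fst z) (\<phi> (snd z)) (snd z))"
      unfolding lerp_def by (intro continuous_intros continuous_on_compose2[OF assms(2)]) auto
    show "lerp (fst z) (\<phi> (snd z)) (snd z) \<in> I1" if "z \<in> I2" for z
      by (rule lerp_in) (use that assms(3)[of "snd z"] in auto)
  qed
  with assms(4,5) show ?thesis by (auto simp: square_def case_prod_unfold)
qed

lemma reparam_lerp: "reparam X f \<phi> = sqclass X (\<lambda>(s, t). f (lerp s (\<phi> t) t))"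
  by (simp add: reparam_def lerp_def)

lemma reparam_natural:
  assumes K: "square X K f f'" and L: "square X L p p'"
    and \<phi>: "continuous_on I1 \<phi>" "\<And>t. t \<in> I1 \<Longrightarrow> \<phi> t \<in> I1" "\<phi> 0 = 0" "\<phi> 1 = 1"
    and LK: "\<And>s t. s \<in> I1 \<Longrightarrow> t \<in> I1 \<Longrightarrow> L (s, t) = K (s, \<phi> t)"
  shows "VComp (Pi2 X) (reparam X f' \<phi>) (sqclass X L) = VComp (Pi2 X) (sqclass X K) (reparam X f \<phi>)"
proof -
  have f: "pathin X f" "pathin X f'" using square_pathin[OF K] by auto
  note R = square_reparam[OF f(1) \<phi>] and R' = square_reparam[OF f(2) \<phi>]
  have K': "K (0, t) = f t" "K (1, t) = f' t" if "t \<in> I1" for t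
    using K that by (auto simp: square_def)
  have L': "square X L (\<lambda>t. f (\<phi> t)) (\<lambda>t. f' (\<phi> t))"
    by (rule square_cong[OF square_self[OF L]]) (use LK K' \<phi>(2) in auto)
  let ?\<Phi> = "\<lambda>z. (min (2 * fst z) 1, lerp (max (2 * fst z - 1) 0) (\<phi> (snd z)) (snd z))"
  let ?\<Phi>' = "\<lambda>z. (max (2 * fst z - 1) 0, lerp (min (2 * fst z) 1) (\<phi> (snd z)) (snd z))"
  have I: "lerp c (\<phi> t) t \<in> I1" if "c \<in> I1" "t \<in> I1" for c t
    using that \<phi>(2) by (intro lerp_in) auto
  have cont: "continuous_on I2 (\<lambda>z. \<phi> (snd z))"
    by (intro continuous_on_compose2[OF \<phi>(1)] continuous_intros) auto
  have "sqclass X (vcat (\<lambda>(s, t). f' (lerp s (\<phi> t) t)) L) =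
      sqclass X (vcat K (\<lambda>(s, t). f (lerp s (\<phi> t) t)))"
  proof (rule sqclass_reparam[OF K square_vcat[OF L' R']])
    show "continuous_on I2 ?\<Phi>" "continuous_on I2 ?\<Phi>'"
      unfolding lerp_def by (intro continuous_intros cont)+
    fix z assume z: "z \<in> I2"
    show "?\<Phi> z \<in> I2" "?\<Phi>' z \<in> I2"
      using z I[of "max (2 * fst z - 1) 0" "snd z"] I[of "min (2 * fst z) 1" "snd z"] by auto
    obtain s t where st: "z = (s, t)" "s \<in> I1" "t \<in> I1" using z by auto
    have c: "2 * s - 1 \<in> I1" if "\<not> s \<le> 1/2" using that st by auto
    have c': "2 * s \<in> I1" if "s \<le> 1/2" using that st by auto
    show "vcat (\<lambda>(s, t). f' (lerp s (\<phi> t) t)) L z = K (?\<Phi> z)"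
    proof (cases "s \<le> 1/2")
      case True
      with LK[OF c'[OF True] st(3)] show ?thesis by (simp add: vcat_def st max_def)
    next
      case False
      with K'(2)[OF I[OF c[OF False] st(3)]] show ?thesis by (simp add: vcat_def st max_def min_def)
    qed
    show "vcat K (\<lambda>(s, t). f (lerp s (\<phi> t) t)) z = K (?\<Phi>' z)"
    proof (cases "s \<le> 1/2")
      case True
      with K'(1)[OF I[OF c'[OF True] st(3)]] show ?thesis by (simp add: vcat_def st max_def min_def)
    next
      case False
      then show ?thesis by (simp add: vcat_def st max_def min_def)
    qed
  qed (simp_all add: \<phi>(3,4))
  then show ?thesis
    by (simp only: reparam_lerp VComp_sqclass[OF L' R'] VComp_sqclass[OF R K])
qed

lemma push_self: "f \<in> extensional I1 \<Longrightarrow> push f (\<lambda>t. t) = f"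
  by (simp add: push_def extensional_restrict)

lemma push_first: "f \<in> extensional I1 \<Longrightarrow> push (path_concat g f) (\<lambda>t. t / 2) = f"
  by (auto simp: push_def path_concat_def fun_eq_iff extensional_def)

lemma push_second:
  assumes "g \<in> extensional I1" "f 1 = g 0"
  shows "push (path_concat g f) (\<lambda>t. 1 / 2 + t / 2) = g"
proof
  fix t show "push (path_concat g f) (\<lambda>t. 1 / 2 + t / 2) t = g t"
    using assms by (cases "t = 0") (auto simp: push_def path_concat_def extensional_def)
qed

lemma push_push: "(\<And>t. t \<in> I1 \<Longrightarrow> q t \<in> I1) \<Longrightarrow> push (push \<Psi> p) q = push \<Psi> (\<lambda>t. p (q t))"
  by (auto simp: push_def fun_eq_iff)

lemma path_concat_extensional [simp]: "path_concat g f \<in> extensional I1"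
  by (simp add: path_concat_def)

lemma path_concat_pcat1: "path_concat g f = restrict (pcat1 g f) I1"
  by (auto simp: path_concat_def pcat1_def)

lemma path_concat_ends [simp]: "path_concat g f 0 = f 0" "path_concat g f 1 = g 1"
  by (simp_all add: path_concat_pcat1)

lemma pathin_cong: "pathin X p \<Longrightarrow> (\<And>t. t \<in> I1 \<Longrightarrow> p t = q t) \<Longrightarrow> pathin X q"
  unfolding pathin_def by (erule continuous_map_eq) auto

lemma pathin_path_concat: "pathin X f \<Longrightarrow> pathin X g \<Longrightarrow> f 1 = g 0 \<Longrightarrow> pathin X (path_concat g f)"
  using pathin_cong[OF pathin_pcat1, of X f g "path_concat g f"] by (simp add: path_concat_pcat1)

lemma contractible_I1: "contractible_space (top_of_set I1)"
  by (simp add: convex_imp_contractible)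

lemma pathin_I1: "continuous_on I1 p \<Longrightarrow> (\<And>t. t \<in> I1 \<Longrightarrow> p t \<in> D) \<Longrightarrow> pathin (top_of_set D) p"
  by (auto simp: pathin_def continuous_map_in_subtopology)

lemma rel_id_reparam:
  assumes K: "square X K f g"
  shows "sqclass X (vcat K (\<lambda>(s, t). f t)) = sqclass X K" "sqclass X (vcat (\<lambda>(s, t). g t) K) = sqclass X K"
proof -
  have K': "K (0, t) = f t" "K (1, t) = g t" if "t \<in> I1" for t
    using K that by (auto simp: square_def)
  have f: "pathin X f" "pathin X g" using square_pathin[OF K] by auto
  show "sqclass X (vcat K (\<lambda>(s, t). f t)) = sqclass X K"
    by (rule sqclass_reparam[OF K square_vcat[OF square_const[OF f(1)] K],
          of "\<lambda>z. (max (2 * fst z - 1) 0, snd z)" "\<lambda>z. z"])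
       (auto simp: vcat_def K' max.absorb1 max.absorb2 min.absorb1 min.absorb2 intro!: continuous_intros)
  show "sqclass X (vcat (\<lambda>(s, t). g t) K) = sqclass X K"
    by (rule sqclass_reparam[OF K square_vcat[OF K square_const[OF f(2)]],
          of "\<lambda>z. (min (2 * fst z) 1, snd z)" "\<lambda>z. z"])
       (auto simp: vcat_def K' max.absorb1 max.absorb2 min.absorb1 min.absorb2 intro!: continuous_intros)
qed

lemma in2_cases:
  assumes "in2 (Pi2 X) \<alpha> f g"
  obtains H where "square X H f g" "\<alpha> = sqclass X H" "f \<in> extensional I1" "g \<in> extensional I1"
    "pathin X f" "pathin X g" "g 0 = f 0" "g 1 = f 1"
proof -
  obtain H where "square X H f g" "\<alpha> = sqclass X H" "f \<in> extensional I1" "g \<in> extensional I1"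
    using assms unfolding in2_Pi2 by blast
  then show ?thesis using that square_pathin[of X H f g] square_endpoints[of X H f g] by blast
qed

lemma sqclass_in2:
  "square X H f g \<Longrightarrow> f \<in> extensional I1 \<Longrightarrow> g \<in> extensional I1 \<Longrightarrow> in2 (Pi2 X) (sqclass X H) f g"
  unfolding in2_Pi2 by blast

lemma path_square:
  assumes "square X H (pcat1 p' p) (pcat1 q' q)"
  shows "square X H (path_concat p' p) (path_concat q' q)"
  by (rule square_cong[OF assms]) (auto simp: path_concat_pcat1)

lemma Pi2_Assoc_lift:
  assumes f: "in1 (Pi2 X) f w x" and g: "in1 (Pi2 X) g x y" and h: "in1 (Pi2 X) h y z"
  shows "iso2 (Pi2 X) (Assoc (Pi2 X) h g f) (path_concat (path_concat h g) f) (path_concat h (path_concat g f))"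
proof -
  note in1 = f[unfolded in1_Pi2] g[unfolded in1_Pi2] h[unfolded in1_Pi2]
  define K where "K = path_concat h (path_concat g f)"
  let ?f = "\<lambda>t::real. t / 4" and ?g = "\<lambda>t::real. 1 / 4 + t / 4" and ?h = "\<lambda>t::real. 1 / 2 + t / 2"
  have K: "continuous_map (top_of_set I1) X K"
    unfolding K_def pathin_def[symmetric] by (intro pathin_path_concat) (use in1 in auto)
  have gf: "push K (\<lambda>t. t / 2) = path_concat g f" unfolding K_def by (rule push_first) simp
  have "push K ?f = f" "push K ?g = g"
    using push_first[of f g] push_second[of g f] in1
      push_push[of "\<lambda>t. t / 2" K "\<lambda>t. t / 2"] push_push[of "\<lambda>t. 1 / 2 + t / 2" K "\<lambda>t. t / 2"]
    by (simp_all add: gf add_divide_distrib)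
  moreover have "push K ?h = h" unfolding K_def by (rule push_second) (use in1 in auto)
  ultimately have *: "push K ?f = f" "push K ?g = g" "push K ?h = h" by auto
  have "cell_lift X (top_of_set I1) K (Assoc (Pi2 X) (push K ?h) (push K ?g) (push K ?f))
    (pcat1 (pcat1 ?h ?g) ?f) (pcat1 ?h (pcat1 ?g ?f))"
    by (rule cell_lift_Assoc) (auto intro!: pathin_I1 continuous_intros)
  from cell_lift_iso2[OF K contractible_I1 this] show ?thesis by (simp add: push_pcat1 *)
qed

lemma Pi2_LUnit_lift:
  assumes f: "in1 (Pi2 X) f x y"
  shows "iso2 (Pi2 X) (LUnit (Pi2 X) f) (path_concat (\<lambda>t\<in>I1. y) f) f"
    and "iso2 (Pi2 X) (RUnit (Pi2 X) f) (path_concat f (\<lambda>t\<in>I1. x)) f"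
proof -
  note in1 = f[unfolded in1_Pi2]
  have K: "continuous_map (top_of_set I1) X f" using in1 by (simp add: pathin_def)
  have *: "push f (\<lambda>t. t) = f" using in1 push_self by blast
  have "cell_lift X (top_of_set I1) f (LUnit (Pi2 X) (push f (\<lambda>t. t))) (pcat1 (\<lambda>t. 1) (\<lambda>t. t)) (\<lambda>t. t)"
    by (rule cell_lift_LUnit) (auto intro!: pathin_I1 continuous_intros)
  from cell_lift_iso2[OF K contractible_I1 this]
  show "iso2 (Pi2 X) (LUnit (Pi2 X) f) (path_concat (\<lambda>t\<in>I1. y) f) f"
    using in1 by (simp add: push_pcat1 * push_def[of f "\<lambda>t. 1"] del: Pi2_simps)
  have "cell_lift X (top_of_set I1) f (RUnit (Pi2 X) (push f (\<lambda>t. t))) (pcat1 (\<lambda>t. t) (\<lambda>t. 0)) (\<lambda>t. t)"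
    by (rule cell_lift_RUnit) (auto intro!: pathin_I1 continuous_intros)
  from cell_lift_iso2[OF K contractible_I1 this]
  show "iso2 (Pi2 X) (RUnit (Pi2 X) f) (path_concat f (\<lambda>t\<in>I1. x)) f"
    using in1 by (simp add: push_pcat1 * push_def[of f "\<lambda>t. 0"] del: Pi2_simps)
qed

lemma Pi2_pentagon:
  assumes f: "in1 (Pi2 X) f v w" and g: "in1 (Pi2 X) g w x" and h: "in1 (Pi2 X) h x y" and k: "in1 (Pi2 X) k y z"
  shows "VComp (Pi2 X) (Assoc (Pi2 X) k h (path_concat g f)) (Assoc (Pi2 X) (path_concat k h) g f) =
      VComp (Pi2 X) (HComp (Pi2 X) (Id2 (Pi2 X) k) (Assoc (Pi2 X) h g f))
        (VComp (Pi2 X) (Assoc (Pi2 X) k (path_concat h g) f) (HComp (Pi2 X) (Assoc (Pi2 X) k h g) (Id2 (Pi2 X) f)))"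
proof -
  note in1 = f[unfolded in1_Pi2] g[unfolded in1_Pi2] h[unfolded in1_Pi2] k[unfolded in1_Pi2]
  define K where "K = path_concat (path_concat k h) (path_concat g f)"
  let ?f = "\<lambda>t::real. t / 4" and ?g = "\<lambda>t::real. 1 / 4 + t / 4"
    and ?h = "\<lambda>t::real. 1 / 2 + t / 4" and ?k = "\<lambda>t::real. 3 / 4 + t / 4"
  have K: "continuous_map (top_of_set I1) X K"
    unfolding K_def pathin_def[symmetric] by (intro pathin_path_concat) (use in1 in auto)
  have gf: "push K (\<lambda>t. t / 2) = path_concat g f" unfolding K_def by (rule push_first) simp
  have kh: "push K (\<lambda>t. 1 / 2 + t / 2) = path_concat k h" unfolding K_def by (rule push_second) (use in1 in auto)
  have *: "push K ?f = f" "push K ?g = g" "push K ?h = h" "push K ?k = k"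
    using push_first[of f g] push_second[of g f] push_first[of h k] push_second[of k h] in1
      push_push[of "\<lambda>t. t / 2" K "\<lambda>t. t / 2"] push_push[of "\<lambda>t. 1 / 2 + t / 2" K "\<lambda>t. t / 2"]
      push_push[of "\<lambda>t. t / 2" K "\<lambda>t. 1 / 2 + t / 2"] push_push[of "\<lambda>t. 1 / 2 + t / 2" K "\<lambda>t. 1 / 2 + t / 2"]
    by (simp_all add: gf kh add_divide_distrib)
  have p: "pathin (top_of_set I1) ?f" "pathin (top_of_set I1) ?g" "pathin (top_of_set I1) ?h" "pathin (top_of_set I1) ?k"
    by (auto intro!: pathin_I1 continuous_intros)
  note rules = cell_lift_VComp[OF K] cell_lift_HComp[OF K] cell_lift_Assoc cell_lift_Id2 pathin_pcat1 p
  have "VComp (Pi2 X) (Assoc (Pi2 X) (push K ?k) (push K ?h) (push K (pcat1 ?g ?f)))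
       (Assoc (Pi2 X) (push K (pcat1 ?k ?h)) (push K ?g) (push K ?f)) =
      VComp (Pi2 X) (HComp (Pi2 X) (Id2 (Pi2 X) (push K ?k)) (Assoc (Pi2 X) (push K ?h) (push K ?g) (push K ?f)))
        (VComp (Pi2 X) (Assoc (Pi2 X) (push K ?k) (push K (pcat1 ?h ?g)) (push K ?f))
          (HComp (Pi2 X) (Assoc (Pi2 X) (push K ?k) (push K ?h) (push K ?g)) (Id2 (Pi2 X) (push K ?f))))"
    by (rule cell_lift_unique[OF K contractible_I1]) (rule rules | simp)+
  then show ?thesis unfolding push_pcat1 * .
qed

lemma Pi2_triangle:
  assumes f: "in1 (Pi2 X) f x y" and g: "in1 (Pi2 X) g y z"
  shows "VComp (Pi2 X) (HComp (Pi2 X) (Id2 (Pi2 X) g) (LUnit (Pi2 X) f)) (Assoc (Pi2 X) g (\<lambda>t\<in>I1. y) f) =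
      HComp (Pi2 X) (RUnit (Pi2 X) g) (Id2 (Pi2 X) f)"
proof -
  note in1 = f[unfolded in1_Pi2] g[unfolded in1_Pi2]
  define K where "K = path_concat g f"
  let ?f = "\<lambda>t::real. t / 2" and ?g = "\<lambda>t::real. 1 / 2 + t / 2" and ?i = "\<lambda>t::real. 1 / 2 :: real"
  have K: "continuous_map (top_of_set I1) X K"
    unfolding K_def pathin_def[symmetric] by (intro pathin_path_concat) (use in1 in auto)
  have *: "push K ?f = f" "push K ?g = g"
    unfolding K_def by (rule push_first push_second, use in1 in auto)+
  have i: "push K ?i = (\<lambda>t\<in>I1. y)" using in1 by (simp add: push_def K_def path_concat_def)
  have p: "pathin (top_of_set I1) ?f" "pathin (top_of_set I1) ?g" "pathin (top_of_set I1) ?i"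
    by (auto intro!: pathin_I1 continuous_intros)
  have l: "cell_lift X (top_of_set I1) K (LUnit (Pi2 X) (push K ?f)) (pcat1 ?i ?f) ?f"
    using cell_lift_LUnit[OF p(1)] by simp
  have r: "cell_lift X (top_of_set I1) K (RUnit (Pi2 X) (push K ?g)) (pcat1 ?g ?i) ?g"
    using cell_lift_RUnit[OF p(2)] by simp
  note rules = cell_lift_VComp[OF K] cell_lift_HComp[OF K] cell_lift_Assoc cell_lift_Id2 l r pathin_pcat1 p
  have "VComp (Pi2 X) (HComp (Pi2 X) (Id2 (Pi2 X) (push K ?g)) (LUnit (Pi2 X) (push K ?f)))
         (Assoc (Pi2 X) (push K ?g) (push K ?i) (push K ?f)) =
      HComp (Pi2 X) (RUnit (Pi2 X) (push K ?g)) (Id2 (Pi2 X) (push K ?f))"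
    by (rule cell_lift_unique[OF K contractible_I1]) (rule rules | simp)+
  then show ?thesis unfolding * i .
qed

lemma pathin_topspace: "pathin X f \<Longrightarrow> t \<in> I1 \<Longrightarrow> f t \<in> topspace X"
  unfolding pathin_def continuous_map_def by auto

lemma pathin_const_restrict:
  assumes "y \<in> topspace X" shows "pathin X (\<lambda>t\<in>I1. y)"
proof (rule pathin_cong)
  show "pathin X (\<lambda>t. y)" using assms by (simp add: pathin_const)
qed simp

theorem bicategory_Pi2: "bicategory (Pi2 X)"
proof
  fix f assume "f \<in> Ar (Pi2 X)"
  then show "Src (Pi2 X) f \<in> Ob (Pi2 X) \<and> Trg (Pi2 X) f \<in> Ob (Pi2 X)"
    using pathin_topspace[of X f 0] pathin_topspace[of X f 1] by (simp add: paths_def)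
  show "in2 (Pi2 X) (Id2 (Pi2 X) f) f f"
    unfolding Pi2_simps
    by (rule sqclass_in2[OF square_const]) (use \<open>f \<in> Ar (Pi2 X)\<close> in \<open>simp_all add: paths_def\<close>)
next
  fix \<alpha> assume "\<alpha> \<in> Cells (Pi2 X)"
  then have "in2 (Pi2 X) \<alpha> (Src2 (Pi2 X) \<alpha>) (Trg2 (Pi2 X) \<alpha>)" by (simp add: in2_def)
  then show "Src2 (Pi2 X) \<alpha> \<in> Ar (Pi2 X) \<and> Trg2 (Pi2 X) \<alpha> \<in> Ar (Pi2 X)"
    and "Src (Pi2 X) (Src2 (Pi2 X) \<alpha>) = Src (Pi2 X) (Trg2 (Pi2 X) \<alpha>) \<and>
      Trg (Pi2 X) (Src2 (Pi2 X) \<alpha>) = Trg (Pi2 X) (Trg2 (Pi2 X) \<alpha>)"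
    by (cases rule: in2_cases, simp add: paths_def)+
next
  fix x assume "x \<in> Ob (Pi2 X)"
  then show "in1 (Pi2 X) (Id1 (Pi2 X) x) x x"
    unfolding in1_Pi2 by (auto intro: pathin_cong[of X "\<lambda>t. x"] simp: pathin_const)
next
  fix f g x y z assume "in1 (Pi2 X) f x y" "in1 (Pi2 X) g y z"
  then show "in1 (Pi2 X) (Comp (Pi2 X) g f) x z"
    unfolding in1_Pi2 by (simp add: pathin_path_concat)
next
  fix \<alpha> f g \<beta> h assume "in2 (Pi2 X) \<alpha> f g" "in2 (Pi2 X) \<beta> g h"
  then show "in2 (Pi2 X) (VComp (Pi2 X) \<beta> \<alpha>) f h"
    by (elim in2_cases) (simp add: VComp_sqclass sqclass_in2 square_vcat)
next
  fix \<alpha> f g assume "in2 (Pi2 X) \<alpha> f g"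
  then show "VComp (Pi2 X) \<alpha> (Id2 (Pi2 X) f) = \<alpha> \<and> VComp (Pi2 X) (Id2 (Pi2 X) g) \<alpha> = \<alpha>"
    by (elim in2_cases) (simp add: VComp_sqclass[OF square_const] VComp_sqclass[OF _ square_const] rel_id_reparam)
next
  fix \<alpha> f g \<beta> h \<gamma> k
  assume "in2 (Pi2 X) \<alpha> f g" "in2 (Pi2 X) \<beta> g h" "in2 (Pi2 X) \<gamma> h k"
  then obtain F G H where F: "square X F f g" "\<alpha> = sqclass X F" and G: "square X G g h" "\<beta> = sqclass X G"
    and H: "square X H h k" "\<gamma> = sqclass X H" by (metis in2_Pi2)
  have "sqclass X (vcat (vcat H G) F) = sqclass X (vcat H (vcat G F))"
    by (rule sqclass_reparam[OF square_vcat[OF square_vcat[OF F(1) G(1)] H(1)]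
          square_vcat[OF F(1) square_vcat[OF G(1) H(1)]], of "\<lambda>z. (assoc_reparam (fst z), snd z)" "\<lambda>z. z"])
       (auto simp: assoc_reparam_bounds intro!: continuous_intros continuous_on_compose2[OF continuous_on_assoc_reparam],
        auto simp: vcat_def assoc_reparam_def algebra_simps)
  then show "VComp (Pi2 X) (VComp (Pi2 X) \<gamma> \<beta>) \<alpha> = VComp (Pi2 X) \<gamma> (VComp (Pi2 X) \<beta> \<alpha>)"
    unfolding F(2) G(2) H(2) VComp_sqclass[OF F(1) G(1)] VComp_sqclass[OF G(1) H(1)]
      VComp_sqclass[OF F(1) square_vcat[OF G(1) H(1)]] VComp_sqclass[OF square_vcat[OF F(1) G(1)] H(1)] .
next
  fix \<alpha> f f' \<beta> g g'
  assume "in2 (Pi2 X) \<alpha> f f'" "in2 (Pi2 X) \<beta> g g'" "Trg (Pi2 X) f = Src (Pi2 X) g"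
  then show "in2 (Pi2 X) (HComp (Pi2 X) \<beta> \<alpha>) (Comp (Pi2 X) g f) (Comp (Pi2 X) g' f')"
    by (elim in2_cases) (simp add: HComp_sqclass sqclass_in2 path_square square_hcat)
next
  fix f x y g z assume "in1 (Pi2 X) f x y" "in1 (Pi2 X) g y z"
  then have *: "pathin X f" "pathin X g" "f 1 = g 0" by (auto simp: in1_Pi2)
  show "HComp (Pi2 X) (Id2 (Pi2 X) g) (Id2 (Pi2 X) f) = Id2 (Pi2 X) (Comp (Pi2 X) g f)"
    unfolding Pi2_simps HComp_sqclass[OF square_const[OF *(1)] square_const[OF *(2)] *(3)]
    by (rule sqclass_cong) (auto simp: hcat_def path_concat_def)
next
  fix \<alpha> f f' \<alpha>' f'' \<beta> g g' \<beta>' g''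
  assume *: "in2 (Pi2 X) \<alpha> f f'" "in2 (Pi2 X) \<alpha>' f' f''" "in2 (Pi2 X) \<beta> g g'" "in2 (Pi2 X) \<beta>' g' g''"
    and fg: "Trg (Pi2 X) f = Src (Pi2 X) g"
  obtain A where A: "square X A f f'" "\<alpha> = sqclass X A" using in2_Pi2_hrep[OF *(1)] by blast
  obtain A' where A': "square X A' f' f''" "\<alpha>' = sqclass X A'" using in2_Pi2_hrep[OF *(2)] by blast
  obtain B where B: "square X B g g'" "\<beta> = sqclass X B" using in2_Pi2_hrep[OF *(3)] by blast
  obtain B' where B': "square X B' g' g''" "\<beta>' = sqclass X B'" using in2_Pi2_hrep[OF *(4)] by blast
  have fg: "f 1 = g 0" "f' 1 = g' 0"
    using fg square_endpoints[OF A(1)] square_endpoints[OF B(1)] by auto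
  have "hcat (vcat B' B) (vcat A' A) = vcat (hcat B' A') (hcat B A)"
    by (auto simp: hcat_def vcat_def fun_eq_iff)
  then show "HComp (Pi2 X) (VComp (Pi2 X) \<beta>' \<beta>) (VComp (Pi2 X) \<alpha>' \<alpha>) =
      VComp (Pi2 X) (HComp (Pi2 X) \<beta>' \<alpha>') (HComp (Pi2 X) \<beta> \<alpha>)"
    unfolding A(2) A'(2) B(2) B'(2) VComp_sqclass[OF A(1) A'(1)] VComp_sqclass[OF B(1) B'(1)]
      HComp_sqclass[OF square_vcat[OF A(1) A'(1)] square_vcat[OF B(1) B'(1)] fg(1)]
      HComp_sqclass[OF A(1) B(1) fg(1)] HComp_sqclass[OF A'(1) B'(1) fg(2)]
      VComp_sqclass[OF square_hcat[OF A(1) B(1) fg(1)] square_hcat[OF A'(1) B'(1) fg(2)]] by simp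
next
  fix f w x g y h z assume "in1 (Pi2 X) f w x" "in1 (Pi2 X) g x y" "in1 (Pi2 X) h y z"
  then show "iso2 (Pi2 X) (Assoc (Pi2 X) h g f) (Comp (Pi2 X) (Comp (Pi2 X) h g) f) (Comp (Pi2 X) h (Comp (Pi2 X) g f))"
    using Pi2_Assoc_lift by simp
next
  fix f x y assume "in1 (Pi2 X) f x y"
  then show "iso2 (Pi2 X) (LUnit (Pi2 X) f) (Comp (Pi2 X) (Id1 (Pi2 X) y) f) f"
    "iso2 (Pi2 X) (RUnit (Pi2 X) f) (Comp (Pi2 X) f (Id1 (Pi2 X) x)) f"
    using Pi2_LUnit_lift by simp_all
next
  fix \<alpha> f f' \<beta> g g' \<gamma> h h'
  assume "in2 (Pi2 X) \<alpha> f f'" "in2 (Pi2 X) \<beta> g g'" "in2 (Pi2 X) \<gamma> h h'"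
    and "Trg (Pi2 X) f = Src (Pi2 X) g" "Trg (Pi2 X) g = Src (Pi2 X) h"
  then obtain A B C where A: "square X A f f'" "\<alpha> = sqclass X A" and B: "square X B g g'" "\<beta> = sqclass X B"
    and C: "square X C h h'" "\<gamma> = sqclass X C" and fg: "f 1 = g 0" "g 1 = h 0"
    by (auto simp: in2_Pi2)
  note BA = square_hcat[OF A(1) B(1) fg(1)] and CB = square_hcat[OF B(1) C(1) fg(2)]
  have 1: "f 1 = pcat1 h g 0" "pcat1 g f 1 = h 0" using fg by simp_all
  note L = square_hcat[OF A(1) CB 1(1)] and K = square_hcat[OF BA C(1) 1(2)]
  have "square X (hcat C (hcat B A)) (path_concat h (path_concat g f)) (path_concat h' (path_concat g' f'))"
    by (rule square_cong[OF K]) (auto simp: path_concat_def pcat1_def)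
  then show "VComp (Pi2 X) (Assoc (Pi2 X) h' g' f') (HComp (Pi2 X) (HComp (Pi2 X) \<gamma> \<beta>) \<alpha>) =
      VComp (Pi2 X) (HComp (Pi2 X) \<gamma> (HComp (Pi2 X) \<beta> \<alpha>)) (Assoc (Pi2 X) h g f)"
    unfolding A(2) B(2) C(2) HComp_sqclass[OF A(1) B(1) fg(1)] HComp_sqclass[OF B(1) C(1) fg(2)]
      HComp_sqclass[OF A(1) CB 1(1)] HComp_sqclass[OF BA C(1) 1(2)] Assoc_Pi2
    by (rule reparam_natural[OF _ L continuous_on_assoc_reparam assoc_reparam_bounds])
       (auto simp: hcat_def assoc_reparam_def algebra_simps)
next
  fix \<alpha> f f' assume "in2 (Pi2 X) \<alpha> f f'"
  then obtain A where A: "square X A f f'" "\<alpha> = sqclass X A" by (auto simp: in2_Pi2)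
  have f: "pathin X f" "f 0 \<in> topspace X" "f 1 \<in> topspace X" "f' 0 = f 0" "f' 1 = f 1"
    using square_pathin[OF A(1)] square_endpoints[OF A(1)] pathin_topspace[of X f] by auto
  have c: "square X (\<lambda>(s, t). (\<lambda>t\<in>I1. f 1) t) (\<lambda>t\<in>I1. f 1) (\<lambda>t\<in>I1. f 1)"
    "square X (\<lambda>(s, t). (\<lambda>t\<in>I1. f 0) t) (\<lambda>t\<in>I1. f 0) (\<lambda>t\<in>I1. f 0)"
    by (rule square_const[OF pathin_const_restrict], rule f)+
  have A0: "A (s, 0) = f 0" "A (s, 1) = f 1" if "s \<in> I1" for s using A(1) that by (auto simp: square_def)
  have e: "f 1 = (\<lambda>t\<in>I1. f 1) 0" "(\<lambda>t\<in>I1. f 0) 1 = f 0" by auto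
  show "VComp (Pi2 X) (LUnit (Pi2 X) f') (HComp (Pi2 X) (Id2 (Pi2 X) (Id1 (Pi2 X) (Trg (Pi2 X) f))) \<alpha>) =
      VComp (Pi2 X) \<alpha> (LUnit (Pi2 X) f)"
    unfolding A(2) Pi2_simps HComp_sqclass[OF A(1) c(1) e(1)]
    by (rule reparam_natural[OF A(1) square_hcat[OF A(1) c(1) e(1)]])
       (auto simp: hcat_def A0 max.absorb1 max.absorb2 min.absorb1 min.absorb2 intro!: continuous_intros)
  show "VComp (Pi2 X) (RUnit (Pi2 X) f') (HComp (Pi2 X) \<alpha> (Id2 (Pi2 X) (Id1 (Pi2 X) (Src (Pi2 X) f)))) =
      VComp (Pi2 X) \<alpha> (RUnit (Pi2 X) f)"
    unfolding A(2) Pi2_simps HComp_sqclass[OF c(2) A(1) e(2)]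
    by (rule reparam_natural[OF A(1) square_hcat[OF c(2) A(1) e(2)]])
       (auto simp: hcat_def A0 max.absorb1 max.absorb2 min.absorb1 min.absorb2 intro!: continuous_intros)
next
  fix f v w g x h y k z
  assume "in1 (Pi2 X) f v w" "in1 (Pi2 X) g w x" "in1 (Pi2 X) h x y" "in1 (Pi2 X) k y z"
  from Pi2_pentagon[OF this]
  show "VComp (Pi2 X) (Assoc (Pi2 X) k h (Comp (Pi2 X) g f)) (Assoc (Pi2 X) (Comp (Pi2 X) k h) g f) =
      VComp (Pi2 X) (HComp (Pi2 X) (Id2 (Pi2 X) k) (Assoc (Pi2 X) h g f))
        (VComp (Pi2 X) (Assoc (Pi2 X) k (Comp (Pi2 X) h g) f) (HComp (Pi2 X) (Assoc (Pi2 X) k h g) (Id2 (Pi2 X) f)))"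
    unfolding Pi2_simps .
next
  fix f x y g z assume "in1 (Pi2 X) f x y" "in1 (Pi2 X) g y z"
  from Pi2_triangle[OF this]
  show "VComp (Pi2 X) (HComp (Pi2 X) (Id2 (Pi2 X) g) (LUnit (Pi2 X) f)) (Assoc (Pi2 X) g (Id1 (Pi2 X) y) f) =
      HComp (Pi2 X) (RUnit (Pi2 X) g) (Id2 (Pi2 X) f)"
    unfolding Pi2_simps .
qed

subsection \<open>Lifted pasting diagrams\<close>

lemma (in bicategory) inverse2_unique:
  assumes "in2 B \<alpha> f g" "inverse2 B \<alpha> \<beta>" "inverse2 B \<alpha> \<gamma>"
  shows "\<beta> = \<gamma>"
proof -
  have *: "Src2 B \<alpha> = f" "Trg2 B \<alpha> = g" using assms(1) by (auto simp: in2_def)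
  have b: "in2 B \<beta> g f" "VComp B \<beta> \<alpha> = Id2 B f" "VComp B \<alpha> \<beta> = Id2 B g"
    and c: "in2 B \<gamma> g f" "VComp B \<gamma> \<alpha> = Id2 B f" "VComp B \<alpha> \<gamma> = Id2 B g"
    using assms(2,3) unfolding inverse2_def * by auto
  have "\<beta> = VComp B \<beta> (VComp B \<alpha> \<gamma>)" using VComp_id[OF b(1)] c by simp
  also have "\<dots> = VComp B (VComp B \<beta> \<alpha>) \<gamma>" using VComp_assoc[OF c(1) assms(1) b(1)] by simp
  also have "\<dots> = \<gamma>" using VComp_id[OF c(1)] b by simp
  finally show ?thesis .
qed

lemma (in bicategory) Inv2_eqI: "in2 B \<alpha> f g \<Longrightarrow> inverse2 B \<alpha> \<beta> \<Longrightarrow> Inv2 B \<alpha> = \<beta>"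
  unfolding Inv2_def by (rule the_equality) (auto intro: inverse2_unique)

definition lifting :: "'a topology \<Rightarrow> 'w topology \<Rightarrow> ('w \<Rightarrow> 'a) \<Rightarrow> bool" where
  "lifting X W \<Psi> \<longleftrightarrow> continuous_map W X \<Psi> \<and> contractible_space W"

lemma cell_lift_Inv2:
  assumes "lifting X W \<Psi>" "cell_lift X W \<Psi> \<alpha> p q"
  shows "cell_lift X W \<Psi> (Inv2 (Pi2 X) \<alpha>) q p"
proof -
  obtain \<beta> where \<beta>: "cell_lift X W \<Psi> \<beta> q p" using cell_lift_reverse[OF assms(2)] by blast
  then have "inverse2 (Pi2 X) \<alpha> \<beta>" using cell_lift_inverse2 assms unfolding lifting_def by blast
  then have "Inv2 (Pi2 X) \<alpha> = \<beta>"
    using bicategory.Inv2_eqI[OF bicategory_Pi2] cell_lift_in2 assms unfolding lifting_def by blast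
  with \<beta> show ?thesis by simp
qed

fun chain :: "'w topology \<Rightarrow> 'w \<Rightarrow> (real \<Rightarrow> 'w) list \<Rightarrow> 'w \<Rightarrow> bool" where
  "chain W w [] w' \<longleftrightarrow> w' = w \<and> w \<in> topspace W"
| "chain W w (p # ps) w' \<longleftrightarrow> pathin W p \<and> p 0 = w \<and> chain W (p 1) ps w'"

fun pcompw :: "'w \<Rightarrow> (real \<Rightarrow> 'w) list \<Rightarrow> real \<Rightarrow> 'w" where
  "pcompw w [] = (\<lambda>t. w)"
| "pcompw w [p] = p"
| "pcompw w (p # q # ps) = pcat1 (pcompw (p 1) (q # ps)) p"

fun wend :: "'w \<Rightarrow> (real \<Rightarrow> 'w) list \<Rightarrow> 'w" where
  "wend w [] = w"
| "wend w (p # ps) = wend (p 1) ps"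

lemma chain_wend: "chain W w ps w' \<Longrightarrow> wend w ps = w'"
  by (induction ps arbitrary: w) auto

lemma chain_append: "chain W w (ps @ qs) w'' \<longleftrightarrow> (\<exists>w'. chain W w ps w' \<and> chain W w' qs w'')"
proof (induction ps arbitrary: w)
  case Nil
  have "chain W w qs w'' \<Longrightarrow> w \<in> topspace W" by (cases qs) (auto intro: pathin_topspace)
  then show ?case by auto
qed auto

lemma chain_topspace: "chain W w ps w' \<Longrightarrow> w \<in> topspace W \<and> w' \<in> topspace W"
  by (induction ps arbitrary: w) (auto intro: pathin_topspace)

lemma chain_pcompw:
  "chain W w ps w' \<Longrightarrow> pathin W (pcompw w ps) \<and> pcompw w ps 0 = w \<and> pcompw w ps 1 = w'"
  by (induction w ps rule: pcompw.induct) (auto simp: pathin_const intro!: pathin_pcat1)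

lemma push_const [simp]: "push \<Psi> (\<lambda>t. w) = (\<lambda>t\<in>I1. \<Psi> w)"
  by (simp add: push_def)

lemma push_pcompw: "push \<Psi> (pcompw w ps) = pcomp (Pi2 X) (\<Psi> w) (map (push \<Psi>) ps)"
  by (induction w ps rule: pcompw.induct) (simp_all add: push_pcat1)

lemma path_end_push: "chain W w ps w' \<Longrightarrow> path_end (Pi2 X) (\<Psi> w) (map (push \<Psi>) ps) = \<Psi> w'"
proof (induction ps arbitrary: w)
  case (Cons p ps)
  then show ?case by (cases "ps = []") (auto simp: path_end_def last_map)
qed (simp add: path_end_def)

lemma pcompw_append_ne: "qs \<noteq> [] \<Longrightarrow> pcompw w (p # qs) = pcat1 (pcompw (p 1) qs) p"
  by (cases qs) auto

lemma cell_lift_pcat: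
  assumes L: "lifting X W \<Psi>" and "chain W w ps w'" "chain W w' qs w''"
  shows "cell_lift X W \<Psi> (pcat (Pi2 X) (\<Psi> w) (map (push \<Psi>) ps) (map (push \<Psi>) qs))
    (pcat1 (pcompw w' qs) (pcompw w ps)) (pcompw w (ps @ qs))"
  using assms(2)
proof (induction w ps rule: pcompw.induct)
  case (1 w)
  then have w: "w' = w" by simp
  note q = chain_pcompw[OF assms(3)]
  show ?case using cell_lift_RUnit[of W "pcompw w qs" X \<Psi>] q w
    by (simp add: push_pcompw[where X=X] del: Pi2_simps)
next
  case (2 w p)
  then have w: "w' = p 1" "pathin W p" by auto
  note q = chain_pcompw[OF assms(3)]
  show ?case
  proof (cases "qs = []")
    case True
    then show ?thesis using cell_lift_LUnit[OF w(2), of X \<Psi>] w by (simp del: Pi2_simps)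
  next
    case False
    have "cell_lift X W \<Psi> (Id2 (Pi2 X) (push \<Psi> (pcat1 (pcompw (p 1) qs) p)))
       (pcat1 (pcompw (p 1) qs) p) (pcat1 (pcompw (p 1) qs) p)"
      by (rule cell_lift_Id2) (use w q in \<open>auto intro: pathin_pcat1\<close>)
    then show ?thesis using False w
      by (simp add: pcompw_append_ne push_pcat1 push_pcompw[where X=X])
  qed
next
  case (3 w p q ps)
  then have c: "pathin W p" "p 0 = w" "chain W (p 1) (q # ps) w'" by auto
  note IH = 3(1)[OF c(3)]
  note Q = chain_pcompw[OF assms(3)] and P = chain_pcompw[OF c(3)]
  have 1: "cell_lift X W \<Psi> (Assoc (Pi2 X) (push \<Psi> (pcompw w' qs)) (push \<Psi> (pcompw (p 1) (q # ps))) (push \<Psi> p))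
    (pcat1 (pcat1 (pcompw w' qs) (pcompw (p 1) (q # ps))) p)
    (pcat1 (pcompw w' qs) (pcat1 (pcompw (p 1) (q # ps)) p))"
    by (rule cell_lift_Assoc) (use c Q P in auto)
  have 2: "cell_lift X W \<Psi> (HComp (Pi2 X) (pcat (Pi2 X) (\<Psi> (p 1)) (map (push \<Psi>) (q # ps)) (map (push \<Psi>) qs))
      (Id2 (Pi2 X) (push \<Psi> p)))
     (pcat1 (pcat1 (pcompw w' qs) (pcompw (p 1) (q # ps))) p) (pcat1 (pcompw (p 1) ((q # ps) @ qs)) p)"
    by (rule cell_lift_HComp[OF _ cell_lift_Id2 IH]) (use L c P in \<open>auto simp: lifting_def\<close>)
  have e: "path_end (Pi2 X) (\<Psi> w) (push \<Psi> p # push \<Psi> q # map (push \<Psi>) ps) = \<Psi> w'"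
    using path_end_push[OF 3(2), of X \<Psi>] by simp
  have cont: "continuous_map W X \<Psi>" using L by (simp add: lifting_def)
  from cell_lift_VComp[OF cont cell_lift_Inv2[OF L 1] 2] show ?case
    by (simp add: e push_pcompw[where X=X] del: Pi2_simps(8))
qed

definition pcell_lift :: "'a topology \<Rightarrow> 'w topology \<Rightarrow> ('w \<Rightarrow> 'a)
    \<Rightarrow> ('a, real \<Rightarrow> 'a, (real \<times> real \<Rightarrow> 'a) set) pcell \<Rightarrow> 'w \<Rightarrow> (real \<Rightarrow> 'w) list \<Rightarrow> (real \<Rightarrow> 'w) list \<Rightarrow> bool" where
  "pcell_lift X W \<Psi> L w ps qs \<longleftrightarrow> chain W w ps (wend w ps) \<and> chain W w qs (wend w ps) \<and>
     org L = \<Psi> w \<and> top_path L = map (push \<Psi>) ps \<and> bot_path L = map (push \<Psi>) qs \<and>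
     cell_lift X W \<Psi> (cell L) (pcompw w ps) (pcompw w qs)"

lemma pcell_liftD:
  assumes "pcell_lift X W \<Psi> L w ps qs"
  shows "chain W w ps (wend w ps)" "chain W w qs (wend w ps)" "wend w qs = wend w ps"
    "org L = \<Psi> w" "top_path L = map (push \<Psi>) ps" "bot_path L = map (push \<Psi>) qs"
    "cell_lift X W \<Psi> (cell L) (pcompw w ps) (pcompw w qs)"
  using assms chain_wend[of W w qs "wend w ps"] unfolding pcell_lift_def by auto

lemma pcell_liftI:
  assumes "chain W w ps w'" "chain W w qs w'" "org L = \<Psi> w" "top_path L = map (push \<Psi>) ps"
    "bot_path L = map (push \<Psi>) qs" "cell_lift X W \<Psi> (cell L) (pcompw w ps) (pcompw w qs)"
  shows "pcell_lift X W \<Psi> L w ps qs"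
  using assms chain_wend[OF assms(1)] unfolding pcell_lift_def by simp

lemma pcell_lift_iso_pcell: "lifting X W \<Psi> \<Longrightarrow> pcell_lift X W \<Psi> L w ps qs \<Longrightarrow> iso_pcell (Pi2 X) L"
  unfolding iso_pcell_def pcell_lift_def lifting_def
  using cell_lift_iso2[of W X \<Psi> "cell L" "pcompw w ps" "pcompw w qs"]
  by (simp add: push_pcompw[where X=X])

lemma pcell_lift_unique:
  assumes "lifting X W \<Psi>" "pcell_lift X W \<Psi> L w ps qs" "pcell_lift X W \<Psi> L' w ps qs'" "qs = qs'"
  shows "L = L'"
proof -
  have "cell L = cell L'"
    by (rule cell_lift_unique[of W X \<Psi> _ "pcompw w ps" "pcompw w qs"])
       (use assms in \<open>auto simp: lifting_def dest: pcell_liftD\<close>)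
  then show ?thesis using assms(4) pcell_liftD[OF assms(2)] pcell_liftD[OF assms(3)] by (cases L; cases L') auto
qed

lemma pcell_lift_pid:
  assumes "chain W w ps w'"
  shows "pcell_lift X W \<Psi> (pid (Pi2 X) (\<Psi> w) (map (push \<Psi>) ps)) w ps ps"
  by (rule pcell_liftI[OF assms assms])
     (simp_all add: pid_def push_pcompw[where X=X, symmetric] cell_lift_Id2 chain_pcompw[OF assms] del: Pi2_simps)

lemma pcell_lift_pinv:
  assumes "lifting X W \<Psi>" "pcell_lift X W \<Psi> L w ps qs"
  shows "pcell_lift X W \<Psi> (pinv (Pi2 X) L) w qs ps"
  using pcell_liftD[OF assms(2)] cell_lift_Inv2[OF assms(1)]
  by (auto intro!: pcell_liftI[of W w qs "wend w ps"] simp: pinv_def)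

lemma cell_lift_pcat3:
  assumes L: "lifting X W \<Psi>" and "chain W x ps y" "chain W y fs z" "chain W z qs w"
  shows "cell_lift X W \<Psi> (pcat3 (Pi2 X) (\<Psi> x) (map (push \<Psi>) ps) (map (push \<Psi>) fs) (map (push \<Psi>) qs))
    (pcat1 (pcat1 (pcompw z qs) (pcompw y fs)) (pcompw x ps)) (pcompw x (ps @ fs @ qs))"
proof -
  have cont: "continuous_map W X \<Psi>" using L by (simp add: lifting_def)
  have c: "chain W y (fs @ qs) w" unfolding chain_append using assms by blast
  have 1: "cell_lift X W \<Psi> (pcat (Pi2 X) (\<Psi> x) (map (push \<Psi>) ps) (map (push \<Psi>) (fs @ qs)))
     (pcat1 (pcompw y (fs @ qs)) (pcompw x ps)) (pcompw x (ps @ fs @ qs))"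
    by (rule cell_lift_pcat[OF L assms(2) c])
  have 2: "cell_lift X W \<Psi> (HComp (Pi2 X) (pcat (Pi2 X) (\<Psi> y) (map (push \<Psi>) fs) (map (push \<Psi>) qs))
       (Id2 (Pi2 X) (push \<Psi> (pcompw x ps))))
     (pcat1 (pcat1 (pcompw z qs) (pcompw y fs)) (pcompw x ps)) (pcat1 (pcompw y (fs @ qs)) (pcompw x ps))"
    by (rule cell_lift_HComp[OF cont cell_lift_Id2 cell_lift_pcat[OF L assms(3,4)]])
       (use chain_pcompw[OF assms(2)] chain_pcompw[OF assms(3)] in auto)
  from cell_lift_VComp[OF cont 2 1] show ?thesis
    unfolding pcat3_def path_end_push[OF assms(2)] push_pcompw[where X=X] by simp
qed

lemma pcell_lift_whisker:
  assumes L: "lifting X W \<Psi>" and ps: "chain W x ps y" and K: "pcell_lift X W \<Psi> K y ts bs"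
    and qs: "chain W (wend y ts) qs z"
  shows "pcell_lift X W \<Psi> (whisker (Pi2 X) (map (push \<Psi>) ps) K (map (push \<Psi>) qs)) x (ps @ ts @ qs) (ps @ bs @ qs)"
proof -
  have cont: "continuous_map W X \<Psi>" using L by (simp add: lifting_def)
  note K = pcell_liftD[OF K]
  have x: "(if map (push \<Psi>) ps = [] then org K else Src (Pi2 X) (hd (map (push \<Psi>) ps))) = \<Psi> x"
    using ps K(4) by (cases ps) auto
  have z: "path_end (Pi2 X) (\<Psi> y) (map (push \<Psi>) ts) = \<Psi> (wend y ts)"
    by (rule path_end_push[OF K(1)])
  have P: "pathin W (pcompw x ps)" "pcompw x ps 1 = y"
    and Q: "pathin W (pcompw (wend y ts) qs)" "pcompw (wend y ts) qs 0 = wend y ts"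
    and T: "pcompw y ts 0 = y" "pcompw y ts 1 = wend y ts"
    using chain_pcompw[OF ps] chain_pcompw[OF qs] chain_pcompw[OF K(1)] by auto
  have mid: "cell_lift X W \<Psi> (HComp (Pi2 X) (HComp (Pi2 X) (Id2 (Pi2 X) (push \<Psi> (pcompw (wend y ts) qs))) (cell K))
        (Id2 (Pi2 X) (push \<Psi> (pcompw x ps))))
      (pcat1 (pcat1 (pcompw (wend y ts) qs) (pcompw y ts)) (pcompw x ps))
      (pcat1 (pcat1 (pcompw (wend y ts) qs) (pcompw y bs)) (pcompw x ps))"
    by (rule cell_lift_HComp[OF cont cell_lift_Id2 cell_lift_HComp[OF cont K(7) cell_lift_Id2]]) (use P Q T in auto)
  let ?c = "VComp (Pi2 X) (pcat3 (Pi2 X) (\<Psi> x) (map (push \<Psi>) ps) (map (push \<Psi>) bs) (map (push \<Psi>) qs))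
    (VComp (Pi2 X) (HComp (Pi2 X) (HComp (Pi2 X) (Id2 (Pi2 X) (push \<Psi> (pcompw (wend y ts) qs))) (cell K))
        (Id2 (Pi2 X) (push \<Psi> (pcompw x ps))))
      (Inv2 (Pi2 X) (pcat3 (Pi2 X) (\<Psi> x) (map (push \<Psi>) ps) (map (push \<Psi>) ts) (map (push \<Psi>) qs))))"
  have eq: "whisker (Pi2 X) (map (push \<Psi>) ps) K (map (push \<Psi>) qs) =
      PC (\<Psi> x) (map (push \<Psi>) (ps @ ts @ qs)) ?c (map (push \<Psi>) (ps @ bs @ qs))"
    unfolding whisker_def Let_def x unfolding K(4,5,6) z push_pcompw[where X=X] map_append ..
  have c: "cell_lift X W \<Psi> ?c (pcompw x (ps @ ts @ qs)) (pcompw x (ps @ bs @ qs))"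
    by (rule cell_lift_VComp[OF cont cell_lift_VComp[OF cont cell_lift_Inv2[OF L cell_lift_pcat3[OF L ps K(1) qs]] mid] cell_lift_pcat3[OF L ps K(2) qs]])
  have ch: "chain W x (ps @ ts @ qs) z" "chain W x (ps @ bs @ qs) z"
    unfolding chain_append using ps K(1,2) qs by blast+
  show ?thesis unfolding eq by (rule pcell_liftI[OF ch]) (simp_all only: pcell.sel c)
qed

lemma pcell_lift_paste_step:
  assumes L: "lifting X W \<Psi>" and M: "pcell_lift X W \<Psi> M w ps cur" and K: "pcell_lift X W \<Psi> K v ts bs"
    and cur: "cur = take n cur @ ts @ drop (n + length ts) cur" and v: "wend w (take n cur) = v"
  shows "pcell_lift X W \<Psi> (paste_step (Pi2 X) M (n, K)) w ps (take n cur @ bs @ drop (n + length ts) cur)"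
proof -
  have cont: "continuous_map W X \<Psi>" using L by (simp add: lifting_def)
  note M = pcell_liftD[OF M]
  let ?pre = "take n cur" and ?post = "drop (n + length ts) cur"
  have "chain W w (?pre @ ts @ ?post) (wend w ps)" using M(2) cur by simp
  then obtain v' v'' where c: "chain W w ?pre v'" "chain W v' ts v''" "chain W v'' ?post (wend w ps)"
    unfolding chain_append by blast
  have v': "v' = v" using chain_wend[OF c(1)] v by simp
  then have v'': "v'' = wend v ts" using chain_wend[OF c(2)] by simp
  have Wh: "pcell_lift X W \<Psi> (whisker (Pi2 X) (map (push \<Psi>) ?pre) K (map (push \<Psi>) ?post)) w
      (?pre @ ts @ ?post) (?pre @ bs @ ?post)"
    by (rule pcell_lift_whisker[OF L _ K]) (use c v' v'' in auto)
  have len: "length (top_path K) = length ts" using pcell_liftD(5)[OF K] by simp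
  have eq: "whisker (Pi2 X) (take n (bot_path M)) K (drop (n + length (top_path K)) (bot_path M)) =
     whisker (Pi2 X) (map (push \<Psi>) ?pre) K (map (push \<Psi>) ?post)"
    unfolding len M(6) by (simp add: take_map drop_map)
  note Wh = pcell_liftD[OF Wh]
  have "wend w cur = wend w ps" using M(2) chain_wend by metis
  then have "chain W w (?pre @ bs @ ?post) (wend w ps)"
    using Wh(2) cur by simp
  moreover have "cell_lift X W \<Psi> (cell (whisker (Pi2 X) (map (push \<Psi>) ?pre) K (map (push \<Psi>) ?post)))
     (pcompw w cur) (pcompw w (?pre @ bs @ ?post))"
    using Wh(7) cur by simp
  ultimately show ?thesis
    unfolding paste_step_def Let_def prod.case eq
    by (intro pcell_liftI[OF M(1)]) (simp_all add: M(4,5) Wh(6) cell_lift_VComp[OF cont M(7)])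
qed

inductive steps_lift :: "'a topology \<Rightarrow> 'w topology \<Rightarrow> ('w \<Rightarrow> 'a) \<Rightarrow> 'w \<Rightarrow> (real \<Rightarrow> 'w) list \<Rightarrow>
    (nat \<times> ('a, real \<Rightarrow> 'a, (real \<times> real \<Rightarrow> 'a) set) pcell) list \<Rightarrow> (real \<Rightarrow> 'w) list \<Rightarrow> bool"
  for X W \<Psi> w where
  steps_lift_Nil: "steps_lift X W \<Psi> w cur [] cur"
| steps_lift_Cons: "pcell_lift X W \<Psi> K v ts bs \<Longrightarrow> cur = take n cur @ ts @ drop (n + length ts) cur \<Longrightarrow>
    wend w (take n cur) = v \<Longrightarrow> new = take n cur @ bs @ drop (n + length ts) cur \<Longrightarrow>
    steps_lift X W \<Psi> w new steps res \<Longrightarrow> steps_lift X W \<Psi> w cur ((n, K) # steps) res"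

lemma pcell_lift_paste:
  assumes L: "lifting X W \<Psi>" and ps: "chain W w ps w'" and x: "x = \<Psi> w" and fs: "fs = map (push \<Psi>) ps"
    and steps: "steps_lift X W \<Psi> w ps steps res"
  shows "pcell_lift X W \<Psi> (paste (Pi2 X) x fs steps) w ps res"
proof -
  have "steps_lift X W \<Psi> w cur steps res \<Longrightarrow> pcell_lift X W \<Psi> M w ps cur \<Longrightarrow>
    pcell_lift X W \<Psi> (foldl (paste_step (Pi2 X)) M steps) w ps res" for M cur
  proof (induction arbitrary: M rule: steps_lift.induct)
    case (steps_lift_Cons K v ts bs cur n new steps res)
    then show ?case using pcell_lift_paste_step[OF L steps_lift_Cons.prems steps_lift_Cons.hyps(1-3)] by simp
  qed simp
  from this[OF steps pcell_lift_pid[OF ps]] show ?thesis unfolding paste_def x fs .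
qed

lemma pcell_lift_change:
  assumes K: "pcell_lift X V \<Psi>' K v ps qs" and \<Phi>: "continuous_map V W \<Phi>"
    and eq: "\<And>v. v \<in> topspace V \<Longrightarrow> \<Psi>' v = \<Psi> (\<Phi> v)"
  shows "pcell_lift X W \<Psi> K (\<Phi> v) (map (\<lambda>p t. \<Phi> (p t)) ps) (map (\<lambda>p t. \<Phi> (p t)) qs)"
proof -
  have c: "chain W (\<Phi> v) (map (\<lambda>p t. \<Phi> (p t)) ps) (\<Phi> v') \<and>
      map (push \<Psi>') ps = map (push \<Psi>) (map (\<lambda>p t. \<Phi> (p t)) ps)" if "chain V v ps v'" for v v' ps
    using that
  proof (induction ps arbitrary: v)
    case Nil
    then show ?case using \<Phi> by (auto simp: continuous_map_def)
  next
    case (Cons p ps)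
    have "pathin W (\<lambda>t. \<Phi> (p t))"
      using Cons.prems continuous_map_compose[OF _ \<Phi>, of "top_of_set I1" p] by (simp add: pathin_def o_def)
    moreover have "push \<Psi>' p = push \<Psi> (\<lambda>t. \<Phi> (p t))"
      using Cons.prems eq pathin_topspace[of V p] by (auto simp: push_def fun_eq_iff)
    ultimately show ?case using Cons by auto
  qed
  have pc: "pcompw (\<Phi> v) (map (\<lambda>p t. \<Phi> (p t)) ps) = (\<lambda>t. \<Phi> (pcompw v ps t))" for v ps
    by (induction v ps rule: pcompw.induct) (auto simp: pcat1_def fun_eq_iff)
  note K = pcell_liftD[OF K]
  show ?thesis
    by (rule pcell_liftI[of _ _ _ "\<Phi> (wend v ps)"])
       (use c[OF K(1)] c[OF K(2)] K(4-6) eq chain_topspace[OF K(1)] cell_lift_change[OF K(7) \<Phi> eq] pc in auto)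
qed

subsection \<open>Strict pseudofunctors\<close>

locale strict_pf =
  fixes B :: "('o, 'm, 'c) bicat" and C :: "('p, 'n, 'd) bicat"
    and F :: "('o, 'm, 'c, 'p, 'n, 'd) pfunctor"
  assumes s_F0: "x \<in> Ob B \<Longrightarrow> F0 F x \<in> Ob C"
    and s_F1: "in1 B f x y \<Longrightarrow> in1 C (F1 F f) (F0 F x) (F0 F y)"
    and s_F2: "in2 B \<alpha> f g \<Longrightarrow> in2 C (F2 F \<alpha>) (F1 F f) (F1 F g)"
    and s_Id1: "x \<in> Ob B \<Longrightarrow> F1 F (Id1 B x) = Id1 C (F0 F x)"
    and s_Comp: "\<lbrakk>in1 B f x y; in1 B g y z\<rbrakk> \<Longrightarrow> F1 F (Comp B g f) = Comp C (F1 F g) (F1 F f)"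
    and s_Id2: "f \<in> Ar B \<Longrightarrow> F2 F (Id2 B f) = Id2 C (F1 F f)"
    and s_VComp: "\<lbrakk>in2 B \<alpha> f g; in2 B \<beta> g h\<rbrakk> \<Longrightarrow>
      F2 F (VComp B \<beta> \<alpha>) = VComp C (F2 F \<beta>) (F2 F \<alpha>)"
    and s_HComp: "\<lbrakk>in2 B \<alpha> f f'; in2 B \<beta> g g'; Trg B f = Src B g\<rbrakk> \<Longrightarrow>
      F2 F (HComp B \<beta> \<alpha>) = HComp C (F2 F \<beta>) (F2 F \<alpha>)"
    and s_Assoc: "\<lbrakk>in1 B f w x; in1 B g x y; in1 B h y z\<rbrakk> \<Longrightarrow>
      F2 F (Assoc B h g f) = Assoc C (F1 F h) (F1 F g) (F1 F f)"
    and s_LUnit: "in1 B f x y \<Longrightarrow> F2 F (LUnit B f) = LUnit C (F1 F f)"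
    and s_RUnit: "in1 B f x y \<Longrightarrow> F2 F (RUnit B f) = RUnit C (F1 F f)"
    and s_Fcomp: "\<lbrakk>in1 B f x y; in1 B g y z\<rbrakk> \<Longrightarrow> Fcomp F g f = Id2 C (Comp C (F1 F g) (F1 F f))"
    and s_Fid: "x \<in> Ob B \<Longrightarrow> Fid F x = Id2 C (Id1 C (F0 F x))"

lemma in1D: "in1 B f x y \<Longrightarrow> f \<in> Ar B \<and> Src B f = x \<and> Trg B f = y"
  by (simp add: in1_def)

lemma in2D: "in2 B \<alpha> f g \<Longrightarrow> \<alpha> \<in> Cells B \<and> Src2 B \<alpha> = f \<and> Trg2 B \<alpha> = g"
  by (simp add: in2_def)

lemma (in bicategory) in2_in1:
  assumes "in2 B \<alpha> f g"
  shows "in1 B f (Src B f) (Trg B f)" "in1 B g (Src B f) (Trg B f)"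
  using Cells_Ar[of \<alpha>] Cells_parallel[of \<alpha>] in2D[OF assms] by (auto simp: in1_def)

lemma (in bicategory) Id2_iso: assumes "f \<in> Ar B" shows "iso2 B (Id2 B f) f f" "Inv2 B (Id2 B f) = Id2 B f"
proof -
  have i: "in2 B (Id2 B f) f f" using Id2_in assms by blast
  then have "inverse2 B (Id2 B f) (Id2 B f)"
    using VComp_id[OF i] by (auto simp: inverse2_def in2_def)
  then show "iso2 B (Id2 B f) f f" "Inv2 B (Id2 B f) = Id2 B f"
    using i Inv2_eqI unfolding iso2_def by blast+
qed

lemma (in strict_pf) pseudofunctor:
  assumes B: "bicategory B" and C: "bicategory C"
  shows "pseudofunctor B C F"
proof -
  interpret B: bicategory B by fact
  interpret C: bicategory C by fact
  show ?thesis
  proof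
    fix f x y g z assume fg: "in1 B f x y" "in1 B g y z"
    have 1: "in1 C (Comp C (F1 F g) (F1 F f)) (F0 F x) (F0 F z)"
      using C.Comp_in s_F1 fg by blast
    then have "Comp C (F1 F g) (F1 F f) \<in> Ar C" using in1D[OF 1] by blast
    then show "iso2 C (Fcomp F g f) (Comp C (F1 F g) (F1 F f)) (F1 F (Comp B g f))"
      by (simp add: s_Fcomp[OF fg] s_Comp[OF fg] C.Id2_iso(1))
  next
    fix x assume "x \<in> Ob B"
    then show "iso2 C (Fid F x) (Id1 C (F0 F x)) (F1 F (Id1 B x))"
      using C.Id2_iso(1) in1D[OF C.Id1_in[OF s_F0]] by (simp add: s_Fid s_Id1)
  next
    fix \<alpha> f f' \<beta> g g' assume h: "in2 B \<alpha> f f'" "in2 B \<beta> g g'" "Trg B f = Src B g"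
    note i = B.in2_in1[OF h(1)] B.in2_in1[OF h(2)]
    have i: "in1 B f (Src B f) (Trg B f)" "in1 B f' (Src B f) (Trg B f)"
      "in1 B g (Trg B f) (Trg B g)" "in1 B g' (Trg B f) (Trg B g)"
      using i h(3) by simp_all
    have "in2 C (HComp C (F2 F \<beta>) (F2 F \<alpha>)) (Comp C (F1 F g) (F1 F f)) (Comp C (F1 F g') (F1 F f'))"
      by (rule C.HComp_in[OF s_F2[OF h(1)] s_F2[OF h(2)]])
         (use in1D[OF s_F1[OF i(1)]] in1D[OF s_F1[OF i(3)]] in simp)
    then show "VComp C (F2 F (HComp B \<beta> \<alpha>)) (Fcomp F g f) =
      VComp C (Fcomp F g' f') (HComp C (F2 F \<beta>) (F2 F \<alpha>))"
      using C.VComp_id by (simp add: s_HComp[OF h] s_Fcomp[OF i(1,3)] s_Fcomp[OF i(2,4)])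
  next
    fix f w x g y h z assume h: "in1 B f w x" "in1 B g x y" "in1 B h y z"
    note F = s_F1[OF h(1)] s_F1[OF h(2)] s_F1[OF h(3)]
    have gf: "in1 C (Comp C (F1 F g) (F1 F f)) (F0 F w) (F0 F y)" and
      hg: "in1 C (Comp C (F1 F h) (F1 F g)) (F0 F x) (F0 F z)" and
      h_gf: "in1 C (Comp C (F1 F h) (Comp C (F1 F g) (F1 F f))) (F0 F w) (F0 F z)"
      using C.Comp_in F by blast+
    have hg_f: "in1 C (Comp C (Comp C (F1 F h) (F1 F g)) (F1 F f)) (F0 F w) (F0 F z)"
      using C.Comp_in F(1) hg by blast
    have A: "in2 C (Assoc C (F1 F h) (F1 F g) (F1 F f)) (Comp C (Comp C (F1 F h) (F1 F g)) (F1 F f))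
       (Comp C (F1 F h) (Comp C (F1 F g) (F1 F f)))"
      using C.Assoc_iso[OF F] by (simp add: iso2_def)
    have I: "in2 C (Id2 C (Comp C (Comp C (F1 F h) (F1 F g)) (F1 F f)))
      (Comp C (Comp C (F1 F h) (F1 F g)) (F1 F f)) (Comp C (Comp C (F1 F h) (F1 F g)) (F1 F f))"
      using C.Id2_in in1D[OF hg_f] by blast
    have 1: "Fcomp F (Comp B h g) f = Id2 C (Comp C (Comp C (F1 F h) (F1 F g)) (F1 F f))"
      using s_Fcomp[OF h(1) B.Comp_in[OF h(2,3)]] s_Comp[OF h(2,3)] by simp
    have 2: "Fcomp F h (Comp B g f) = Id2 C (Comp C (F1 F h) (Comp C (F1 F g) (F1 F f)))"
      using s_Fcomp[OF B.Comp_in[OF h(1,2)] h(3)] s_Comp[OF h(1,2)] by simp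
    show "VComp C (F2 F (Assoc B h g f))
        (VComp C (Fcomp F (Comp B h g) f) (HComp C (Fcomp F h g) (Id2 C (F1 F f)))) =
      VComp C (Fcomp F h (Comp B g f))
        (VComp C (HComp C (Id2 C (F1 F h)) (Fcomp F g f)) (Assoc C (F1 F h) (F1 F g) (F1 F f)))"
      using C.VComp_id[OF A] C.VComp_id[OF I]
      by (simp add: 1 2 s_Fcomp[OF h(2,3)] s_Fcomp[OF h(1,2)] s_Assoc[OF h] C.HComp_id[OF F(1) hg] C.HComp_id[OF gf F(3)])
  next
    fix f x y assume f: "in1 B f x y"
    have xy: "x \<in> Ob B" "y \<in> Ob B" using B.Ar_Ob[of f] in1D[OF f] by auto
    note F = s_F1[OF f] C.Id1_in[OF s_F0[OF xy(1)]] C.Id1_in[OF s_F0[OF xy(2)]]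
    have L: "in2 C (LUnit C (F1 F f)) (Comp C (Id1 C (F0 F y)) (F1 F f)) (F1 F f)"
      and R: "in2 C (RUnit C (F1 F f)) (Comp C (F1 F f) (Id1 C (F0 F x))) (F1 F f)"
      using C.LUnit_iso[OF F(1)] C.RUnit_iso[OF F(1)] by (auto simp: iso2_def)
    have I: "in2 C (Id2 C g) g g" if "g \<in> {Comp C (Id1 C (F0 F y)) (F1 F f), Comp C (F1 F f) (Id1 C (F0 F x))}" for g
      using that C.Id2_in in1D[OF C.Comp_in[OF F(1,3)]] in1D[OF C.Comp_in[OF F(2,1)]] by blast
    show "VComp C (F2 F (LUnit B f))
        (VComp C (Fcomp F (Id1 B y) f) (HComp C (Fid F y) (Id2 C (F1 F f)))) = LUnit C (F1 F f)"
      using C.VComp_id[OF L] C.VComp_id[OF I]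
      by (simp add: s_Fcomp[OF f B.Id1_in[OF xy(2)]] s_Fid xy s_Id1 s_LUnit[OF f] C.HComp_id[OF F(1,3)])
    show "VComp C (F2 F (RUnit B f))
        (VComp C (Fcomp F f (Id1 B x)) (HComp C (Id2 C (F1 F f)) (Fid F x))) = RUnit C (F1 F f)"
      using C.VComp_id[OF R] C.VComp_id[OF I]
      by (simp add: s_Fcomp[OF B.Id1_in[OF xy(1)] f] s_Fid xy s_Id1 s_RUnit[OF f] C.HComp_id[OF F(2,1)])
  qed (use s_F0 s_F1 s_F2 s_Id2 s_VComp in blast)+
qed

lemma strict_pf_comp:
  assumes F: "strict_pf B C F" and G: "strict_pf C D G" and B: "bicategory B"
    and D: "\<And>\<alpha> f g. in2 D \<alpha> f g \<Longrightarrow> VComp D \<alpha> (Id2 D f) = \<alpha>"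
    and Id2: "\<And>f. f \<in> Ar D \<Longrightarrow> in2 D (Id2 D f) f f" and C: "bicategory C"
  shows "strict_pf B D (pf_comp D G F)"
proof -
  interpret F: strict_pf B C F by fact
  interpret G: strict_pf C D G by fact
  interpret B: bicategory B by fact
  interpret C: bicategory C by fact
  show ?thesis
  proof
    fix \<alpha> f f' \<beta> g g' assume h: "in2 B \<alpha> f f'" "in2 B \<beta> g g'" "Trg B f = Src B g"
    have "Trg C (F1 F f) = Src C (F1 F g)"
      using in1D[OF F.s_F1[OF B.in2_in1(1)[OF h(1)]]] in1D[OF F.s_F1[OF B.in2_in1(1)[OF h(2)]]] h(3) by simp
    then show "F2 (pf_comp D G F) (HComp B \<beta> \<alpha>) = HComp D (F2 (pf_comp D G F) \<beta>) (F2 (pf_comp D G F) \<alpha>)"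
      using G.s_HComp[OF F.s_F2[OF h(1)] F.s_F2[OF h(2)]] by (simp add: pf_comp_def F.s_HComp[OF h])
  next
    fix f x y g z assume h: "in1 B f x y" "in1 B g y z"
    note F = F.s_F1[OF h(1)] F.s_F1[OF h(2)]
    note GF = G.s_F1[OF C.Comp_in[OF F]]
    show "Fcomp (pf_comp D G F) g f = Id2 D (Comp D (F1 (pf_comp D G F) g) (F1 (pf_comp D G F) f))"
      using D[OF Id2] in1D[OF GF] in1D[OF C.Comp_in[OF F]]
      by (simp add: pf_comp_def F.s_Fcomp[OF h] G.s_Id2 G.s_Fcomp[OF F] G.s_Comp[OF F])
  next
    fix x assume x: "x \<in> Ob B"
    note I = C.Id1_in[OF F.s_F0[OF x]]
    show "Fid (pf_comp D G F) x = Id2 D (Id1 D (F0 (pf_comp D G F) x))"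
      using D[OF Id2] in1D[OF I] in1D[OF G.s_F1[OF I]] F.s_F0[OF x]
      by (simp add: pf_comp_def F.s_Fid[OF x] G.s_Id2 G.s_Fid G.s_Id1)
  next
    fix f assume f: "f \<in> Ar B"
    have "F1 F f \<in> Ar C" using F.s_F1[of f "Src B f" "Trg B f"] f by (simp add: in1_def)
    then show "F2 (pf_comp D G F) (Id2 B f) = Id2 D (F1 (pf_comp D G F) f)"
      by (simp add: pf_comp_def F.s_Id2[OF f] G.s_Id2)
  next
    fix f x y g z assume h: "in1 B f x y" "in1 B g y z"
    show "F1 (pf_comp D G F) (Comp B g f) = Comp D (F1 (pf_comp D G F) g) (F1 (pf_comp D G F) f)"
      by (simp add: pf_comp_def F.s_Comp[OF h] G.s_Comp[OF F.s_F1[OF h(1)] F.s_F1[OF h(2)]])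
  next
    fix \<alpha> f g \<beta> h assume h: "in2 B \<alpha> f g" "in2 B \<beta> g h"
    show "F2 (pf_comp D G F) (VComp B \<beta> \<alpha>) = VComp D (F2 (pf_comp D G F) \<beta>) (F2 (pf_comp D G F) \<alpha>)"
      by (simp add: pf_comp_def F.s_VComp[OF h] G.s_VComp[OF F.s_F2[OF h(1)] F.s_F2[OF h(2)]])
  next
    fix f w x g y h z assume h: "in1 B f w x" "in1 B g x y" "in1 B h y z"
    show "F2 (pf_comp D G F) (Assoc B h g f) =
       Assoc D (F1 (pf_comp D G F) h) (F1 (pf_comp D G F) g) (F1 (pf_comp D G F) f)"
      by (simp add: pf_comp_def F.s_Assoc[OF h] G.s_Assoc[OF F.s_F1[OF h(1)] F.s_F1[OF h(2)] F.s_F1[OF h(3)]])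
  next
    fix f x y assume h: "in1 B f x y"
    show "F2 (pf_comp D G F) (LUnit B f) = LUnit D (F1 (pf_comp D G F) f)"
      "F2 (pf_comp D G F) (RUnit B f) = RUnit D (F1 (pf_comp D G F) f)"
      by (simp_all add: pf_comp_def F.s_LUnit[OF h] F.s_RUnit[OF h] G.s_LUnit[OF F.s_F1[OF h]] G.s_RUnit[OF F.s_F1[OF h]])
  qed (simp_all add: pf_comp_def F.s_F0 F.s_F1 F.s_F2 G.s_F0 G.s_F1 G.s_F2 F.s_Id1 G.s_Id1)
qed

lemma prod_bicat_simps [simp]:
  "Ob (B \<times>\<^sub>b C) = Ob B \<times> Ob C" "Ar (B \<times>\<^sub>b C) = Ar B \<times> Ar C" "Cells (B \<times>\<^sub>b C) = Cells B \<times> Cells C"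
  "Src (B \<times>\<^sub>b C) (f, f') = (Src B f, Src C f')" "Trg (B \<times>\<^sub>b C) (f, f') = (Trg B f, Trg C f')"
  "Src2 (B \<times>\<^sub>b C) (\<alpha>, \<alpha>') = (Src2 B \<alpha>, Src2 C \<alpha>')" "Trg2 (B \<times>\<^sub>b C) (\<alpha>, \<alpha>') = (Trg2 B \<alpha>, Trg2 C \<alpha>')"
  "Id1 (B \<times>\<^sub>b C) (x, x') = (Id1 B x, Id1 C x')" "Id2 (B \<times>\<^sub>b C) (f, f') = (Id2 B f, Id2 C f')"
  "Comp (B \<times>\<^sub>b C) (g, g') (f, f') = (Comp B g f, Comp C g' f')"
  "VComp (B \<times>\<^sub>b C) (\<beta>, \<beta>') (\<alpha>, \<alpha>') = (VComp B \<beta> \<alpha>, VComp C \<beta>' \<alpha>')"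
  "HComp (B \<times>\<^sub>b C) (\<beta>, \<beta>') (\<alpha>, \<alpha>') = (HComp B \<beta> \<alpha>, HComp C \<beta>' \<alpha>')"
  "Assoc (B \<times>\<^sub>b C) (h, h') (g, g') (f, f') = (Assoc B h g f, Assoc C h' g' f')"
  "LUnit (B \<times>\<^sub>b C) (f, f') = (LUnit B f, LUnit C f')" "RUnit (B \<times>\<^sub>b C) (f, f') = (RUnit B f, RUnit C f')"
  by (simp_all add: prod_bicat_def)

lemma in1_prod: "in1 (B \<times>\<^sub>b C) (f, f') (x, x') (y, y') \<longleftrightarrow> in1 B f x y \<and> in1 C f' x' y'"
  by (auto simp: in1_def)

lemma in2_prod: "in2 (B \<times>\<^sub>b C) (\<alpha>, \<alpha>') (f, f') (g, g') \<longleftrightarrow> in2 B \<alpha> f g \<and> in2 C \<alpha>' f' g'"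
  by (auto simp: in2_def)

lemma iso2_prod: "iso2 (B \<times>\<^sub>b C) (\<alpha>, \<alpha>') (f, f') (g, g') \<longleftrightarrow> iso2 B \<alpha> f g \<and> iso2 C \<alpha>' f' g'"
  by (auto simp: iso2_def inverse2_def in2_def)

lemma bicategory_prod:
  assumes B: "bicategory B" and C: "bicategory C"
  shows "bicategory (B \<times>\<^sub>b C)"
proof -
  interpret B: bicategory B by fact
  interpret C: bicategory C by fact
  show ?thesis
  proof (unfold_locales, unfold split_paired_all, goal_cases)
    case 1 then show ?case using B.Ar_Ob C.Ar_Ob by auto
  next
    case 2 then show ?case using B.Cells_Ar C.Cells_Ar by auto
  next
    case 3 then show ?case using B.Cells_parallel C.Cells_parallel by auto
  next
    case 4 then show ?case using B.Id1_in C.Id1_in by (auto simp: in1_prod)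
  next
    case 5 then show ?case by (auto simp: in1_prod intro: B.Comp_in C.Comp_in)
  next
    case 6 then show ?case by (auto simp: in2_prod intro: B.Id2_in C.Id2_in)
  next
    case 7 then show ?case by (auto simp: in2_prod intro: B.VComp_in C.VComp_in)
  next
    case 8 then show ?case by (auto simp: in2_prod B.VComp_id C.VComp_id)
  next
    case 9 then show ?case by (auto simp: in2_prod B.VComp_assoc C.VComp_assoc)
  next
    case 10 then show ?case by (auto simp: in2_prod intro: B.HComp_in C.HComp_in)
  next
    case 11 then show ?case by (auto simp: in1_prod B.HComp_id C.HComp_id)
  next
    case 12 then show ?case by (auto simp: in2_prod B.interchange C.interchange)
  next
    case 13 then show ?case by (auto simp: in1_prod iso2_prod B.Assoc_iso C.Assoc_iso)
  next
    case 14 then show ?case by (auto simp: in1_prod iso2_prod B.LUnit_iso C.LUnit_iso)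
  next
    case 15 then show ?case by (auto simp: in1_prod iso2_prod B.RUnit_iso C.RUnit_iso)
  next
    case 16 then show ?case by (auto simp: in2_prod B.Assoc_natural C.Assoc_natural)
  next
    case 17 then show ?case by (auto simp: in2_prod B.LUnit_natural C.LUnit_natural)
  next
    case 18 then show ?case by (auto simp: in2_prod B.RUnit_natural C.RUnit_natural)
  next
    case 19 then show ?case by (auto simp: in1_prod B.pentagon C.pentagon)
  next
    case 20 then show ?case by (auto simp: in1_prod B.triangle C.triangle)
  qed
qed

lemma strict_pf_id: "strict_pf B B (pf_id B)"
  by (unfold_locales) (simp_all add: pf_id_def)

lemma strict_pf_swap: "strict_pf (B \<times>\<^sub>b B) (B \<times>\<^sub>b B) (pf_swap B)"
  by (unfold_locales, unfold split_paired_all) (auto simp: pf_swap_def in1_prod in2_prod)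

lemma strict_pf_reassoc: "strict_pf (B \<times>\<^sub>b (B \<times>\<^sub>b B)) ((B \<times>\<^sub>b B) \<times>\<^sub>b B) (pf_reassoc B)"
  by (unfold_locales, unfold split_paired_all) (auto simp: pf_reassoc_def in1_prod in2_prod)

lemma strict_pf_prod:
  assumes F: "strict_pf B C F" and G: "strict_pf B' C' G"
  shows "strict_pf (B \<times>\<^sub>b B') (C \<times>\<^sub>b C') (pf_prod F G)"
proof -
  interpret F: strict_pf B C F by fact
  interpret G: strict_pf B' C' G by fact
  show ?thesis
    by (unfold_locales, unfold split_paired_all)
       (auto simp: pf_prod_def in1_prod in2_prod F.s_F0 G.s_F0 F.s_F1 G.s_F1 F.s_F2 G.s_F2
         F.s_Id1 G.s_Id1 F.s_Comp G.s_Comp F.s_Id2 G.s_Id2 F.s_VComp G.s_VComp F.s_HComp G.s_HComp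
         F.s_Assoc G.s_Assoc F.s_LUnit G.s_LUnit F.s_RUnit G.s_RUnit F.s_Fcomp G.s_Fcomp F.s_Fid G.s_Fid)
qed

text \<open>In \<open>\<Pi>\<^sub>2 X\<close> all constraint cells at a constant path are identities, hence the inclusions
  \<open>x \<mapsto> (A, x)\<close> and \<open>x \<mapsto> (x, A)\<close> are strict.\<close>

lemma
  assumes x: "x \<in> topspace X"
  shows path_concat_const: "path_concat (\<lambda>t\<in>I1. x) (\<lambda>t\<in>I1. x) = (\<lambda>t\<in>I1. x)"
    and reparam_const: "(\<And>t. t \<in> I1 \<Longrightarrow> \<phi> t \<in> I1) \<Longrightarrow> reparam X (\<lambda>t\<in>I1. x) \<phi> = Id2 (Pi2 X) (\<lambda>t\<in>I1. x)"
    and VComp_const: "VComp (Pi2 X) (Id2 (Pi2 X) (\<lambda>t\<in>I1. x)) (Id2 (Pi2 X) (\<lambda>t\<in>I1. x)) = Id2 (Pi2 X) (\<lambda>t\<in>I1. x)"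
    and HComp_const: "HComp (Pi2 X) (Id2 (Pi2 X) (\<lambda>t\<in>I1. x)) (Id2 (Pi2 X) (\<lambda>t\<in>I1. x)) = Id2 (Pi2 X) (\<lambda>t\<in>I1. x)"
    and in1_const: "in1 (Pi2 X) (\<lambda>t\<in>I1. x) x x" and in2_const: "in2 (Pi2 X) (Id2 (Pi2 X) (\<lambda>t\<in>I1. x)) (\<lambda>t\<in>I1. x) (\<lambda>t\<in>I1. x)"
proof -
  interpret bicategory "Pi2 X" by (rule bicategory_Pi2)
  show c: "path_concat (\<lambda>t\<in>I1. x) (\<lambda>t\<in>I1. x) = (\<lambda>t\<in>I1. x)"
    by (auto simp: path_concat_def fun_eq_iff)
  show i: "in1 (Pi2 X) (\<lambda>t\<in>I1. x) x x" using Id1_in[of x] x by simp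
  show j: "in2 (Pi2 X) (Id2 (Pi2 X) (\<lambda>t\<in>I1. x)) (\<lambda>t\<in>I1. x) (\<lambda>t\<in>I1. x)"
    using Id2_in in1D[OF i] by blast
  show "VComp (Pi2 X) (Id2 (Pi2 X) (\<lambda>t\<in>I1. x)) (Id2 (Pi2 X) (\<lambda>t\<in>I1. x)) = Id2 (Pi2 X) (\<lambda>t\<in>I1. x)"
    using VComp_id[OF j] by blast
  show "HComp (Pi2 X) (Id2 (Pi2 X) (\<lambda>t\<in>I1. x)) (Id2 (Pi2 X) (\<lambda>t\<in>I1. x)) = Id2 (Pi2 X) (\<lambda>t\<in>I1. x)"
    using HComp_id[OF i i] c by (simp del: Pi2_simps(8))
  assume "\<And>t. t \<in> I1 \<Longrightarrow> \<phi> t \<in> I1"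
  then have "lerp s (\<phi> t) t \<in> I1" if "s \<in> I1" "t \<in> I1" for s t using that lerp_in by blast
  then show "reparam X (\<lambda>t\<in>I1. x) \<phi> = Id2 (Pi2 X) (\<lambda>t\<in>I1. x)"
    unfolding reparam_lerp Pi2_simps by (intro sqclass_cong) auto
qed

lemma strict_pf_pair:
  assumes x: "A \<in> topspace X"
  shows "strict_pf (Pi2 X) (Pi2 X \<times>\<^sub>b Pi2 X) (pf_pairl (Pi2 X) A)" (is ?l)
    and "strict_pf (Pi2 X) (Pi2 X \<times>\<^sub>b Pi2 X) (pf_pairr (Pi2 X) A)" (is ?r)
proof -
  have e: "Id1 (Pi2 X) A = (\<lambda>t\<in>I1. A)" "Comp (Pi2 X) = path_concat" "Ob (Pi2 X) = topspace X" by simp_all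
  have "LUnit (Pi2 X) (\<lambda>t\<in>I1. A) = Id2 (Pi2 X) (\<lambda>t\<in>I1. A)"
    unfolding Pi2_simps(9) by (rule reparam_const[OF x]) auto
  moreover have "RUnit (Pi2 X) (\<lambda>t\<in>I1. A) = Id2 (Pi2 X) (\<lambda>t\<in>I1. A)"
    unfolding Pi2_simps(10) by (rule reparam_const[OF x]) auto
  moreover have "Assoc (Pi2 X) (\<lambda>t\<in>I1. A) (\<lambda>t\<in>I1. A) (\<lambda>t\<in>I1. A) = Id2 (Pi2 X) (\<lambda>t\<in>I1. A)"
    unfolding Assoc_Pi2 path_concat_const[OF x] by (rule reparam_const[OF x assoc_reparam_bounds(1)])
  ultimately have L: "LUnit (Pi2 X) (\<lambda>t\<in>I1. A) = Id2 (Pi2 X) (\<lambda>t\<in>I1. A)"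
    "RUnit (Pi2 X) (\<lambda>t\<in>I1. A) = Id2 (Pi2 X) (\<lambda>t\<in>I1. A)"
    "Assoc (Pi2 X) (\<lambda>t\<in>I1. A) (\<lambda>t\<in>I1. A) (\<lambda>t\<in>I1. A) = Id2 (Pi2 X) (\<lambda>t\<in>I1. A)" by blast+
  note rules = L path_concat_const[OF x] VComp_const[OF x] HComp_const[OF x] in1_const[OF x] in2_const[OF x]
  show ?l ?r
    by (unfold_locales,
      simp_all add: pf_pairl_def pf_pairr_def e rules in1_prod in2_prod x del: Pi2_simps)
qed

fun opath :: "('o, 'm, 'c) bicat \<Rightarrow> 'o \<Rightarrow> 'm list \<Rightarrow> 'o \<Rightarrow> bool" where
  "opath B x [] y \<longleftrightarrow> y = x \<and> x \<in> Ob B"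
| "opath B x (f # fs) y \<longleftrightarrow> f \<in> Ar B \<and> Src B f = x \<and> opath B (Trg B f) fs y"

lemma (in bicategory) opath_pcomp: "opath B x fs y \<Longrightarrow> in1 B (pcomp B x fs) x y"
proof (induction fs arbitrary: x)
  case Nil
  then show ?case using Id1_in by simp
next
  case (Cons f fs)
  then have f: "in1 B f x (Trg B f)" "opath B (Trg B f) fs y" by (auto simp: in1_def)
  show ?case
  proof (cases fs)
    case Nil
    then show ?thesis using f by simp
  next
    case (Cons g gs)
    then show ?thesis using Comp_in[OF f(1) Cons.IH[OF f(2)]] by simp
  qed
qed

lemma (in strict_pf) pf_path_strict:
  assumes B: "bicategory B" and C: "bicategory C" and "opath B x fs y"
  shows "pf_path B C F x fs = Id2 C (F1 F (pcomp B x fs))"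
  using assms(3)
proof (induction fs arbitrary: x)
  case Nil
  then show ?case by (simp add: s_Fid s_Id1)
next
  case (Cons f fs)
  interpret B: bicategory B by fact
  interpret C: bicategory C by fact
  have f: "in1 B f x (Trg B f)" "opath B (Trg B f) fs y" using Cons.prems by (auto simp: in1_def)
  show ?case
  proof (cases fs)
    case Nil
    then show ?thesis by simp
  next
    case (Cons g gs)
    note q = B.opath_pcomp[OF f(2)]
    note F = s_F1[OF f(1)] s_F1[OF q]
    note I = C.Id2_in[THEN C.VComp_id, OF in1D[OF C.Comp_in[OF F], THEN conjunct1]]
    show ?thesis
      using Cons I by (simp add: Cons.IH[OF f(2), unfolded Cons] C.HComp_id[OF F, unfolded Cons]
        s_Fcomp[OF f(1) q, unfolded Cons] s_Comp[OF f(1) q, unfolded Cons])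
  qed
qed

lemma (in strict_pf) pf_image_strict:
  assumes B: "bicategory B" and C: "bicategory C" and t: "opath B (org L) (top_path L) y"
    and b: "opath B (org L) (bot_path L) y"
    and c: "in2 B (cell L) (pcomp B (org L) (top_path L)) (pcomp B (org L) (bot_path L))"
  shows "pf_image B C F L = PC (F0 F (org L)) (map (F1 F) (top_path L)) (F2 F (cell L)) (map (F1 F) (bot_path L))"
proof -
  interpret B: bicategory B by fact
  interpret C: bicategory C by fact
  have "F1 F (pcomp B (org L) (bot_path L)) \<in> Ar C" using in1D[OF s_F1[OF B.opath_pcomp[OF b]]] by blast
  then show ?thesis
    using C.VComp_id[OF s_F2[OF c]]
    by (simp add: pf_image_def pf_path_strict[OF B C t] pf_path_strict[OF B C b] C.Id2_iso(2))
qed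

lemma pcomp_prod: "length fs = length hs \<Longrightarrow>
  pcomp (B \<times>\<^sub>b C) (x, y) (zip fs hs) = (pcomp B x fs, pcomp C y hs)"
proof (induction fs hs arbitrary: x y rule: list_induct2)
  case (Cons f fs h hs)
  then show ?case by (cases fs; cases hs) auto
qed simp

lemma opath_prod: "length fs = length hs \<Longrightarrow> opath B x fs x' \<Longrightarrow> opath C y hs y' \<Longrightarrow>
  opath (B \<times>\<^sub>b C) (x, y) (zip fs hs) (x', y')"
  by (induction fs hs arbitrary: x y rule: list_induct2) auto

lemma opath_push:
  assumes "continuous_map W X \<Psi>"
  shows "chain W w ps w' \<Longrightarrow> opath (Pi2 X) (\<Psi> w) (map (push \<Psi>) ps) (\<Psi> w')"
proof (induction ps arbitrary: w)
  case Nil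
  then show ?case using assms by (auto simp: continuous_map_def)
next
  case (Cons p ps)
  then show ?case using pathin_push[OF assms, of p] by (simp add: paths_def)
qed

subsection \<open>The pseudofunctor induced by a binary operation\<close>

definition op_pf :: "'a topology \<Rightarrow> ('a \<Rightarrow> 'a \<Rightarrow> 'a) \<Rightarrow>
  ('a \<times> 'a, (real \<Rightarrow> 'a) \<times> (real \<Rightarrow> 'a), (real \<times> real \<Rightarrow> 'a) set \<times> (real \<times> real \<Rightarrow> 'a) set,
    'a, real \<Rightarrow> 'a, (real \<times> real \<Rightarrow> 'a) set) pfunctor" where
  "op_pf X m = \<lparr>
     F0 = (\<lambda>(x, y). m x y),
     F1 = (\<lambda>(f, g). \<lambda>t\<in>I1. m (f t) (g t)),
     F2 = (\<lambda>(\<alpha>, \<beta>). sqclass X (\<lambda>z. m (hrep \<alpha> z) (hrep \<beta> z))),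
     Fcomp = (\<lambda>(g, g') (f, f'). Id2 (Pi2 X) (\<lambda>t\<in>I1. m (path_concat g f t) (path_concat g' f' t))),
     Fid = (\<lambda>(x, y). Id2 (Pi2 X) (\<lambda>t\<in>I1. m x y))\<rparr>"

lemma op_pf_simps [simp]:
  "F0 (op_pf X m) (x, y) = m x y" "F1 (op_pf X m) (f, g) = (\<lambda>t\<in>I1. m (f t) (g t))"
  "Fid (op_pf X m) (x, y) = Id2 (Pi2 X) (\<lambda>t\<in>I1. m x y)"
  by (simp_all add: op_pf_def)

lemma rel_homotopic_pair:
  assumes "rel_homotopic X H H'" "rel_homotopic Y K K'"
  shows "rel_homotopic (prod_topology X Y) (\<lambda>z. (H z, K z)) (\<lambda>z. (H' z, K' z))"
proof -
  obtain F where F: "continuous_map (top_of_set (I1 \<times> I2)) X F"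
     "\<And>z. z\<in>I2 \<Longrightarrow> F (0, z) = H z \<and> F (1, z) = H' z" "\<And>r z. r\<in>I1 \<Longrightarrow> z\<in>square_boundary \<Longrightarrow> F (r, z) = H z"
    using assms(1) unfolding rel_homotopic_def by blast
  obtain G where G: "continuous_map (top_of_set (I1 \<times> I2)) Y G"
     "\<And>z. z\<in>I2 \<Longrightarrow> G (0, z) = K z \<and> G (1, z) = K' z" "\<And>r z. r\<in>I1 \<Longrightarrow> z\<in>square_boundary \<Longrightarrow> G (r, z) = K z"
    using assms(2) unfolding rel_homotopic_def by blast
  show ?thesis unfolding rel_homotopic_def
    by (intro exI[of _ "\<lambda>x. (F x, G x)"] conjI ballI continuous_map_pairedI F(1) G(1))
       (simp_all only: F(2,3) G(2,3))
qed

lemma square_pair: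
  "square X H p q \<Longrightarrow> square Y K p' q' \<Longrightarrow>
    square (prod_topology X Y) (\<lambda>z. (H z, K z)) (\<lambda>t. (p t, p' t)) (\<lambda>t. (q t, q' t))"
  unfolding square_def by (simp add: continuous_map_pairedI)

lemma reparam_op:
  assumes \<phi>: "\<And>t. t \<in> I1 \<Longrightarrow> \<phi> t \<in> I1"
  shows "reparam X (\<lambda>t\<in>I1. m (f t) (g t)) \<phi> = sqclass X (\<lambda>(s, t). m (f (lerp s (\<phi> t) t)) (g (lerp s (\<phi> t) t)))"
  unfolding reparam_lerp by (rule sqclass_cong) (use lerp_in \<phi> in force)

context
  fixes X :: "'a topology" and m :: "'a \<Rightarrow> 'a \<Rightarrow> 'a"
  assumes m: "continuous_map (prod_topology X X) X (\<lambda>(x, y). m x y)"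
begin

lemma m_in: "x \<in> topspace X \<Longrightarrow> y \<in> topspace X \<Longrightarrow> m x y \<in> topspace X"
  using funcset_mem[of "\<lambda>(x, y). m x y" "topspace X \<times> topspace X" "topspace X" "(x, y)"] m
  by (simp add: continuous_map_def)

lemma square_op:
  assumes "square X H p q" "square X K p' q'"
  shows "square X (\<lambda>z. m (H z) (K z)) (\<lambda>t. m (p t) (p' t)) (\<lambda>t. m (q t) (q' t))"
  using square_map[OF square_pair[OF assms] m] by (simp add: o_def)

lemma square_op':
  assumes "square X H p q" "square X K p' q'"
  shows "square X (\<lambda>z. m (H z) (K z)) (\<lambda>t\<in>I1. m (p t) (p' t)) (\<lambda>t\<in>I1. m (q t) (q' t))"
  by (rule square_cong[OF square_op[OF assms]]) auto

lemma op_F2_sqclass: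
  assumes H: "square X H p q" and K: "square X K p' q'"
  shows "F2 (op_pf X m) (sqclass X H, sqclass X K) = sqclass X (\<lambda>z. m (H z) (K z))"
proof -
  have "rel_homotopic X (\<lambda>z. m (H z) (K z)) (\<lambda>z. m (hrep (sqclass X H) z) (hrep (sqclass X K) z))"
    using rel_homotopic_map[OF rel_homotopic_pair[OF hrep_sqclass(2)[OF H] hrep_sqclass(2)[OF K]] m]
    by (simp add: o_def)
  from sqclass_eqI[OF square_op[OF H K] this] show ?thesis by (simp add: op_pf_def)
qed

lemma pathin_op:
  assumes "pathin X f" "pathin X g" shows "pathin X (\<lambda>t\<in>I1. m (f t) (g t))"
proof (rule pathin_cong)
  show "pathin X (\<lambda>t. m (f t) (g t))"
    using continuous_map_compose[OF continuous_map_pairedI m] assms by (fastforce simp: pathin_def o_def)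
qed simp

lemma path_concat_op:
  "(\<lambda>t\<in>I1. m (path_concat g f t) (path_concat g' f' t)) =
    path_concat (\<lambda>t\<in>I1. m (g t) (g' t)) (\<lambda>t\<in>I1. m (f t) (f' t))"
  by (auto simp: path_concat_def fun_eq_iff)

lemma op_F2_reparam:
  assumes "pathin X f" "pathin X g" "continuous_on I1 \<phi>" "\<And>t. t \<in> I1 \<Longrightarrow> \<phi> t \<in> I1" "\<phi> 0 = 0" "\<phi> 1 = 1"
  shows "F2 (op_pf X m) (reparam X f \<phi>, reparam X g \<phi>) = reparam X (\<lambda>t\<in>I1. m (f t) (g t)) \<phi>"
proof -
  have "F2 (op_pf X m) (reparam X f \<phi>, reparam X g \<phi>) =
      sqclass X (\<lambda>z. m (case z of (s, t) \<Rightarrow> f (lerp s (\<phi> t) t)) (case z of (s, t) \<Rightarrow> g (lerp s (\<phi> t) t)))"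
    unfolding reparam_lerp
    by (rule op_F2_sqclass[OF square_reparam[OF assms(1,3-6)] square_reparam[OF assms(2,3-6)]])
  also have "\<dots> = sqclass X (\<lambda>(s, t). m (f (lerp s (\<phi> t) t)) (g (lerp s (\<phi> t) t)))"
    by (rule sqclass_cong) (simp add: case_prod_unfold)
  also have "\<dots> = reparam X (\<lambda>t\<in>I1. m (f t) (g t)) \<phi>"
    by (rule reparam_op[symmetric]) (rule assms(4))
  finally show ?thesis .
qed

lemma strict_pf_op: "strict_pf (Pi2 X \<times>\<^sub>b Pi2 X) (Pi2 X) (op_pf X m)"
proof (unfold_locales, unfold split_paired_all in1_prod in2_prod prod_bicat_simps mem_Times_iff fst_conv snd_conv prod.inject, goal_cases)
  case (1 x y)
  then show ?case using m_in by simp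
next
  case (2 f g x y x' y')
  then show ?case unfolding in1_Pi2 by (auto intro: pathin_op)
next
  case (3 \<alpha> \<beta> f g f' g')
  then obtain H K where H: "square X H f f'" "\<alpha> = sqclass X H" and K: "square X K g g'" "\<beta> = sqclass X K"
    unfolding in2_Pi2 by blast
  show ?case unfolding H(2) K(2) op_F2_sqclass[OF H(1) K(1)]
    by (rule sqclass_in2) (use square_op'[OF H(1) K(1)] in auto)
next
  case (4 x y)
  then show ?case by auto
next
  case (5 f f' x x' y y' g g' z z')
  then show ?case unfolding Pi2_simps op_pf_simps by (rule_tac path_concat_op)
next
  case (6 f g)
  then have fg: "pathin X f" "pathin X g" by (auto simp: paths_def)
  show ?case unfolding Pi2_simps op_F2_sqclass[OF square_const[OF fg(1)] square_const[OF fg(2)]]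
    by (rule sqclass_cong) auto
next
  case (7 \<alpha> \<alpha>' f f' g g' \<beta> \<beta>' h h')
  obtain H where H: "square X H f g" "\<alpha> = sqclass X H" using 7 in2_Pi2_hrep by blast
  obtain H' where H': "square X H' f' g'" "\<alpha>' = sqclass X H'" using 7 in2_Pi2_hrep by blast
  obtain K where K: "square X K g h" "\<beta> = sqclass X K" using 7 in2_Pi2_hrep by blast
  obtain K' where K': "square X K' g' h'" "\<beta>' = sqclass X K'" using 7 in2_Pi2_hrep by blast
  have e: "vcat (\<lambda>z. m (K z) (K' z)) (\<lambda>z. m (H z) (H' z)) = (\<lambda>z. m (vcat K H z) (vcat K' H' z))"
    by (auto simp: vcat_def fun_eq_iff)
  show ?case
    unfolding H(2) H'(2) K(2) K'(2) VComp_sqclass[OF H(1) K(1)] VComp_sqclass[OF H'(1) K'(1)]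
      op_F2_sqclass[OF H(1) H'(1)] op_F2_sqclass[OF K(1) K'(1)]
      op_F2_sqclass[OF square_vcat[OF H(1) K(1)] square_vcat[OF H'(1) K'(1)]]
      VComp_sqclass[OF square_op[OF H(1) H'(1)] square_op[OF K(1) K'(1)]] e ..
next
  case (8 \<alpha> \<alpha>' f f' g g' \<beta> \<beta>' h h' k k')
  obtain H where H: "square X H f g" "\<alpha> = sqclass X H" using 8 in2_Pi2_hrep by blast
  obtain H' where H': "square X H' f' g'" "\<alpha>' = sqclass X H'" using 8 in2_Pi2_hrep by blast
  obtain K where K: "square X K h k" "\<beta> = sqclass X K" using 8 in2_Pi2_hrep by blast
  obtain K' where K': "square X K' h' k'" "\<beta>' = sqclass X K'" using 8 in2_Pi2_hrep by blast
  have c: "f 1 = h 0" "f' 1 = h' 0" "m (f 1) (f' 1) = m (h 0) (h' 0)" using 8(3) by auto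
  have e: "hcat (\<lambda>z. m (K z) (K' z)) (\<lambda>z. m (H z) (H' z)) = (\<lambda>z. m (hcat K H z) (hcat K' H' z))"
    by (auto simp: hcat_def fun_eq_iff)
  show ?case
    unfolding H(2) H'(2) K(2) K'(2) HComp_sqclass[OF H(1) K(1) c(1)] HComp_sqclass[OF H'(1) K'(1) c(2)]
      op_F2_sqclass[OF H(1) H'(1)] op_F2_sqclass[OF K(1) K'(1)]
      op_F2_sqclass[OF square_hcat[OF H(1) K(1) c(1)] square_hcat[OF H'(1) K'(1) c(2)]]
      HComp_sqclass[OF square_op[OF H(1) H'(1)] square_op[OF K(1) K'(1)] c(3)] e ..
next
  case (9 f f' w w' x x' g g' y y' h h' z z')
  then have "pathin X (path_concat h (path_concat g f))" "pathin X (path_concat h' (path_concat g' f'))"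
    by (auto simp: in1_Pi2 intro!: pathin_path_concat)
  from op_F2_reparam[OF this continuous_on_assoc_reparam assoc_reparam_bounds]
  show ?case unfolding Assoc_Pi2 op_pf_simps path_concat_op by simp
next
  case (10 f f' x x' y y')
  then have "pathin X f" "pathin X f'" by (auto simp: in1_Pi2)
  moreover have "continuous_on I1 (\<lambda>t::real. min (2 * t) 1)" by (intro continuous_intros)
  ultimately have "F2 (op_pf X m) (reparam X f (\<lambda>t. min (2 * t) 1), reparam X f' (\<lambda>t. min (2 * t) 1)) =
      reparam X (\<lambda>t\<in>I1. m (f t) (f' t)) (\<lambda>t. min (2 * t) 1)"
    by (rule op_F2_reparam) auto
  then show ?case unfolding Pi2_simps op_pf_simps .
next
  case (11 f f' x x' y y')
  then have "pathin X f" "pathin X f'" by (auto simp: in1_Pi2)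
  moreover have "continuous_on I1 (\<lambda>t::real. max (2 * t - 1) 0)" by (intro continuous_intros)
  ultimately have "F2 (op_pf X m) (reparam X f (\<lambda>t. max (2 * t - 1) 0), reparam X f' (\<lambda>t. max (2 * t - 1) 0)) =
      reparam X (\<lambda>t\<in>I1. m (f t) (f' t)) (\<lambda>t. max (2 * t - 1) 0)"
    by (rule op_F2_reparam) auto
  then show ?case unfolding Pi2_simps op_pf_simps .
next
  case (12 f f' x x' y y' g g' z z')
  show ?case unfolding op_pf_simps by (simp add: op_pf_def path_concat_op)
next
  case (13 x y)
  then show ?case by simp
qed

lemma cell_lift_op:
  assumes "continuous_map V X \<Psi>" "continuous_map W X \<Psi>'" "cell_lift X V \<Psi> \<alpha> p q" "cell_lift X W \<Psi>' \<beta> p' q'"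
  shows "cell_lift X (prod_topology V W) (\<lambda>(v, w). m (\<Psi> v) (\<Psi>' w)) (F2 (op_pf X m) (\<alpha>, \<beta>))
    (\<lambda>t. (p t, p' t)) (\<lambda>t. (q t, q' t))"
proof -
  obtain H where H: "square V H p q" "\<alpha> = sqclass X (\<Psi> \<circ> H)" using assms(3) unfolding cell_lift_def by blast
  obtain K where K: "square W K p' q'" "\<beta> = sqclass X (\<Psi>' \<circ> K)" using assms(4) unfolding cell_lift_def by blast
  have "F2 (op_pf X m) (\<alpha>, \<beta>) = sqclass X ((\<lambda>(v, w). m (\<Psi> v) (\<Psi>' w)) \<circ> (\<lambda>z. (H z, K z)))"
    unfolding H(2) K(2) op_F2_sqclass[OF square_map[OF H(1) assms(1)] square_map[OF K(1) assms(2)]]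
    by (simp add: o_def)
  with square_pair[OF H(1) K(1)] show ?thesis unfolding cell_lift_def by blast
qed

lemma chain_pair: "length ps = length rs \<Longrightarrow> chain V v ps v' \<Longrightarrow> chain W w rs w' \<Longrightarrow>
   chain (prod_topology V W) (v, w) (map2 (\<lambda>p r t. (p t, r t)) ps rs) (v', w')"
proof (induction ps rs arbitrary: v w rule: list_induct2)
  case (Cons p ps r rs)
  then show ?case by (auto simp: pathin_def intro: continuous_map_pairedI)
qed simp

lemma pcompw_pair: "length ps = length rs \<Longrightarrow>
  pcompw (v, w) (map2 (\<lambda>p r t. (p t, r t)) ps rs) = (\<lambda>t. (pcompw v ps t, pcompw w rs t))"
proof (induction ps rs arbitrary: v w rule: list_induct2)
  case (Cons p ps r rs)
  then show ?case by (cases ps; cases rs) (auto simp: pcat1_def fun_eq_iff)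
qed simp

lemma chain_pair_const: "chain W w rs w' \<Longrightarrow> v \<in> topspace V \<Longrightarrow>
   chain (prod_topology V W) (v, w) (map (\<lambda>r t. (v, r t)) rs) (v, w')"
  "chain W w rs w' \<Longrightarrow> v \<in> topspace V \<Longrightarrow>
   chain (prod_topology W V) (w, v) (map (\<lambda>r t. (r t, v)) rs) (w', v)"
  by (induction rs arbitrary: w) (auto simp: pathin_def intro: continuous_map_pairedI)

lemma pcompw_pair_const: "pcompw (v, w) (map (\<lambda>r t. (v, r t)) rs) = (\<lambda>t. (v, pcompw w rs t))"
  "pcompw (w, v) (map (\<lambda>r t. (r t, v)) rs) = (\<lambda>t. (pcompw w rs t, v))"
  by (induction w rs rule: pcompw.induct) (auto simp: pcat1_def fun_eq_iff)

lemma push_op: "push (\<lambda>(v, w). m (\<Psi> v) (\<Psi>' w)) (\<lambda>t. (p t, r t)) = F1 (op_pf X m) (push \<Psi> p, push \<Psi>' r)"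
  by (auto simp: push_def fun_eq_iff)

lemma pcell_lift_op:
  assumes \<Psi>: "continuous_map V X \<Psi>" "continuous_map W X \<Psi>'"
    and K: "pcell_lift X V \<Psi> K v ps qs" and L: "pcell_lift X W \<Psi>' L w rs ss"
    and len: "length ps = length rs" "length qs = length ss"
  shows "pcell_lift X (prod_topology V W) (\<lambda>(v, w). m (\<Psi> v) (\<Psi>' w))
    (pf_image (Pi2 X \<times>\<^sub>b Pi2 X) (Pi2 X) (op_pf X m) (pair_pcell K L)) (v, w)
    (map2 (\<lambda>p r t. (p t, r t)) ps rs) (map2 (\<lambda>p r t. (p t, r t)) qs ss)"
proof -
  note K = pcell_liftD[OF K] and L = pcell_liftD[OF L]
  define P where "P = pair_pcell K L"
  have P: "org P = (\<Psi> v, \<Psi>' w)" "top_path P = zip (map (push \<Psi>) ps) (map (push \<Psi>') rs)"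
    "bot_path P = zip (map (push \<Psi>) qs) (map (push \<Psi>') ss)" "cell P = (cell K, cell L)"
    unfolding P_def using K(4-6) L(4-6) by (cases K; cases L; simp)+
  have im: "pf_image (Pi2 X \<times>\<^sub>b Pi2 X) (Pi2 X) (op_pf X m) P = PC (F0 (op_pf X m) (org P))
    (map (F1 (op_pf X m)) (top_path P)) (F2 (op_pf X m) (cell P)) (map (F1 (op_pf X m)) (bot_path P))"
  proof (rule strict_pf.pf_image_strict[OF strict_pf_op bicategory_prod[OF bicategory_Pi2 bicategory_Pi2] bicategory_Pi2])
    show "opath (Pi2 X \<times>\<^sub>b Pi2 X) (org P) (top_path P) (\<Psi> (wend v ps), \<Psi>' (wend w rs))"
      unfolding P by (rule opath_prod) (use len opath_push[OF \<Psi>(1) K(1)] opath_push[OF \<Psi>(2) L(1)] in auto)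
    show "opath (Pi2 X \<times>\<^sub>b Pi2 X) (org P) (bot_path P) (\<Psi> (wend v ps), \<Psi>' (wend w rs))"
      unfolding P by (rule opath_prod) (use len opath_push[OF \<Psi>(1) K(2)] opath_push[OF \<Psi>(2) L(2)] in auto)
    show "in2 (Pi2 X \<times>\<^sub>b Pi2 X) (cell P) (pcomp (Pi2 X \<times>\<^sub>b Pi2 X) (org P) (top_path P))
       (pcomp (Pi2 X \<times>\<^sub>b Pi2 X) (org P) (bot_path P))"
      using cell_lift_in2[OF \<Psi>(1) K(7)] cell_lift_in2[OF \<Psi>(2) L(7)] len
      unfolding P by (simp add: pcomp_prod in2_prod push_pcompw[where X=X])
  qed
  have mp: "map (F1 (op_pf X m)) (zip (map (push \<Psi>) ps) (map (push \<Psi>') rs)) =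
    map (push (\<lambda>(v, w). m (\<Psi> v) (\<Psi>' w))) (map2 (\<lambda>p r t. (p t, r t)) ps rs)" for ps rs
    by (simp add: zip_map1 zip_map2 o_def case_prod_unfold push_op[unfolded case_prod_unfold] split_def)
  show ?thesis
    unfolding P_def[symmetric] im
    by (rule pcell_liftI[OF chain_pair[OF len(1) K(1) L(1)]])
       (use chain_pair[OF len(2) K(2) L(2)] cell_lift_op[OF \<Psi> K(7) L(7)] in
         \<open>simp_all only: pcell.sel P mp pcompw_pair len op_pf_simps prod.case\<close>)
qed

lemma pcell_lift_op_left:
  assumes \<Psi>: "continuous_map V X \<Psi>" "continuous_map W X \<Psi>'"
    and v: "v \<in> topspace V" and L: "pcell_lift X W \<Psi>' L w rs ss"
  shows "pcell_lift X (prod_topology V W) (\<lambda>(v, w). m (\<Psi> v) (\<Psi>' w))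
    (pf_image (Pi2 X) (Pi2 X) (pf_comp (Pi2 X) (op_pf X m) (pf_pairl (Pi2 X) (\<Psi> v))) L) (v, w)
    (map (\<lambda>r t. (v, r t)) rs) (map (\<lambda>r t. (v, r t)) ss)"
proof -
  let ?F = "pf_comp (Pi2 X) (op_pf X m) (pf_pairl (Pi2 X) (\<Psi> v))"
  note L = pcell_liftD[OF L]
  have x: "\<Psi> v \<in> topspace X" using v \<Psi>(1) by (auto simp: continuous_map_def)
  interpret bicategory "Pi2 X" by (rule bicategory_Pi2)
  have sF: "strict_pf (Pi2 X) (Pi2 X) ?F"
    by (rule strict_pf_comp[OF strict_pf_pair(1)[OF x] strict_pf_op bicategory_Pi2 _ Id2_in bicategory_prod[OF bicategory_Pi2 bicategory_Pi2]])
       (use VComp_id in blast)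
  have im: "pf_image (Pi2 X) (Pi2 X) ?F L = PC (F0 ?F (org L)) (map (F1 ?F) (top_path L)) (F2 ?F (cell L)) (map (F1 ?F) (bot_path L))"
  proof (rule strict_pf.pf_image_strict[OF sF bicategory_Pi2 bicategory_Pi2])
    show "opath (Pi2 X) (org L) (top_path L) (\<Psi>' (wend w rs))" "opath (Pi2 X) (org L) (bot_path L) (\<Psi>' (wend w rs))"
      using opath_push[OF \<Psi>(2) L(1)] opath_push[OF \<Psi>(2) L(2)] L(4-6) by simp_all
    show "in2 (Pi2 X) (cell L) (pcomp (Pi2 X) (org L) (top_path L)) (pcomp (Pi2 X) (org L) (bot_path L))"
      using cell_lift_in2[OF \<Psi>(2) L(7)] L(4-6) by (simp add: push_pcompw[where X=X])
  qed
  have F1: "F1 ?F (push \<Psi>' r) = push (\<lambda>(v, w). m (\<Psi> v) (\<Psi>' w)) (\<lambda>t. (v, r t))" for r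
    by (auto simp: pf_comp_def pf_pairl_def push_def fun_eq_iff)
  have F2: "F2 ?F (cell L) = F2 (op_pf X m) (Id2 (Pi2 X) (push \<Psi> (\<lambda>t. v)), cell L)"
    by (simp add: pf_comp_def pf_pairl_def del: Pi2_simps(8))
  have F0: "F0 ?F (\<Psi>' w) = m (\<Psi> v) (\<Psi>' w)" by (simp add: pf_comp_def pf_pairl_def)
  have pv: "pathin V (\<lambda>t. v)" using v by (simp add: pathin_const)
  show ?thesis
    unfolding im
    by (rule pcell_liftI[OF chain_pair_const(1)[OF L(1) v] chain_pair_const(1)[OF L(2) v]])
       (use cell_lift_op[OF \<Psi> cell_lift_Id2[OF pv] L(7)] in
         \<open>simp_all only: pcell.sel L(4-6) F0 F2 map_map o_def F1 pcompw_pair_const prod.case\<close>)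
qed

lemma pcell_lift_op_right:
  assumes \<Psi>: "continuous_map V X \<Psi>" "continuous_map W X \<Psi>'"
    and v: "v \<in> topspace V" and L: "pcell_lift X W \<Psi>' L w rs ss"
  shows "pcell_lift X (prod_topology W V) (\<lambda>(w, v). m (\<Psi>' w) (\<Psi> v))
    (pf_image (Pi2 X) (Pi2 X) (pf_comp (Pi2 X) (op_pf X m) (pf_pairr (Pi2 X) (\<Psi> v))) L) (w, v)
    (map (\<lambda>r t. (r t, v)) rs) (map (\<lambda>r t. (r t, v)) ss)"
proof -
  let ?F = "pf_comp (Pi2 X) (op_pf X m) (pf_pairr (Pi2 X) (\<Psi> v))"
  note L = pcell_liftD[OF L]
  have x: "\<Psi> v \<in> topspace X" using v \<Psi>(1) by (auto simp: continuous_map_def)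
  interpret bicategory "Pi2 X" by (rule bicategory_Pi2)
  have sF: "strict_pf (Pi2 X) (Pi2 X) ?F"
    by (rule strict_pf_comp[OF strict_pf_pair(2)[OF x] strict_pf_op bicategory_Pi2 _ Id2_in bicategory_prod[OF bicategory_Pi2 bicategory_Pi2]])
       (use VComp_id in blast)
  have im: "pf_image (Pi2 X) (Pi2 X) ?F L = PC (F0 ?F (org L)) (map (F1 ?F) (top_path L)) (F2 ?F (cell L)) (map (F1 ?F) (bot_path L))"
  proof (rule strict_pf.pf_image_strict[OF sF bicategory_Pi2 bicategory_Pi2])
    show "opath (Pi2 X) (org L) (top_path L) (\<Psi>' (wend w rs))" "opath (Pi2 X) (org L) (bot_path L) (\<Psi>' (wend w rs))"
      using opath_push[OF \<Psi>(2) L(1)] opath_push[OF \<Psi>(2) L(2)] L(4-6) by simp_all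
    show "in2 (Pi2 X) (cell L) (pcomp (Pi2 X) (org L) (top_path L)) (pcomp (Pi2 X) (org L) (bot_path L))"
      using cell_lift_in2[OF \<Psi>(2) L(7)] L(4-6) by (simp add: push_pcompw[where X=X])
  qed
  have F1: "F1 ?F (push \<Psi>' r) = push (\<lambda>(w, v). m (\<Psi>' w) (\<Psi> v)) (\<lambda>t. (r t, v))" for r
    by (auto simp: pf_comp_def pf_pairr_def push_def fun_eq_iff)
  have F2: "F2 ?F (cell L) = F2 (op_pf X m) (cell L, Id2 (Pi2 X) (push \<Psi> (\<lambda>t. v)))"
    by (simp add: pf_comp_def pf_pairr_def del: Pi2_simps(8))
  have F0: "F0 ?F (\<Psi>' w) = m (\<Psi>' w) (\<Psi> v)" by (simp add: pf_comp_def pf_pairr_def)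
  have pv: "pathin V (\<lambda>t. v)" using v by (simp add: pathin_const)
  show ?thesis
    unfolding im
    by (rule pcell_liftI[OF chain_pair_const(2)[OF L(1) v] chain_pair_const(2)[OF L(2) v]])
       (use cell_lift_op[OF \<Psi>(2,1) L(7) cell_lift_Id2[OF pv]] in
         \<open>simp_all only: pcell.sel L(4-6) F0 F2 map_map o_def F1 pcompw_pair_const prod.case\<close>)
qed

end

subsection \<open>A homotopy induces an adjoint equivalence\<close>

text \<open>\<open>D\<close> will be a power of \<open>\<Pi>\<^sub>2 X\<close>, \<open>Y\<close> the corresponding power of \<open>X\<close>, and \<open>P1\<close> the passage
  from tuples of paths to paths of tuples; \<open>F\<close> and \<open>G\<close> are induced by the maps \<open>\<Theta> (0, _)\<close> and
  \<open>\<Theta> (1, _)\<close>.\<close>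

locale homotopy_pf =
  fixes X :: "'a topology" and Y :: "'y topology" and \<Theta> :: "real \<times> 'y \<Rightarrow> 'a"
    and D :: "('o, 'm, 'c) bicat" and P0 :: "'o \<Rightarrow> 'y" and P1 :: "'m \<Rightarrow> real \<Rightarrow> 'y"
    and F G :: "('o, 'm, 'c, 'a, real \<Rightarrow> 'a, (real \<times> real \<Rightarrow> 'a) set) pfunctor"
  assumes \<Theta>: "continuous_map (prod_topology (top_of_set {0..1}) Y) X \<Theta>"
    and D: "bicategory D"
    and F: "strict_pf D (Pi2 X) F" and G: "strict_pf D (Pi2 X) G"
    and P0_in: "x \<in> Ob D \<Longrightarrow> P0 x \<in> topspace Y"
    and P1: "in1 D f x y \<Longrightarrow> pathin Y (P1 f) \<and> P1 f 0 = P0 x \<and> P1 f 1 = P0 y"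
    and P1_Id: "x \<in> Ob D \<Longrightarrow> t \<in> {0..1} \<Longrightarrow> P1 (Id1 D x) t = P0 x"
    and P1_Comp: "in1 D f x y \<Longrightarrow> in1 D g y z \<Longrightarrow> t \<in> {0..1} \<Longrightarrow> P1 (Comp D g f) t = pcat1 (P1 g) (P1 f) t"
    and P2: "in2 D \<alpha> f g \<Longrightarrow> \<exists>H. square Y H (P1 f) (P1 g) \<and>
      F2 F \<alpha> = sqclass X (\<lambda>z. \<Theta> (0, H z)) \<and> F2 G \<alpha> = sqclass X (\<lambda>z. \<Theta> (1, H z))"
    and F0_eq: "x \<in> Ob D \<Longrightarrow> F0 F x = \<Theta> (0, P0 x) \<and> F0 G x = \<Theta> (1, P0 x)"
    and F1_eq: "f \<in> Ar D \<Longrightarrow> F1 F f = push (\<lambda>y. \<Theta> (0, y)) (P1 f) \<and> F1 G f = push (\<lambda>y. \<Theta> (1, y)) (P1 f)"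

definition turn :: "real \<times> real \<Rightarrow> real \<times> real" where
  "turn = (\<lambda>(s, t). (lerp s (min (2 * t) 1) (max (2 * t - 1) 0), lerp s (max (2 * t - 1) 0) (min (2 * t) 1)))"

definition homotopy_trans ::
  "'a topology \<Rightarrow> (real \<times> 'y \<Rightarrow> 'a) \<Rightarrow> ('o \<Rightarrow> 'y) \<Rightarrow> ('m \<Rightarrow> real \<Rightarrow> 'y)
    \<Rightarrow> ('o, 'm, real \<Rightarrow> 'a, (real \<times> real \<Rightarrow> 'a) set) ptrans" where
  "homotopy_trans X \<Theta> P0 P1 = \<lparr>tcomp = (\<lambda>x. \<lambda>t\<in>I1. \<Theta> (t, P0 x)),
     tnat = (\<lambda>f. sqclass X (\<lambda>z. \<Theta> (fst (turn z), P1 f (snd (turn z)))))\<rparr>"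

definition homotopy_equiv ::
  "'a topology \<Rightarrow> (real \<times> 'y \<Rightarrow> 'a) \<Rightarrow> ('o \<Rightarrow> 'y) \<Rightarrow> ('m \<Rightarrow> real \<Rightarrow> 'y)
    \<Rightarrow> ('o, 'm, real \<Rightarrow> 'a, (real \<times> real \<Rightarrow> 'a) set) adj_equiv" where
  "homotopy_equiv X \<Theta> P0 P1 = \<lparr>fwd = homotopy_trans X \<Theta> P0 P1,
     bwd = homotopy_trans X (\<lambda>(t, y). \<Theta> (1 - t, y)) P0 P1,
     unit_at = (\<lambda>x. sqclass X (\<lambda>(s, t). \<Theta> (lerp s 0 (pcat1 (\<lambda>t. 1 - t) (\<lambda>t. t) t), P0 x))),
     counit_at = (\<lambda>x. sqclass X (\<lambda>(s, t). \<Theta> (lerp s (pcat1 (\<lambda>t. t) (\<lambda>t. 1 - t) t) 1, P0 x)))\<rparr>"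

lemma continuous_turn: "continuous_on S turn"
  unfolding turn_def case_prod_unfold lerp_def by (intro continuous_intros)

lemma turn_in: "z \<in> I2 \<Longrightarrow> turn z \<in> I2"
  by (cases z) (auto simp: turn_def simp del: atLeastAtMost_iff intro!: lerp_in; auto)

definition seg :: "real \<Rightarrow> real \<Rightarrow> real \<Rightarrow> real" where "seg a b t = lerp t a b"

lemma seg_simps [simp]: "seg a b 0 = a" "seg a b 1 = b"
  by (simp_all add: seg_def)

lemma seg_01: "seg 0 1 = (\<lambda>t. t)" "seg 1 0 = (\<lambda>t. 1 - t)"
  by (simp_all add: fun_eq_iff seg_def lerp_def)

lemma seg_in: "t \<in> I1 \<Longrightarrow> a \<in> I1 \<Longrightarrow> b \<in> I1 \<Longrightarrow> seg a b t \<in> I1"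
  unfolding seg_def by (rule lerp_in)

lemma continuous_on_seg: "continuous_on S f \<Longrightarrow> continuous_on S (\<lambda>z. seg a b (f z))"
  unfolding seg_def lerp_def by (intro continuous_intros)

lemma turn_square: "square (top_of_set I2) turn (pcat1 (\<lambda>t. (1, seg 0 1 t)) (\<lambda>t. (seg 0 1 t, 0)))
  (pcat1 (\<lambda>t. (seg 0 1 t, 1)) (\<lambda>t. (0, seg 0 1 t)))"
  unfolding square_def
proof (intro conjI)
  have "turn \<in> I2 \<rightarrow> I2" using turn_in by blast
  then show "continuous_map (top_of_set I2) (top_of_set I2) turn"
    using continuous_turn[of I2] by (simp add: continuous_map_in_subtopology image_subset_iff_funcset)
qed (auto simp: turn_def pcat1_def seg_01 max_def min_def)

lemma convex_I2: "convex I2"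
  by (intro convex_Times) auto

lemma contractible_I2: "contractible_space (top_of_set I2)"
  by (simp add: convex_imp_contractible convex_I2)

lemma pathin_top_of_set: "continuous_on I1 p \<Longrightarrow> (\<And>t. t \<in> I1 \<Longrightarrow> p t \<in> S) \<Longrightarrow> pathin (top_of_set S) p"
  unfolding pathin_def by (auto simp: continuous_map_in_subtopology)

lemma pathin_seg:
  "a \<in> I1 \<Longrightarrow> b \<in> I1 \<Longrightarrow> pathin (top_of_set I1) (seg a b)"
  "a \<in> I1 \<Longrightarrow> b \<in> I1 \<Longrightarrow> c \<in> I1 \<Longrightarrow> pathin (top_of_set I2) (\<lambda>t. (c, seg a b t))"
  "a \<in> I1 \<Longrightarrow> b \<in> I1 \<Longrightarrow> c \<in> I1 \<Longrightarrow> pathin (top_of_set I2) (\<lambda>t. (seg a b t, c))"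
  "c \<in> I1 \<Longrightarrow> pathin (top_of_set I1) (\<lambda>t. c)"
  by (rule pathin_top_of_set; use seg_in[of _ a b] in \<open>auto intro!: continuous_intros continuous_on_seg[where f = "\<lambda>t. t"]\<close>)+

context homotopy_pf
begin

abbreviation "\<sigma> \<equiv> homotopy_trans X \<Theta> P0 P1"

lemma continuous_\<Theta>:
  assumes "continuous_on S u" "\<And>z. z \<in> S \<Longrightarrow> u z \<in> I1" "continuous_map (top_of_set S) Y v"
  shows "continuous_map (top_of_set S) X (\<lambda>z. \<Theta> (u z, v z))"
proof -
  have "continuous_map (top_of_set S) (prod_topology (top_of_set I1) Y) (\<lambda>z. (u z, v z))"
    using assms by (intro continuous_map_pairedI) (auto simp: continuous_map_in_subtopology)
  from continuous_map_compose[OF this \<Theta>] show ?thesis by (simp add: o_def)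
qed

lemma continuous_\<Theta>_at: "u \<in> I1 \<Longrightarrow> continuous_map Y X (\<lambda>y. \<Theta> (u, y))"
proof -
  assume "u \<in> I1"
  then have "continuous_map Y (prod_topology (top_of_set I1) Y) (\<lambda>y. (u, y))"
    by (intro continuous_map_pairedI) auto
  from continuous_map_compose[OF this \<Theta>] show ?thesis by (simp add: o_def)
qed

lemma lift_path:
  assumes "pathin Y p"
  shows "lifting X (top_of_set I2) (\<lambda>(u, v). \<Theta> (u, p v))"
proof -
  have "continuous_map (top_of_set I2) Y (\<lambda>z. p (snd z))"
    by (rule continuous_map_reparam[of I1 Y p]) (use assms in \<open>auto simp: pathin_def intro!: continuous_intros\<close>)
  then have "continuous_map (top_of_set I2) X (\<lambda>z. \<Theta> (fst z, p (snd z)))"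
    by (rule continuous_\<Theta>[rotated 2]) (auto intro!: continuous_intros)
  then show ?thesis unfolding lifting_def case_prod_unfold using contractible_I2 by blast
qed

lemma lift_point:
  assumes "y \<in> topspace Y"
  shows "lifting X (top_of_set I1) (\<lambda>u. \<Theta> (u, y))"
proof -
  have "continuous_map (top_of_set I1) X (\<lambda>z. \<Theta> (z, y))"
    by (rule continuous_\<Theta>[where u = "\<lambda>z. z" and v = "\<lambda>z. y"]) (simp_all add: assms)
  then show ?thesis unfolding lifting_def using contractible_I1 by blast
qed

lemma Ar_D: "in1 D f x y \<Longrightarrow> f \<in> Ar D" "in1 D f x y \<Longrightarrow> Src D f = x" "in1 D f x y \<Longrightarrow> Trg D f = y"
  "in1 D f x y \<Longrightarrow> x \<in> Ob D" "in1 D f x y \<Longrightarrow> y \<in> Ob D"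
  using bicategory.Ar_Ob[OF D, of f] by (auto simp: in1_def)

lemma tcomp_push: "tcomp \<sigma> x = push (\<lambda>u. \<Theta> (u, P0 x)) (seg 0 1)"
  by (simp add: homotopy_trans_def push_def seg_01)

lemma pcell_lift_tsquare:
  assumes f: "in1 D f x y"
  shows "pcell_lift X (top_of_set I2) (\<lambda>(u, v). \<Theta> (u, P1 f v)) (tsquare D F G \<sigma> f) (0, 0)
    [\<lambda>t. (seg 0 1 t, 0), \<lambda>t. (1, seg 0 1 t)] [\<lambda>t. (0, seg 0 1 t), \<lambda>t. (seg 0 1 t, 1)]"
proof -
  note P = P1[OF f]
  show ?thesis
  proof (rule pcell_liftI)
    show "chain (top_of_set I2) (0, 0) [\<lambda>t. (seg 0 1 t, 0), \<lambda>t. (1, seg 0 1 t)] (1, 1)"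
      "chain (top_of_set I2) (0, 0) [\<lambda>t. (0, seg 0 1 t), \<lambda>t. (seg 0 1 t, 1)] (1, 1)"
      by (simp_all add: pathin_seg)
    show "cell_lift X (top_of_set I2) (\<lambda>(u, v). \<Theta> (u, P1 f v)) (cell (tsquare D F G \<sigma> f))
       (pcompw (0, 0) [\<lambda>t. (seg 0 1 t, 0), \<lambda>t. (1, seg 0 1 t)])
       (pcompw (0, 0) [\<lambda>t. (0, seg 0 1 t), \<lambda>t. (seg 0 1 t, 1)])"
      unfolding cell_lift_def
      by (rule exI[of _ turn]) (use turn_square in \<open>simp add: tsquare_def homotopy_trans_def case_prod_unfold o_def\<close>)
  qed (use P F0_eq[OF Ar_D(4)[OF f]] F1_eq[OF Ar_D(1)[OF f]] Ar_D[OF f] in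
      \<open>auto simp: tsquare_def tcomp_push push_def seg_01 fun_eq_iff\<close>)
qed

lemma pcell_lift_tsquare_sub:
  assumes f: "in1 D f x y" and p: "pathin Y p" and ab: "a \<in> I1" "b \<in> I1"
    and fp: "\<And>t. t \<in> I1 \<Longrightarrow> P1 f t = p (seg a b t)"
  shows "pcell_lift X (top_of_set I2) (\<lambda>(u, v). \<Theta> (u, p v)) (tsquare D F G \<sigma> f) (0, a)
    [\<lambda>t. (seg 0 1 t, a), \<lambda>t. (1, seg a b t)] [\<lambda>t. (0, seg a b t), \<lambda>t. (seg 0 1 t, b)]"
proof -
  let ?\<Phi> = "\<lambda>z. (fst z, seg a b (snd z))"
  have "continuous_map (top_of_set I2) (top_of_set I2) ?\<Phi>"
    using seg_in[OF _ ab] by (auto simp: continuous_map_in_subtopology intro!: continuous_intros continuous_on_seg)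
  from pcell_lift_change[OF pcell_lift_tsquare[OF f] this, of "\<lambda>(u, v). \<Theta> (u, p v)"] show ?thesis
    using fp by (simp add: seg_01 case_prod_unfold mem_Times_iff)
qed

lemma strict_Fcomp:
  assumes f: "in1 D f x y" and g: "in1 D g y z"
  shows "Fcomp F g f = Id2 (Pi2 X) (path_concat (F1 F g) (F1 F f))" "Fcomp G g f = Id2 (Pi2 X) (path_concat (F1 G g) (F1 G f))"
  using strict_pf.s_Fcomp[OF F f g] strict_pf.s_Fcomp[OF G f g] by simp_all

lemma strict_Fid:
  assumes "x \<in> Ob D"
  shows "Fid F x = Id2 (Pi2 X) (\<lambda>t\<in>I1. \<Theta> (0, P0 x))" "Fid G x = Id2 (Pi2 X) (\<lambda>t\<in>I1. \<Theta> (1, P0 x))"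
  using strict_pf.s_Fid[OF F assms] strict_pf.s_Fid[OF G assms] F0_eq[OF assms] by simp_all

lemma tnat_natural:
  assumes f: "in1 D f x y" and \<alpha>: "in2 D \<alpha> f g"
  shows "VComp (Pi2 X) (tnat \<sigma> g) (HComp (Pi2 X) (F2 G \<alpha>) (Id2 (Pi2 X) (tcomp \<sigma> x))) =
      VComp (Pi2 X) (HComp (Pi2 X) (Id2 (Pi2 X) (tcomp \<sigma> y)) (F2 F \<alpha>)) (tnat \<sigma> f)"
proof -
  have g: "in1 D g x y" using bicategory.in2_in1(2)[OF D \<alpha>] Ar_D[OF f] by simp
  note xy = Ar_D(4,5)[OF f]
  obtain H where H: "square Y H (P1 f) (P1 g)" "F2 F \<alpha> = sqclass X (\<lambda>z. \<Theta> (0, H z))"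
    "F2 G \<alpha> = sqclass X (\<lambda>z. \<Theta> (1, H z))" using P2[OF \<alpha>] by blast
  have H': "H (0, t) = P1 f t" "H (1, t) = P1 g t" "H (t, 0) = P0 x" "H (t, 1) = P0 y" if "t \<in> I1" for t
    using H(1) that P1[OF f] by (auto simp: square_def)
  define s0 where "s0 = (\<lambda>z::real\<times>real. \<Theta> (0, H z))"
  define s1 where "s1 = (\<lambda>z::real\<times>real. \<Theta> (1, H z))"
  have s0: "square X s0 (\<lambda>t. \<Theta> (0, P1 f t)) (\<lambda>t. \<Theta> (0, P1 g t))"
    and s1: "square X s1 (\<lambda>t. \<Theta> (1, P1 f t)) (\<lambda>t. \<Theta> (1, P1 g t))"
    using square_map[OF H(1) continuous_\<Theta>_at[of 0]] square_map[OF H(1) continuous_\<Theta>_at[of 1]]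
    by (simp_all add: s0_def s1_def o_def)
  have \<sigma>: "pathin X (tcomp \<sigma> x)" if "x \<in> Ob D" for x
    unfolding tcomp_push
    by (rule pathin_push[of "top_of_set I1"]) (use lift_point[OF P0_in[OF that]] pathin_seg in \<open>auto simp: lifting_def\<close>)
  have \<sigma>_eq: "tcomp \<sigma> x t = \<Theta> (t, P0 x)" if "t \<in> I1" for x t using that by (simp add: homotopy_trans_def)
  define n where "n = (\<lambda>f z. \<Theta> (fst (turn z), P1 f (snd (turn z))))"
  have n: "square X (n f) (pcat1 (\<lambda>t. \<Theta> (1, P1 f t)) (tcomp \<sigma> x)) (pcat1 (tcomp \<sigma> y) (\<lambda>t. \<Theta> (0, P1 f t)))"
    if f: "in1 D f x y" for f
    using lift_path[of "P1 f"] P1[OF f]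
    by (intro square_cong[OF square_map[OF turn_square, of X "\<lambda>(u, v). \<Theta> (u, P1 f v)"]])
       (auto simp: lifting_def n_def case_prod_unfold pcat1_def seg_01 \<sigma>_eq)
  have tn: "tnat \<sigma> f = sqclass X (n f)" for f by (simp add: homotopy_trans_def n_def)
  have e0: "tcomp \<sigma> x 1 = \<Theta> (1, P1 f 0)" "\<Theta> (0, P1 f 1) = tcomp \<sigma> y 0"
    using P1[OF f] by (simp_all add: \<sigma>_eq)
  note h1 = square_hcat[OF square_const[OF \<sigma>[OF xy(1)]] s1 e0(1)]
    and h0 = square_hcat[OF s0 square_const[OF \<sigma>[OF xy(2)]] e0(2)]
  let ?L = "vcat (n g) (hcat s1 (\<lambda>(s, t). tcomp \<sigma> x t))" and ?R = "vcat (hcat (\<lambda>(s, t). tcomp \<sigma> y t) s0) (n f)"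
  let ?K = "\<lambda>w. \<Theta> (fst w, H (snd w))"
  let ?\<Phi> = "\<lambda>c d z. (fst (turn (c z, snd z)), d z, snd (turn (c z, snd z)))"
  let ?mx = "\<lambda>z::real \<times> real. max (2 * fst z - 1) 0" and ?mn = "\<lambda>z::real\<times>real. min (2 * fst z) 1"
  have "rel_homotopic X (\<lambda>z. ?K (?\<Phi> ?mx ?mn z)) (\<lambda>z. ?K (?\<Phi> ?mn ?mx z))"
  proof (rule rel_homotopic_segment[of "I1 \<times> I2"])
    show "convex (I1 \<times> I2)" by (intro convex_Times convex_I2) auto
    have "continuous_map (top_of_set (I1 \<times> I2)) Y (\<lambda>w. H (snd w))"
      by (rule continuous_map_reparam[OF square_continuous[OF H(1)]]) (auto intro!: continuous_intros)
    then show "continuous_map (top_of_set (I1 \<times> I2)) X ?K"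
      by (rule continuous_\<Theta>[rotated 2]) (auto intro!: continuous_intros)
    have cc: "continuous_on I2 (?\<Phi> c d)" if "continuous_on I2 c" "continuous_on I2 d" for c d
      using that by (intro continuous_intros continuous_on_compose2[OF continuous_turn[of UNIV]]) auto
    show "continuous_on I2 (?\<Phi> ?mx ?mn)" "continuous_on I2 (?\<Phi> ?mn ?mx)"
      by (rule cc; intro continuous_intros)+
    show "?\<Phi> ?mx ?mn z \<in> I1 \<times> I2" "?\<Phi> ?mn ?mx z \<in> I1 \<times> I2" if "z \<in> I2" for z
      using turn_in[of "(?mx z, snd z)"] turn_in[of "(?mn z, snd z)"] that by (auto simp: mem_Times_iff)
    fix r :: real and z :: "real \<times> real" assume r: "r \<in> I1" and z: "z \<in> square_boundary"
    have lr: "(1 - r) * a + r * b \<in> I1" if "a \<in> I1" "b \<in> I1" for a b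
      using lerp_in[OF r that] by (simp add: lerp_def)
    have a: "(1 - r) * a + r * a = a" for a :: real by (simp add: algebra_simps)
    show "?K ((1 - r) *\<^sub>R ?\<Phi> ?mx ?mn z + r *\<^sub>R ?\<Phi> ?mn ?mx z) = ?K (?\<Phi> ?mx ?mn z)"
      using z
    proof (cases rule: square_boundaryE)
      case (3 s)
      then show ?thesis using H'(3) lr[of "?mn z" "?mx z"] by (simp add: turn_def)
    next
      case (4 s)
      then show ?thesis using H'(4) lr[of "?mn z" "?mx z"] by (simp add: turn_def a)
    qed (simp_all add: a)
  qed
  moreover have "?L z = ?K (?\<Phi> ?mx ?mn z)" "?R z = ?K (?\<Phi> ?mn ?mx z)" if zI: "z \<in> I2" for z
  proof -
    obtain s t where z: "z = (s, t)" "s \<in> I1" "t \<in> I1" using zI by auto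
    have T: "snd (turn (c, t)) \<in> I1" if "c \<in> I1" for c
      using turn_in[of "(c, t)"] that z by (auto simp: mem_Times_iff)
    have t0: "turn (0, t) = (if t \<le> 1/2 then (2 * t, 0) else (1, 2 * t - 1))"
      "turn (1, t) = (if t \<le> 1/2 then (0, 2 * t) else (2 * t - 1, 1))"
      by (auto simp: turn_def max_def min_def)
    show "?L z = ?K (?\<Phi> ?mx ?mn z)"
    proof (cases "s \<le> 1/2")
      case True
      then have *: "?mx z = 0" "?mn z = 2 * s" "2 * s \<in> I1" using z by auto
      show ?thesis
        using z True unfolding * by (auto simp: vcat_def hcat_def z s1_def t0 \<sigma>_eq H'(3))
    next
      case False
      then have *: "?mx z = 2 * s - 1" "?mn z = 1" "2 * s - 1 \<in> I1" using z by auto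
      show ?thesis using False z T[OF *(3)] unfolding *(1,2) by (simp add: vcat_def n_def H'(2))
    qed
    show "?R z = ?K (?\<Phi> ?mn ?mx z)"
    proof (cases "s \<le> 1/2")
      case True
      then have *: "?mx z = 0" "?mn z = 2 * s" "2 * s \<in> I1" using z by auto
      show ?thesis using True z T[OF *(3)] unfolding *(1,2) by (simp add: vcat_def n_def H'(1))
    next
      case False
      then have *: "?mx z = 2 * s - 1" "?mn z = 1" "2 * s - 1 \<in> I1" using z by auto
      show ?thesis
        using z False *(3) unfolding *(1,2) by (auto simp: vcat_def hcat_def z s0_def t0 \<sigma>_eq H'(4))
    qed
  qed
  ultimately have "rel_homotopic X ?L ?R" by (rule_tac rel_homotopic_cong) auto
  from sqclass_eqI[OF square_vcat[OF h1 n[OF g]] this]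
  show ?thesis
    unfolding tn H(2,3) Pi2_simps s0_def[symmetric] s1_def[symmetric]
      HComp_sqclass[OF square_const[OF \<sigma>[OF xy(1)]] s1 e0(1)] VComp_sqclass[OF h1 n[OF g]]
      HComp_sqclass[OF s0 square_const[OF \<sigma>[OF xy(2)]] e0(2)] VComp_sqclass[OF n[OF f] h0] .
qed

lemma pcell_lift_PC_Id2:
  assumes "continuous_map W X \<Psi>" "chain W w ps w'" "chain W w qs w'"
    "\<And>t. t \<in> I1 \<Longrightarrow> pcompw w ps t = pcompw w qs t"
    "x = \<Psi> w" "fs = map (push \<Psi>) ps" "gs = map (push \<Psi>) qs" "f = push \<Psi> (pcompw w ps)"
  shows "pcell_lift X W \<Psi> (PC x fs (Id2 (Pi2 X) f) gs) w ps qs"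
proof (rule pcell_liftI[OF assms(2,3)])
  show "cell_lift X W \<Psi> (cell (PC x fs (Id2 (Pi2 X) f) gs)) (pcompw w ps) (pcompw w qs)"
    unfolding pcell.sel assms(8)
    by (rule cell_lift_cong[OF cell_lift_Id2]) (use chain_pcompw[OF assms(2)] assms(4) in auto)
qed (use assms in simp_all)

lemma pseudonatural: "pseudonatural D (Pi2 X) F G \<sigma>"
proof
  fix x assume x: "x \<in> Ob D"
  have "in1 (Pi2 X) (push (\<lambda>u. \<Theta> (u, P0 x)) (seg 0 1)) (\<Theta> (0, P0 x)) (\<Theta> (1, P0 x))"
    unfolding in1_Pi2 using pathin_push[of "top_of_set I1" X "\<lambda>u. \<Theta> (u, P0 x)" "seg 0 1"]
      lift_point[OF P0_in[OF x]] pathin_seg(1)[of 0 1] by (simp add: lifting_def)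
  then show "in1 (Pi2 X) (tcomp \<sigma> x) (F0 F x) (F0 G x)"
    using F0_eq[OF x] by (simp add: tcomp_push)
next
  fix f x y assume f: "in1 D f x y"
  have "iso_pcell (Pi2 X) (tsquare D F G \<sigma> f)"
    by (rule pcell_lift_iso_pcell[OF lift_path pcell_lift_tsquare[OF f]]) (use P1[OF f] in auto)
  then show "iso2 (Pi2 X) (tnat \<sigma> f) (Comp (Pi2 X) (F1 G f) (tcomp \<sigma> x)) (Comp (Pi2 X) (tcomp \<sigma> y) (F1 F f))"
    using Ar_D[OF f] by (simp add: iso_pcell_def tsquare_def)
next
  fix f x y \<alpha> g assume f: "in1 D f x y" "in2 D \<alpha> f g"
  show "VComp (Pi2 X) (tnat \<sigma> g) (HComp (Pi2 X) (F2 G \<alpha>) (Id2 (Pi2 X) (tcomp \<sigma> x))) =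
    VComp (Pi2 X) (HComp (Pi2 X) (Id2 (Pi2 X) (tcomp \<sigma> y)) (F2 F \<alpha>)) (tnat \<sigma> f)"
    by (rule tnat_natural[OF f])
next
  fix f x y g z assume f: "in1 D f x y" and g: "in1 D g y z"
  have h: "in1 D (Comp D g f) x z" using bicategory.Comp_in[OF D f g] .
  define p where "p = P1 (Comp D g f)"
  let ?\<Psi> = "\<lambda>(u, v). \<Theta> (u, p v)"
  have p: "pathin Y p" "p 0 = P0 x" "p 1 = P0 z" using P1[OF h] by (auto simp: p_def)
  have pf: "P1 f t = p (seg 0 (1/2) t)" and pg: "P1 g t = p (seg (1/2) 1 t)" if "t \<in> I1" for t
  proof -
    have "seg 0 (1/2) t \<in> I1" "seg (1/2) 1 t \<in> I1" using that by (intro seg_in; simp)+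
    moreover have "P1 g 0 = P1 f 1" using P1[OF f] P1[OF g] by simp
    ultimately show "P1 f t = p (seg 0 (1/2) t)" "P1 g t = p (seg (1/2) 1 t)"
      using that by (auto simp: p_def P1_Comp[OF f g] pcat1_def seg_def lerp_def field_simps)
  qed
  have L: "lifting X (top_of_set I2) ?\<Psi>" by (rule lift_path[OF p(1)])
  then have cont: "continuous_map (top_of_set I2) X ?\<Psi>" by (simp add: lifting_def)
  have F1: "F1 F f = push ?\<Psi> (\<lambda>t. (0, seg 0 (1/2) t))" "F1 F g = push ?\<Psi> (\<lambda>t. (0, seg (1/2) 1 t))"
    "F1 G f = push ?\<Psi> (\<lambda>t. (1, seg 0 (1/2) t))" "F1 G g = push ?\<Psi> (\<lambda>t. (1, seg (1/2) 1 t))"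
    "F1 F (Comp D g f) = push ?\<Psi> (\<lambda>t. (0, seg 0 1 t))" "F1 G (Comp D g f) = push ?\<Psi> (\<lambda>t. (1, seg 0 1 t))"
    using F1_eq[OF Ar_D(1)[OF f]] F1_eq[OF Ar_D(1)[OF g]] F1_eq[OF Ar_D(1)[OF h]]
    by (auto simp: push_def pf pg fun_eq_iff p_def[symmetric] seg_01)
  have t: "tcomp \<sigma> x = push ?\<Psi> (\<lambda>t. (seg 0 1 t, 0))"
    by (auto simp: tcomp_push push_def p fun_eq_iff)
  have half: "pcat1 (\<lambda>t. (c, seg (1/2) 1 t)) (\<lambda>t. (c, seg 0 (1/2) t)) t = (c, seg 0 1 t)" for c :: real and t
    by (auto simp: pcat1_def seg_def lerp_def field_simps)
  have cG: "pcell_lift X (top_of_set I2) ?\<Psi> (PC (F0 G x) [F1 G f, F1 G g] (Fcomp G g f) [F1 G (Comp D g f)]) (1, 0)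
      [\<lambda>t. (1, seg 0 (1/2) t), \<lambda>t. (1, seg (1/2) 1 t)] [\<lambda>t. (1, seg 0 1 t)]"
    unfolding strict_Fcomp[OF f g] F1
    by (rule pcell_lift_PC_Id2[OF cont, of _ _ "(1, 1)"])
       (use F0_eq[OF Ar_D(4)[OF f]] p in \<open>simp_all add: pathin_seg half push_pcat1\<close>)
  have cF: "pcell_lift X (top_of_set I2) ?\<Psi> (PC (F0 F x) [F1 F f, F1 F g] (Fcomp F g f) [F1 F (Comp D g f)]) (0, 0)
      [\<lambda>t. (0, seg 0 (1/2) t), \<lambda>t. (0, seg (1/2) 1 t)] [\<lambda>t. (0, seg 0 1 t)]"
    unfolding strict_Fcomp[OF f g] F1
    by (rule pcell_lift_PC_Id2[OF cont, of _ _ "(0, 1)"])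
       (use F0_eq[OF Ar_D(4)[OF f]] p in \<open>simp_all add: pathin_seg half push_pcat1\<close>)
  have sf: "pcell_lift X (top_of_set I2) ?\<Psi> (tsquare D F G \<sigma> f) (0, 0)
      [\<lambda>t. (seg 0 1 t, 0), \<lambda>t. (1, seg 0 (1/2) t)] [\<lambda>t. (0, seg 0 (1/2) t), \<lambda>t. (seg 0 1 t, 1/2)]"
    by (rule pcell_lift_tsquare_sub[OF f p(1) _ _ pf]) auto
  have sg: "pcell_lift X (top_of_set I2) ?\<Psi> (tsquare D F G \<sigma> g) (0, 1/2)
      [\<lambda>t. (seg 0 1 t, 1/2), \<lambda>t. (1, seg (1/2) 1 t)] [\<lambda>t. (0, seg (1/2) 1 t), \<lambda>t. (seg 0 1 t, 1)]"
    by (rule pcell_lift_tsquare_sub[OF g p(1) _ _ pg]) auto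
  have sh: "pcell_lift X (top_of_set I2) ?\<Psi> (tsquare D F G \<sigma> (Comp D g f)) (0, 0)
      [\<lambda>t. (seg 0 1 t, 0), \<lambda>t. (1, seg 0 1 t)] [\<lambda>t. (0, seg 0 1 t), \<lambda>t. (seg 0 1 t, 1)]"
    by (rule pcell_lift_tsquare_sub[OF h p(1)]) (auto simp: p_def seg_01)
  let ?ps = "[\<lambda>t. (seg 0 1 t, 0), \<lambda>t. (1, seg 0 (1/2) t), \<lambda>t. (1, seg (1/2) 1 t)]"
  have ch: "chain (top_of_set I2) (0, 0) ?ps (1, 1)" by (simp add: pathin_seg)
  have l1: "steps_lift X (top_of_set I2) ?\<Psi> (0, 0) ?ps
      [(1, PC (F0 G x) [F1 G f, F1 G g] (Fcomp G g f) [F1 G (Comp D g f)]), (0, tsquare D F G \<sigma> (Comp D g f))]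
      [\<lambda>t. (0, seg 0 1 t), \<lambda>t. (seg 0 1 t, 1)]"
    by (rule steps_lift_Cons steps_lift_Nil cG sh | simp)+
  have l2: "steps_lift X (top_of_set I2) ?\<Psi> (0, 0) ?ps
      [(0, tsquare D F G \<sigma> f), (1, tsquare D F G \<sigma> g), (0, PC (F0 F x) [F1 F f, F1 F g] (Fcomp F g f) [F1 F (Comp D g f)])]
      [\<lambda>t. (0, seg 0 1 t), \<lambda>t. (seg 0 1 t, 1)]"
    by (rule steps_lift_Cons steps_lift_Nil sf sg cF | simp)+
  have st: "F0 F x = ?\<Psi> (0, 0)" "[tcomp \<sigma> x, F1 G f, F1 G g] = map (push ?\<Psi>) ?ps"
    using F0_eq[OF Ar_D(4)[OF f]] p F1 t by simp_all
  show "paste (Pi2 X) (F0 F x) [tcomp \<sigma> x, F1 G f, F1 G g]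
        [(1, PC (F0 G x) [F1 G f, F1 G g] (Fcomp G g f) [F1 G (Comp D g f)]),
         (0, tsquare D F G \<sigma> (Comp D g f))] =
      paste (Pi2 X) (F0 F x) [tcomp \<sigma> x, F1 G f, F1 G g]
        [(0, tsquare D F G \<sigma> f), (1, tsquare D F G \<sigma> g),
         (0, PC (F0 F x) [F1 F f, F1 F g] (Fcomp F g f) [F1 F (Comp D g f)])]"
    by (rule pcell_lift_unique[OF L pcell_lift_paste[OF L ch st l1] pcell_lift_paste[OF L ch st l2] refl])
next
  fix x assume x: "x \<in> Ob D"
  have i: "in1 D (Id1 D x) x x" using bicategory.Id1_in[OF D x] .
  let ?\<Psi> = "\<lambda>u. \<Theta> (u, P0 x)"
  have L: "lifting X (top_of_set I1) ?\<Psi>" by (rule lift_point[OF P0_in[OF x]])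
  then have cont: "continuous_map (top_of_set I1) X ?\<Psi>" by (simp add: lifting_def)
  have F1: "F1 F (Id1 D x) = push ?\<Psi> (\<lambda>t. 0)" "F1 G (Id1 D x) = push ?\<Psi> (\<lambda>t. 1)"
    using F1_eq[OF Ar_D(1)[OF i]] P1_Id[OF x] by (auto simp: push_def fun_eq_iff)
  have fi: "continuous_map (top_of_set I2) (top_of_set I1) fst"
    by (auto simp: continuous_map_in_subtopology intro!: continuous_intros)
  have s: "pcell_lift X (top_of_set I1) ?\<Psi> (tsquare D F G \<sigma> (Id1 D x)) 0 [\<lambda>t. seg 0 1 t, \<lambda>t. 1] [\<lambda>t. 0, \<lambda>t. seg 0 1 t]"
    using pcell_lift_change[OF pcell_lift_tsquare[OF i] fi, of ?\<Psi>] P1_Id[OF x] by (simp add: case_prod_unfold mem_Times_iff)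
  have cG: "pcell_lift X (top_of_set I1) ?\<Psi> (PC (F0 G x) [] (Fid G x) [F1 G (Id1 D x)]) 1 [] [\<lambda>t. 1]"
    unfolding strict_Fid[OF x] F1
    by (rule pcell_lift_PC_Id2[OF cont]) (use F0_eq[OF x] in \<open>simp_all add: pathin_seg(4)\<close>)
  have cF: "pcell_lift X (top_of_set I1) ?\<Psi> (PC (F0 F x) [] (Fid F x) [F1 F (Id1 D x)]) 0 [] [\<lambda>t. 0]"
    unfolding strict_Fid[OF x] F1
    by (rule pcell_lift_PC_Id2[OF cont]) (use F0_eq[OF x] in \<open>simp_all add: pathin_seg(4)\<close>)
  have ch: "chain (top_of_set I1) 0 [\<lambda>t. seg 0 1 t] 1" using pathin_seg(1)[of 0 1] by simp
  have l1: "steps_lift X (top_of_set I1) ?\<Psi> 0 [\<lambda>t. seg 0 1 t]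
      [(1, PC (F0 G x) [] (Fid G x) [F1 G (Id1 D x)]), (0, tsquare D F G \<sigma> (Id1 D x))] [\<lambda>t. 0, \<lambda>t. seg 0 1 t]"
    by (rule steps_lift_Cons steps_lift_Nil cG s | simp)+
  have l2: "steps_lift X (top_of_set I1) ?\<Psi> 0 [\<lambda>t. seg 0 1 t]
      [(0, PC (F0 F x) [] (Fid F x) [F1 F (Id1 D x)])] [\<lambda>t. 0, \<lambda>t. seg 0 1 t]"
    by (rule steps_lift_Cons steps_lift_Nil cF | simp)+
  have st: "F0 F x = ?\<Psi> 0" "[tcomp \<sigma> x] = map (push ?\<Psi>) [\<lambda>t. seg 0 1 t]"
    using F0_eq[OF x] tcomp_push by simp_all
  show "paste (Pi2 X) (F0 F x) [tcomp \<sigma> x]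
        [(1, PC (F0 G x) [] (Fid G x) [F1 G (Id1 D x)]), (0, tsquare D F G \<sigma> (Id1 D x))] =
      paste (Pi2 X) (F0 F x) [tcomp \<sigma> x] [(0, PC (F0 F x) [] (Fid F x) [F1 F (Id1 D x)])]"
    by (rule pcell_lift_unique[OF L pcell_lift_paste[OF L ch st l1] pcell_lift_paste[OF L ch st l2] refl])
qed

end

lemma square_lerp:
  assumes "pathin (top_of_set I1) p" "pathin (top_of_set I1) q" "p 0 = q 0" "p 1 = q 1"
  shows "square (top_of_set I1) (\<lambda>(s, t). lerp s (p t) (q t)) p q"
proof -
  have c: "continuous_on I1 p" "continuous_on I1 q" and i: "\<And>t. t \<in> I1 \<Longrightarrow> p t \<in> I1" "\<And>t. t \<in> I1 \<Longrightarrow> q t \<in> I1"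
    using assms(1,2) by (auto simp: pathin_def continuous_map_in_subtopology)
  have 1: "continuous_on I2 (\<lambda>z. lerp (fst z) (p (snd z)) (q (snd z)))"
    unfolding lerp_def
    by (intro continuous_intros continuous_on_compose2[OF c(1)] continuous_on_compose2[OF c(2)]) auto
  have 2: "lerp (fst z) (p (snd z)) (q (snd z)) \<in> I1" if "z \<in> I2" for z
    by (rule lerp_in) (use i(1)[of "snd z"] i(2)[of "snd z"] that in auto)
  have "(\<lambda>z. lerp (fst z) (p (snd z)) (q (snd z))) \<in> I2 \<rightarrow> I1" using 2 by blast
  with 1 have "continuous_map (top_of_set I2) (top_of_set I1) (\<lambda>z. lerp (fst z) (p (snd z)) (q (snd z)))"
    by (simp add: continuous_map_in_subtopology image_subset_iff_funcset)
  then show ?thesis using assms(3,4) unfolding square_def case_prod_unfold by auto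
qed

context homotopy_pf
begin

abbreviation "\<Theta>r \<equiv> \<lambda>(t, y). \<Theta> (1 - t, y)"
abbreviation "E \<equiv> homotopy_equiv X \<Theta> P0 P1"

lemma fwd_E: "fwd E = \<sigma>" and bwd_E: "bwd E = homotopy_trans X \<Theta>r P0 P1"
  by (simp_all add: homotopy_equiv_def)

lemma reverse: "homotopy_pf X Y \<Theta>r D P0 P1 G F"
proof (intro homotopy_pf.intro)
  have "continuous_map (prod_topology (top_of_set I1) Y) (prod_topology (top_of_set I1) Y) (\<lambda>z. (1 - fst z, snd z))"
  proof (intro continuous_map_pairedI)
    have "continuous_map (prod_topology (top_of_set I1) Y) (top_of_set I1) fst" by (rule continuous_map_fst)
    moreover have "continuous_map (top_of_set I1) (top_of_set I1) (\<lambda>u. 1 - u)"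
      by (auto simp: continuous_map_in_subtopology intro!: continuous_intros)
    ultimately have "continuous_map (prod_topology (top_of_set I1) Y) (top_of_set I1) ((\<lambda>u. 1 - u) \<circ> fst)"
      by (rule continuous_map_compose)
    then show "continuous_map (prod_topology (top_of_set I1) Y) (top_of_set I1) (\<lambda>z. 1 - fst z)"
      by (simp add: o_def)
    show "continuous_map (prod_topology (top_of_set I1) Y) Y snd" by (rule continuous_map_snd)
  qed
  from continuous_map_compose[OF this \<Theta>]
  show "continuous_map (prod_topology (top_of_set I1) Y) X \<Theta>r" by (simp add: o_def case_prod_unfold)
  fix \<alpha> f g assume "in2 D \<alpha> f g"
  then obtain H where "square Y H (P1 f) (P1 g)" "F2 F \<alpha> = sqclass X (\<lambda>z. \<Theta> (0, H z))"
    "F2 G \<alpha> = sqclass X (\<lambda>z. \<Theta> (1, H z))" using P2 by blast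
  then show "\<exists>H. square Y H (P1 f) (P1 g) \<and> F2 G \<alpha> = sqclass X (\<lambda>z. \<Theta>r (0, H z)) \<and>
      F2 F \<alpha> = sqclass X (\<lambda>z. \<Theta>r (1, H z))"
    by (intro exI[of _ H]) simp
qed (use D F G P0_in P1 P1_Id P1_Comp F0_eq F1_eq in simp_all)

lemma pcell_lift_bwd_sub:
  assumes f: "in1 D f x y" and p: "pathin Y p" and ab: "a \<in> I1" "b \<in> I1"
    and fp: "\<And>t. t \<in> I1 \<Longrightarrow> P1 f t = p (seg a b t)"
  shows "pcell_lift X (top_of_set I2) (\<lambda>(u, v). \<Theta> (u, p v)) (tsquare D G F (bwd E) f) (1, a)
    [\<lambda>t. (seg 1 0 t, a), \<lambda>t. (0, seg a b t)] [\<lambda>t. (1, seg a b t), \<lambda>t. (seg 1 0 t, b)]"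
proof -
  let ?\<Phi> = "\<lambda>z. (1 - fst z, snd z)"
  have "continuous_map (top_of_set I2) (top_of_set I2) ?\<Phi>"
    by (auto simp: continuous_map_in_subtopology intro!: continuous_intros)
  from pcell_lift_change[OF homotopy_pf.pcell_lift_tsquare_sub[OF reverse f p ab fp] this, of "\<lambda>(u, v). \<Theta> (u, p v)"] show ?thesis
    by (simp add: seg_01 case_prod_unfold bwd_E)
qed

lemma pcell_lift_unit:
  assumes x: "x \<in> Ob D"
  shows "pcell_lift X (top_of_set I1) (\<lambda>u. \<Theta> (u, P0 x)) (unit_pcell F E x) 0 [] [seg 0 1, seg 1 0]"
proof (rule pcell_liftI)
  show "chain (top_of_set I1) 0 [] 0" "chain (top_of_set I1) 0 [seg 0 1, seg 1 0] 0"
    by (simp_all add: pathin_seg)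
  have "square (top_of_set I1) (\<lambda>(s, t). lerp s 0 (pcat1 (seg 1 0) (seg 0 1) t)) (\<lambda>t. 0) (pcat1 (seg 1 0) (seg 0 1))"
    by (rule square_lerp) (simp_all add: pathin_seg pathin_pcat1)
  then show "cell_lift X (top_of_set I1) (\<lambda>u. \<Theta> (u, P0 x)) (cell (unit_pcell F E x)) (pcompw 0 []) (pcompw 0 [seg 0 1, seg 1 0])"
    unfolding cell_lift_def by (intro exI conjI) (simp, simp add: unit_pcell_def homotopy_equiv_def case_prod_unfold o_def seg_01)
qed (use F0_eq[OF x] in \<open>simp_all add: unit_pcell_def homotopy_equiv_def homotopy_trans_def push_def seg_01\<close>)

lemma pcell_lift_counit:
  assumes x: "x \<in> Ob D"
  shows "pcell_lift X (top_of_set I1) (\<lambda>u. \<Theta> (u, P0 x)) (counit_pcell G E x) 1 [seg 1 0, seg 0 1] []"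
proof (rule pcell_liftI)
  show "chain (top_of_set I1) 1 [] 1" "chain (top_of_set I1) 1 [seg 1 0, seg 0 1] 1"
    by (simp_all add: pathin_seg)
  have "square (top_of_set I1) (\<lambda>(s, t). lerp s (pcat1 (seg 0 1) (seg 1 0) t) 1) (pcat1 (seg 0 1) (seg 1 0)) (\<lambda>t. 1)"
    by (rule square_lerp) (simp_all add: pathin_seg pathin_pcat1)
  then show "cell_lift X (top_of_set I1) (\<lambda>u. \<Theta> (u, P0 x)) (cell (counit_pcell G E x)) (pcompw 1 [seg 1 0, seg 0 1]) (pcompw 1 [])"
    unfolding cell_lift_def by (intro exI conjI) (simp, simp add: counit_pcell_def homotopy_equiv_def case_prod_unfold o_def seg_01)
qed (use F0_eq[OF x] in \<open>simp_all add: counit_pcell_def homotopy_equiv_def homotopy_trans_def push_def seg_01\<close>)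

lemma continuous_map_at: "c \<in> I1 \<Longrightarrow> continuous_map (top_of_set I1) (top_of_set I2) (\<lambda>u. (u, c))"
  by (auto simp: continuous_map_in_subtopology intro!: continuous_intros)

lemma pcell_lift_unit_at:
  assumes x: "x \<in> Ob D" "c \<in> I1" "p c = P0 x"
  shows "pcell_lift X (top_of_set I2) (\<lambda>(u, v). \<Theta> (u, p v)) (unit_pcell F E x) (0, c) [] [\<lambda>t. (seg 0 1 t, c), \<lambda>t. (seg 1 0 t, c)]"
  using pcell_lift_change[OF pcell_lift_unit[OF x(1)] continuous_map_at[OF x(2)], of "\<lambda>(u, v). \<Theta> (u, p v)"] x(3) by simp

lemma pcell_lift_counit_at:
  assumes x: "x \<in> Ob D" "c \<in> I1" "p c = P0 x"
  shows "pcell_lift X (top_of_set I2) (\<lambda>(u, v). \<Theta> (u, p v)) (counit_pcell G E x) (1, c) [\<lambda>t. (seg 1 0 t, c), \<lambda>t. (seg 0 1 t, c)] []"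
  using pcell_lift_change[OF pcell_lift_counit[OF x(1)] continuous_map_at[OF x(2)], of "\<lambda>(u, v). \<Theta> (u, p v)"] x(3) by simp

lemma adjoint_equivalence: "adjoint_equivalence D (Pi2 X) F G E"
proof (rule adjoint_equivalence.intro)
  show "pseudofunctor D (Pi2 X) F" "pseudofunctor D (Pi2 X) G"
    using strict_pf.pseudofunctor[OF F D bicategory_Pi2] strict_pf.pseudofunctor[OF G D bicategory_Pi2] by simp_all
  show "pseudonatural D (Pi2 X) F G (fwd E)" unfolding fwd_E by (rule pseudonatural)
  show "pseudonatural D (Pi2 X) G F (bwd E)" unfolding bwd_E by (rule homotopy_pf.pseudonatural[OF reverse])
  have iso: "iso_pcell (Pi2 X) (unit_pcell F E x)" "iso_pcell (Pi2 X) (counit_pcell G E x)" if "x \<in> Ob D" for x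
    using pcell_lift_iso_pcell[OF lift_point[OF P0_in[OF that]]] pcell_lift_unit[OF that] pcell_lift_counit[OF that] by blast+
  have sl2: "slides [s1, s2] f = [(1, s2 f), (0, s1 f)]"
    for s1 s2 :: "'m \<Rightarrow> ('a, real \<Rightarrow> 'a, (real \<times> real \<Rightarrow> 'a) set) pcell" and f
    by (simp add: slides_def)
  have sl0: "slides ([] :: ('m \<Rightarrow> ('a, real \<Rightarrow> 'a, (real \<times> real \<Rightarrow> 'a) set) pcell) list) f = []" for f
    by (simp add: slides_def)
  have *: "paste (Pi2 X) (F0 F x) [F1 F f] [(1, unit_pcell F E y)] =
       paste (Pi2 X) (F0 F x) [F1 F f] [(0, unit_pcell F E x), (1, tsquare D G F (bwd E) f), (0, tsquare D F G (fwd E) f)] \<and>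
    paste (Pi2 X) (F0 G x) [tcomp (bwd E) x, tcomp (fwd E) x, F1 G f]
        [(1, tsquare D F G (fwd E) f), (0, tsquare D G F (bwd E) f), (1, counit_pcell G E y)] =
       paste (Pi2 X) (F0 G x) [tcomp (bwd E) x, tcomp (fwd E) x, F1 G f] [(0, counit_pcell G E x)]"
    if f: "in1 D f x y" for f x y
  proof -
    note xy = Ar_D(4,5)[OF f]
    let ?\<Psi> = "\<lambda>(u, v). \<Theta> (u, P1 f v)"
    have p: "pathin Y (P1 f)" "P1 f 0 = P0 x" "P1 f 1 = P0 y" using P1[OF f] by auto
    have L: "lifting X (top_of_set I2) ?\<Psi>" by (rule lift_path[OF p(1)])
    have u: "pcell_lift X (top_of_set I2) ?\<Psi> (unit_pcell F E x) (0, 0) [] [\<lambda>t. (seg 0 1 t, 0), \<lambda>t. (seg 1 0 t, 0)]"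
      "pcell_lift X (top_of_set I2) ?\<Psi> (unit_pcell F E y) (0, 1) [] [\<lambda>t. (seg 0 1 t, 1), \<lambda>t. (seg 1 0 t, 1)]"
      "pcell_lift X (top_of_set I2) ?\<Psi> (counit_pcell G E x) (1, 0) [\<lambda>t. (seg 1 0 t, 0), \<lambda>t. (seg 0 1 t, 0)] []"
      "pcell_lift X (top_of_set I2) ?\<Psi> (counit_pcell G E y) (1, 1) [\<lambda>t. (seg 1 0 t, 1), \<lambda>t. (seg 0 1 t, 1)] []"
      by (rule pcell_lift_unit_at pcell_lift_counit_at; simp add: xy p)+
    have s: "pcell_lift X (top_of_set I2) ?\<Psi> (tsquare D F G (fwd E) f) (0, 0)
      [\<lambda>t. (seg 0 1 t, 0), \<lambda>t. (1, seg 0 1 t)] [\<lambda>t. (0, seg 0 1 t), \<lambda>t. (seg 0 1 t, 1)]"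
      unfolding fwd_E by (rule pcell_lift_tsquare[OF f])
    have r: "pcell_lift X (top_of_set I2) ?\<Psi> (tsquare D G F (bwd E) f) (1, 0)
      [\<lambda>t. (seg 1 0 t, 0), \<lambda>t. (0, seg 0 1 t)] [\<lambda>t. (1, seg 0 1 t), \<lambda>t. (seg 1 0 t, 1)]"
      by (rule pcell_lift_bwd_sub[OF f p(1)]) (simp_all add: seg_01)
    have F1: "F1 F f = push ?\<Psi> (\<lambda>t. (0, seg 0 1 t))" "F1 G f = push ?\<Psi> (\<lambda>t. (1, seg 0 1 t))"
      using F1_eq[OF Ar_D(1)[OF f]] by (auto simp: push_def fun_eq_iff seg_01)
    have t: "tcomp (fwd E) x = push ?\<Psi> (\<lambda>t. (seg 0 1 t, 0))" "tcomp (bwd E) x = push ?\<Psi> (\<lambda>t. (seg 1 0 t, 0))"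
      unfolding fwd_E bwd_E by (auto simp: homotopy_trans_def push_def p seg_01 fun_eq_iff)
    let ?ps = "[\<lambda>t. (0, seg 0 1 t)]"
    let ?qs = "[\<lambda>t. (seg 1 0 t, 0), \<lambda>t. (seg 0 1 t, 0), \<lambda>t. (1, seg 0 1 t)]"
    have ch: "chain (top_of_set I2) (0, 0) ?ps (0, 1)" "chain (top_of_set I2) (1, 0) ?qs (1, 1)" by (simp_all add: pathin_seg)
    have st: "F0 F x = ?\<Psi> (0, 0)" "[F1 F f] = map (push ?\<Psi>) ?ps"
      and st': "F0 G x = ?\<Psi> (1, 0)" "[tcomp (bwd E) x, tcomp (fwd E) x, F1 G f] = map (push ?\<Psi>) ?qs"
      using F0_eq[OF xy(1)] F1 t p by simp_all
    have l1: "steps_lift X (top_of_set I2) ?\<Psi> (0, 0) ?ps [(1, unit_pcell F E y)]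
      [\<lambda>t. (0, seg 0 1 t), \<lambda>t. (seg 0 1 t, 1), \<lambda>t. (seg 1 0 t, 1)]"
      by (rule steps_lift_Cons steps_lift_Nil u | simp)+
    have l2: "steps_lift X (top_of_set I2) ?\<Psi> (0, 0) ?ps
      [(0, unit_pcell F E x), (1, tsquare D G F (bwd E) f), (0, tsquare D F G (fwd E) f)]
      [\<lambda>t. (0, seg 0 1 t), \<lambda>t. (seg 0 1 t, 1), \<lambda>t. (seg 1 0 t, 1)]"
      by (rule steps_lift_Cons steps_lift_Nil u s r | simp)+
    have l3: "steps_lift X (top_of_set I2) ?\<Psi> (1, 0) ?qs
      [(1, tsquare D F G (fwd E) f), (0, tsquare D G F (bwd E) f), (1, counit_pcell G E y)] [\<lambda>t. (1, seg 0 1 t)]"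
      by (rule steps_lift_Cons steps_lift_Nil u s r | simp)+
    have l4: "steps_lift X (top_of_set I2) ?\<Psi> (1, 0) ?qs [(0, counit_pcell G E x)] [\<lambda>t. (1, seg 0 1 t)]"
      by (rule steps_lift_Cons steps_lift_Nil u s r | simp)+
    show ?thesis
      using pcell_lift_unique[OF L pcell_lift_paste[OF L ch(1) st l1] pcell_lift_paste[OF L ch(1) st l2] refl]
        pcell_lift_unique[OF L pcell_lift_paste[OF L ch(2) st' l3] pcell_lift_paste[OF L ch(2) st' l4] refl] by blast
  qed
  show "inv_modification D (Pi2 X) (F1 F) [] [tsquare D F G (fwd E), tsquare D G F (bwd E)] (unit_pcell F E)"
    unfolding inv_modification_def sl2 sl0 Let_def
  proof (intro conjI ballI)
    fix f assume "f \<in> Ar D"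
    then have f: "in1 D f (Src D f) (Trg D f)" by (simp add: in1_def)
    have e: "org (unit_pcell F E (Src D f)) = F0 F (Src D f)" "top_path (unit_pcell F E (Src D f)) = []"
      by (simp_all add: unit_pcell_def)
    show "paste (Pi2 X) (org (unit_pcell F E (Src D f))) (top_path (unit_pcell F E (Src D f)) @ [F1 F f])
          ([] @ [(1, unit_pcell F E (Trg D f))]) =
         paste (Pi2 X) (org (unit_pcell F E (Src D f))) (top_path (unit_pcell F E (Src D f)) @ [F1 F f])
          [(0, unit_pcell F E (Src D f)), (1, tsquare D G F (bwd E) f), (0, tsquare D F G (fwd E) f)]"
      unfolding e append_Nil using *[OF f] by blast
  qed (rule iso)
  show "inv_modification D (Pi2 X) (F1 G) [tsquare D G F (bwd E), tsquare D F G (fwd E)] [] (counit_pcell G E)"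
    unfolding inv_modification_def sl2 sl0 Let_def
  proof (intro conjI ballI)
    fix f assume "f \<in> Ar D"
    then have f: "in1 D f (Src D f) (Trg D f)" by (simp add: in1_def)
    have e: "org (counit_pcell G E (Src D f)) = F0 G (Src D f)"
      "top_path (counit_pcell G E (Src D f)) = [tcomp (bwd E) (Src D f), tcomp (fwd E) (Src D f)]"
      by (simp_all add: counit_pcell_def)
    show "paste (Pi2 X) (org (counit_pcell G E (Src D f))) (top_path (counit_pcell G E (Src D f)) @ [F1 G f])
          ([(1, tsquare D F G (fwd E) f), (0, tsquare D G F (bwd E) f)] @ [(1, counit_pcell G E (Trg D f))]) =
         paste (Pi2 X) (org (counit_pcell G E (Src D f))) (top_path (counit_pcell G E (Src D f)) @ [F1 G f])
          [(0, counit_pcell G E (Src D f))]"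
      unfolding e append_Nil append_Cons using *[OF f] by blast
  qed (rule iso)
  fix x assume x: "x \<in> Ob D"
  let ?\<Psi> = "\<lambda>u. \<Theta> (u, P0 x)"
  have L: "lifting X (top_of_set I1) ?\<Psi>" by (rule lift_point[OF P0_in[OF x]])
  have t: "tcomp (fwd E) x = push ?\<Psi> (seg 0 1)" "tcomp (bwd E) x = push ?\<Psi> (seg 1 0)"
    unfolding fwd_E bwd_E by (auto simp: homotopy_trans_def push_def seg_01 fun_eq_iff)
  have c: "chain (top_of_set I1) 0 [seg 0 1] 1" "chain (top_of_set I1) 1 [seg 1 0] 0" by (simp_all add: pathin_seg)
  have st: "F0 F x = ?\<Psi> 0" "[tcomp (fwd E) x] = map (push ?\<Psi>) [seg 0 1]"
    "F0 G x = ?\<Psi> 1" "[tcomp (bwd E) x] = map (push ?\<Psi>) [seg 1 0]"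
    using F0_eq[OF x] t by simp_all
  note u = pcell_lift_unit[OF x] pcell_lift_counit[OF x]
  have l1: "steps_lift X (top_of_set I1) ?\<Psi> 0 [seg 0 1] [(0, unit_pcell F E x), (1, counit_pcell G E x)] [seg 0 1]"
    by (rule steps_lift_Cons steps_lift_Nil u | simp)+
  have l2: "steps_lift X (top_of_set I1) ?\<Psi> 1 [seg 1 0] [(1, unit_pcell F E x), (0, counit_pcell G E x)] [seg 1 0]"
    by (rule steps_lift_Cons steps_lift_Nil u | simp)+
  show "paste (Pi2 X) (F0 F x) [tcomp (fwd E) x] [(0, unit_pcell F E x), (1, counit_pcell G E x)] =
      pid (Pi2 X) (F0 F x) [tcomp (fwd E) x]"
    using pcell_lift_unique[OF L pcell_lift_paste[OF L c(1) st(1,2) l1] pcell_lift_pid[OF c(1)] refl] st by simp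
  show "paste (Pi2 X) (F0 G x) [tcomp (bwd E) x] [(1, unit_pcell F E x), (0, counit_pcell G E x)] =
      pid (Pi2 X) (F0 G x) [tcomp (bwd E) x]"
    using pcell_lift_unique[OF L pcell_lift_paste[OF L c(2) st(3,4) l2] pcell_lift_pid[OF c(2)] refl] st by simp
qed

end

subsection \<open>Configurations of labelled cubes\<close>

type_synonym conf = "nat \<rightharpoonup> cube \<times> real"

definition cb :: "(nat \<rightharpoonup> cube \<times> 'l) \<Rightarrow> nat \<Rightarrow> cube" where "cb w i = fst (the (w i))"
definition lb :: "(nat \<rightharpoonup> cube \<times> 'l) \<Rightarrow> nat \<Rightarrow> 'l" where "lb w i = snd (the (w i))"

definition cubes_disjoint :: "cube \<Rightarrow> cube \<Rightarrow> bool" where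
  "cubes_disjoint c d \<longleftrightarrow> cube_map c ` open_square \<inter> cube_map d ` open_square = {}"

definition adm :: "(nat \<rightharpoonup> cube \<times> 'l) \<Rightarrow> bool" where
  "adm w \<longleftrightarrow> finite (dom w) \<and> (\<forall>i\<in>dom w. little_cube (cb w i)) \<and>
     (\<forall>i\<in>dom w. \<forall>j\<in>dom w. i \<noteq> j \<longrightarrow> cubes_disjoint (cb w i) (cb w j))"

text \<open>Substitution of configurations into the cubes of \<open>w\<close>: the cubes of \<open>U\<close> with label \<open>l\<close> are
  put into the cube of \<open>w\<close> with label \<open>own l\<close>.\<close>

definition subst :: "(nat \<rightharpoonup> cube \<times> 'k) \<Rightarrow> (nat \<Rightarrow> nat) \<Rightarrow> (nat \<rightharpoonup> cube \<times> 'l) \<Rightarrow> (nat \<rightharpoonup> cube \<times> 'l)" where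
  "subst w own U = (\<lambda>l. case U l of None \<Rightarrow> None | Some (c, x) \<Rightarrow>
     (case w (own l) of None \<Rightarrow> None | Some (q, y) \<Rightarrow> Some (cube_comp q c, x)))"

definition part :: "(nat \<Rightarrow> nat) \<Rightarrow> (nat \<rightharpoonup> 'b) \<Rightarrow> nat \<Rightarrow> (nat \<rightharpoonup> 'b)" where
  "part own U k = (\<lambda>l. if own l = k then U l else None)"

lemma dom_part: "dom (part own U k) = {l \<in> dom U. own l = k}"
  by (auto simp: part_def split: if_splits)

lemma cb_part: "own l = k \<Longrightarrow> cb (part own U k) l = cb U l"
  and lb_part: "own l = k \<Longrightarrow> lb (part own U k) l = lb U l"
  by (simp_all add: part_def cb_def lb_def)

lemma dom_subst: "dom (subst w own U) = {l \<in> dom U. own l \<in> dom w}"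
  by (auto simp: subst_def split: option.splits)

lemma cb_subst: "l \<in> dom (subst w own U) \<Longrightarrow> cb (subst w own U) l = cube_comp (cb w (own l)) (cb U l)"
  and lb_subst: "l \<in> dom (subst w own U) \<Longrightarrow> lb (subst w own U) l = lb U l"
  by (auto simp: subst_def cb_def lb_def split: option.splits)

lemma little_cube_iff: "little_cube c \<longleftrightarrow> 0 \<le> fst (fst c) \<and> fst (fst c) < snd (fst c) \<and> snd (fst c) \<le> 1 \<and>
    0 \<le> fst (snd c) \<and> fst (snd c) < snd (snd c) \<and> snd (snd c) \<le> 1"
  by (auto simp: little_cube_def split: prod.splits)

lemma affine_map_alt: "affine_map p t = (snd p - fst p) * t + fst p"
  by (simp add: affine_map_def split: prod.splits)

lemma affine_mono: "fst p < snd p \<Longrightarrow> affine_map p s \<le> affine_map p t \<longleftrightarrow> s \<le> t"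
  "fst p < snd p \<Longrightarrow> affine_map p s < affine_map p t \<longleftrightarrow> s < t"
  by (simp_all add: affine_map_alt)

lemma affine_bounds:
  assumes "fst p < snd p" "0 \<le> t" "t \<le> 1"
  shows "fst p \<le> affine_map p t" "affine_map p t \<le> snd p"
  using affine_mono(1)[OF assms(1), of 0 t] affine_mono(1)[OF assms(1), of t 1] assms(2,3)
  by (simp_all add: affine_map_alt)

lemma fst_cube_comp: "fst (cube_comp q c) = (affine_map (fst q) (fst (fst c)), affine_map (fst q) (snd (fst c)))"
  and snd_cube_comp: "snd (cube_comp q c) = (affine_map (snd q) (fst (snd c)), affine_map (snd q) (snd (snd c)))"
  by (simp_all add: cube_comp_def map_prod_def split: prod.splits)

lemma little_cube_comp:
  assumes "little_cube q" "little_cube c"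
  shows "little_cube (cube_comp q c)"
proof -
  have q: "fst (fst q) < snd (fst q)" "fst (snd q) < snd (snd q)" using assms by (auto simp: little_cube_iff)
  have "fst (fst q) \<le> affine_map (fst q) (fst (fst c))" "affine_map (fst q) (snd (fst c)) \<le> snd (fst q)"
    "fst (snd q) \<le> affine_map (snd q) (fst (snd c))" "affine_map (snd q) (snd (snd c)) \<le> snd (snd q)"
    using assms(2) by (intro affine_bounds q; simp add: little_cube_iff)+
  then show ?thesis
    using assms affine_mono[OF q(1)] affine_mono[OF q(2)] unfolding little_cube_iff fst_cube_comp snd_cube_comp by simp
qed

lemma cube_map_in: "little_cube c \<Longrightarrow> z \<in> open_square \<Longrightarrow> cube_map c z \<in> open_square"
proof -
  assume c: "little_cube c" and z: "z \<in> open_square"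
  then have q: "fst (fst c) < snd (fst c)" "fst (snd c) < snd (snd c)" by (auto simp: little_cube_iff)
  have z': "0 < fst z" "fst z < 1" "0 < snd z" "snd z < 1" using z by (auto simp: open_square_def)
  have e: "affine_map p 0 = fst p" "affine_map p 1 = snd p" for p by (simp_all add: affine_map_alt)
  have "0 < affine_map (fst c) (fst z)" "affine_map (fst c) (fst z) < 1"
    "0 < affine_map (snd c) (snd z)" "affine_map (snd c) (snd z) < 1"
    using affine_mono(2)[OF q(1), of 0 "fst z"] affine_mono(2)[OF q(1), of "fst z" 1]
      affine_mono(2)[OF q(2), of 0 "snd z"] affine_mono(2)[OF q(2), of "snd z" 1] c z'
    by (simp_all add: e little_cube_iff)
  then show ?thesis by (simp add: cube_map_def open_square_def mem_Times_iff)
qed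

lemma cube_map_inj:
  assumes "little_cube c" "cube_map c z = cube_map c z'" shows "z = z'"
  using assms by (cases z; cases z') (auto simp: cube_map_def little_cube_iff affine_map_alt)

lemma cubes_disjoint_comp_same:
  assumes "little_cube q" "cubes_disjoint c d" shows "cubes_disjoint (cube_comp q c) (cube_comp q d)"
  using assms(2) cube_map_inj[OF assms(1)] unfolding cubes_disjoint_def cube_map_comp by (fastforce simp: disjoint_iff)

lemma cubes_disjoint_comp:
  assumes "cubes_disjoint q q'" "little_cube c" "little_cube d" shows "cubes_disjoint (cube_comp q c) (cube_comp q' d)"
proof -
  have "cube_map (cube_comp q c) ` open_square \<subseteq> cube_map q ` open_square"
    "cube_map (cube_comp q' d) ` open_square \<subseteq> cube_map q' ` open_square"
    unfolding cube_map_comp image_comp[symmetric]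
    by (intro image_mono image_subsetI cube_map_in assms(2,3), assumption)+
  then show ?thesis using assms(1) unfolding cubes_disjoint_def by blast
qed

lemma adm_subst:
  assumes w: "adm w" and U: "finite (dom U)" and p: "\<And>k. k \<in> dom w \<Longrightarrow> adm (part own U k)"
  shows "adm (subst w own U)"
proof -
  have l: "little_cube (cb U l) \<and> little_cube (cb w (own l))" if "l \<in> dom (subst w own U)" for l
  proof -
    have *: "own l \<in> dom w" "l \<in> dom (part own U (own l))" using that by (auto simp: dom_subst dom_part)
    then have "little_cube (cb (part own U (own l)) l)" using p[OF *(1)] unfolding adm_def by blast
    moreover have "little_cube (cb w (own l))" using w *(1) unfolding adm_def by blast
    ultimately show ?thesis by (simp add: cb_part)
  qed
  have d: "cubes_disjoint (cube_comp (cb w (own l)) (cb U l)) (cube_comp (cb w (own l')) (cb U l'))"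
    if "l \<in> dom (subst w own U)" "l' \<in> dom (subst w own U)" "l \<noteq> l'" for l l'
  proof (cases "own l = own l'")
    case True
    then have "own l \<in> dom w" "l \<in> dom (part own U (own l))" "l' \<in> dom (part own U (own l))"
      using that by (auto simp: dom_subst dom_part)
    then have "cubes_disjoint (cb (part own U (own l)) l) (cb (part own U (own l)) l')"
      using p[of "own l"] that(3) unfolding adm_def by blast
    then have "cubes_disjoint (cb U l) (cb U l')" using True by (simp add: cb_part)
    then show ?thesis using True l[OF that(1)] cubes_disjoint_comp_same by simp
  next
    case False
    then have "cubes_disjoint (cb w (own l)) (cb w (own l'))" using w that(1,2) by (auto simp: adm_def dom_subst)
    then show ?thesis using cubes_disjoint_comp l that by blast
  qed
  show ?thesis
    unfolding adm_def using l d U little_cube_comp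
    by (auto simp: cb_subst) (auto simp: dom_subst)
qed

definition act_enum :: "(nat \<Rightarrow> (nat \<Rightarrow> cube) \<Rightarrow> (nat \<Rightarrow> 'a) \<Rightarrow> 'a) \<Rightarrow> (nat \<Rightarrow> nat) \<Rightarrow> nat \<Rightarrow> (nat \<rightharpoonup> cube \<times> 'a) \<Rightarrow> 'a" where
  "act_enum \<theta> e n w = \<theta> n (\<lambda>i\<in>{..<n}. cb w (e i)) (\<lambda>i\<in>{..<n}. lb w (e i))"

definition sorted_enum :: "nat set \<Rightarrow> nat \<Rightarrow> nat" where
  "sorted_enum S = (!) (sorted_list_of_set S)"

lemma bij_sorted_enum: "finite S \<Longrightarrow> bij_betw (sorted_enum S) {..<card S} S"
  unfolding sorted_enum_def by (rule bij_betw_nth) auto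

definition act :: "(nat \<Rightarrow> (nat \<Rightarrow> cube) \<Rightarrow> (nat \<Rightarrow> 'a) \<Rightarrow> 'a) \<Rightarrow> (nat \<rightharpoonup> cube \<times> 'a) \<Rightarrow> 'a" where
  "act \<theta> w = act_enum \<theta> (sorted_enum (dom w)) (card (dom w)) w"

lemma little_cubes_iff:
  "c \<in> topspace (little_cubes k) \<longleftrightarrow> c \<in> extensional {..<k} \<and> (\<forall>i<k. little_cube (c i)) \<and>
     (\<forall>i<k. \<forall>j<k. i \<noteq> j \<longrightarrow> cubes_disjoint (c i) (c j))"
  by (auto simp: little_cubes_def cubes_disjoint_def PiE_def)

lemma enum_little_cubes:
  assumes "adm w" "bij_betw e {..<n} (dom w)"
  shows "(\<lambda>i\<in>{..<n}. cb w (e i)) \<in> topspace (little_cubes n)"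
proof -
  have "e i \<in> dom w" if "i < n" for i using assms(2) that by (auto simp: bij_betw_def)
  moreover have "e i \<noteq> e j" if "i < n" "j < n" "i \<noteq> j" for i j
    using assms(2) that by (auto simp: bij_betw_def inj_on_def)
  ultimately show ?thesis using assms(1) unfolding little_cubes_iff adm_def by simp
qed

lemma block_start_Suc: "block_start j (Suc i) = block_start j i + j i"
  by (simp add: block_start_def)

lemma block_start_mono: "i \<le> i' \<Longrightarrow> block_start j i \<le> block_start j i'"
  unfolding block_start_def by (rule sum_mono2) auto

lemma block_eq: "r < j i \<Longrightarrow> block j (block_start j i + r) = i"
  unfolding block_def
proof (rule Least_equality)
  assume "r < j i"
  then show "block_start j i + r < block_start j (Suc i)" by (simp add: block_start_Suc)
  fix i' assume "block_start j i + r < block_start j (Suc i')"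
  then have "\<not> Suc i' \<le> i" using block_start_mono[of "Suc i'" i j] by linarith
  then show "i \<le> i'" by simp
qed

lemma block_cases:
  assumes "n < block_start j k"
  obtains i r where "i < k" "r < j i" "n = block_start j i + r"
proof -
  have "\<exists>i<k. block_start j i \<le> n \<and> n < block_start j (Suc i)"
    using assms
  proof (induction k)
    case 0 then show ?case by (simp add: block_start_def)
  next
    case (Suc k)
    then show ?case by (cases "n < block_start j k") (auto intro: less_SucI)
  qed
  then obtain i where "i < k" "block_start j i \<le> n" "n < block_start j (Suc i)" by blast
  then show ?thesis using that[of i "n - block_start j i"] by (simp add: block_start_Suc)
qed

context little_2_cubes_algebra
begin

abbreviation adX :: "(nat \<rightharpoonup> cube \<times> 'a) \<Rightarrow> bool" where
  "adX w \<equiv> adm w \<and> (\<forall>i\<in>dom w. lb w i \<in> topspace X)"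

lemma act_eq:
  assumes w: "adX w" and e: "bij_betw e {..<n} (dom w)"
  shows "act \<theta> w = act_enum \<theta> e n w"
proof -
  define e0 where "e0 = sorted_enum (dom w)"
  have n: "n = card (dom w)" using bij_betw_same_card[OF e] by simp
  have e0: "bij_betw e0 {..<n} (dom w)"
    unfolding e0_def n by (rule bij_sorted_enum) (use w in \<open>simp add: adm_def\<close>)
  define \<sigma> where "\<sigma> = (\<lambda>i. if i \<in> {..<n} then inv_into {..<n} e0 (e i) else i)"
  have "bij_betw (inv_into {..<n} e0 \<circ> e) {..<n} {..<n}"
    using bij_betw_trans[OF e bij_betw_inv_into[OF e0]] .
  then have "bij_betw \<sigma> {..<n} {..<n}"
    by (rule bij_betw_cong[THEN iffD1, rotated]) (simp add: \<sigma>_def)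
  then have \<sigma>: "\<sigma> permutes {..<n}"
    by (rule bij_imp_permutes) (simp add: \<sigma>_def)
  have es: "e0 (\<sigma> i) = e i" "\<sigma> i < n" if "i < n" for i
  proof -
    have "e i \<in> e0 ` {..<n}" using that e e0 by (auto simp: bij_betw_def)
    then show "e0 (\<sigma> i) = e i" using that by (simp add: \<sigma>_def f_inv_into_f)
    show "\<sigma> i < n" using permutes_in_image[OF \<sigma>, of i] that by simp
  qed
  let ?c = "\<lambda>i\<in>{..<n}. cb w (e0 i)" and ?x = "\<lambda>i\<in>{..<n}. lb w (e0 i)"
  have "?c \<circ> \<sigma> = (\<lambda>i\<in>{..<n}. cb w (e i))" "?x \<circ> \<sigma> = (\<lambda>i\<in>{..<n}. lb w (e i))"
    using es by (auto simp: fun_eq_iff \<sigma>_def)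
  moreover have "?c \<in> topspace (little_cubes n)" using enum_little_cubes[OF _ e0] w by blast
  moreover have "e0 i \<in> dom w" if "i < n" for i using e0 that by (auto simp: bij_betw_def)
  then have "?x \<in> topspace (product_topology (\<lambda>_. X) {..<n})"
    using w by (simp add: PiE_iff)
  ultimately show ?thesis
    using action_equivariant[OF _ _ \<sigma>, of ?c ?x] by (simp add: act_def act_enum_def e0_def n)
qed

lemma act_subst:
  fixes w :: "nat \<rightharpoonup> cube \<times> 'k" and U :: "nat \<rightharpoonup> cube \<times> 'a"
  assumes w: "adm w" and U: "finite (dom U)" and p: "\<And>k. k \<in> dom w \<Longrightarrow> adX (part own U k)"
  shows "act \<theta> (subst w own U) = act \<theta> (\<lambda>k. map_option (\<lambda>(q, y). (q, act \<theta> (part own U k))) (w k))"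
proof -
  define k where "k = card (dom w)"
  define e where "e = sorted_enum (dom w)"
  have e: "bij_betw e {..<k} (dom w)"
    unfolding e_def k_def by (rule bij_sorted_enum) (use w in \<open>simp add: adm_def\<close>)
  have eD: "e i \<in> dom w" if "i < k" for i using e that by (auto simp: bij_betw_def)
  define j where "j = (\<lambda>i. card (dom (part own U (e i))))"
  define e' where "e' = (\<lambda>i. sorted_enum (dom (part own U (e i))))"
  have e': "bij_betw (e' i) {..<j i} (dom (part own U (e i)))" if "i < k" for i
    unfolding e'_def j_def by (rule bij_sorted_enum) (use p[OF eD[OF that]] in \<open>simp add: adm_def\<close>)
  have e'D: "e' i r \<in> dom U" "own (e' i r) = e i" if "i < k" "r < j i" for i r
  proof -
    have "e' i r \<in> dom (part own U (e i))" using e'[OF that(1)] that(2) by (auto simp: bij_betw_def)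
    then show "e' i r \<in> dom U" "own (e' i r) = e i" by (simp_all add: dom_part)
  qed
  define N where "N = block_start j k"
  define E where "E = (\<lambda>n. e' (block j n) (n - block_start j (block j n)))"
  have E: "E (block_start j i + r) = e' i r" if "i < k" "r < j i" for i r
    using block_eq[of r j i] that by (simp add: E_def)
  have lt: "block_start j i + r < N" if "i < k" "r < j i" for i r
    using block_start_mono[of "Suc i" k j] that by (simp add: N_def block_start_Suc)
  have V: "dom (subst w own U) = E ` {..<N}"
  proof (intro equalityI subsetI)
    fix l assume "l \<in> dom (subst w own U)"
    then have l: "l \<in> dom U" "own l \<in> dom w" by (auto simp: dom_subst)
    then have "own l \<in> e ` {..<k}" using e by (simp add: bij_betw_def)
    then obtain i where i: "i < k" "e i = own l" by auto
    then have "l \<in> dom (part own U (e i))" using l by (simp add: dom_part)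
    then have "l \<in> e' i ` {..<j i}" using e'[OF i(1)] by (simp add: bij_betw_def)
    then obtain r where r: "r < j i" "e' i r = l" by auto
    show "l \<in> E ` {..<N}"
      by (rule image_eqI[of _ _ "block_start j i + r"]) (use E lt i r in auto)
  next
    fix l assume "l \<in> E ` {..<N}"
    then obtain n where n: "n < N" "l = E n" by auto
    from n(1) obtain i r where ir: "i < k" "r < j i" "n = block_start j i + r" unfolding N_def by (rule block_cases)
    then show "l \<in> dom (subst w own U)" using E e'D eD n(2) by (auto simp: dom_subst)
  qed
  have "inj_on E {..<N}"
  proof (rule inj_onI)
    fix n n' assume n: "n \<in> {..<N}" "n' \<in> {..<N}" "E n = E n'"
    from n(1) obtain i r where ir: "i < k" "r < j i" "n = block_start j i + r"
      unfolding N_def lessThan_iff by (rule block_cases)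
    from n(2) obtain i' r' where ir': "i' < k" "r' < j i'" "n' = block_start j i' + r'"
      unfolding N_def lessThan_iff by (rule block_cases)
    have eq: "e' i r = e' i' r'" using n(3) E ir ir' by simp
    then have "e i = e i'" using e'D ir ir' by metis
    then have "i = i'" using e ir ir' by (auto simp: bij_betw_def inj_on_def)
    moreover from this have "r = r'" using e'[OF ir(1)] eq ir(2) ir'(2) by (auto simp: bij_betw_def inj_on_def)
    ultimately show "n = n'" using ir ir' by simp
  qed
  with V have bE: "bij_betw E {..<N} (dom (subst w own U))" by (simp add: bij_betw_def)
  have adS: "adm (subst w own U)" by (rule adm_subst[OF w U]) (use p in blast)
  have lbU: "lb U l \<in> topspace X" if "l \<in> dom U" "own l \<in> dom w" for l
  proof -
    have "l \<in> dom (part own U (own l))" using that by (simp add: dom_part)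
    then have "lb (part own U (own l)) l \<in> topspace X" using p[OF that(2)] by blast
    then show ?thesis by (simp add: lb_part)
  qed
  have "lb (subst w own U) l \<in> topspace X" if l: "l \<in> dom (subst w own U)" for l
    using l lbU[of l] unfolding lb_subst[OF l] dom_subst by blast
  with adS have lS: "adX (subst w own U)" by blast
  let ?c = "\<lambda>i\<in>{..<k}. cb w (e i)"
  let ?d = "\<lambda>i. \<lambda>r\<in>{..<j i}. cb (part own U (e i)) (e' i r)"
  let ?x = "\<lambda>n\<in>{..<N}. lb U (E n)"
  have "act \<theta> (subst w own U) = \<theta> N (\<lambda>n\<in>{..<N}. cb (subst w own U) (E n)) (\<lambda>n\<in>{..<N}. lb (subst w own U) (E n))"
    using act_eq[OF lS bE] by (simp add: act_enum_def)
  also have "(\<lambda>n\<in>{..<N}. cb (subst w own U) (E n)) = operad_comp k j ?c ?d"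
    unfolding operad_comp_def N_def[symmetric]
  proof (rule restrict_ext)
    fix n assume n: "n \<in> {..<N}"
    then obtain i r where ir: "i < k" "r < j i" "n = block_start j i + r"
      unfolding N_def lessThan_iff by (rule block_cases)
    have "E n \<in> dom (subst w own U)" using n V by blast
    then show "cb (subst w own U) (E n) = cube_comp (?c (block j n)) (?d (block j n) (n - block_start j (block j n)))"
      using ir e'D[OF ir(1,2)] by (simp add: cb_subst block_eq E) (simp add: cb_def part_def)
  qed
  also have "(\<lambda>n\<in>{..<N}. lb (subst w own U) (E n)) = ?x"
    by (rule restrict_ext) (use V lb_subst in blast)
  also have "\<theta> N (operad_comp k j ?c ?d) ?x =
      \<theta> k ?c (\<lambda>i\<in>{..<k}. \<theta> (j i) (?d i) (\<lambda>r\<in>{..<j i}. ?x (block_start j i + r)))"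
    unfolding N_def
  proof (rule action_comp)
    show "?c \<in> topspace (little_cubes k)" by (rule enum_little_cubes[OF w e])
    show "?d i \<in> topspace (little_cubes (j i))" if "i < k" for i
      by (rule enum_little_cubes[OF _ e'[OF that]]) (use p[OF eD[OF that]] in blast)
    have "?x n \<in> topspace X" if "n < N" for n
    proof -
      have "E n \<in> dom (subst w own U)" using that V by blast
      then show ?thesis using that lbU by (simp add: dom_subst)
    qed
    then show "(\<lambda>n\<in>{..<block_start j k}. lb U (E n)) \<in> topspace (product_topology (\<lambda>_. X) {..<block_start j k})"
      unfolding N_def by auto
  qed
  also have "\<dots> = \<theta> k ?c (\<lambda>i\<in>{..<k}. act \<theta> (part own U (e i)))"
  proof -
    have "\<theta> (j i) (?d i) (\<lambda>r\<in>{..<j i}. ?x (block_start j i + r)) = act \<theta> (part own U (e i))" if "i < k" for i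
    proof -
      have "(\<lambda>r\<in>{..<j i}. ?x (block_start j i + r)) = (\<lambda>r\<in>{..<j i}. lb (part own U (e i)) (e' i r))"
        by (rule restrict_ext) (use lt E e'D that in \<open>simp add: lb_def part_def\<close>)
      then show ?thesis using act_eq[OF p[OF eD[OF that]] e'[OF that]] by (simp add: act_enum_def)
    qed
    then have "(\<lambda>i\<in>{..<k}. \<theta> (j i) (?d i) (\<lambda>r\<in>{..<j i}. ?x (block_start j i + r))) = (\<lambda>i\<in>{..<k}. act \<theta> (part own U (e i)))"
      by (intro restrict_ext) simp
    then show ?thesis by simp
  qed
  also have "\<dots> = act \<theta> (\<lambda>k. map_option (\<lambda>(q, y). (q, act \<theta> (part own U k))) (w k))"
  proof -
    let ?w = "\<lambda>k. map_option (\<lambda>(q, y). (q, act \<theta> (part own U k))) (w k)"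
    have "dom ?w = dom w" by (auto simp: dom_def)
    moreover have "cb ?w i = cb w i" "lb ?w i = act \<theta> (part own U i)" if "i \<in> dom w" for i
      using that by (auto simp: cb_def lb_def)
    ultimately show ?thesis
      using eD by (auto simp: act_def act_enum_def k_def[symmetric] e_def[symmetric] intro!: arg_cong2[of _ _ _ _ "\<theta> k"] restrict_ext)
  qed
  finally show ?thesis .
qed

lemma act_continuous:
  assumes S: "finite S" and f: "\<And>z. z \<in> topspace T \<Longrightarrow> dom (f z) = S \<and> adm (f z)"
    and c: "\<And>i. i \<in> S \<Longrightarrow> continuous_map T euclidean (\<lambda>z. cb (f z) i)"
    and l: "\<And>i. i \<in> S \<Longrightarrow> continuous_map T X (\<lambda>z. lb (f z) i)"
  shows "continuous_map T X (\<lambda>z. act \<theta> (f z))"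
proof -
  define n where "n = card S"
  define e where "e = sorted_enum S"
  have e: "bij_betw e {..<n} S" unfolding n_def e_def by (rule bij_sorted_enum[OF S])
  have eS: "e i \<in> S" if "i < n" for i using e that by (auto simp: bij_betw_def)
  have "continuous_map T (product_topology (\<lambda>_. euclidean) {..<n}) (\<lambda>z. \<lambda>i\<in>{..<n}. cb (f z) (e i))"
    unfolding continuous_map_componentwise using c eS by auto
  then have 1: "continuous_map T (little_cubes n) (\<lambda>z. \<lambda>i\<in>{..<n}. cb (f z) (e i))"
    using enum_little_cubes[of "f _" e n] f e
    unfolding little_cubes_def continuous_map_in_subtopology by (auto simp: Pi_iff)
  have 2: "continuous_map T (product_topology (\<lambda>_. X) {..<n}) (\<lambda>z. \<lambda>i\<in>{..<n}. lb (f z) (e i))"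
    unfolding continuous_map_componentwise using l eS by auto
  have "continuous_map T X ((\<lambda>(c, x). \<theta> n c x) \<circ> (\<lambda>z. (\<lambda>i\<in>{..<n}. cb (f z) (e i), \<lambda>i\<in>{..<n}. lb (f z) (e i))))"
    by (rule continuous_map_compose[OF continuous_map_pairedI[OF 1 2] action_continuous])
  then show ?thesis
    by (rule continuous_map_eq) (use f in \<open>simp add: act_def act_enum_def n_def e_def\<close>)
qed

lemma act_leaf:
  assumes "x \<in> topspace X"
  shows "act \<theta> [i \<mapsto> (cube_id, x)] = x"
proof -
  have "dom [i \<mapsto> (cube_id, x)] = {i}" by simp
  moreover have e: "sorted_enum {i} n = i" if "n < 1" for n using that by (simp add: sorted_enum_def)
  have "(\<lambda>n\<in>{..<1}. cb [i \<mapsto> (cube_id, x)] (sorted_enum {i} n)) = (\<lambda>i\<in>{..<1}. cube_id)"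
    "(\<lambda>n\<in>{..<1}. lb [i \<mapsto> (cube_id, x)] (sorted_enum {i} n)) = (\<lambda>i\<in>{..<1}. x)"
    by (rule restrict_ext, use e in \<open>simp add: cb_def lb_def\<close>)+
  ultimately have "act \<theta> [i \<mapsto> (cube_id, x)] = \<theta> 1 (\<lambda>i\<in>{..<1}. cube_id) (\<lambda>i\<in>{..<1}. x)"
    by (simp add: act_def act_enum_def)
  then show ?thesis using action_unit[OF assms] by simp
qed

end

definition left_of :: "cube \<Rightarrow> cube \<Rightarrow> bool" where "left_of c d \<longleftrightarrow> snd (fst c) \<le> fst (fst d)"
definition above :: "cube \<Rightarrow> cube \<Rightarrow> bool" where "above c d \<longleftrightarrow> snd (snd d) \<le> fst (snd c)"

text \<open>Cubes in the same row are ordered from left to right; a cube in an earlier row may pass a cube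
  in a later row only above it. The space of these configurations is contractible.\<close>

definition valid :: "(nat \<Rightarrow> nat) \<Rightarrow> conf \<Rightarrow> bool" where
  "valid rk w \<longleftrightarrow> finite (dom w) \<and> (\<forall>i\<in>dom w. little_cube (cb w i) \<and> lb w i \<in> I1) \<and>
     (\<forall>i\<in>dom w. \<forall>j\<in>dom w.
        (rk i < rk j \<longrightarrow> left_of (cb w i) (cb w j) \<or> left_of (cb w j) (cb w i) \<or> above (cb w i) (cb w j)) \<and>
        (rk i = rk j \<and> i < j \<longrightarrow> left_of (cb w i) (cb w j)))"

lemma left_of_disjoint: "little_cube c \<Longrightarrow> little_cube d \<Longrightarrow> left_of c d \<Longrightarrow> cubes_disjoint c d"
  and above_disjoint: "little_cube c \<Longrightarrow> little_cube d \<Longrightarrow> above c d \<Longrightarrow> cubes_disjoint c d"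
proof -
  have *: "affine_map p s < snd p" "fst p < affine_map p s" if "fst p < snd p" "0 < s" "s < 1" for p s
    using affine_mono(2)[OF that(1), of s 1] affine_mono(2)[OF that(1), of 0 s] that by (simp_all add: affine_map_alt)
  assume c: "little_cube c" and d: "little_cube d"
  have x: "fst (fst c) < fst (cube_map c z)" "fst (cube_map c z) < snd (fst c)"
    "fst (snd c) < snd (cube_map c z)" "snd (cube_map c z) < snd (snd c)" if "z \<in> open_square" "little_cube c" for z c
    using that *[of "fst c" "fst z"] *[of "snd c" "snd z"]
    by (auto simp: cube_map_def open_square_def little_cube_iff mem_Times_iff)
  have n: "cube_map c z \<noteq> cube_map d z'" if "z \<in> open_square" "z' \<in> open_square" "left_of c d \<or> above c d" for z z'
    using x[OF that(1) c] x[OF that(2) d] that(3) unfolding left_of_def above_def by (metis not_less_iff_gr_or_eq order.strict_trans2 order.strict_trans)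
  show "left_of c d \<Longrightarrow> cubes_disjoint c d" "above c d \<Longrightarrow> cubes_disjoint c d"
    using n unfolding cubes_disjoint_def by blast+
qed

lemma cubes_disjoint_sym: "cubes_disjoint c d \<Longrightarrow> cubes_disjoint d c"
  unfolding cubes_disjoint_def by blast

lemma valid_adm:
  assumes "valid rk w" shows "adm w"
proof -
  have "cubes_disjoint (cb w i) (cb w j)" if ij: "i \<in> dom w" "j \<in> dom w" "i \<noteq> j" for i j
  proof -
    have L: "little_cube (cb w i)" "little_cube (cb w j)" using assms ij unfolding valid_def by blast+
    have v: "rk i < rk j \<Longrightarrow> left_of (cb w i) (cb w j) \<or> left_of (cb w j) (cb w i) \<or> above (cb w i) (cb w j)"
      "rk i = rk j \<Longrightarrow> i < j \<Longrightarrow> left_of (cb w i) (cb w j)" if "i \<in> dom w" "j \<in> dom w" for i j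
      using assms that unfolding valid_def by blast+
    have "left_of (cb w i) (cb w j) \<or> left_of (cb w j) (cb w i) \<or> above (cb w i) (cb w j) \<or> above (cb w j) (cb w i)"
      using v[OF ij(1,2)] v[OF ij(2,1)] ij(3) by (metis linorder_neqE_nat)
    then show ?thesis
      using left_of_disjoint L above_disjoint cubes_disjoint_sym by blast
  qed
  then show ?thesis using assms unfolding adm_def valid_def by blast
qed

definition Wt :: "(nat \<Rightarrow> nat) \<Rightarrow> nat set \<Rightarrow> conf topology" where
  "Wt rk S = pullback_topology {w. dom w = S \<and> valid rk w} (\<lambda>w. \<lambda>i\<in>S. the (w i)) (product_topology (\<lambda>_. euclidean) S)"

lemma topspace_Wt: "topspace (Wt rk S) = {w. dom w = S \<and> valid rk w}"
  unfolding Wt_def topspace_pullback_topology by auto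

lemma continuous_map_Wt:
  "continuous_map T (Wt rk S) f \<longleftrightarrow> (\<forall>z\<in>topspace T. dom (f z) = S \<and> valid rk (f z)) \<and>
     (\<forall>i\<in>S. continuous_map T euclidean (\<lambda>z. the (f z i)))"
proof
  assume f: "continuous_map T (Wt rk S) f"
  have "continuous_map (Wt rk S) (product_topology (\<lambda>_. euclidean) S) (\<lambda>w. \<lambda>i\<in>S. the (w i))"
    unfolding Wt_def using continuous_map_pullback[OF continuous_map_id, where f = "\<lambda>w. \<lambda>i\<in>S. the (w i)"] by (simp add: o_def)
  from continuous_map_compose[OF f this]
  have "continuous_map T euclidean (\<lambda>z. the (f z i))" if "i \<in> S" for i
    using that unfolding continuous_map_componentwise by (auto simp: o_def)
  then show "(\<forall>z\<in>topspace T. dom (f z) = S \<and> valid rk (f z)) \<and>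
     (\<forall>i\<in>S. continuous_map T euclidean (\<lambda>z. the (f z i)))"
    using continuous_map_image_subset_topspace[OF f] unfolding topspace_Wt by blast
next
  assume f: "(\<forall>z\<in>topspace T. dom (f z) = S \<and> valid rk (f z)) \<and> (\<forall>i\<in>S. continuous_map T euclidean (\<lambda>z. the (f z i)))"
  then have "continuous_map T (product_topology (\<lambda>_. euclidean) S) ((\<lambda>w. \<lambda>i\<in>S. the (w i)) \<circ> f)"
    unfolding continuous_map_componentwise by (auto simp: o_def)
  then show "continuous_map T (Wt rk S) f"
    unfolding Wt_def by (rule continuous_map_pullback') (use f in auto)
qed

lemma continuous_map_Wt_coord: "i \<in> S \<Longrightarrow> continuous_map (Wt rk S) euclidean (\<lambda>w. the (w i))"
  using continuous_map_Wt[of "Wt rk S" rk S id] continuous_map_id by auto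

lemma
  assumes "i \<in> S"
  shows continuous_map_Wt_cb: "continuous_map (Wt rk S) euclidean (\<lambda>w. cb w i)"
    and continuous_map_Wt_lb: "continuous_map (Wt rk S) euclidean (\<lambda>w. lb w i)"
proof -
  have "continuous_map euclidean euclidean (fst :: cube \<times> real \<Rightarrow> cube)"
    "continuous_map euclidean euclidean (snd :: cube \<times> real \<Rightarrow> real)"
    by (simp_all add: continuous_on_fst continuous_on_snd)
  from this[THEN continuous_map_compose[OF continuous_map_Wt_coord[OF assms]]]
  show "continuous_map (Wt rk S) euclidean (\<lambda>w. cb w i)" "continuous_map (Wt rk S) euclidean (\<lambda>w. lb w i)"
    by (simp_all add: o_def cb_def lb_def)
qed

subsection \<open>Contractibility\<close>

definition stack_x :: "nat \<Rightarrow> real \<times> real" where "stack_x i = (1 - 1 / (real i + 1), 1 - 1 / (real i + 2))"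
definition stack_y :: "nat \<Rightarrow> real \<times> real" where "stack_y i = (1 / (real i + 2), 1 / (real i + 1))"

definition mapc :: "(nat \<Rightarrow> cube \<times> real \<Rightarrow> cube \<times> real) \<Rightarrow> conf \<Rightarrow> conf" where
  "mapc F w = (\<lambda>i. map_option (F i) (w i))"

lemma dom_mapc [simp]: "dom (mapc F w) = dom w" by (auto simp: mapc_def dom_def)
lemma cb_mapc: "i \<in> dom w \<Longrightarrow> cb (mapc F w) i = fst (F i (cb w i, lb w i))"
  and lb_mapc: "i \<in> dom w \<Longrightarrow> lb (mapc F w) i = snd (F i (cb w i, lb w i))"
  by (auto simp: mapc_def cb_def lb_def)

definition to_stack_y :: "(nat \<Rightarrow> nat) \<Rightarrow> real \<Rightarrow> nat \<Rightarrow> cube \<times> real \<Rightarrow> cube \<times> real" where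
  "to_stack_y rk r i cl = ((fst (fst cl), (1 - r) *\<^sub>R snd (fst cl) + r *\<^sub>R stack_y (rk i)), snd cl)"

definition to_stack_x :: "(nat \<Rightarrow> nat) \<Rightarrow> real \<Rightarrow> nat \<Rightarrow> cube \<times> real \<Rightarrow> cube \<times> real" where
  "to_stack_x rk r i cl = (((1 - r) *\<^sub>R fst (fst cl) + r *\<^sub>R stack_x i, stack_y (rk i)), (1 - r) * snd cl)"

lemma convex_comb_less:
  assumes "0 \<le> r" "r \<le> 1" "a < b" "c < (d::real)"
  shows "(1 - r) * a + r * c < (1 - r) * b + r * d"
proof (cases "r = 1")
  case False
  then have "(1 - r) * a < (1 - r) * b" using assms by simp
  moreover have "r * c \<le> r * d" using assms by (simp add: mult_left_mono)
  ultimately show ?thesis by simp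
qed (use assms in simp)

lemma convex_comb_le: "0 \<le> r \<Longrightarrow> r \<le> 1 \<Longrightarrow> a \<le> b \<Longrightarrow> c \<le> (d::real) \<Longrightarrow> (1 - r) * a + r * c \<le> (1 - r) * b + r * d"
  by (intro add_mono mult_left_mono) auto

lemma convex_comb_bounds:
  "0 \<le> r \<Longrightarrow> r \<le> 1 \<Longrightarrow> 0 \<le> a \<Longrightarrow> 0 \<le> (c::real) \<Longrightarrow> 0 \<le> (1 - r) * a + r * c"
  "0 \<le> r \<Longrightarrow> r \<le> 1 \<Longrightarrow> b \<le> 1 \<Longrightarrow> (d::real) \<le> 1 \<Longrightarrow> (1 - r) * b + r * d \<le> 1"
  using convex_comb_le[of r 0 a 0 c] convex_comb_le[of r b 1 d 1] by simp_all

lemma stack_y_order: "i < j \<Longrightarrow> snd (stack_y j) \<le> fst (stack_y i)"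
  and stack_x_order: "i < j \<Longrightarrow> snd (stack_x i) \<le> fst (stack_x j)"
  by (auto simp: stack_x_def stack_y_def intro!: divide_left_mono)

lemma stack_y_bounds: "0 \<le> fst (stack_y i)" "fst (stack_y i) < snd (stack_y i)" "snd (stack_y i) \<le> 1"
  and stack_x_bounds: "0 \<le> fst (stack_x i)" "fst (stack_x i) < snd (stack_x i)" "snd (stack_x i) \<le> 1"
  by (auto simp: stack_x_def stack_y_def field_simps)

lemma valid_to_stack_y:
  assumes w: "valid rk w" and r: "r \<in> I1"
  shows "valid rk (mapc (to_stack_y rk r) w)"
proof -
  have r: "0 \<le> r" "r \<le> 1" using r by auto
  have c: "cb (mapc (to_stack_y rk r) w) i = (fst (cb w i), (1 - r) *\<^sub>R snd (cb w i) + r *\<^sub>R stack_y (rk i))"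
    "lb (mapc (to_stack_y rk r) w) i = lb w i" if "i \<in> dom w" for i
    using that by (simp_all add: cb_mapc lb_mapc to_stack_y_def)
  show ?thesis
    unfolding valid_def dom_mapc
  proof (intro conjI ballI impI)
    show "finite (dom w)" using w by (simp add: valid_def)
    fix i assume i: "i \<in> dom w"
    have "little_cube (cb w i)" using w i unfolding valid_def by blast
    then show "little_cube (cb (mapc (to_stack_y rk r) w) i)"
      unfolding c[OF i] little_cube_iff
      using r stack_y_bounds[of "rk i"] by (simp add: convex_comb_less convex_comb_bounds)
    show "lb (mapc (to_stack_y rk r) w) i \<in> I1" using w i unfolding c[OF i] valid_def by blast
    fix j assume j: "j \<in> dom w"
    show "rk i < rk j \<Longrightarrow> left_of (cb (mapc (to_stack_y rk r) w) i) (cb (mapc (to_stack_y rk r) w) j) \<or>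
       left_of (cb (mapc (to_stack_y rk r) w) j) (cb (mapc (to_stack_y rk r) w) i) \<or>
       above (cb (mapc (to_stack_y rk r) w) i) (cb (mapc (to_stack_y rk r) w) j)"
    proof -
      assume ij: "rk i < rk j"
      then have "left_of (cb w i) (cb w j) \<or> left_of (cb w j) (cb w i) \<or> above (cb w i) (cb w j)"
        using w i j unfolding valid_def by blast
      then show ?thesis
        unfolding c[OF i] c[OF j] left_of_def above_def
        using r stack_y_order[OF ij] by (auto simp: convex_comb_le)
    qed
    show "rk i = rk j \<and> i < j \<Longrightarrow> left_of (cb (mapc (to_stack_y rk r) w) i) (cb (mapc (to_stack_y rk r) w) j)"
    proof -
      assume "rk i = rk j \<and> i < j"
      then have "left_of (cb w i) (cb w j)" using w i j unfolding valid_def by blast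
      then show ?thesis unfolding c[OF i] c[OF j] left_of_def by simp
    qed
  qed
qed

lemma valid_to_stack_x:
  assumes w: "valid rk w" and r: "r \<in> I1"
  shows "valid rk (mapc (to_stack_x rk r) w)"
proof -
  have r: "0 \<le> r" "r \<le> 1" using r by auto
  have c: "cb (mapc (to_stack_x rk r) w) i = ((1 - r) *\<^sub>R fst (cb w i) + r *\<^sub>R stack_x i, stack_y (rk i))"
    "lb (mapc (to_stack_x rk r) w) i = (1 - r) * lb w i" if "i \<in> dom w" for i
    using that by (simp_all add: cb_mapc lb_mapc to_stack_x_def)
  show ?thesis
    unfolding valid_def dom_mapc
  proof (intro conjI ballI impI)
    show "finite (dom w)" using w by (simp add: valid_def)
    fix i assume i: "i \<in> dom w"
    have l: "little_cube (cb w i)" "lb w i \<in> I1" using w i unfolding valid_def by blast+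
    then show "little_cube (cb (mapc (to_stack_x rk r) w) i)"
      unfolding c[OF i] little_cube_iff
      using r stack_y_bounds[of "rk i"] stack_x_bounds[of i] by (simp add: convex_comb_less convex_comb_bounds)
    show "lb (mapc (to_stack_x rk r) w) i \<in> I1"
      using l(2) r unfolding c[OF i] by (auto intro: mult_le_one)
    fix j assume j: "j \<in> dom w"
    show "rk i < rk j \<Longrightarrow> left_of (cb (mapc (to_stack_x rk r) w) i) (cb (mapc (to_stack_x rk r) w) j) \<or>
       left_of (cb (mapc (to_stack_x rk r) w) j) (cb (mapc (to_stack_x rk r) w) i) \<or>
       above (cb (mapc (to_stack_x rk r) w) i) (cb (mapc (to_stack_x rk r) w) j)"
      unfolding c[OF i] c[OF j] above_def using stack_y_order[of "rk i" "rk j"] by simp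
    show "rk i = rk j \<and> i < j \<Longrightarrow> left_of (cb (mapc (to_stack_x rk r) w) i) (cb (mapc (to_stack_x rk r) w) j)"
    proof -
      assume ij: "rk i = rk j \<and> i < j"
      then have "left_of (cb w i) (cb w j)" using w i j unfolding valid_def by blast
      then show ?thesis using ij r stack_x_order[of i j] unfolding c[OF i] c[OF j] left_of_def by (simp add: convex_comb_le)
    qed
  qed
qed

lemma continuous_map_mapc:
  assumes F: "\<And>i. i \<in> S \<Longrightarrow> continuous_on UNIV (\<lambda>(r, cl). F r i cl)"
    and v: "\<And>r w. r \<in> I1 \<Longrightarrow> valid rk w \<Longrightarrow> valid rk (mapc (F r) w)"
  shows "continuous_map (prod_topology (top_of_set I1) (Wt rk S)) (Wt rk S) (\<lambda>(r, w). mapc (F r) w)"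
  unfolding continuous_map_Wt
proof (intro conjI ballI)
  fix z assume z: "z \<in> topspace (prod_topology (top_of_set I1) (Wt rk S))"
  then have "fst z \<in> I1" "dom (snd z) = S" "valid rk (snd z)" by (auto simp: topspace_Wt)
  then show "dom (case z of (r, w) \<Rightarrow> mapc (F r) w) = S" "valid rk (case z of (r, w) \<Rightarrow> mapc (F r) w)"
    using v by (simp_all add: case_prod_unfold)
next
  fix i assume i: "i \<in> S"
  have "continuous_map (prod_topology (top_of_set I1) (Wt rk S)) euclidean (\<lambda>z. fst z)"
    using continuous_map_fst continuous_map_into_fulltopology by blast
  moreover have "continuous_map (prod_topology (top_of_set I1) (Wt rk S)) euclidean (\<lambda>z. the (snd z i))"
    using continuous_map_compose[OF continuous_map_snd continuous_map_Wt_coord[OF i]] by (simp add: o_def)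
  ultimately have "continuous_map (prod_topology (top_of_set I1) (Wt rk S)) euclidean (\<lambda>z. (fst z, the (snd z i)))"
    unfolding prod_topology_euclidean[symmetric] by (rule continuous_map_pairedI)
  from continuous_map_compose[OF this, of euclidean "\<lambda>(r, cl). F r i cl"] F[OF i]
  have *: "continuous_map (prod_topology (top_of_set I1) (Wt rk S)) euclidean (\<lambda>z. F (fst z) i (the (snd z i)))"
    by (simp add: o_def)
  show "continuous_map (prod_topology (top_of_set I1) (Wt rk S)) euclidean (\<lambda>z. the ((case z of (r, w) \<Rightarrow> mapc (F r) w) i))"
  proof (rule continuous_map_eq[OF *])
    fix z assume "z \<in> topspace (prod_topology (top_of_set I1) (Wt rk S))"
    then have "i \<in> dom (snd z)" using i by (auto simp: topspace_Wt)
    then show "F (fst z) i (the (snd z i)) = the ((case z of (r, w) \<Rightarrow> mapc (F r) w) i)"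
      by (auto simp: mapc_def case_prod_unfold)
  qed
qed

lemma contractible_Wt: "contractible_space (Wt rk S)"
proof -
  define a :: conf where "a = (\<lambda>i. if i \<in> S then Some ((stack_x i, stack_y (rk i)), 0) else None)"
  have 1: "continuous_map (prod_topology (top_of_set I1) (Wt rk S)) (Wt rk S) (\<lambda>(r, w). mapc (to_stack_y rk r) w)"
    by (rule continuous_map_mapc[OF _ valid_to_stack_y])
       (auto simp: to_stack_y_def case_prod_unfold intro!: continuous_intros)
  have 2: "continuous_map (prod_topology (top_of_set I1) (Wt rk S)) (Wt rk S) (\<lambda>(r, w). mapc (to_stack_x rk r) w)"
    by (rule continuous_map_mapc[OF _ valid_to_stack_x])
       (auto simp: to_stack_x_def case_prod_unfold intro!: continuous_intros)
  have "to_stack_y rk 0 i = (\<lambda>cl. cl)" for i by (simp add: to_stack_y_def fun_eq_iff)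
  then have e0: "mapc (to_stack_y rk 0) w = w" for w by (simp add: mapc_def option.map_ident)
  have "to_stack_x rk 0 = to_stack_y rk 1" by (simp add: to_stack_y_def to_stack_x_def fun_eq_iff)
  then have e1: "mapc (to_stack_x rk 0) w = mapc (to_stack_y rk 1) w" for w by simp
  have e2: "mapc (to_stack_x rk 1) w = a" if "w \<in> topspace (Wt rk S)" for w
  proof
    fix i show "mapc (to_stack_x rk 1) w i = a i"
      using that by (cases "w i") (auto simp: mapc_def to_stack_x_def a_def topspace_Wt dom_def)
  qed
  have "homotopic_with (\<lambda>_. True) (Wt rk S) (Wt rk S) id (\<lambda>w. mapc (to_stack_y rk 1) w)"
    by (subst homotopic_with, simp)
       (rule exI[of _ "\<lambda>(r, w). mapc (to_stack_y rk r) w"], use 1 e0 in simp)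
  moreover have "homotopic_with (\<lambda>_. True) (Wt rk S) (Wt rk S) (\<lambda>w. mapc (to_stack_y rk 1) w) (\<lambda>w. a)"
    by (subst homotopic_with, simp)
       (rule exI[of _ "\<lambda>(r, w). mapc (to_stack_x rk r) w"], use 2 e1 e2 in simp)
  ultimately show ?thesis unfolding contractible_space_def using homotopic_with_trans by blast
qed

subsection \<open>Substitution of lists of configurations\<close>

fun own_of :: "(nat \<rightharpoonup> 'b) list \<Rightarrow> nat \<Rightarrow> nat" where
  "own_of [] l = 0"
| "own_of (u # us) l = (if l \<in> dom u then 0 else Suc (own_of us l))"

fun merged :: "(nat \<rightharpoonup> 'b) list \<Rightarrow> (nat \<rightharpoonup> 'b)" where
  "merged [] = Map.empty"
| "merged (u # us) = merged us ++ u"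

definition csub :: "(nat \<rightharpoonup> cube \<times> 'k) \<Rightarrow> (nat \<rightharpoonup> cube \<times> 'l) list \<Rightarrow> (nat \<rightharpoonup> cube \<times> 'l)" where
  "csub w us = subst w (own_of us) (merged us)"

text \<open>\<open>fits rk' rk Ss\<close>: configurations with label sets \<open>Ss\<close>, valid for \<open>rk\<close>, may be
  substituted into a configuration which is valid for \<open>rk'\<close>.\<close>

definition fits :: "(nat \<Rightarrow> nat) \<Rightarrow> (nat \<Rightarrow> nat) \<Rightarrow> nat set list \<Rightarrow> bool" where
  "fits rk' rk Ss \<longleftrightarrow> (\<forall>a<length Ss. \<forall>b<length Ss. a \<noteq> b \<longrightarrow> Ss ! a \<inter> Ss ! b = {} \<and>
     (\<forall>l\<in>Ss ! a. \<forall>l'\<in>Ss ! b. (rk' a < rk' b \<longrightarrow> rk l < rk l') \<and>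
        (rk' a = rk' b \<and> a < b \<longrightarrow> rk l \<noteq> rk l' \<or> l < l')))"

lemma dom_merged: "dom (merged us) = \<Union> (dom ` set us)"
  by (induction us) auto

lemma own_of_props:
  "l \<in> dom (merged us) \<Longrightarrow> own_of us l < length us \<and> l \<in> dom (us ! own_of us l) \<and> merged us l = (us ! own_of us l) l"
proof (induction us)
  case (Cons u us)
  show ?case
  proof (cases "l \<in> dom u")
    case True
    then show ?thesis by (simp add: map_add_dom_app_simps)
  next
    case False
    then show ?thesis using Cons by (simp add: map_add_dom_app_simps)
  qed
qed simp

lemma own_of_eq:
  assumes "k < length us" "l \<in> dom (us ! k)" "\<And>j. j < length us \<Longrightarrow> j \<noteq> k \<Longrightarrow> dom (us ! j) \<inter> dom (us ! k) = {}"
  shows "own_of us l = k" "merged us l = (us ! k) l"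
proof -
  have "l \<in> dom (merged us)" unfolding dom_merged using assms(1,2) nth_mem by blast
  from own_of_props[OF this] show "own_of us l = k" using assms by blast
  then show "merged us l = (us ! k) l" using own_of_props[OF \<open>l \<in> dom (merged us)\<close>] by simp
qed

lemma fits_disjoint: "fits rk' rk (map dom us) \<Longrightarrow> j < length us \<Longrightarrow> k < length us \<Longrightarrow> j \<noteq> k \<Longrightarrow> dom (us ! j) \<inter> dom (us ! k) = {}"
proof -
  assume f: "fits rk' rk (map dom us)" and jk: "j < length us" "k < length us" "j \<noteq> k"
  then have "j < length (map dom us)" "k < length (map dom us)" by simp_all
  then have "map dom us ! j \<inter> map dom us ! k = {}" using f jk(3) unfolding fits_def by blast
  then show ?thesis using jk by simp
qed

lemma fits_rk:
  assumes f: "fits rk' rk (map dom us)" and ab: "a < length us" "b < length us" "a \<noteq> b"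
    and l: "l \<in> dom (us ! a)" "l' \<in> dom (us ! b)"
  shows "(rk' a < rk' b \<longrightarrow> rk l < rk l') \<and> (rk' a = rk' b \<and> a < b \<longrightarrow> rk l \<noteq> rk l' \<or> l < l')"
proof -
  have "a < length (map dom us)" "b < length (map dom us)" "l \<in> map dom us ! a" "l' \<in> map dom us ! b"
    using ab l by simp_all
  then show ?thesis using f ab(3) unfolding fits_def by blast
qed

lemma part_own_of:
  assumes "fits rk' rk (map dom us)" "k < length us"
  shows "part (own_of us) (merged us) k = us ! k"
proof
  fix l
  note eq = own_of_eq[OF assms(2) _ fits_disjoint[OF assms(1) _ assms(2)]]
  show "part (own_of us) (merged us) k l = (us ! k) l"
  proof (cases "l \<in> dom (us ! k)")
    case True
    then show ?thesis using eq[OF True] by (simp add: part_def)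
  next
    case False
    have "own_of us l = k \<Longrightarrow> l \<notin> dom (merged us)" using own_of_props[of l us] False by auto
    then show ?thesis using False by (auto simp: part_def)
  qed
qed

lemma dom_csub:
  assumes "dom w = {..<length us}"
  shows "dom (csub w us) = \<Union> (dom ` set us)"
proof -
  have "dom (csub w us) = dom (merged us)"
    unfolding csub_def dom_subst assms using own_of_props[of _ us] by blast
  then show ?thesis by (simp only: dom_merged)
qed

lemma csub_at:
  assumes "fits rk' rk (map dom us)" "k < length us" "l \<in> dom (us ! k)" "k \<in> dom w"
  shows "csub w us l = Some (cube_comp (cb w k) (cb (us ! k) l), lb (us ! k) l)"
proof -
  note eq = own_of_eq[OF assms(2,3) fits_disjoint[OF assms(1) _ assms(2)]]
  obtain c x where "(us ! k) l = Some (c, x)" using assms(3) by auto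
  moreover obtain q y where "w k = Some (q, y)" using assms(4) by auto
  ultimately show ?thesis by (simp add: csub_def subst_def eq cb_def lb_def)
qed

lemma cube_comp_assoc: "cube_comp (cube_comp q c) d = cube_comp q (cube_comp c d)"
  by (simp add: cube_comp_def affine_map_alt map_prod_def case_prod_unfold algebra_simps)

lemma cube_comp_id: "cube_comp cube_id c = c"
  by (simp add: cube_comp_def cube_id_def affine_map_alt map_prod_def case_prod_unfold)

lemma csub_eq: "csub w us l = (case merged us l of None \<Rightarrow> None | Some (c, x) \<Rightarrow>
   (case w (own_of us l) of None \<Rightarrow> None | Some (q, y) \<Rightarrow> Some (cube_comp q c, x)))"
  by (simp add: csub_def subst_def)

lemma merged_csub: "merged (map (\<lambda>v. csub v us) vs) l = csub (merged vs) us l"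
proof (induction vs)
  case Nil
  show ?case by (auto simp: csub_eq split: option.split)
next
  case (Cons v vs)
  show ?case
    by (simp only: list.map merged.simps map_add_def Cons.IH) (auto simp: csub_eq map_add_def split: option.splits)
qed

lemma own_of_csub: "l \<in> dom (merged us) \<Longrightarrow> own_of (map (\<lambda>v. csub v us) vs) l = own_of vs (own_of us l)"
proof (induction vs)
  case (Cons v vs)
  have "l \<in> dom (csub v us) \<longleftrightarrow> own_of us l \<in> dom v"
    using Cons.prems by (cases "merged us l"; cases "v (own_of us l)") (auto simp: csub_eq domIff simp del: not_None_eq)
  then show ?case using Cons by simp
qed simp

lemma csub_csub: "csub (csub w vs) us = csub w (map (\<lambda>v. csub v us) vs)"
proof
  fix l
  show "csub (csub w vs) us l = csub w (map (\<lambda>v. csub v us) vs) l"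
  proof (cases "merged us l")
    case None
    then show ?thesis
      by (simp only: csub_eq[of w "map (\<lambda>v. csub v us) vs" l] merged_csub) (simp add: csub_eq)
  next
    case (Some cx)
    then have "l \<in> dom (merged us)" by auto
    note own = own_of_csub[OF this]
    show ?thesis
      by (simp only: csub_eq[of w "map (\<lambda>v. csub v us) vs" l] merged_csub own)
         (auto simp: csub_eq cube_comp_assoc split: option.split prod.split)
  qed
qed

definition leaf :: "nat \<Rightarrow> real \<Rightarrow> conf" where
  "leaf i t = [i \<mapsto> (cube_id, t)]"

lemma dom_leaf [simp]: "dom (leaf i t) = {i}" by (simp add: leaf_def)

lemma csub_leaf:
  assumes "fits rk' rk (map dom us)" "k < length us"
  shows "csub (leaf k t) us = us ! k"
proof
  fix l
  show "csub (leaf k t) us l = (us ! k) l"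
  proof (cases "l \<in> dom (us ! k)")
    case True
    have "cb (leaf k t) k = cube_id" by (simp add: leaf_def cb_def)
    then show ?thesis using csub_at[OF assms True, of "leaf k t"] True by (auto simp: cube_comp_id cb_def lb_def)
  next
    case False
    have "own_of us l = k \<Longrightarrow> merged us l = None" using own_of_props[of l us] False by (auto simp: domIff simp del: not_None_eq)
    moreover have "(us ! k) l = None" using False by (simp add: domIff del: not_None_eq)
    ultimately show ?thesis by (cases "merged us l"; cases "own_of us l = k") (auto simp: csub_eq leaf_def)
  qed
qed

lemma csub_empty: "csub Map.empty us = Map.empty"
  by (auto simp: csub_eq fun_eq_iff split: option.split)

lemma valid_leaf: "t \<in> I1 \<Longrightarrow> valid rk (leaf i t)"
  by (simp add: valid_def leaf_def cb_def lb_def little_cube_iff cube_id_def)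

lemma valid_empty: "valid rk Map.empty"
  by (simp add: valid_def)

lemma left_of_comp:
  assumes "left_of q q'" "little_cube q" "little_cube q'" "little_cube c" "little_cube d"
  shows "left_of (cube_comp q c) (cube_comp q' d)"
proof -
  have "affine_map (fst q) (snd (fst c)) \<le> snd (fst q)" "fst (fst q') \<le> affine_map (fst q') (fst (fst d))"
    using assms by (intro affine_bounds; simp add: little_cube_iff)+
  then show ?thesis using assms(1) by (simp add: left_of_def fst_cube_comp)
qed

lemma above_comp:
  assumes "above q q'" "little_cube q" "little_cube q'" "little_cube c" "little_cube d"
  shows "above (cube_comp q c) (cube_comp q' d)"
proof -
  have "affine_map (snd q') (snd (snd d)) \<le> snd (snd q')" "fst (snd q) \<le> affine_map (snd q) (fst (snd c))"
    using assms by (intro affine_bounds; simp add: little_cube_iff)+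
  then show ?thesis using assms(1) by (simp add: above_def snd_cube_comp)
qed

lemma comp_same:
  assumes "little_cube q"
  shows "left_of c d \<Longrightarrow> left_of (cube_comp q c) (cube_comp q d)" "above c d \<Longrightarrow> above (cube_comp q c) (cube_comp q d)"
  using assms affine_mono(1)[of "fst q"] affine_mono(1)[of "snd q"]
  by (simp_all add: left_of_def above_def fst_cube_comp snd_cube_comp little_cube_iff)

lemma valid_csub:
  assumes w: "valid rk' w" and d: "dom w = {..<length us}" and us: "\<And>k. k < length us \<Longrightarrow> valid rk (us ! k)"
    and f: "fits rk' rk (map dom us)"
  shows "valid rk (csub w us)"
proof -
  have D: "\<exists>k<length us. l \<in> dom (us ! k)" if "l \<in> dom (csub w us)" for l
    using that in_set_conv_nth[of _ us] unfolding dom_csub[OF d] by (metis UN_E)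
  have at: "cb (csub w us) l = cube_comp (cb w k) (cb (us ! k) l)" "lb (csub w us) l = lb (us ! k) l"
    if "k < length us" "l \<in> dom (us ! k)" for k l
    using csub_at[OF f that, of w] d that(1) by (simp_all add: cb_def lb_def)
  have lw: "little_cube (cb w k)" if "k < length us" for k
  proof -
    have "k \<in> dom w" using d that by simp
    then show ?thesis using w unfolding valid_def by blast
  qed
  have lu: "little_cube (cb (us ! k) l)" "lb (us ! k) l \<in> I1" if "k < length us" "l \<in> dom (us ! k)" for k l
    using us[OF that(1)] that(2) unfolding valid_def by blast+
  note f' = fits_rk[OF f]
  have vw: "(rk' a < rk' b \<longrightarrow> left_of (cb w a) (cb w b) \<or> left_of (cb w b) (cb w a) \<or> above (cb w a) (cb w b)) \<and>
        (rk' a = rk' b \<and> a < b \<longrightarrow> left_of (cb w a) (cb w b))" if "a < length us" "b < length us" for a b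
  proof -
    have "a \<in> dom w" "b \<in> dom w" using d that by auto
    then show ?thesis using w unfolding valid_def by blast
  qed
  show ?thesis
    unfolding valid_def
  proof (intro conjI ballI)
    have "finite (dom u)" if "u \<in> set us" for u
      using that us by (auto simp: in_set_conv_nth valid_def)
    then show "finite (dom (csub w us))" unfolding dom_csub[OF d] by auto
    fix l assume "l \<in> dom (csub w us)"
    then obtain a where a: "a < length us" "l \<in> dom (us ! a)" using D by blast
    show "little_cube (cb (csub w us) l)" "lb (csub w us) l \<in> I1"
      unfolding at[OF a] using little_cube_comp[OF lw[OF a(1)] lu(1)[OF a]] lu(2)[OF a] by blast+
    fix l' assume "l' \<in> dom (csub w us)"
    then obtain b where b: "b < length us" "l' \<in> dom (us ! b)" using D by blast
    note comp = left_of_comp[OF _ lw[OF a(1)] lw[OF b(1)] lu(1)[OF a] lu(1)[OF b]]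
      left_of_comp[OF _ lw[OF b(1)] lw[OF a(1)] lu(1)[OF b] lu(1)[OF a]]
      above_comp[OF _ lw[OF a(1)] lw[OF b(1)] lu(1)[OF a] lu(1)[OF b]]
    let ?l = "cb (csub w us) l" and ?l' = "cb (csub w us) l'"
    have vu: "(rk l < rk l' \<longrightarrow> left_of (cb (us ! a) l) (cb (us ! a) l') \<or> left_of (cb (us ! a) l') (cb (us ! a) l) \<or>
         above (cb (us ! a) l) (cb (us ! a) l')) \<and> (rk l = rk l' \<and> l < l' \<longrightarrow> left_of (cb (us ! a) l) (cb (us ! a) l'))"
      if "a = b"
    proof -
      have "l' \<in> dom (us ! a)" using b that by simp
      then show ?thesis using us[OF a(1)] a(2) unfolding valid_def by blast
    qed
    have ab: "rk' a < rk' b \<or> rk' b < rk' a \<or> rk' a = rk' b \<and> (a < b \<or> b < a)" if "a \<noteq> b" using that by linarith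
    show "rk l < rk l' \<longrightarrow> left_of ?l ?l' \<or> left_of ?l' ?l \<or> above ?l ?l'"
    proof
      assume r: "rk l < rk l'"
      show "left_of ?l ?l' \<or> left_of ?l' ?l \<or> above ?l ?l'"
      proof (cases "a = b")
        case True
        then show ?thesis using vu[OF True] r comp_same[OF lw[OF a(1)]] unfolding at[OF a] at[OF b] by blast
      next
        case False
        then have "\<not> rk' b < rk' a" using f'[OF b(1) a(1) _ b(2) a(2)] r by auto
        then show ?thesis using ab[OF False] vw[OF a(1) b(1)] vw[OF b(1) a(1)] comp unfolding at[OF a] at[OF b] by auto
      qed
    qed
    show "rk l = rk l' \<and> l < l' \<longrightarrow> left_of ?l ?l'"
    proof
      assume r: "rk l = rk l' \<and> l < l'"
      show "left_of ?l ?l'"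
      proof (cases "a = b")
        case True
        then show ?thesis using vu[OF True] r comp_same[OF lw[OF a(1)]] unfolding at[OF a] at[OF b] by blast
      next
        case False
        then have "\<not> rk' b < rk' a" "\<not> rk' a < rk' b" "\<not> (rk' a = rk' b \<and> b < a)"
          using f'[OF b(1) a(1) _ b(2) a(2)] f'[OF a(1) b(1) _ a(2) b(2)] r by auto
        then show ?thesis using ab[OF False] vw[OF a(1) b(1)] comp unfolding at[OF a] at[OF b] by auto
      qed
    qed
  qed
qed

lemma continuous_on_cube_comp: "continuous_on UNIV (\<lambda>(q, c). cube_comp q c)"
  unfolding cube_comp_def affine_map_alt map_prod_def case_prod_unfold by (intro continuous_intros)

lemma continuous_csub:
  assumes g: "continuous_map T (Wt rk' {..<length fs}) g" and len: "length Ss = length fs"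
    and fs: "\<And>k. k < length fs \<Longrightarrow> continuous_map T (Wt rk (Ss ! k)) (fs ! k)" and f: "fits rk' rk Ss"
  shows "continuous_map T (Wt rk (\<Union> (set Ss))) (\<lambda>z. csub (g z) (map (\<lambda>f. f z) fs))"
proof -
  have gz: "dom (g z) = {..<length fs}" "valid rk' (g z)" if "z \<in> topspace T" for z
    using g that unfolding continuous_map_Wt by blast+
  have fz: "dom ((fs ! k) z) = Ss ! k" "valid rk ((fs ! k) z)" if "z \<in> topspace T" "k < length fs" for z k
    using fs[OF that(2)] that(1) unfolding continuous_map_Wt by blast+
  have Ss: "map dom (map (\<lambda>f. f z) fs) = Ss" if "z \<in> topspace T" for z
    using fz[OF that] len by (auto intro: nth_equalityI)
  show ?thesis
    unfolding continuous_map_Wt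
  proof (intro conjI ballI)
    fix z assume z: "z \<in> topspace T"
    have "dom (csub (g z) (map (\<lambda>f. f z) fs)) = \<Union> (dom ` set (map (\<lambda>f. f z) fs))"
      by (rule dom_csub) (use gz[OF z] in simp)
    also have "dom ` set (map (\<lambda>f. f z) fs) = set Ss" unfolding Ss[OF z, symmetric] by (simp add: image_image)
    finally show "dom (csub (g z) (map (\<lambda>f. f z) fs)) = \<Union> (set Ss)" .
    show "valid rk (csub (g z) (map (\<lambda>f. f z) fs))"
      by (rule valid_csub[OF gz(2)[OF z]]) (use gz[OF z] fz[OF z] f Ss[OF z] in simp_all)
  next
    fix l assume "l \<in> \<Union> (set Ss)"
    then obtain k where k: "k < length fs" "l \<in> Ss ! k" using len by (auto simp: in_set_conv_nth)
    have "continuous_map T euclidean (\<lambda>z. cb (g z) k)"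
      using continuous_map_compose[OF g continuous_map_Wt_cb, of k] k(1) by (simp add: o_def)
    moreover have "continuous_map T euclidean (\<lambda>z. cb ((fs ! k) z) l)" "continuous_map T euclidean (\<lambda>z. lb ((fs ! k) z) l)"
      using continuous_map_compose[OF fs[OF k(1)] continuous_map_Wt_cb[OF k(2)]]
        continuous_map_compose[OF fs[OF k(1)] continuous_map_Wt_lb[OF k(2)]] by (simp_all add: o_def)
    ultimately have c: "continuous_map T euclidean (\<lambda>z. (cb (g z) k, cb ((fs ! k) z) l))"
      unfolding prod_topology_euclidean[symmetric] by (intro continuous_map_pairedI)
    have "continuous_map T euclidean (\<lambda>z. cube_comp (cb (g z) k) (cb ((fs ! k) z) l))"
      using continuous_map_compose[OF c, of euclidean "\<lambda>(q, c). cube_comp q c"] continuous_on_cube_comp by (simp add: o_def)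
    then have *: "continuous_map T euclidean (\<lambda>z. (cube_comp (cb (g z) k) (cb ((fs ! k) z) l), lb ((fs ! k) z) l))"
      using \<open>continuous_map T euclidean (\<lambda>z. lb ((fs ! k) z) l)\<close>
      unfolding prod_topology_euclidean[symmetric] by (intro continuous_map_pairedI)
    show "continuous_map T euclidean (\<lambda>z. the (csub (g z) (map (\<lambda>f. f z) fs) l))"
    proof (rule continuous_map_eq[OF *])
      fix z assume z: "z \<in> topspace T"
      have "csub (g z) (map (\<lambda>f. f z) fs) l =
        Some (cube_comp (cb (g z) k) (cb (map (\<lambda>f. f z) fs ! k) l), lb (map (\<lambda>f. f z) fs ! k) l)"
        by (rule csub_at[of rk' rk]) (use f Ss[OF z] k fz[OF z] gz[OF z] in simp_all)
      then show "(cube_comp (cb (g z) k) (cb ((fs ! k) z) l), lb ((fs ! k) z) l) = the (csub (g z) (map (\<lambda>f. f z) fs) l)"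
        using k by simp
    qed
  qed
qed

subsection \<open>Evaluation in an algebra\<close>

definition relabel :: "(nat \<Rightarrow> real \<Rightarrow> 'a) \<Rightarrow> conf \<Rightarrow> (nat \<rightharpoonup> cube \<times> 'a)" where
  "relabel \<phi> w = (\<lambda>i. map_option (\<lambda>(c, t). (c, \<phi> i t)) (w i))"

lemma dom_relabel [simp]: "dom (relabel \<phi> w) = dom w" by (auto simp: relabel_def dom_def)
lemma cb_relabel: "i \<in> dom w \<Longrightarrow> cb (relabel \<phi> w) i = cb w i"
  and lb_relabel: "i \<in> dom w \<Longrightarrow> lb (relabel \<phi> w) i = \<phi> i (lb w i)"
  by (auto simp: relabel_def cb_def lb_def)

lemma relabel_subst: "relabel \<phi> (subst w own U) = subst w own (relabel \<phi> U)"
  by (auto simp: relabel_def subst_def fun_eq_iff split: option.split)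

lemma relabel_part: "relabel \<phi> (part own U k) = part own (relabel \<phi> U) k"
  by (auto simp: relabel_def part_def fun_eq_iff)

lemma adm_relabel: "adm w \<Longrightarrow> adm (relabel \<phi> w)"
  unfolding adm_def dom_relabel by (auto simp: cb_relabel)

lemma valid_lb: "valid rk w \<Longrightarrow> i \<in> dom w \<Longrightarrow> lb w i \<in> I1"
  unfolding valid_def by blast

context little_2_cubes_algebra
begin

definition ev :: "(nat \<Rightarrow> real \<Rightarrow> 'a) \<Rightarrow> conf \<Rightarrow> 'a" where
  "ev \<phi> w = act \<theta> (relabel \<phi> w)"

abbreviation evl :: "'a list \<Rightarrow> conf \<Rightarrow> 'a" where
  "evl xs \<equiv> ev (\<lambda>i t. xs ! i)"

lemma adX_relabel:
  assumes "valid rk w" "\<And>i t. i \<in> dom w \<Longrightarrow> t \<in> I1 \<Longrightarrow> \<phi> i t \<in> topspace X"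
  shows "adX (relabel \<phi> w)"
proof -
  have "\<phi> i (lb w i) \<in> topspace X" if "i \<in> dom w" for i
    using assms(2)[OF that valid_lb[OF assms(1) that]] .
  then show ?thesis using adm_relabel[OF valid_adm[OF assms(1)], of \<phi>] by (simp add: lb_relabel)
qed

lemma ev_continuous':
  assumes S: "finite S" and g: "continuous_map T (Wt rk S) g"
    and x: "\<And>i. i \<in> S \<Longrightarrow> continuous_map T X (\<lambda>z. \<phi> z i (lb (g z) i))"
  shows "continuous_map T X (\<lambda>z. ev (\<phi> z) (g z))"
  unfolding ev_def
proof (rule act_continuous[OF S])
  have gz: "dom (g z) = S" "valid rk (g z)" if "z \<in> topspace T" for z
    using g that unfolding continuous_map_Wt by blast+
  show "dom (relabel (\<phi> z) (g z)) = S \<and> adm (relabel (\<phi> z) (g z))" if "z \<in> topspace T" for z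
    using gz[OF that] adm_relabel[OF valid_adm] by simp
  fix i assume i: "i \<in> S"
  have c: "continuous_map T euclidean (\<lambda>z. cb (g z) i)"
    using continuous_map_compose[OF g continuous_map_Wt_cb[OF i]] by (simp add: o_def)
  show "continuous_map T euclidean (\<lambda>z. cb (relabel (\<phi> z) (g z)) i)"
    by (rule continuous_map_eq[OF c]) (use gz i in \<open>simp add: cb_relabel\<close>)
  show "continuous_map T X (\<lambda>z. lb (relabel (\<phi> z) (g z)) i)"
    by (rule continuous_map_eq[OF x[OF i]]) (use gz i in \<open>simp add: lb_relabel\<close>)
qed

lemma ev_continuous:
  assumes S: "finite S" and \<phi>: "\<And>i. i \<in> S \<Longrightarrow> pathin X (\<phi> i)"
  shows "continuous_map (Wt rk S) X (ev \<phi>)"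
proof -
  have "continuous_map (Wt rk S) X (\<lambda>w. ev \<phi> (id w))"
  proof (rule ev_continuous'[OF S continuous_map_id])
    fix i assume i: "i \<in> S"
    have "continuous_map (Wt rk S) (top_of_set I1) (\<lambda>w. lb w i)"
      unfolding continuous_map_in_subtopology
    proof (intro conjI continuous_map_Wt_lb[OF i] funcsetI)
      fix w assume "w \<in> topspace (Wt rk S)"
      then show "lb w i \<in> I1" using valid_lb[of rk w i] i unfolding topspace_Wt by blast
    qed
    from continuous_map_compose[OF this \<phi>[OF i, unfolded pathin_def]]
    show "continuous_map (Wt rk S) X (\<lambda>w. \<phi> i (lb (id w) i))" by (simp add: o_def)
  qed
  then show ?thesis by simp
qed

lemma ev_lifting: "finite S \<Longrightarrow> (\<And>i. i \<in> S \<Longrightarrow> pathin X (\<phi> i)) \<Longrightarrow> lifting X (Wt rk S) (ev \<phi>)"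
  unfolding lifting_def using ev_continuous contractible_Wt by blast

lemma ev_in: "valid rk w \<Longrightarrow> (\<And>i. i \<in> dom w \<Longrightarrow> pathin X (\<phi> i)) \<Longrightarrow> ev \<phi> w \<in> topspace X"
  using continuous_map_image_subset_topspace[OF ev_continuous[of "dom w" \<phi> rk]]
  unfolding topspace_Wt valid_def[of rk w] by (auto simp: valid_def)

lemma ev_csub:
  assumes w: "valid rk' w" and d: "dom w = {..<length us}" and us: "\<And>k. k < length us \<Longrightarrow> valid rk (us ! k)"
    and f: "fits rk' rk (map dom us)" and \<phi>: "\<And>k i. k < length us \<Longrightarrow> i \<in> dom (us ! k) \<Longrightarrow> pathin X (\<phi> i)"
  shows "ev \<phi> (csub w us) = evl (map (ev \<phi>) us) w"
proof -
  let ?U = "relabel \<phi> (merged us)"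
  have p: "part (own_of us) ?U k = relabel \<phi> (us ! k)" if "k < length us" for k
    using part_own_of[OF f that] by (simp flip: relabel_part)
  have "finite (dom u)" if "u \<in> set us" for u
    using that us by (auto simp: in_set_conv_nth valid_def)
  then have fin: "finite (dom ?U)" by (simp add: dom_merged)
  have ad: "adX (part (own_of us) ?U k)" if "k \<in> dom w" for k
  proof -
    have k: "k < length us" using that d by simp
    show ?thesis unfolding p[OF k]
      by (rule adX_relabel[OF us[OF k]]) (use \<phi>[OF k] pathin_topspace in blast)
  qed
  have "ev \<phi> (csub w us) = act \<theta> (subst w (own_of us) ?U)" by (simp add: ev_def csub_def relabel_subst)
  also have "\<dots> = act \<theta> (\<lambda>k. map_option (\<lambda>(q, y). (q, act \<theta> (part (own_of us) ?U k))) (w k))"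
    by (rule act_subst[OF valid_adm[OF w] fin ad])
  also have "(\<lambda>k. map_option (\<lambda>(q, y). (q, act \<theta> (part (own_of us) ?U k))) (w k)) = relabel (\<lambda>i t. map (ev \<phi>) us ! i) w"
  proof
    fix k
    show "map_option (\<lambda>(q, y). (q, act \<theta> (part (own_of us) ?U k))) (w k) = relabel (\<lambda>i t. map (ev \<phi>) us ! i) w k"
    proof (cases "k \<in> dom w")
      case True
      then have "k < length us" using d by simp
      then show ?thesis
        unfolding relabel_def[of "\<lambda>i t. map (ev \<phi>) us ! i"] p[OF \<open>k < length us\<close>] by (simp add: ev_def)
    qed (simp add: relabel_def domIff del: not_None_eq)
  qed
  finally show ?thesis by (simp add: ev_def)
qed

lemma ev_leaf: "\<phi> i t \<in> topspace X \<Longrightarrow> ev \<phi> (leaf i t) = \<phi> i t"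
proof -
  assume *: "\<phi> i t \<in> topspace X"
  have "relabel \<phi> (leaf i t) = [i \<mapsto> (cube_id, \<phi> i t)]" by (auto simp: relabel_def leaf_def fun_eq_iff)
  then show ?thesis using act_leaf[OF *] by (simp add: ev_def)
qed

end

subsection \<open>The lifted monoidal structure\<close>

definition mm :: conf where
  "mm = [0 \<mapsto> (((0, 1/2), (0, 1)), 0), 1 \<mapsto> (((1/2, 1), (0, 1)), 0)]"

definition tn :: "conf \<Rightarrow> conf \<Rightarrow> conf" where
  "tn x y = csub mm [x, y]"

definition sep :: "(nat \<Rightarrow> nat) \<Rightarrow> nat set \<Rightarrow> nat set \<Rightarrow> bool" where
  "sep rk A B \<longleftrightarrow> A \<inter> B = {} \<and> (\<forall>l\<in>A. \<forall>l'\<in>B. rk l \<noteq> rk l' \<or> l < l')"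

definition over :: "(nat \<Rightarrow> nat) \<Rightarrow> nat set \<Rightarrow> nat set \<Rightarrow> bool" where
  "over rk A B \<longleftrightarrow> A \<inter> B = {} \<and> (\<forall>l\<in>A. \<forall>l'\<in>B. rk l < rk l')"

lemma dom_mm: "dom mm = {..<2}"
  by (auto simp: mm_def)

lemma valid_mm: "valid rk mm" if "rk 0 = rk 1"
  using that by (auto simp: valid_def mm_def cb_def lb_def little_cube_iff left_of_def)

lemma fits1: "fits rk' rk [A]"
  by (simp add: fits_def)

lemma fits2: "sep rk A B \<Longrightarrow> fits (\<lambda>_. 0) rk [A, B]"
  by (auto simp: fits_def sep_def less_Suc_eq)

lemma fits2_over: "over rk A B \<Longrightarrow> fits (\<lambda>i. i) rk [A, B]"
  by (auto simp: fits_def over_def less_Suc_eq)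

lemma fits3: "sep rk A B \<Longrightarrow> sep rk A C \<Longrightarrow> sep rk B C \<Longrightarrow> fits (\<lambda>_. 0) rk [A, B, C]"
  by (auto simp: fits_def sep_def less_Suc_eq)

lemma dom_tn [simp]: "dom (tn x y) = dom x \<union> dom y"
  unfolding tn_def by (subst dom_csub) (auto simp: dom_mm)

lemma valid_tn: "valid rk x \<Longrightarrow> valid rk y \<Longrightarrow> sep rk (dom x) (dom y) \<Longrightarrow> valid rk (tn x y)"
  unfolding tn_def
  by (rule valid_csub[OF valid_mm[of "\<lambda>_. 0"]]) (auto simp: dom_mm less_Suc_eq fits2)

lemma csub_tn: "csub (tn x y) us = tn (csub x us) (csub y us)"
  unfolding tn_def csub_csub by simp

definition hid :: "'w \<Rightarrow> real \<Rightarrow> 'w" where "hid x = (\<lambda>t. x)"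
definition hten :: "(real \<Rightarrow> conf) \<Rightarrow> (real \<Rightarrow> conf) \<Rightarrow> real \<Rightarrow> conf" where
  "hten p q = (\<lambda>t. tn (p t) (q t))"

lemma hid_at [simp]: "hid x t = x" and hten_at [simp]: "hten p q t = tn (p t) (q t)"
  and hten_hid [simp]: "hten (hid x) (hid y) = hid (tn x y)"
  by (simp_all add: hid_def hten_def)

definition some_path :: "(nat \<Rightarrow> nat) \<Rightarrow> nat \<Rightarrow> conf \<Rightarrow> conf \<Rightarrow> real \<Rightarrow> conf" where
  "some_path rk n x y = (SOME p. pathin (Wt rk {..<n}) p \<and> p 0 = x \<and> p 1 = y)"

lemma some_path:
  assumes "valid rk x" "valid rk y" "dom x = {..<n}" "dom y = {..<n}"
  shows "pathin (Wt rk {..<n}) (some_path rk n x y)" "some_path rk n x y 0 = x" "some_path rk n x y 1 = y"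
proof -
  have "\<exists>p. pathin (Wt rk {..<n}) p \<and> p 0 = x \<and> p 1 = y"
    using contractible_imp_path_connected_space[OF contractible_Wt] assms
    unfolding path_connected_space_def topspace_Wt by blast
  from someI_ex[OF this] show "pathin (Wt rk {..<n}) (some_path rk n x y)" "some_path rk n x y 0 = x" "some_path rk n x y 1 = y"
    unfolding some_path_def by blast+
qed

abbreviation lf :: "nat \<Rightarrow> conf" where "lf i \<equiv> leaf i 0"

text \<open>The associator, the unit constraints and the braiding.  The first argument of \<open>some_path\<close>
  matters only for the braiding, where it fixes the homotopy class of the half turn.\<close>

definition pA :: "real \<Rightarrow> conf" where
  "pA = some_path (\<lambda>_. 0) 3 (tn (tn (lf 0) (lf 1)) (lf 2)) (tn (lf 0) (tn (lf 1) (lf 2)))"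
definition pL :: "real \<Rightarrow> conf" where
  "pL = some_path (\<lambda>_. 0) 1 (tn Map.empty (lf 0)) (lf 0)"
definition pU :: "real \<Rightarrow> conf" where
  "pU = some_path (\<lambda>_. 0) 1 (tn (lf 0) Map.empty) (lf 0)"
definition pR :: "real \<Rightarrow> conf" where
  "pR = some_path (\<lambda>i. i) 2 (tn (lf 0) (lf 1)) (tn (lf 1) (lf 0))"

lemma valid_lf [simp]: "valid rk (lf i)" by (simp add: valid_leaf)

lemma lessThan_3: "{..<3::nat} = {0, 1, 2}" and lessThan_2: "{..<2::nat} = {0, 1}" and lessThan_1: "{..<1::nat} = {0}"
  by auto

lemma pA: "pathin (Wt (\<lambda>_. 0) {..<3}) pA" "pA 0 = tn (tn (lf 0) (lf 1)) (lf 2)" "pA 1 = tn (lf 0) (tn (lf 1) (lf 2))"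
  unfolding pA_def
  by (rule some_path; auto simp: lessThan_3 sep_def intro!: valid_tn)+

lemma pL: "pathin (Wt (\<lambda>_. 0) {..<1}) pL" "pL 0 = tn Map.empty (lf 0)" "pL 1 = lf 0"
  unfolding pL_def
  by (rule some_path; auto simp: lessThan_1 sep_def valid_empty intro!: valid_tn)+

lemma pU: "pathin (Wt (\<lambda>_. 0) {..<1}) pU" "pU 0 = tn (lf 0) Map.empty" "pU 1 = lf 0"
  unfolding pU_def
  by (rule some_path; auto simp: lessThan_1 sep_def valid_empty intro!: valid_tn)+

lemma pR: "pathin (Wt (\<lambda>i. i) {..<2}) pR" "pR 0 = tn (lf 0) (lf 1)" "pR 1 = tn (lf 1) (lf 0)"
  unfolding pR_def
  by (rule some_path; auto simp: lessThan_2 sep_def intro!: valid_tn)+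

text \<open>The explicit values at the end points hold by definition, even for overlapping label sets.\<close>

definition hpath :: "(real \<Rightarrow> conf) \<Rightarrow> conf list \<Rightarrow> conf
    \<Rightarrow> conf \<Rightarrow> real \<Rightarrow> conf" where
  "hpath p us x y t = (if t = 0 then x else if t = 1 then y else csub (p t) us)"

definition "hA x y z = hpath pA [x, y, z] (tn (tn x y) z) (tn x (tn y z))"
definition "hB x y z = hpath (\<lambda>t. pA (1 - t)) [x, y, z] (tn x (tn y z)) (tn (tn x y) z)"
definition "hL x = hpath pL [x] (tn Map.empty x) x"
definition "hU x = hpath pU [x] (tn x Map.empty) x"
definition "hUb x = hpath (\<lambda>t. pU (1 - t)) [x] x (tn x Map.empty)"
definition "hR x y = hpath pR [x, y] (tn x y) (tn y x)"

lemma hats_ends [simp]: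
  "hA x y z 0 = tn (tn x y) z" "hA x y z 1 = tn x (tn y z)" "hB x y z 0 = tn x (tn y z)" "hB x y z 1 = tn (tn x y) z"
  "hL x 0 = tn Map.empty x" "hL x 1 = x"
  "hU x 0 = tn x Map.empty" "hU x 1 = x" "hUb x 0 = x" "hUb x 1 = tn x Map.empty"
  "hR x y 0 = tn x y" "hR x y 1 = tn y x"
  by (simp_all add: hA_def hB_def hL_def hU_def hUb_def hR_def hpath_def)

lemma csub_lf:
  assumes "fits rk' rk (map dom us)" "k < length us" shows "csub (lf k) us = us ! k"
  by (rule csub_leaf[OF assms])

lemma hpath_csub: "csub (p 0) us = x \<Longrightarrow> csub (p 1) us = y \<Longrightarrow> hpath p us x y = (\<lambda>t. csub (p t) us)"
  by (auto simp: hpath_def fun_eq_iff)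

lemma hA_csub:
  assumes "sep rk (dom x) (dom y)" "sep rk (dom x) (dom z)" "sep rk (dom y) (dom z)"
  shows "hA x y z = (\<lambda>t. csub (pA t) [x, y, z])" "hB x y z = (\<lambda>t. csub (pA (1 - t)) [x, y, z])"
proof -
  have f: "fits (\<lambda>_. 0) rk (map dom [x, y, z])" using fits3[OF assms] by simp
  note l = csub_lf[OF f, of 0] csub_lf[OF f, of 1] csub_lf[OF f, of 2]
  show "hA x y z = (\<lambda>t. csub (pA t) [x, y, z])"
    unfolding hA_def by (rule hpath_csub) (use l in \<open>simp_all add: pA csub_tn\<close>)
  show "hB x y z = (\<lambda>t. csub (pA (1 - t)) [x, y, z])"
    unfolding hB_def by (rule hpath_csub) (use l in \<open>simp_all add: pA csub_tn\<close>)
qed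

lemma hL_csub: "hL x = (\<lambda>t. csub (pL t) [x])"
  and hU_csub: "hU x = (\<lambda>t. csub (pU t) [x])" "hUb x = (\<lambda>t. csub (pU (1 - t)) [x])"
proof -
  have l: "csub (lf 0) [x] = x"
    using csub_lf[of id id "[x]" 0] fits1[of id id "dom x"] by simp
  show "hL x = (\<lambda>t. csub (pL t) [x])"
    "hU x = (\<lambda>t. csub (pU t) [x])" "hUb x = (\<lambda>t. csub (pU (1 - t)) [x])"
    unfolding hL_def hU_def hUb_def
    by (rule hpath_csub; simp add: pL pU csub_tn csub_empty l)+
qed

lemma hR_csub:
  assumes "over rk (dom x) (dom y)"
  shows "hR x y = (\<lambda>t. csub (pR t) [x, y])"
proof -
  have f: "fits (\<lambda>i. i) rk (map dom [x, y])" using fits2_over[OF assms] by simp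
  note l = csub_lf[OF f, of 0] csub_lf[OF f, of 1]
  show "hR x y = (\<lambda>t. csub (pR t) [x, y])"
    unfolding hR_def by (rule hpath_csub; use l in \<open>simp add: pR csub_tn\<close>)
qed

lemma pathin_reverse: "pathin W p \<Longrightarrow> pathin W (\<lambda>t. p (1 - t))"
  unfolding pathin_def by (erule continuous_map_reparam) (auto intro!: continuous_intros)

lemma continuous_csub2:
  assumes p: "continuous_map T (Wt rk' {..<2}) p" and fg: "continuous_map T (Wt rk S) f" "continuous_map T (Wt rk S') g"
    and fits: "fits rk' rk [S, S']"
  shows "continuous_map T (Wt rk (S \<union> S')) (\<lambda>z. csub (p z) [f z, g z])"
proof -
  have "continuous_map T (Wt rk ([S, S'] ! k)) ([f, g] ! k)" if "k < length [f, g]" for k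
    using that fg by (auto simp: less_Suc_eq)
  from continuous_csub[OF _ _ this fits] show ?thesis using p by (simp add: numeral_2_eq_2)
qed

lemma continuous_csub_const:
  assumes "\<And>u. u \<in> set us \<Longrightarrow> valid rk u" "fits rk' rk (map dom us)"
  shows "continuous_map (Wt rk' {..<length us}) (Wt rk (\<Union> (dom ` set us))) (\<lambda>w. csub w us)"
proof -
  let ?T = "Wt rk' {..<length us}"
  have c: "continuous_map ?T (Wt rk (map dom us ! k)) (map (\<lambda>u w. u) us ! k)" if "k < length (map (\<lambda>u (w :: nat \<rightharpoonup> cube \<times> real). u) us)" for k
    using that assms(1)[of "us ! k"] by (auto simp: topspace_Wt)
  have i: "continuous_map ?T (Wt rk' {..<length (map (\<lambda>u (w :: nat \<rightharpoonup> cube \<times> real). u) us)}) (\<lambda>w. w)"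
    by (simp add: continuous_map_id[unfolded id_def])
  from continuous_csub[OF i _ c assms(2)] show ?thesis by (simp add: o_def)
qed

lemma continuous_tn:
  assumes "continuous_map T (Wt rk S) f" "continuous_map T (Wt rk S') g" "sep rk S S'"
  shows "continuous_map T (Wt rk (S \<union> S')) (\<lambda>z. tn (f z) (g z))"
  unfolding tn_def
  by (rule continuous_csub2[OF _ assms(1,2) fits2[OF assms(3)]])
     (use valid_mm[of "\<lambda>_. 0"] in \<open>simp add: topspace_Wt dom_mm\<close>)

definition some_square :: "(nat \<Rightarrow> nat) \<Rightarrow> nat \<Rightarrow> conf \<Rightarrow> (real \<Rightarrow> conf) list
    \<Rightarrow> (real \<Rightarrow> conf) list \<Rightarrow> real \<times> real \<Rightarrow> conf" where
  "some_square rk n w ps qs = (SOME H. square (Wt rk {..<n}) H (pcompw w ps) (pcompw w qs))"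

lemma some_square:
  assumes "chain (Wt rk {..<n}) w ps w'" "chain (Wt rk {..<n}) w qs w'"
  shows "square (Wt rk {..<n}) (some_square rk n w ps qs) (pcompw w ps) (pcompw w qs)"
proof -
  have "\<exists>H. square (Wt rk {..<n}) H (pcompw w ps) (pcompw w qs)"
    by (rule contractible_square[OF contractible_Wt]) (use chain_pcompw[OF assms(1)] chain_pcompw[OF assms(2)] in auto)
  from someI_ex[OF this] show ?thesis unfolding some_square_def .
qed

definition "sqPi = some_square (\<lambda>_. 0) 4 (tn (tn (tn (lf 0) (lf 1)) (lf 2)) (lf 3))
  [hten (hA (lf 0) (lf 1) (lf 2)) (hid (lf 3)), hA (lf 0) (tn (lf 1) (lf 2)) (lf 3), hten (hid (lf 0)) (hA (lf 1) (lf 2) (lf 3))]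
  [hA (tn (lf 0) (lf 1)) (lf 2) (lf 3), hA (lf 0) (lf 1) (tn (lf 2) (lf 3))]"

definition "sqMu = some_square (\<lambda>_. 0) 2 (tn (lf 0) (lf 1))
  [hten (hUb (lf 0)) (hid (lf 1)), hA (lf 0) Map.empty (lf 1), hten (hid (lf 0)) (hL (lf 1))] []"

definition "sqLam = some_square (\<lambda>_. 0) 2 (tn (tn Map.empty (lf 0)) (lf 1))
  [hten (hL (lf 0)) (hid (lf 1))] [hA Map.empty (lf 0) (lf 1), hL (tn (lf 0) (lf 1))]"

definition "sqRho = some_square (\<lambda>_. 0) 2 (tn (lf 0) (lf 1))
  [hten (hid (lf 0)) (hUb (lf 1))] [hUb (tn (lf 0) (lf 1)), hA (lf 0) (lf 1) Map.empty]"

text \<open>Only the label of the object which moves past the two others is in a row of its own.\<close>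

definition rk1 :: "nat \<Rightarrow> nat" where "rk1 i = (if i = 0 then 0 else 1)"
definition rk2 :: "nat \<Rightarrow> nat" where "rk2 i = (if i = 2 then 1 else 0)"

definition "sqR1 = some_square rk1 3 (tn (tn (lf 0) (lf 1)) (lf 2))
  [hten (hR (lf 0) (lf 1)) (hid (lf 2)), hA (lf 1) (lf 0) (lf 2), hten (hid (lf 1)) (hR (lf 0) (lf 2))]
  [hA (lf 0) (lf 1) (lf 2), hR (lf 0) (tn (lf 1) (lf 2)), hA (lf 1) (lf 2) (lf 0)]"

definition "sqR2 = some_square rk2 3 (tn (lf 0) (tn (lf 1) (lf 2)))
  [hten (hid (lf 0)) (hR (lf 1) (lf 2)), hB (lf 0) (lf 2) (lf 1), hten (hR (lf 0) (lf 2)) (hid (lf 1))]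
  [hB (lf 0) (lf 1) (lf 2), hR (tn (lf 0) (lf 1)) (lf 2), hB (lf 2) (lf 0) (lf 1)]"

context little_2_cubes_algebra
begin

abbreviation "BB \<equiv> Pi2 X"

definition mul :: "'a \<Rightarrow> 'a \<Rightarrow> 'a" where "mul x y = evl [x, y] mm"

definition hA3 :: "real \<times> 'a \<times> 'a \<times> 'a \<Rightarrow> 'a" where "hA3 = (\<lambda>(u, x, y, z). evl [x, y, z] (pA u))"
definition hL1 :: "real \<times> 'a \<Rightarrow> 'a" where "hL1 = (\<lambda>(u, x). evl [x] (pL u))"
definition hU1 :: "real \<times> 'a \<Rightarrow> 'a" where "hU1 = (\<lambda>(u, x). evl [x] (pU u))"
definition hR2 :: "real \<times> 'a \<times> 'a \<Rightarrow> 'a" where "hR2 = (\<lambda>(u, x, y). evl [x, y] (pR u))"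

definition MM :: "('a, real \<Rightarrow> 'a, (real \<times> real \<Rightarrow> 'a) set) monoidal_data" where
  "MM = \<lparr>Tensor = op_pf X mul, Unit = evl [] Map.empty,
    AssocE = homotopy_equiv X hA3 (\<lambda>x. x) (\<lambda>(f, g, h) t. (f t, g t, h t)),
    LUnitE = homotopy_equiv X hL1 (\<lambda>x. x) (\<lambda>f. f),
    RUnitE = homotopy_equiv X hU1 (\<lambda>x. x) (\<lambda>f. f),
    PiM = (\<lambda>x y z w. sqclass X (\<lambda>s. evl [x, y, z, w] (sqPi s))),
    MuM = (\<lambda>x y. sqclass X (\<lambda>s. evl [x, y] (sqMu s))),
    LambdaM = (\<lambda>x y. sqclass X (\<lambda>s. evl [x, y] (sqLam s))),
    RhoM = (\<lambda>x y. sqclass X (\<lambda>s. evl [x, y] (sqRho s)))\<rparr>"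

definition SS :: "('a, real \<Rightarrow> 'a, (real \<times> real \<Rightarrow> 'a) set) braiding_data" where
  "SS = \<lparr>BraidE = homotopy_equiv X hR2 (\<lambda>x. x) (\<lambda>(f, g) t. (f t, g t)),
    Braid1 = (\<lambda>x y z. sqclass X (\<lambda>s. evl [x, y, z] (sqR1 s))),
    Braid2 = (\<lambda>x y z. sqclass X (\<lambda>s. evl [x, y, z] (sqR2 s)))\<rparr>"

lemma Tensor_MM: "Tensor MM = op_pf X mul" by (simp add: MM_def)

lemma mul_continuous: "continuous_map (prod_topology X X) X (\<lambda>(x, y). mul x y)"
proof -
  have "continuous_map (prod_topology X X) X (\<lambda>z. ev (\<lambda>i t. [fst z, snd z] ! i) mm)"
  proof (rule ev_continuous'[of "{..<2}" _ "\<lambda>_. 0"])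
    show "continuous_map (prod_topology X X) (Wt (\<lambda>_. 0) {..<2}) (\<lambda>z. mm)"
      using valid_mm[of "\<lambda>_. 0"] by (simp add: topspace_Wt dom_mm)
    show "continuous_map (prod_topology X X) X (\<lambda>z. [fst z, snd z] ! i)" if "i \<in> {..<2}" for i
      using that by (auto simp: less_Suc_eq numeral_2_eq_2 continuous_map_fst continuous_map_snd)
  qed simp
  then show ?thesis by (simp add: mul_def case_prod_unfold)
qed

lemma ev_tn:
  assumes "valid rk w" "valid rk v" "sep rk (dom w) (dom v)" and \<phi>: "\<And>i. i \<in> dom w \<union> dom v \<Longrightarrow> pathin X (\<phi> i)"
  shows "ev \<phi> (tn w v) = mul (ev \<phi> w) (ev \<phi> v)"
proof -
  have m: "valid (\<lambda>_. 0) mm" "dom mm = {..<length [w, v]}" using valid_mm by (simp_all add: dom_mm)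
  have u: "valid rk ([w, v] ! k)" if "k < length [w, v]" for k
    using that assms(1,2) by (auto simp: less_Suc_eq)
  have p: "pathin X (\<phi> i)" if "k < length [w, v]" "i \<in> dom ([w, v] ! k)" for k i
    using that by (intro \<phi>) (auto simp: less_Suc_eq)
  have f: "fits (\<lambda>_. 0) rk (map dom [w, v])" using fits2[OF assms(3)] by simp
  show ?thesis unfolding tn_def mul_def using ev_csub[OF m u f p] by simp
qed

lemma ev_empty: "ev \<phi> Map.empty = Unit MM"
proof -
  have "relabel \<phi> Map.empty = relabel \<psi> Map.empty" for \<psi> :: "nat \<Rightarrow> real \<Rightarrow> 'a"
    unfolding relabel_def by simp
  then have "relabel \<phi> Map.empty = relabel (\<lambda>i t. [] ! i) Map.empty" .
  then show ?thesis unfolding MM_def ev_def monoidal_data.simps by (rule arg_cong)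
qed

lemma Unit_in: "Unit MM \<in> topspace X"
  using ev_in[OF valid_empty, of undefined] ev_empty by auto

lemma evl_lf: "i < length xs \<Longrightarrow> set xs \<subseteq> topspace X \<Longrightarrow> evl xs (lf i) = xs ! i"
  by (rule ev_leaf) (use nth_mem in blast)

lemma evl_tn:
  assumes "valid rk w" "valid rk v" "sep rk (dom w) (dom v)" "dom w \<union> dom v \<subseteq> {..<length xs}" "set xs \<subseteq> topspace X"
  shows "evl xs (tn w v) = mul (evl xs w) (evl xs v)"
proof (rule ev_tn[OF assms(1-3)])
  fix i assume "i \<in> dom w \<union> dom v"
  then have "xs ! i \<in> topspace X" using assms(4,5) nth_mem by blast
  then show "pathin X (\<lambda>t. xs ! i)" by (simp add: pathin_const)
qed

lemma hA3_ends:
  assumes "x \<in> topspace X" "y \<in> topspace X" "z \<in> topspace X"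
  shows "hA3 (0, x, y, z) = mul (mul x y) z" "hA3 (1, x, y, z) = mul x (mul y z)"
  using assms unfolding hA3_def
  by (auto simp: pA evl_tn[where rk = "\<lambda>_. 0"] evl_lf valid_tn sep_def)

lemma hL1_ends: "x \<in> topspace X \<Longrightarrow> hL1 (0, x) = mul (Unit MM) x" "x \<in> topspace X \<Longrightarrow> hL1 (1, x) = x"
  unfolding hL1_def by (auto simp: pL evl_tn[where rk = "\<lambda>_. 0"] evl_lf valid_tn sep_def valid_empty ev_empty)

lemma hU1_ends: "x \<in> topspace X \<Longrightarrow> hU1 (0, x) = mul x (Unit MM)" "x \<in> topspace X \<Longrightarrow> hU1 (1, x) = x"
  unfolding hU1_def by (auto simp: pU evl_tn[where rk = "\<lambda>_. 0"] evl_lf valid_tn sep_def valid_empty ev_empty)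

lemma hR2_ends:
  assumes "x \<in> topspace X" "y \<in> topspace X"
  shows "hR2 (0, x, y) = mul x y" "hR2 (1, x, y) = mul y x"
  using assms unfolding hR2_def
  by (auto simp: pR evl_tn[where rk = "\<lambda>i. i"] evl_lf valid_tn sep_def)

lemma evl_path_continuous:
  assumes p: "pathin (Wt rk {..<n}) p" and u: "continuous_map T (top_of_set I1) u"
    and x: "\<And>i. i < n \<Longrightarrow> continuous_map T X (\<lambda>z. xs z ! i)"
  shows "continuous_map T X (\<lambda>z. evl (xs z) (p (u z)))"
proof (rule ev_continuous')
  show "continuous_map T (Wt rk {..<n}) (\<lambda>z. p (u z))"
    using continuous_map_compose[OF u p[unfolded pathin_def]] by (simp add: o_def)
qed (use x in simp_all)

abbreviation "X3 \<equiv> prod_topology X (prod_topology X X)"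

lemma hA3_continuous: "continuous_map (prod_topology (top_of_set I1) X3) X hA3"
proof -
  let ?T = "prod_topology (top_of_set I1) X3"
  have "continuous_map ?T X (\<lambda>v. evl [fst (snd v), fst (snd (snd v)), snd (snd (snd v))] (pA (fst v)))"
  proof (rule evl_path_continuous[OF pA(1)])
    have s: "continuous_map ?T X3 snd" by (rule continuous_map_snd)
    have "continuous_map ?T X (fst \<circ> snd)" "continuous_map ?T X (fst \<circ> (snd \<circ> snd))" "continuous_map ?T X (snd \<circ> (snd \<circ> snd))"
      by (rule continuous_map_compose[OF s continuous_map_fst]
          continuous_map_compose[OF continuous_map_compose[OF s continuous_map_snd] continuous_map_fst]
          continuous_map_compose[OF continuous_map_compose[OF s continuous_map_snd] continuous_map_snd])+
    then show "continuous_map ?T X (\<lambda>v. [fst (snd v), fst (snd (snd v)), snd (snd (snd v))] ! i)" if "i < 3" for i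
      using that by (auto simp: numeral_3_eq_3 less_Suc_eq o_def)
  qed (rule continuous_map_fst)
  then show ?thesis by (simp add: hA3_def case_prod_unfold)
qed

lemma hR2_continuous: "continuous_map (prod_topology (top_of_set I1) (prod_topology X X)) X hR2"
proof -
  let ?T = "prod_topology (top_of_set I1) (prod_topology X X)"
  have "continuous_map ?T X (\<lambda>v. evl [fst (snd v), snd (snd v)] (pR (fst v)))"
  proof (rule evl_path_continuous[OF pR(1)])
    have s: "continuous_map ?T (prod_topology X X) snd" by (rule continuous_map_snd)
    have "continuous_map ?T X (fst \<circ> snd)" "continuous_map ?T X (snd \<circ> snd)"
      by (rule continuous_map_compose[OF s continuous_map_fst] continuous_map_compose[OF s continuous_map_snd])+
    then show "continuous_map ?T X (\<lambda>v. [fst (snd v), snd (snd v)] ! i)" if "i < 2" for i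
      using that by (auto simp: numeral_2_eq_2 less_Suc_eq o_def)
  qed (rule continuous_map_fst)
  then show ?thesis by (simp add: hR2_def case_prod_unfold)
qed

lemma hLU_continuous:
  "continuous_map (prod_topology (top_of_set I1) X) X hL1" "continuous_map (prod_topology (top_of_set I1) X) X hU1"
proof -
  let ?T = "prod_topology (top_of_set I1) X"
  have "continuous_map ?T X (\<lambda>v. evl [snd v] (pL (fst v)))"
    by (rule evl_path_continuous[OF pL(1) continuous_map_fst]) (simp add: continuous_map_snd)
  then show "continuous_map ?T X hL1" by (simp add: hL1_def case_prod_unfold)
  have "continuous_map ?T X (\<lambda>v. evl [snd v] (pU (fst v)))"
    by (rule evl_path_continuous[OF pU(1) continuous_map_fst]) (simp add: continuous_map_snd)
  then show "continuous_map ?T X hU1" by (simp add: hU1_def case_prod_unfold)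
qed

abbreviation "B2' \<equiv> BB \<times>\<^sub>b BB"
abbreviation "B3' \<equiv> BB \<times>\<^sub>b (BB \<times>\<^sub>b BB)"
abbreviation "lbrM \<equiv> monoidal_structure.lbr BB MM"
abbreviation "rbrM \<equiv> monoidal_structure.rbr BB MM"
abbreviation "tenlM \<equiv> monoidal_structure.tenl BB MM"
abbreviation "tenrM \<equiv> monoidal_structure.tenr BB MM"
abbreviation "swpM \<equiv> pf_comp BB (Tensor MM) (pf_swap BB)"

lemma bicat: "bicategory BB" "bicategory B2'" "bicategory B3'" "bicategory (B2' \<times>\<^sub>b BB)"
  by (intro bicategory_prod bicategory_Pi2)+

lemma strict_Tensor: "strict_pf B2' BB (Tensor MM)"
  unfolding Tensor_MM by (rule strict_pf_op[OF mul_continuous])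

lemma bicat_VComp_id: "bicategory C \<Longrightarrow> in2 C \<alpha> f g \<Longrightarrow> VComp C \<alpha> (Id2 C f) = \<alpha>"
  by (simp add: bicategory.VComp_id)

lemmas strict_comp = strict_pf_comp[OF _ _ _ bicat_VComp_id bicategory.Id2_in]

lemma strict_lbr: "strict_pf B3' BB lbrM"
  unfolding monoidal_structure.lbr_def
  by (rule strict_comp[OF strict_comp[OF strict_pf_reassoc strict_pf_prod[OF strict_Tensor strict_pf_id]] strict_Tensor])
     (rule bicat | assumption)+

lemma strict_rbr: "strict_pf B3' BB rbrM"
  unfolding monoidal_structure.rbr_def
  by (rule strict_comp[OF strict_pf_prod[OF strict_pf_id strict_Tensor] strict_Tensor]) (rule bicat | assumption)+

lemma strict_ten: "A \<in> topspace X \<Longrightarrow> strict_pf BB BB (tenlM A)" "A \<in> topspace X \<Longrightarrow> strict_pf BB BB (tenrM A)"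
  unfolding monoidal_structure.tenl_def monoidal_structure.tenr_def
  by (rule strict_comp[OF strict_pf_pair(1) strict_Tensor] strict_comp[OF strict_pf_pair(2) strict_Tensor];
     (rule bicat | assumption)+)+

lemma strict_swp: "strict_pf B2' BB swpM"
  by (rule strict_comp[OF strict_pf_swap strict_Tensor]) (rule bicat | assumption)+

lemma F0_MM: "F0 (Tensor MM) (x, y) = mul x y" "F0 lbrM (x, y, z) = mul (mul x y) z" "F0 rbrM (x, y, z) = mul x (mul y z)"
  "F0 swpM (x, y) = mul y x" "F0 (tenlM A) x = mul A x" "F0 (tenrM A) x = mul x A"
  by (simp_all add: Tensor_MM monoidal_structure.lbr_def monoidal_structure.rbr_def monoidal_structure.tenl_def
      monoidal_structure.tenr_def pf_comp_def pf_prod_def pf_id_def pf_reassoc_def pf_swap_def pf_pairl_def pf_pairr_def)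

lemma F1_MM: "F1 (Tensor MM) (f, g) = (\<lambda>t\<in>I1. mul (f t) (g t))"
  "F1 lbrM (f, g, h) = F1 (Tensor MM) (F1 (Tensor MM) (f, g), h)"
  "F1 rbrM (f, g, h) = F1 (Tensor MM) (f, F1 (Tensor MM) (g, h))"
  "F1 swpM (f, g) = F1 (Tensor MM) (g, f)" "F1 (tenlM A) f = F1 (Tensor MM) (Id1 BB A, f)"
  "F1 (tenrM A) f = F1 (Tensor MM) (f, Id1 BB A)"
  by (simp_all add: Tensor_MM monoidal_structure.lbr_def monoidal_structure.rbr_def monoidal_structure.tenl_def
      monoidal_structure.tenr_def pf_comp_def pf_prod_def pf_id_def pf_reassoc_def pf_swap_def pf_pairl_def pf_pairr_def)

lemma F2_MM: "F2 lbrM (\<alpha>, \<beta>, \<gamma>) = F2 (Tensor MM) (F2 (Tensor MM) (\<alpha>, \<beta>), \<gamma>)"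
  "F2 rbrM (\<alpha>, \<beta>, \<gamma>) = F2 (Tensor MM) (\<alpha>, F2 (Tensor MM) (\<beta>, \<gamma>))"
  "F2 swpM (\<alpha>, \<beta>) = F2 (Tensor MM) (\<beta>, \<alpha>)" "F2 (tenlM A) \<alpha> = F2 (Tensor MM) (Id2 BB (Id1 BB A), \<alpha>)"
  "F2 (tenrM A) \<alpha> = F2 (Tensor MM) (\<alpha>, Id2 BB (Id1 BB A))"
  by (simp_all add: Tensor_MM monoidal_structure.lbr_def monoidal_structure.rbr_def monoidal_structure.tenl_def
      monoidal_structure.tenr_def pf_comp_def pf_prod_def pf_id_def pf_reassoc_def pf_swap_def pf_pairl_def pf_pairr_def)

lemma F2_sqclass: "square X H p q \<Longrightarrow> square X K p' q' \<Longrightarrow>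
  F2 (Tensor MM) (sqclass X H, sqclass X K) = sqclass X (\<lambda>z. mul (H z) (K z))"
  unfolding Tensor_MM by (rule op_F2_sqclass[OF mul_continuous])

lemma square_mul: "square X H p q \<Longrightarrow> square X K p' q' \<Longrightarrow>
  square X (\<lambda>z. mul (H z) (K z)) (\<lambda>t. mul (p t) (p' t)) (\<lambda>t. mul (q t) (q' t))"
  by (rule square_op[OF mul_continuous])

lemma homotopy_A: "homotopy_pf X X3 hA3 B3' (\<lambda>x. x) (\<lambda>(f, g, h) t. (f t, g t, h t)) lbrM rbrM"
proof (intro homotopy_pf.intro, unfold split_paired_all in1_prod in2_prod prod_bicat_simps, goal_cases)
  case (8 f g h x y z x' y' z' f' g' h' x'' y'' z'' t)
  then show ?case by (auto simp: path_concat_pcat1 pcat1_def)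
next
  case (9 \<alpha> \<beta> \<gamma> f g h f' g' h')
  obtain H where H: "square X H f f'" "\<alpha> = sqclass X H" using 9 in2_Pi2_hrep by blast
  obtain K where K: "square X K g g'" "\<beta> = sqclass X K" using 9 in2_Pi2_hrep by blast
  obtain L where L: "square X L h h'" "\<gamma> = sqclass X L" using 9 in2_Pi2_hrep by blast
  have t: "H s \<in> topspace X" "K s \<in> topspace X" "L s \<in> topspace X" if "s \<in> I2" for s
    using square_in_topspace H(1) K(1) L(1) that by blast+
  have "F2 lbrM (\<alpha>, \<beta>, \<gamma>) = sqclass X (\<lambda>z. hA3 (0, H z, K z, L z))"
    unfolding F2_MM H(2) K(2) L(2) F2_sqclass[OF H(1) K(1)] F2_sqclass[OF square_mul[OF H(1) K(1)] L(1)]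
    by (rule sqclass_cong) (simp only: hA3_ends t)
  moreover have "F2 rbrM (\<alpha>, \<beta>, \<gamma>) = sqclass X (\<lambda>z. hA3 (1, H z, K z, L z))"
    unfolding F2_MM H(2) K(2) L(2) F2_sqclass[OF K(1) L(1)] F2_sqclass[OF H(1) square_mul[OF K(1) L(1)]]
    by (rule sqclass_cong) (simp only: hA3_ends t)
  moreover have "square X3 (\<lambda>z. (H z, K z, L z)) (\<lambda>t. (f t, g t, h t)) (\<lambda>t. (f' t, g' t, h' t))"
    by (intro square_pair H(1) K(1) L(1))
  ultimately show ?case unfolding prod.case by blast
next
  case (11 f g h)
  then have "f t \<in> topspace X" "g t \<in> topspace X" "h t \<in> topspace X" if "t \<in> I1" for t
    using that pathin_topspace by (auto simp: paths_def)
  then show ?case by (auto simp: F1_MM push_def fun_eq_iff hA3_ends)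
qed (use hA3_continuous bicat strict_lbr strict_rbr hA3_ends in \<open>auto simp: in1_Pi2 pathin_def F0_MM intro: continuous_map_pairedI\<close>)

lemma homotopy_R: "homotopy_pf X (prod_topology X X) hR2 B2' (\<lambda>x. x) (\<lambda>(f, g) t. (f t, g t)) (Tensor MM) swpM"
proof (intro homotopy_pf.intro, unfold split_paired_all in1_prod in2_prod prod_bicat_simps, goal_cases)
  case (8 f g x y x' y' f' g' x'' y'' t)
  then show ?case by (auto simp: path_concat_pcat1 pcat1_def)
next
  case (9 \<alpha> \<beta> f g f' g')
  obtain H where H: "square X H f f'" "\<alpha> = sqclass X H" using 9 in2_Pi2_hrep by blast
  obtain K where K: "square X K g g'" "\<beta> = sqclass X K" using 9 in2_Pi2_hrep by blast
  have t: "H s \<in> topspace X" "K s \<in> topspace X" if "s \<in> I2" for s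
    using square_in_topspace H(1) K(1) that by blast+
  have "F2 (Tensor MM) (\<alpha>, \<beta>) = sqclass X (\<lambda>z. hR2 (0, H z, K z))"
    unfolding H(2) K(2) F2_sqclass[OF H(1) K(1)] by (rule sqclass_cong) (simp only: hR2_ends t)
  moreover have "F2 swpM (\<alpha>, \<beta>) = sqclass X (\<lambda>z. hR2 (1, H z, K z))"
    unfolding F2_MM H(2) K(2) F2_sqclass[OF K(1) H(1)] by (rule sqclass_cong) (simp only: hR2_ends t)
  moreover have "square (prod_topology X X) (\<lambda>z. (H z, K z)) (\<lambda>t. (f t, g t)) (\<lambda>t. (f' t, g' t))"
    by (intro square_pair H(1) K(1))
  ultimately show ?case unfolding prod.case by blast
next
  case (11 f g)
  then have "f t \<in> topspace X" "g t \<in> topspace X" if "t \<in> I1" for t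
    using that pathin_topspace by (auto simp: paths_def)
  then show ?case by (auto simp: F1_MM push_def fun_eq_iff hR2_ends)
qed (use hR2_continuous bicat strict_Tensor strict_swp hR2_ends in \<open>auto simp: in1_Pi2 pathin_def F0_MM intro: continuous_map_pairedI\<close>)

lemma square_Unit: "square X (\<lambda>(s, t). (\<lambda>t\<in>I1. Unit MM) t) (\<lambda>t\<in>I1. Unit MM) (\<lambda>t\<in>I1. Unit MM)"
  by (rule square_const[OF pathin_const_restrict[OF Unit_in]])

lemma F2_pf_id: "F0 (pf_id B) x = x" "F1 (pf_id B) f = f" "F2 (pf_id B) \<alpha> = \<alpha>"
  by (simp_all add: pf_id_def)

lemma homotopy_L: "homotopy_pf X X hL1 BB (\<lambda>x. x) (\<lambda>f. f) (tenlM (Unit MM)) (pf_id BB)"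
proof (intro homotopy_pf.intro, goal_cases)
  case (8 f x y g z t)
  then show ?case by (simp add: path_concat_pcat1)
next
  case (9 \<alpha> f g)
  obtain H where H: "square X H f g" "\<alpha> = sqclass X H" using 9 in2_Pi2_hrep by blast
  have t: "H s \<in> topspace X" if "s \<in> I2" for s using square_in_topspace H(1) that by blast
  have "F2 (tenlM (Unit MM)) \<alpha> = sqclass X (\<lambda>z. hL1 (0, H z))"
    unfolding F2_MM H(2) Pi2_simps F2_sqclass[OF square_Unit H(1)]
    by (rule sqclass_cong) (use hL1_ends(1) t in auto)
  moreover have "F2 (pf_id BB) \<alpha> = sqclass X (\<lambda>z. hL1 (1, H z))"
    unfolding F2_pf_id H(2) by (rule sqclass_cong) (simp only: hL1_ends t)
  ultimately show ?case using H(1) by blast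
next
  case (11 f)
  then have "f t \<in> topspace X" "f \<in> extensional I1" if "t \<in> I1" for t
    using that pathin_topspace by (auto simp: paths_def)
  with 11 show ?case by (auto simp: F1_MM F2_pf_id push_def fun_eq_iff hL1_ends paths_def extensional_def)
qed (use hLU_continuous bicat strict_ten[OF Unit_in] strict_pf_id hL1_ends in \<open>auto simp: in1_Pi2 F0_MM F2_pf_id\<close>)

lemma homotopy_U: "homotopy_pf X X hU1 BB (\<lambda>x. x) (\<lambda>f. f) (tenrM (Unit MM)) (pf_id BB)"
proof (intro homotopy_pf.intro, goal_cases)
  case (8 f x y g z t)
  then show ?case by (simp add: path_concat_pcat1)
next
  case (9 \<alpha> f g)
  obtain H where H: "square X H f g" "\<alpha> = sqclass X H" using 9 in2_Pi2_hrep by blast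
  have t: "H s \<in> topspace X" if "s \<in> I2" for s using square_in_topspace H(1) that by blast
  have "F2 (tenrM (Unit MM)) \<alpha> = sqclass X (\<lambda>z. hU1 (0, H z))"
    unfolding F2_MM H(2) Pi2_simps F2_sqclass[OF H(1) square_Unit]
    by (rule sqclass_cong) (use hU1_ends(1) t in auto)
  moreover have "F2 (pf_id BB) \<alpha> = sqclass X (\<lambda>z. hU1 (1, H z))"
    unfolding F2_pf_id H(2) by (rule sqclass_cong) (simp only: hU1_ends t)
  ultimately show ?case using H(1) by blast
next
  case (11 f)
  then have "f t \<in> topspace X" "f \<in> extensional I1" if "t \<in> I1" for t
    using that pathin_topspace by (auto simp: paths_def)
  with 11 show ?case by (auto simp: F1_MM F2_pf_id push_def fun_eq_iff hU1_ends paths_def extensional_def)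
qed (use hLU_continuous bicat strict_ten[OF Unit_in] strict_pf_id hU1_ends in \<open>auto simp: in1_Pi2 F0_MM F2_pf_id\<close>)

end

lemma pcell_lift_cong:
  assumes K: "pcell_lift X W \<Psi> K w ps qs"
    and ps: "list_all2 (\<lambda>p p'. \<forall>t\<in>I1. p t = p' t) ps ps'" and qs: "list_all2 (\<lambda>p p'. \<forall>t\<in>I1. p t = p' t) qs qs'"
  shows "pcell_lift X W \<Psi> K w ps' qs'"
proof -
  have *: "chain W w ps' w' \<and> map (push \<Psi>) ps' = map (push \<Psi>) ps \<and> (\<forall>t\<in>I1. pcompw w ps t = pcompw w ps' t)"
    if "chain W w ps w'" "list_all2 (\<lambda>p p'. \<forall>t\<in>I1. p t = p' t) ps ps'" for w w' ps ps'
    using that(2,1)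
  proof (induction arbitrary: w rule: list_all2_induct)
    case (Cons p ps p' ps')
    have e: "p t = p' t" if "t \<in> I1" for t using Cons.hyps that by blast
    have e01: "p 0 = p' 0" "p 1 = p' 1" using e by simp_all
    have "pathin W p'" using pathin_cong[of W p p'] Cons.prems e by simp
    moreover have "push \<Psi> p = push \<Psi> p'" using e by (auto simp: push_def fun_eq_iff)
    moreover have "pcompw w (p # ps) t = pcompw w (p' # ps') t" if t: "t \<in> I1" for t
    proof (cases "ps = []")
      case True
      then show ?thesis using Cons.hyps e[OF t] by simp
    next
      case False
      then have "ps' \<noteq> []" using Cons.hyps by auto
      have IH: "pcompw (p 1) ps t = pcompw (p 1) ps' t" if "t \<in> I1" for t
        using Cons.IH[of "p 1"] Cons.prems that by simp
      show ?thesis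
        unfolding pcompw_append_ne[OF False] pcompw_append_ne[OF \<open>ps' \<noteq> []\<close>] pcat1_def
        using e[of "2 * t"] IH[of "2 * t - 1"] t e01 by simp
    qed
    ultimately show ?case using Cons.IH[of "p 1"] Cons.prems e01 by simp
  qed simp
  note K = pcell_liftD[OF K]
  note P = *[OF K(1) ps] and Q = *[OF K(2) qs]
  show ?thesis
    by (rule pcell_liftI[where w' = "wend w ps"]) (use P Q K in \<open>auto intro: cell_lift_cong[OF K(7)]\<close>)
qed

fun linked :: "'w \<Rightarrow> (real \<Rightarrow> 'w) list \<Rightarrow> bool" where
  "linked w [] \<longleftrightarrow> True"
| "linked w (p # ps) \<longleftrightarrow> p 0 = w \<and> linked (p 1) ps"

sublocale little_2_cubes_algebra \<subseteq> S: braided_structure "Pi2 X" MM SS .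

lemma (in little_2_cubes_algebra) MM_sel: "AssocE MM = homotopy_equiv X hA3 (\<lambda>x. x) (\<lambda>(f, g, h) t. (f t, g t, h t))"
  "LUnitE MM = homotopy_equiv X hL1 (\<lambda>x. x) (\<lambda>f. f)" "RUnitE MM = homotopy_equiv X hU1 (\<lambda>x. x) (\<lambda>f. f)"
  "PiM MM x y z w = sqclass X (\<lambda>s. evl [x, y, z, w] (sqPi s))" "MuM MM x y = sqclass X (\<lambda>s. evl [x, y] (sqMu s))"
  "LambdaM MM x y = sqclass X (\<lambda>s. evl [x, y] (sqLam s))" "RhoM MM x y = sqclass X (\<lambda>s. evl [x, y] (sqRho s))"
  and SS_sel: "BraidE SS = homotopy_equiv X hR2 (\<lambda>x. x) (\<lambda>(f, g) t. (f t, g t))"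
  "Braid1 SS x y z = sqclass X (\<lambda>s. evl [x, y, z] (sqR1 s))" "Braid2 SS x y z = sqclass X (\<lambda>s. evl [x, y, z] (sqR2 s))"
  by (simp_all add: MM_def SS_def)

text \<open>Objects, paths and pasting cells of \<open>\<Pi>\<^sub>2 X\<close> which are the images under \<open>ev \<phi>\<close> of configurations
  with labels in \<open>S\<close>.  The rules below compute such lifts by resolution, so that each axiom
  reduces to the comparison of two lists of paths.\<close>

locale lifted = little_2_cubes_algebra X \<theta>
  for X :: "'a topology" and \<theta> :: "nat \<Rightarrow> (nat \<Rightarrow> cube) \<Rightarrow> (nat \<Rightarrow> 'a) \<Rightarrow> 'a" +
  fixes rk :: "nat \<Rightarrow> nat" and \<phi> :: "nat \<Rightarrow> real \<Rightarrow> 'a" and S :: "nat set"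
  assumes finite_S: "finite S" and \<phi>: "i \<in> S \<Longrightarrow> pathin X (\<phi> i)"
begin

definition ob_lifted :: "'a \<Rightarrow> conf \<Rightarrow> bool" where
  "ob_lifted A w \<longleftrightarrow> valid rk w \<and> dom w \<subseteq> S \<and> A = ev \<phi> w"

definition path_lifted :: "(real \<Rightarrow> 'a) \<Rightarrow> (real \<Rightarrow> conf) \<Rightarrow> bool" where
  "path_lifted F p \<longleftrightarrow> dom (p 0) \<subseteq> S \<and> pathin (Wt rk (dom (p 0))) p \<and> F = push (ev \<phi>) p"

definition pcell_lifted :: "('a, real \<Rightarrow> 'a, (real \<times> real \<Rightarrow> 'a) set) pcell \<Rightarrow> conf
    \<Rightarrow> (real \<Rightarrow> conf) list \<Rightarrow> (real \<Rightarrow> conf) list \<Rightarrow> bool" where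
  "pcell_lifted K w ps qs \<longleftrightarrow> dom w \<subseteq> S \<and> pcell_lift X (Wt rk (dom w)) (ev \<phi>) K w ps qs"

lemma lifting: "D \<subseteq> S \<Longrightarrow> lifting X (Wt rk D) (ev \<phi>)"
  by (rule ev_lifting) (use finite_S \<phi> in \<open>auto dest: finite_subset\<close>)

lemma continuous_ev: "D \<subseteq> S \<Longrightarrow> continuous_map (Wt rk D) X (ev \<phi>)"
  using lifting by (simp add: lifting_def)

lemma ob_liftedD: "ob_lifted A w \<Longrightarrow> valid rk w" "ob_lifted A w \<Longrightarrow> dom w \<subseteq> S" "ob_lifted A w \<Longrightarrow> A = ev \<phi> w"
  by (simp_all add: ob_lifted_def)

lemma ob_lifted_topspace: "ob_lifted A w \<Longrightarrow> A \<in> topspace X"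
  unfolding ob_lifted_def by (metis ev_in \<phi> subsetD)

lemma path_liftedD:
  assumes "path_lifted F p"
  shows "dom (p 0) \<subseteq> S" "pathin (Wt rk (dom (p 0))) p" "F = push (ev \<phi>) p"
    "t \<in> I1 \<Longrightarrow> valid rk (p t)" "t \<in> I1 \<Longrightarrow> dom (p t) = dom (p 0)"
  using assms pathin_topspace[of "Wt rk (dom (p 0))" p t] unfolding path_lifted_def topspace_Wt by auto

lemma path_liftedI: "pathin (Wt rk D) p \<Longrightarrow> D \<subseteq> S \<Longrightarrow> F = push (ev \<phi>) p \<Longrightarrow> path_lifted F p"
  using pathin_topspace[of "Wt rk D" p 0] unfolding path_lifted_def topspace_Wt by auto

lemma path_lifted_at: "path_lifted F p \<Longrightarrow> t \<in> I1 \<Longrightarrow> ob_lifted (F t) (p t)"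
  unfolding ob_lifted_def using path_liftedD(1-3)[of F p] path_liftedD(4,5)[of F p t] by (auto simp: push_def)

lemma path_lifted_in1: "path_lifted F p \<Longrightarrow> in1 (Pi2 X) F (F 0) (F 1)"
  unfolding in1_Pi2 using path_liftedD(1-3)[of F p] pathin_push[OF continuous_ev] by (auto simp: push_def)

lemma ob_lifted_I: "ob_lifted (Unit MM) Map.empty"
  by (simp add: ob_lifted_def valid_empty ev_empty)

lemma ev_ten:
  assumes "valid rk u" "valid rk w" "sep rk (dom u) (dom w)" "dom u \<subseteq> S" "dom w \<subseteq> S"
  shows "ev \<phi> (tn u w) = mul (ev \<phi> u) (ev \<phi> w)"
  by (rule ev_tn[OF assms(1-3)], rule \<phi>) (use assms(4,5) in blast)

lemma ob_lifted_ten: "ob_lifted A u \<Longrightarrow> ob_lifted B w \<Longrightarrow> sep rk (dom u) (dom w) \<Longrightarrow> ob_lifted (F0 (Tensor MM) (A, B)) (tn u w)"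
  unfolding F0_MM ob_lifted_def using ev_ten[of u w] valid_tn[of rk u w] by simp

lemma path_lifted_id: "ob_lifted A u \<Longrightarrow> path_lifted (Id1 (Pi2 X) A) (hid u)"
  unfolding path_lifted_def ob_lifted_def by (auto simp: hid_def push_def topspace_Wt)

lemma path_lifted_ten:
  assumes p: "path_lifted F p" and q: "path_lifted G q" and s: "sep rk (dom (p 0)) (dom (q 0))"
  shows "path_lifted (F1 (Tensor MM) (F, G)) (hten p q)"
proof (rule path_liftedI)
  show "pathin (Wt rk (dom (p 0) \<union> dom (q 0))) (hten p q)"
    unfolding pathin_def hten_def
    by (rule continuous_tn) (use path_liftedD(2)[OF p] path_liftedD(2)[OF q] s in \<open>auto simp: pathin_def\<close>)
  have "mul (F t) (G t) = ev \<phi> (hten p q t)" if t: "t \<in> I1" for t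
    using ev_ten[of "p t" "q t"] ob_liftedD[OF path_lifted_at[OF p t]] ob_liftedD[OF path_lifted_at[OF q t]] path_liftedD(5)[OF p t] path_liftedD(5)[OF q t] s
    by simp
  then show "F1 (Tensor MM) (F, G) = push (ev \<phi>) (hten p q)"
    unfolding F1_MM push_def by (auto simp: fun_eq_iff)
qed (use path_liftedD(1)[OF p] path_liftedD(1)[OF q] in auto)

lemma ev_csub_list:
  assumes us: "list_all2 ob_lifted xs us" and f: "fits rk' rk (map dom us)" and w: "w \<in> topspace (Wt rk' {..<length us})"
  shows "ev \<phi> (csub w us) = evl xs w"
proof -
  have u: "valid rk (us ! k)" "dom (us ! k) \<subseteq> S" "xs ! k = ev \<phi> (us ! k)" if "k < length us" for k
    using us that by (auto simp: list_all2_conv_all_nth ob_lifted_def)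
  have "xs = map (ev \<phi>) us" by (rule nth_equalityI) (use u us in \<open>auto simp: list_all2_lengthD\<close>)
  then show ?thesis using ev_csub[of rk' w us rk \<phi>] w u f \<phi> unfolding topspace_Wt by blast
qed

lemma continuous_csub_list:
  assumes us: "list_all2 ob_lifted xs us" and f: "fits rk' rk (map dom us)"
  shows "continuous_map (Wt rk' {..<length us}) (Wt rk (\<Union> (dom ` set us))) (\<lambda>w. csub w us)"
    "\<Union> (dom ` set us) \<subseteq> S"
proof -
  have *: "valid rk u \<and> dom u \<subseteq> S" if "u \<in> set us" for u
  proof -
    obtain i where "i < length us" "u = us ! i" using \<open>u \<in> set us\<close> unfolding in_set_conv_nth by blast
    then show ?thesis using us by (simp add: list_all2_conv_all_nth ob_lifted_def)
  qed
  from * show "continuous_map (Wt rk' {..<length us}) (Wt rk (\<Union> (dom ` set us))) (\<lambda>w. csub w us)"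
    "\<Union> (dom ` set us) \<subseteq> S"
    using continuous_csub_const[OF _ f] by blast+
qed

lemma path_lifted_csub:
  assumes us: "list_all2 ob_lifted xs us" and f: "fits rk' rk (map dom us)" and p: "pathin (Wt rk' {..<length us}) p"
  shows "path_lifted (\<lambda>t\<in>I1. evl xs (p t)) (\<lambda>t. csub (p t) us)"
proof (rule path_liftedI)
  show "pathin (Wt rk (\<Union> (dom ` set us))) (\<lambda>t. csub (p t) us)"
    using continuous_map_compose[OF p[unfolded pathin_def] continuous_csub_list(1)[OF us f]] by (simp add: pathin_def o_def)
  show "(\<lambda>t\<in>I1. evl xs (p t)) = push (ev \<phi>) (\<lambda>t. csub (p t) us)"
    unfolding push_def by (rule restrict_ext) (simp add: ev_csub_list[OF us f pathin_topspace[OF p]])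
qed (rule continuous_csub_list(2)[OF us f])

lemma pcell_lifted_csub:
  assumes us: "list_all2 ob_lifted xs us" and f: "fits rk' rk (map dom us)"
    and K: "pcell_lift X (Wt rk' {..<length us}) (evl xs) K w ps qs"
  shows "pcell_lifted K (csub w us) (map (\<lambda>p t. csub (p t) us) ps) (map (\<lambda>p t. csub (p t) us) qs)"
proof -
  have w: "w \<in> topspace (Wt rk' {..<length us})" using chain_topspace[OF pcell_liftD(1)[OF K]] by simp
  have c: "csub w us \<in> topspace (Wt rk (\<Union> (dom ` set us)))"
    using continuous_map_image_subset_topspace[OF continuous_csub_list(1)[OF us f]] w by blast
  then have d: "dom (csub w us) = \<Union> (dom ` set us)" by (simp add: topspace_Wt)
  show ?thesis
    unfolding pcell_lifted_def d
    using pcell_lift_change[OF K continuous_csub_list(1)[OF us f], of "ev \<phi>"] ev_csub_list[OF us f] continuous_csub_list(2)[OF us f]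
    by simp
qed

lemma a_eq: "S.a x y z = (\<lambda>t\<in>I1. evl [x, y, z] (pA t))" and b_eq: "S.b x y z = (\<lambda>t\<in>I1. evl [x, y, z] (pA (1 - t)))"
  and l_eq: "S.l x = (\<lambda>t\<in>I1. evl [x] (pL t))" and rb_eq: "S.rb x = (\<lambda>t\<in>I1. evl [x] (pU (1 - t)))"
  and R_eq: "S.R x y = (\<lambda>t\<in>I1. evl [x, y] (pR t))"
  unfolding S.a_def S.b_def S.l_def S.rb_def S.R_def MM_sel SS_sel homotopy_equiv_def homotopy_trans_def
    hA3_def hL1_def hU1_def hR2_def
  by simp_all

lemma path_lifted_ab:
  assumes "ob_lifted x u" "ob_lifted y v" "ob_lifted z w" "sep rk (dom u) (dom v)" "sep rk (dom u) (dom w)" "sep rk (dom v) (dom w)"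
  shows "path_lifted (S.a x y z) (hA u v w)" "path_lifted (S.b x y z) (hB u v w)"
  unfolding a_eq b_eq hA_csub[OF assms(4-6)]
  by (rule path_lifted_csub[where rk' = "\<lambda>_. 0"]; use assms(1-3) pA(1) pathin_reverse[OF pA(1)] fits3[OF assms(4-6)] in \<open>simp_all add: numeral_3_eq_3\<close>)+

lemma path_lifted_l: "ob_lifted x u \<Longrightarrow> path_lifted (S.l x) (hL u)" and path_lifted_rb: "ob_lifted x u \<Longrightarrow> path_lifted (S.rb x) (hUb u)"
  unfolding l_eq rb_eq hL_csub hU_csub
  by (rule path_lifted_csub[where rk' = "\<lambda>_. 0"]; use pL(1) pathin_reverse[OF pU(1)] fits1 in simp)+

lemma path_lifted_R: "ob_lifted x u \<Longrightarrow> ob_lifted y v \<Longrightarrow> over rk (dom u) (dom v) \<Longrightarrow> path_lifted (S.R x y) (hR u v)"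
  unfolding R_eq by (subst hR_csub, assumption) (rule path_lifted_csub[where rk' = "\<lambda>i. i"]; use pR(1) fits2_over[of rk "dom u" "dom v"] in \<open>simp_all add: numeral_2_eq_2\<close>)

subsection \<open>Lifts of pasting cells\<close>

lemma pcell_lifted_iso: "pcell_lifted K w ps qs \<Longrightarrow> iso_pcell (Pi2 X) K"
  unfolding pcell_lifted_def using pcell_lift_iso_pcell[OF lifting] by blast

lemma pcell_lifted_unique: "pcell_lifted K w ps qs \<Longrightarrow> pcell_lifted L w ps qs' \<Longrightarrow> qs = qs' \<Longrightarrow> K = L"
  unfolding pcell_lifted_def using pcell_lift_unique[OF lifting] by blast

lemma pcell_lifted_inv: "pcell_lifted K w ps qs \<Longrightarrow> pcell_lifted (pinv (Pi2 X) K) w qs ps"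
  unfolding pcell_lifted_def using pcell_lift_pinv[OF lifting] by blast

lemma path_lifted_chain:
  assumes "list_all2 path_lifted Fs ps" "linked w ps" "valid rk w"
  shows "chain (Wt rk (dom w)) w ps (wend w ps) \<and> Fs = map (push (ev \<phi>)) ps"
  using assms
proof (induction arbitrary: w rule: list_all2_induct)
  case (Cons F Fs p ps)
  have p: "path_lifted F p" "p 0 = w" "linked (p 1) ps" using Cons by simp_all
  then have "dom (p 1) = dom w" "valid rk (p 1)" using path_liftedD(4,5)[OF p(1), of 1] by simp_all
  then show ?case using path_liftedD(2,3)[OF p(1)] p Cons.IH[of "p 1"] by simp
qed (simp add: topspace_Wt)

inductive steps_lifted :: "conf \<Rightarrow> (real \<Rightarrow> conf) list \<Rightarrow>
    (nat \<times> ('a, real \<Rightarrow> 'a, (real \<times> real \<Rightarrow> 'a) set) pcell) list \<Rightarrow> (real \<Rightarrow> conf) list \<Rightarrow> bool"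
  for w where
  steps_lifted_Nil: "steps_lifted w cur [] cur"
| steps_lifted_Cons: "pcell_lifted K v ts bs \<Longrightarrow> cur = take n cur @ ts @ drop (n + length ts) cur \<Longrightarrow>
    wend w (take n cur) = v \<Longrightarrow> new = take n cur @ bs @ drop (n + length ts) cur \<Longrightarrow>
    steps_lifted w new steps res \<Longrightarrow> steps_lifted w cur ((n, K) # steps) res"

lemma steps_lifted_lpsteps:
  "steps_lifted w cur steps res \<Longrightarrow> chain (Wt rk D) w cur w' \<Longrightarrow> steps_lift X (Wt rk D) (ev \<phi>) w cur steps res"
proof (induction rule: steps_lifted.induct)
  case (steps_lifted_Cons K v ts bs cur n new steps res)
  have "chain (Wt rk D) w (take n cur @ ts @ drop (n + length ts) cur) w'"
    using steps_lifted_Cons.prems steps_lifted_Cons.hyps(2) by simp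
  then obtain v1 v2 where c: "chain (Wt rk D) w (take n cur) v1" "chain (Wt rk D) v1 ts v2"
    "chain (Wt rk D) v2 (drop (n + length ts) cur) w'"
    unfolding chain_append by blast
  have v: "v1 = v" using chain_wend[OF c(1)] steps_lifted_Cons.hyps(3) by simp
  have "dom v = D" using chain_topspace[OF c(1)] v by (simp add: topspace_Wt)
  then have K: "pcell_lift X (Wt rk D) (ev \<phi>) K v ts bs" using steps_lifted_Cons.hyps(1) by (auto simp: pcell_lifted_def)
  have "v2 = wend v ts" using chain_wend[OF c(2)] v by simp
  then have "chain (Wt rk D) v1 bs v2" using pcell_liftD(2)[OF K] v by simp
  then have "chain (Wt rk D) w new w'"
    unfolding steps_lifted_Cons.hyps(4) chain_append using c by blast
  from steps_lifted_Cons.IH[OF this] show ?case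
    by (rule steps_lift_Cons[OF K steps_lifted_Cons.hyps(2-4)])
qed (rule steps_lift_Nil)

lemma pcell_lifted_paste:
  assumes x: "ob_lifted x w" and fs: "list_all2 path_lifted fs ps" "linked w ps" and steps: "steps_lifted w ps steps res"
  shows "pcell_lifted (paste (Pi2 X) x fs steps) w ps res"
proof -
  note c = path_lifted_chain[OF fs ob_liftedD(1)[OF x]]
  show ?thesis unfolding pcell_lifted_def
    using pcell_lift_paste[OF lifting[OF ob_liftedD(2)[OF x]] conjunct1[OF c] ob_liftedD(3)[OF x] conjunct2[OF c]
        steps_lifted_lpsteps[OF steps conjunct1[OF c]]] ob_liftedD(2)[OF x] by blast
qed

lemma pcell_lifted_some_square:
  assumes x: "ob_lifted x w" and fs: "list_all2 path_lifted fs ps" "linked w ps" and gs: "list_all2 path_lifted gs qs" "linked w qs"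
    and e: "wend w ps = wend w qs" and d: "dom w = {..<n}"
  shows "pcell_lifted (PC x fs (sqclass X (\<lambda>s. ev \<phi> (some_square rk n w ps qs s))) gs) w ps qs"
proof -
  note c = path_lifted_chain[OF fs ob_liftedD(1)[OF x], unfolded d] path_lifted_chain[OF gs ob_liftedD(1)[OF x], unfolded d]
  have "square (Wt rk {..<n}) (some_square rk n w ps qs) (pcompw w ps) (pcompw w qs)"
    by (rule some_square[where w' = "wend w qs"]) (use c e in simp_all)
  then have l: "cell_lift X (Wt rk {..<n}) (ev \<phi>) (sqclass X (\<lambda>s. ev \<phi> (some_square rk n w ps qs s))) (pcompw w ps) (pcompw w qs)"
    unfolding cell_lift_def by (intro exI[of _ "some_square rk n w ps qs"]) (simp add: o_def)
  have ch: "chain (Wt rk {..<n}) w ps (wend w ps)" "chain (Wt rk {..<n}) w qs (wend w ps)"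
    using c e by simp_all
  have "pcell_lift X (Wt rk {..<n}) (ev \<phi>) (PC x fs (sqclass X (\<lambda>s. ev \<phi> (some_square rk n w ps qs s))) gs) w ps qs"
    by (rule pcell_liftI[OF ch]; unfold pcell.sel) (use c ob_liftedD(3)[OF x] l in simp_all)
  then show ?thesis unfolding pcell_lifted_def d using ob_liftedD(2)[OF x] d by simp
qed

end

context lifted
begin

lemma pcell_lifted_lwh:
  assumes x: "ob_lifted x u" and L: "pcell_lifted L w rs ss" and s: "sep rk (dom u) (dom w)"
  shows "pcell_lifted (S.lwh x L) (tn u w) (map (hten (hid u)) rs) (map (hten (hid u)) ss)"
proof -
  have L': "dom w \<subseteq> S" "pcell_lift X (Wt rk (dom w)) (ev \<phi>) L w rs ss" using L by (simp_all add: pcell_lifted_def)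
  note u = ob_liftedD[OF x]
  let ?V = "Wt rk (dom u)" and ?W = "Wt rk (dom w)"
  have "continuous_map (prod_topology ?V ?W) (Wt rk (dom u \<union> dom w)) (\<lambda>z. tn (fst z) (snd z))"
    by (rule continuous_tn[OF continuous_map_fst continuous_map_snd s])
  moreover have "(\<lambda>(v, w). mul (ev \<phi> v) (ev \<phi> w)) z = ev \<phi> (tn (fst z) (snd z))" if "z \<in> topspace (prod_topology ?V ?W)" for z
    using that ev_ten[of "fst z" "snd z"] s u L' by (auto simp: topspace_Wt case_prod_unfold)
  moreover have "u \<in> topspace ?V" using u by (simp add: topspace_Wt)
  ultimately have "pcell_lift X (Wt rk (dom u \<union> dom w)) (ev \<phi>)
    (pf_image (Pi2 X) (Pi2 X) (pf_comp (Pi2 X) (op_pf X mul) (pf_pairl (Pi2 X) (ev \<phi> u))) L) (tn u w)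
    (map (hten (hid u)) rs) (map (hten (hid u)) ss)"
    using pcell_lift_change[OF pcell_lift_op_left[OF mul_continuous continuous_ev[OF u(2)] continuous_ev[OF L'(1)] _ L'(2)], of u
        "Wt rk (dom u \<union> dom w)" "\<lambda>z. tn (fst z) (snd z)" "ev \<phi>"]
    by (simp add: o_def hten_def[abs_def])
  then show ?thesis
    using u L' by (simp add: pcell_lifted_def S.lwh_def S.tenl_def Tensor_MM)
qed

lemma pcell_lifted_rwh:
  assumes x: "ob_lifted x u" and L: "pcell_lifted L w rs ss" and s: "sep rk (dom w) (dom u)"
  shows "pcell_lifted (S.rwh L x) (tn w u) (map (\<lambda>p. hten p (hid u)) rs) (map (\<lambda>p. hten p (hid u)) ss)"
proof -
  have L': "dom w \<subseteq> S" "pcell_lift X (Wt rk (dom w)) (ev \<phi>) L w rs ss" using L by (simp_all add: pcell_lifted_def)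
  note u = ob_liftedD[OF x]
  let ?V = "Wt rk (dom u)" and ?W = "Wt rk (dom w)"
  have "continuous_map (prod_topology ?W ?V) (Wt rk (dom w \<union> dom u)) (\<lambda>z. tn (fst z) (snd z))"
    by (rule continuous_tn[OF continuous_map_fst continuous_map_snd s])
  moreover have "(\<lambda>(v, w). mul (ev \<phi> v) (ev \<phi> w)) z = ev \<phi> (tn (fst z) (snd z))" if "z \<in> topspace (prod_topology ?W ?V)" for z
    using that ev_ten[of "fst z" "snd z"] s u L' by (auto simp: topspace_Wt case_prod_unfold)
  moreover have "u \<in> topspace ?V" using u by (simp add: topspace_Wt)
  ultimately have "pcell_lift X (Wt rk (dom w \<union> dom u)) (ev \<phi>)
    (pf_image (Pi2 X) (Pi2 X) (pf_comp (Pi2 X) (op_pf X mul) (pf_pairr (Pi2 X) (ev \<phi> u))) L) (tn w u)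
    (map (\<lambda>p. hten p (hid u)) rs) (map (\<lambda>p. hten p (hid u)) ss)"
    using pcell_lift_change[OF pcell_lift_op_right[OF mul_continuous continuous_ev[OF u(2)] continuous_ev[OF L'(1)] _ L'(2)], of u
        "Wt rk (dom w \<union> dom u)" "\<lambda>z. tn (fst z) (snd z)" "ev \<phi>"]
    by (simp add: o_def hten_def)
  then show ?thesis
    using u L' by (simp add: pcell_lifted_def S.rwh_def S.tenr_def Tensor_MM)
qed

lemma pcell_lifted_tenp:
  assumes K: "pcell_lifted K v ps qs" and L: "pcell_lifted L w rs ss" and s: "sep rk (dom v) (dom w)"
    and len: "length ps = length rs" "length qs = length ss"
  shows "pcell_lifted (S.tenp K L) (tn v w) (map2 hten ps rs) (map2 hten qs ss)"
proof -
  have K': "dom v \<subseteq> S" "pcell_lift X (Wt rk (dom v)) (ev \<phi>) K v ps qs" using K by (simp_all add: pcell_lifted_def)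
  have L': "dom w \<subseteq> S" "pcell_lift X (Wt rk (dom w)) (ev \<phi>) L w rs ss" using L by (simp_all add: pcell_lifted_def)
  let ?V = "Wt rk (dom v)" and ?W = "Wt rk (dom w)"
  have "continuous_map (prod_topology ?V ?W) (Wt rk (dom v \<union> dom w)) (\<lambda>z. tn (fst z) (snd z))"
    by (rule continuous_tn[OF continuous_map_fst continuous_map_snd s])
  moreover have "(\<lambda>(v, w). mul (ev \<phi> v) (ev \<phi> w)) z = ev \<phi> (tn (fst z) (snd z))" if "z \<in> topspace (prod_topology ?V ?W)" for z
    using that ev_ten[of "fst z" "snd z"] s K' L' by (auto simp: topspace_Wt case_prod_unfold)
  ultimately have "pcell_lift X (Wt rk (dom v \<union> dom w)) (ev \<phi>)
    (pf_image (Pi2 X \<times>\<^sub>b Pi2 X) (Pi2 X) (op_pf X mul) (pair_pcell K L)) (tn v w)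
    (map2 hten ps rs) (map2 hten qs ss)"
    using pcell_lift_change[OF pcell_lift_op[OF mul_continuous continuous_ev[OF K'(1)] continuous_ev[OF L'(1)] K'(2) L'(2) len],
        of "Wt rk (dom v \<union> dom w)" "\<lambda>z. tn (fst z) (snd z)" "ev \<phi>"]
    by (simp add: o_def hten_def case_prod_unfold)
  then show ?thesis
    using K' L' by (simp add: pcell_lifted_def S.tenp_def Tensor_MM)
qed

lemma pcell_lifted_sl:
  assumes p: "path_lifted h p"
  shows "pcell_lifted (slide_id (Pi2 X) h) (p 0) [hid (p 0), p] [p, hid (p 1)]"
proof -
  note P = path_liftedD(1-3)[OF p]
  let ?W = "Wt rk (dom (p 0))"
  have d: "dom (p 1) = dom (p 0)" "valid rk (p 0)" "valid rk (p 1)"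
    using path_liftedD(4,5)[OF p, of 1] path_liftedD(4)[OF p, of 0] by simp_all
  have h: "h 0 = ev \<phi> (p 0)" "h 1 = ev \<phi> (p 1)" by (simp_all add: P(3))
  have "cell_lift X ?W (ev \<phi>) (VComp (Pi2 X) (Inv2 (Pi2 X) (LUnit (Pi2 X) h)) (RUnit (Pi2 X) h))
      (pcat1 p (\<lambda>t. p 0)) (pcat1 (\<lambda>t. p 1) p)"
    unfolding P(3)
    by (rule cell_lift_VComp[OF continuous_ev[OF P(1)] cell_lift_RUnit[OF P(2)] cell_lift_Inv2[OF lifting[OF P(1)] cell_lift_LUnit[OF P(2)]]])
  then have "pcell_lift X ?W (ev \<phi>) (slide_id (Pi2 X) h) (p 0) [hid (p 0), p] [p, hid (p 1)]"
    by (intro pcell_liftI[where w' = "p 1"])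
      (use P(2) d h in \<open>auto simp: slide_id_def topspace_Wt hid_def P(3)[symmetric]\<close>)
  then show ?thesis using P(1) by (simp add: pcell_lifted_def)
qed

lemma Fid_Tensor: "x \<in> topspace X \<Longrightarrow> y \<in> topspace X \<Longrightarrow> Fid (Tensor MM) (x, y) = Id2 (Pi2 X) (Id1 (Pi2 X) (mul x y))"
  using strict_pf.s_Fid[OF strict_Tensor, of "(x, y)"] by (simp add: prod_bicat_simps F0_MM)

lemma Inv2_Id2: "x \<in> topspace X \<Longrightarrow> Inv2 (Pi2 X) (Id2 (Pi2 X) (Id1 (Pi2 X) x)) = Id2 (Pi2 X) (Id1 (Pi2 X) x)"
  by (rule bicategory.Id2_iso(2)[OF bicategory_Pi2])
     (use bicategory.Id1_in[OF bicategory_Pi2, of x X] in \<open>simp add: in1_def\<close>)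

lemma F2_Tensor_Id2:
  assumes "in1 (Pi2 X) f x y" "in1 (Pi2 X) g x' y'"
  shows "F2 (Tensor MM) (Id2 (Pi2 X) f, Id2 (Pi2 X) g) = Id2 (Pi2 X) (F1 (Tensor MM) (f, g))"
proof -
  have "(f, g) \<in> Ar (Pi2 X \<times>\<^sub>b Pi2 X)" using assms by (simp add: prod_bicat_simps in1_def)
  from pseudofunctor.F2_id[OF strict_pf.pseudofunctor[OF strict_Tensor bicat(2) bicategory_Pi2] this]
  show ?thesis by (simp add: prod_bicat_simps)
qed

lemma F1_Tensor_Id1: "F1 (Tensor MM) (Id1 (Pi2 X) x, Id1 (Pi2 X) y) = Id1 (Pi2 X) (mul x y)"
  by (auto simp: F1_MM fun_eq_iff)

lemma pcell_lifted_Id2: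
  assumes p: "path_lifted f p" and x: "x = f 0"
  shows "pcell_lifted (PC x [f] (Id2 (Pi2 X) f) [f]) (p 0) [p] [p]"
proof -
  note P = path_liftedD(1-3)[OF p]
  have c: "chain (Wt rk (dom (p 0))) (p 0) [p] (p 1)"
    using P(2) path_liftedD(4,5)[OF p, of 1] by (simp add: topspace_Wt)
  show ?thesis unfolding pcell_lifted_def
    using pcell_liftI[OF c c, of "PC x [f] (Id2 (Pi2 X) f) [f]" "ev \<phi>" X] cell_lift_Id2[OF P(2), of X "ev \<phi>"] P x
    by (simp del: Pi2_simps)
qed

lemma pcell_lifted_fuse_l:
  assumes x: "ob_lifted x u" and y: "ob_lifted y v" and f: "path_lifted f p"
    and s: "sep rk (dom u) (dom v)" "sep rk (dom (tn u v)) (dom (p 0))"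
  shows "pcell_lifted (S.fuse_l x y f) (tn (tn u v) (p 0)) [hten (hid (tn u v)) p] [hten (hid (tn u v)) p]"
proof -
  note X = ob_lifted_topspace[OF x] ob_lifted_topspace[OF y]
  have xy: "ob_lifted (mul x y) (tn u v)" using ob_lifted_ten[OF x y s(1)] by (simp add: F0_MM)
  note XY = ob_lifted_topspace[OF xy]
  have i: "in1 (Pi2 X) (Id1 (Pi2 X) (mul x y)) (mul x y) (mul x y)"
    using bicategory.Id1_in[OF bicategory_Pi2, of "mul x y" X] XY by simp
  have t: "path_lifted (F1 (Tensor MM) (Id1 (Pi2 X) (mul x y), f)) (hten (hid (tn u v)) p)"
    by (rule path_lifted_ten[OF path_lifted_id[OF xy] f]) (use s(2) in simp)
  have eq: "S.fuse_l x y f = PC (mul (mul x y) (f 0)) [F1 (Tensor MM) (Id1 (Pi2 X) (mul x y), f)]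
     (Id2 (Pi2 X) (F1 (Tensor MM) (Id1 (Pi2 X) (mul x y), f))) [F1 (Tensor MM) (Id1 (Pi2 X) (mul x y), f)]"
    unfolding S.fuse_l_def Fid_Tensor[OF X] Inv2_Id2[OF XY] F2_Tensor_Id2[OF i path_lifted_in1[OF f]] F1_Tensor_Id1 F0_MM
    by simp
  show ?thesis unfolding eq using pcell_lifted_Id2[OF t, of "mul (mul x y) (f 0)"] by (simp add: F1_MM)
qed

lemma pcell_lifted_fuse_r:
  assumes f: "path_lifted f p" and x: "ob_lifted x u" and y: "ob_lifted y v"
    and s: "sep rk (dom u) (dom v)" "sep rk (dom (p 0)) (dom (tn u v))"
  shows "pcell_lifted (S.fuse_r f x y) (tn (p 0) (tn u v)) [hten p (hid (tn u v))] [hten p (hid (tn u v))]"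
proof -
  note X = ob_lifted_topspace[OF x] ob_lifted_topspace[OF y]
  have xy: "ob_lifted (mul x y) (tn u v)" using ob_lifted_ten[OF x y s(1)] by (simp add: F0_MM)
  note XY = ob_lifted_topspace[OF xy]
  have i: "in1 (Pi2 X) (Id1 (Pi2 X) (mul x y)) (mul x y) (mul x y)"
    using bicategory.Id1_in[OF bicategory_Pi2, of "mul x y" X] XY by simp
  have t: "path_lifted (F1 (Tensor MM) (f, Id1 (Pi2 X) (mul x y))) (hten p (hid (tn u v)))"
    by (rule path_lifted_ten[OF f path_lifted_id[OF xy]]) (use s(2) in simp)
  have eq: "S.fuse_r f x y = PC (mul (f 0) (mul x y)) [F1 (Tensor MM) (f, Id1 (Pi2 X) (mul x y))]
     (Id2 (Pi2 X) (F1 (Tensor MM) (f, Id1 (Pi2 X) (mul x y)))) [F1 (Tensor MM) (f, Id1 (Pi2 X) (mul x y))]"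
    unfolding S.fuse_r_def Fid_Tensor[OF X] Inv2_Id2[OF XY] F2_Tensor_Id2[OF path_lifted_in1[OF f] i] F1_Tensor_Id1 F0_MM
    by simp
  show ?thesis unfolding eq using pcell_lifted_Id2[OF t, of "mul (f 0) (mul x y)"] by (simp add: F1_MM)
qed

end

context lifted
begin

lemma continuous_csub_paths:
  assumes ps: "list_all2 path_lifted fs ps" and f: "fits rk' rk (map (\<lambda>p. dom (p 0)) ps)" and P: "pathin (Wt rk' {..<length ps}) P"
  shows "continuous_map (top_of_set I2) (Wt rk (\<Union>p\<in>set ps. dom (p 0))) (\<lambda>z. csub (P (fst z)) (map (\<lambda>p. p (snd z)) ps))"
    (is ?cont)
    and "u \<in> I1 \<Longrightarrow> v \<in> I1 \<Longrightarrow> ev \<phi> (csub (P u) (map (\<lambda>p. p v) ps)) = evl (map (\<lambda>f. f v) fs) (P u)"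
    and "(\<Union>p\<in>set ps. dom (p 0)) \<subseteq> S"
proof -
  have path_lifted: "path_lifted (fs ! k) (ps ! k)" if "k < length ps" for k
    using ps that by (simp add: list_all2_conv_all_nth)
  have 1: "continuous_map (top_of_set I2) (Wt rk' {..<length (map (\<lambda>p z. p (snd z)) ps)}) (\<lambda>z. P (fst z))"
  proof -
    have "continuous_map (top_of_set I2) (top_of_set I1) fst"
      by (auto simp: continuous_map_in_subtopology intro!: continuous_intros)
    from continuous_map_compose[OF this P[unfolded pathin_def]] show ?thesis by (simp add: o_def)
  qed
  have 2: "continuous_map (top_of_set I2) (Wt rk (map (\<lambda>p. dom (p 0)) ps ! k)) (map (\<lambda>p z. p (snd z)) ps ! k)"
    if "k < length (map (\<lambda>p z. p (snd z)) ps)" for k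
  proof -
    have k: "k < length ps" using that by simp
    have "continuous_map (top_of_set I2) (top_of_set I1) snd"
      by (auto simp: continuous_map_in_subtopology intro!: continuous_intros)
    from continuous_map_compose[OF this path_liftedD(2)[OF path_lifted[OF k], unfolded pathin_def]] k show ?thesis by (simp add: o_def)
  qed
  show ?cont
    using continuous_csub[OF 1 _ 2 f] by (simp add: o_def)
  show "(\<Union>p\<in>set ps. dom (p 0)) \<subseteq> S"
    using path_liftedD(1)[OF path_lifted] by (auto simp: in_set_conv_nth) blast
  assume uv: "u \<in> I1" "v \<in> I1"
  show "ev \<phi> (csub (P u) (map (\<lambda>p. p v) ps)) = evl (map (\<lambda>f. f v) fs) (P u)"
  proof (rule ev_csub_list)
    show "list_all2 ob_lifted (map (\<lambda>f. f v) fs) (map (\<lambda>p. p v) ps)"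
      using ps path_lifted_at[OF _ uv(2)] by (auto simp: list_all2_conv_all_nth)
    have "map dom (map (\<lambda>p. p v) ps) = map (\<lambda>p. dom (p 0)) ps"
      by (rule nth_equalityI) (use path_liftedD(5)[OF path_lifted uv(2)] in simp_all)
    then show "fits rk' rk (map dom (map (\<lambda>p. p v) ps))" using f by (simp only:)
    show "P u \<in> topspace (Wt rk' {..<length (map (\<lambda>p. p v) ps)})" using pathin_topspace[OF P uv(1)] by simp
  qed
qed

lemma pcell_lifted_tsquare:
  assumes H: "homotopy_pf X Y \<Theta> D P0 P1 F G" and f: "in1 D f x y"
    and \<Phi>: "continuous_map (top_of_set I2) (Wt rk E) \<Phi>" and E: "E \<subseteq> S"
    and eq: "\<And>u v. u \<in> I1 \<Longrightarrow> v \<in> I1 \<Longrightarrow> \<Theta> (u, P1 f v) = ev \<phi> (\<Phi> (u, v))"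
    and q: "\<And>t. t \<in> I1 \<Longrightarrow> q0 t = \<Phi> (0, t)" "\<And>t. t \<in> I1 \<Longrightarrow> q1 t = \<Phi> (1, t)"
  shows "(\<And>t. t \<in> I1 \<Longrightarrow> p0 t = \<Phi> (t, 0)) \<Longrightarrow> (\<And>t. t \<in> I1 \<Longrightarrow> p1 t = \<Phi> (t, 1)) \<Longrightarrow>
      pcell_lifted (tsquare D F G (fwd (homotopy_equiv X \<Theta> P0 P1)) f) (p0 0) [p0, q1] [q0, p1]"
    and "(\<And>t. t \<in> I1 \<Longrightarrow> b0 t = \<Phi> (1 - t, 0)) \<Longrightarrow> (\<And>t. t \<in> I1 \<Longrightarrow> b1 t = \<Phi> (1 - t, 1)) \<Longrightarrow>
      pcell_lifted (tsquare D G F (bwd (homotopy_equiv X \<Theta> P0 P1)) f) (b0 0) [b0, q0] [q1, b1]"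
proof -
  have "\<forall>z\<in>I2. dom (\<Phi> z) = E \<and> valid rk (\<Phi> z)"
    using \<Phi>[unfolded continuous_map_Wt, THEN conjunct1] by simp
  then have d: "dom (\<Phi> (u, v)) = E" if "u \<in> I1" "v \<in> I1" for u v
    using that by blast
  have pY: "pathin Y (P1 f)" using homotopy_pf.P1[OF H f] by simp
  have eq': "(\<lambda>(u, v). \<Theta> (u, P1 f v)) z = ev \<phi> (\<Phi> z)" if "z \<in> topspace (top_of_set I2)" for z
    using that eq by auto
  show "pcell_lifted (tsquare D F G (fwd (homotopy_equiv X \<Theta> P0 P1)) f) (p0 0) [p0, q1] [q0, p1]"
    if p: "\<And>t. t \<in> I1 \<Longrightarrow> p0 t = \<Phi> (t, 0)" "\<And>t. t \<in> I1 \<Longrightarrow> p1 t = \<Phi> (t, 1)"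
  proof -
    have p0: "p0 0 = \<Phi> (0, 0)" by (rule p(1)) simp
    have "pcell_lift X (Wt rk E) (ev \<phi>) (tsquare D F G (fwd (homotopy_equiv X \<Theta> P0 P1)) f) (p0 0) [p0, q1] [q0, p1]"
      unfolding homotopy_pf.fwd_E[OF H] p0
      by (rule pcell_lift_cong[OF pcell_lift_change[OF homotopy_pf.pcell_lift_tsquare[OF H f] \<Phi>, of "ev \<phi>", OF eq']])
        (use p q in \<open>simp_all add: seg_01\<close>)
    then show ?thesis unfolding pcell_lifted_def using d[of 0 0] p(1)[of 0] E by simp
  qed
  show "pcell_lifted (tsquare D G F (bwd (homotopy_equiv X \<Theta> P0 P1)) f) (b0 0) [b0, q0] [q1, b1]"
    if p: "\<And>t. t \<in> I1 \<Longrightarrow> b0 t = \<Phi> (1 - t, 0)" "\<And>t. t \<in> I1 \<Longrightarrow> b1 t = \<Phi> (1 - t, 1)"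
  proof -
    have p0: "b0 0 = \<Phi> (1, 0)" using p(1)[of 0] by simp
    have l: "pcell_lift X (top_of_set I2) (\<lambda>(u, v). \<Theta> (u, P1 f v)) (tsquare D G F (bwd (homotopy_equiv X \<Theta> P0 P1)) f) (1, 0)
      [\<lambda>t. (seg 1 0 t, 0), \<lambda>t. (0, seg 0 1 t)] [\<lambda>t. (1, seg 0 1 t), \<lambda>t. (seg 1 0 t, 1)]"
      by (rule homotopy_pf.pcell_lift_bwd_sub[OF H f pY]) (simp_all add: seg_01)
    have "pcell_lift X (Wt rk E) (ev \<phi>) (tsquare D G F (bwd (homotopy_equiv X \<Theta> P0 P1)) f) (b0 0) [b0, q0] [q1, b1]"
      unfolding p0
      by (rule pcell_lift_cong[OF pcell_lift_change[OF l \<Phi>, of "ev \<phi>", OF eq']])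
        (use p q in \<open>simp_all add: seg_01\<close>)
    then show ?thesis unfolding pcell_lifted_def using d[of 1 0] p(1)[of 0] E by simp
  qed
qed

lemma in1_triple: "path_lifted f p \<Longrightarrow> path_lifted g q \<Longrightarrow> path_lifted h r \<Longrightarrow> in1 B3' (f, g, h) (f 0, g 0, h 0) (f 1, g 1, h 1)"
  and in1_pair: "path_lifted f p \<Longrightarrow> path_lifted g q \<Longrightarrow> in1 B2' (f, g) (f 0, g 0) (f 1, g 1)"
  by (simp_all add: in1_prod path_lifted_in1)

lemma sep_at:
  assumes "path_lifted f p" "path_lifted g q" "sep rk (dom (p 0)) (dom (q 0))" "t \<in> I1" shows "sep rk (dom (p t)) (dom (q t))"
  using assms path_liftedD(5) by metis

lemma pcell_lifted_nat_ab:
  assumes f: "path_lifted f p" and g: "path_lifted g q" and h: "path_lifted h r"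
    and s: "sep rk (dom (p 0)) (dom (q 0))" "sep rk (dom (p 0)) (dom (r 0))" "sep rk (dom (q 0)) (dom (r 0))"
  shows "pcell_lifted (S.nat_a f g h) (tn (tn (p 0) (q 0)) (r 0)) [hA (p 0) (q 0) (r 0), hten p (hten q r)]
      [hten (hten p q) r, hA (p 1) (q 1) (r 1)]"
    and "pcell_lifted (S.nat_b f g h) (tn (p 0) (tn (q 0) (r 0))) [hB (p 0) (q 0) (r 0), hten (hten p q) r]
      [hten p (hten q r), hB (p 1) (q 1) (r 1)]"
proof -
  have st: "sep rk (dom (p t)) (dom (q t))" "sep rk (dom (p t)) (dom (r t))" "sep rk (dom (q t)) (dom (r t))" if "t \<in> I1" for t
    using sep_at[OF f g s(1) that] sep_at[OF f h s(2) that] sep_at[OF g h s(3) that] by blast+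
  have A: "hA (p t) (q t) (r t) = (\<lambda>s. csub (pA s) [p t, q t, r t])" "hB (p t) (q t) (r t) = (\<lambda>s. csub (pA (1 - s)) [p t, q t, r t])" if "t \<in> I1" for t
    by (rule hA_csub[OF st[OF that]])+
  have e: "csub (pA 0) [p t, q t, r t] = tn (tn (p t) (q t)) (r t)" "csub (pA 1) [p t, q t, r t] = tn (p t) (tn (q t) (r t))"
    if "t \<in> I1" for t
    using fun_cong[OF hA_csub(1)[OF st[OF that]], of 0] fun_cong[OF hA_csub(1)[OF st[OF that]], of 1]
    by (simp_all only: hats_ends)
  have fs: "list_all2 path_lifted [f, g, h] [p, q, r]" using f g h by simp
  have ft: "fits (\<lambda>_. 0) rk (map (\<lambda>p. dom (p 0)) [p, q, r])" using fits3[OF s] by simp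
  have P: "pathin (Wt (\<lambda>_. 0) {..<length [p, q, r]}) pA" using pA(1) by (simp add: numeral_3_eq_3)
  note C = continuous_csub_paths[OF fs ft P]
  note T = pcell_lifted_tsquare[OF homotopy_A in1_triple[OF f g h] C(1) C(3)]
  show "pcell_lifted (S.nat_a f g h) (tn (tn (p 0) (q 0)) (r 0)) [hA (p 0) (q 0) (r 0), hten p (hten q r)]
      [hten (hten p q) r, hA (p 1) (q 1) (r 1)]"
    using T(1)[of "hten (hten p q) r" "hten p (hten q r)" "hA (p 0) (q 0) (r 0)" "hA (p 1) (q 1) (r 1)"] C(2) A(1) e
    unfolding S.nat_a_def MM_sel by (simp add: hA3_def)
  show "pcell_lifted (S.nat_b f g h) (tn (p 0) (tn (q 0) (r 0))) [hB (p 0) (q 0) (r 0), hten (hten p q) r]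
      [hten p (hten q r), hB (p 1) (q 1) (r 1)]"
    using T(2)[of "hten (hten p q) r" "hten p (hten q r)" "hB (p 0) (q 0) (r 0)" "hB (p 1) (q 1) (r 1)"] C(2) A(2) e
    unfolding S.nat_b_def MM_sel by (simp add: hA3_def)
qed

lemma pcell_lifted_nat_l:
  assumes f: "path_lifted f p"
  shows "pcell_lifted (S.nat_l f) (tn Map.empty (p 0)) [hL (p 0), p] [hten (hid Map.empty) p, hL (p 1)]"
proof -
  have e: "csub (pL 0) [w] = tn Map.empty w" "csub (pL 1) [w] = w" for w
    using fun_cong[OF hL_csub[of w], of 0] fun_cong[OF hL_csub[of w], of 1] by (simp_all only: hats_ends)
  have fs: "list_all2 path_lifted [f] [p]" using f by simp
  have ft: "fits (\<lambda>_. 0) rk (map (\<lambda>p. dom (p 0)) [p])" using fits1 by simp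
  have P: "pathin (Wt (\<lambda>_. 0) {..<length [p]}) pL" using pL(1) by simp
  note C = continuous_csub_paths[OF fs ft P]
  note T = pcell_lifted_tsquare[OF homotopy_L path_lifted_in1[OF f] C(1) C(3)]
  show ?thesis
    unfolding S.nat_l_def MM_sel
    by (rule T(1)[of "hten (hid Map.empty) p" p "hL (p 0)" "hL (p 1)", unfolded hats_ends])
      (simp_all add: C(2)[unfolded list.map] hL1_def hL_csub e)
qed

lemma pcell_lifted_nat_rb:
  assumes f: "path_lifted f p"
  shows "pcell_lifted (S.nat_rb f) (p 0) [hUb (p 0), hten p (hid Map.empty)] [p, hUb (p 1)]"
proof -
  have e: "csub (pU 0) [w] = tn w Map.empty" "csub (pU 1) [w] = w" for w
    using fun_cong[OF hU_csub(1)[of w], of 0] fun_cong[OF hU_csub(1)[of w], of 1] by (simp_all only: hats_ends)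
  have fs: "list_all2 path_lifted [f] [p]" using f by simp
  have ft: "fits (\<lambda>_. 0) rk (map (\<lambda>p. dom (p 0)) [p])" using fits1 by simp
  have P: "pathin (Wt (\<lambda>_. 0) {..<length [p]}) pU" using pU(1) by simp
  note C = continuous_csub_paths[OF fs ft P]
  note T = pcell_lifted_tsquare[OF homotopy_U path_lifted_in1[OF f] C(1) C(3)]
  show ?thesis
    unfolding S.nat_rb_def MM_sel
    by (rule T(2)[of "hten p (hid Map.empty)" p "hUb (p 0)" "hUb (p 1)", unfolded hats_ends])
      (simp_all add: C(2)[unfolded list.map] hU1_def hU_csub(2) e)
qed

lemma pcell_lifted_nat_R:
  assumes f: "path_lifted f p" and g: "path_lifted g q" and s: "over rk (dom (p 0)) (dom (q 0))"
  shows "pcell_lifted (S.nat_R f g) (tn (p 0) (q 0)) [hR (p 0) (q 0), hten q p] [hten p q, hR (p 1) (q 1)]"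
proof -
  have st: "over rk (dom (p t)) (dom (q t))" if "t \<in> I1" for t
    using path_liftedD(5)[OF f that] path_liftedD(5)[OF g that] s by simp
  note R = hR_csub[OF st]
  have e: "csub (pR 0) [p t, q t] = tn (p t) (q t)" "csub (pR 1) [p t, q t] = tn (q t) (p t)" if "t \<in> I1" for t
    using fun_cong[OF R[OF that], of 0] fun_cong[OF R[OF that], of 1] by (simp_all only: hats_ends)
  have fs: "list_all2 path_lifted [f, g] [p, q]" using f g by simp
  have ft: "fits (\<lambda>i. i) rk (map (\<lambda>p. dom (p 0)) [p, q])" using fits2_over[OF s] by simp
  have P: "pathin (Wt (\<lambda>i. i) {..<length [p, q]}) pR" using pR(1) by (simp add: numeral_2_eq_2)
  note C = continuous_csub_paths[OF fs ft P]
  note T = pcell_lifted_tsquare[OF homotopy_R in1_pair[OF f g] C(1) C(3)]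
  show ?thesis
    using T(1)[of "hten p q" "hten q p" "hR (p 0) (q 0)" "hR (p 1) (q 1)"] C(2) R[of 0] R[of 1] e
    unfolding S.nat_R_def SS_sel by (simp add: hR2_def)
qed

lemma
  assumes u: "ob_lifted x u" "ob_lifted y v" "ob_lifted z w" and s: "sep rk (dom u) (dom v)" "sep rk (dom u) (dom w)" "sep rk (dom v) (dom w)"
  shows pcell_lifted_\<eta>: "pcell_lifted (S.\<eta> x y z) (tn (tn u v) w) [] [hA u v w, hB u v w]"
    and pcell_lifted_\<epsilon>: "pcell_lifted (S.\<epsilon> x y z) (tn u (tn v w)) [hB u v w, hA u v w] []"
proof -
  have us: "list_all2 ob_lifted [x, y, z] [u, v, w]" using u by simp
  have f: "fits (\<lambda>_. 0) rk (map dom [u, v, w])" using fits3[OF s] by simp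
  have P: "pathin (Wt (\<lambda>_. 0) {..<length [u, v, w]}) pA" using pA(1) by (simp add: numeral_3_eq_3)
  note C = continuous_map_compose[OF P[unfolded pathin_def] continuous_csub_list(1)[OF us f], unfolded o_def]
  note D = continuous_csub_list(2)[OF us f]
  have eq: "hA3 (t, x, y, z) = ev \<phi> (csub (pA t) [u, v, w])" if "t \<in> topspace (top_of_set I1)" for t
    using ev_csub_list[OF us f pathin_topspace[OF P]] that by (simp add: hA3_def)
  note A = hA_csub[OF s]
  have e: "csub (pA 0) [u, v, w] = tn (tn u v) w" "csub (pA 1) [u, v, w] = tn u (tn v w)"
    using fun_cong[OF A(1), of 0] fun_cong[OF A(1), of 1] by (simp_all only: hats_ends)
  have o: "(x, y, z) \<in> Ob B3'" using ob_lifted_topspace[OF u(1)] ob_lifted_topspace[OF u(2)] ob_lifted_topspace[OF u(3)] by simp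
  show "pcell_lifted (S.\<eta> x y z) (tn (tn u v) w) [] [hA u v w, hB u v w]"
    using pcell_lift_change[OF homotopy_pf.pcell_lift_unit[OF homotopy_A o] C, of "ev \<phi>"] eq D
    unfolding pcell_lifted_def S.\<eta>_def MM_sel A by (simp add: e seg_01 Un_ac)
  show "pcell_lifted (S.\<epsilon> x y z) (tn u (tn v w)) [hB u v w, hA u v w] []"
    using pcell_lift_change[OF homotopy_pf.pcell_lift_counit[OF homotopy_A o] C, of "ev \<phi>"] eq D
    unfolding pcell_lifted_def S.\<epsilon>_def MM_sel A by (simp add: e seg_01 Un_ac)
qed

end

lemma csub_hats:
  fixes w :: conf
  shows "(\<lambda>t. csub (hid w t) us) = hid (csub w us)"
  "(\<lambda>t. csub (hten p q t) us) = hten (\<lambda>t. csub (p t) us) (\<lambda>t. csub (q t) us)"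
  "(\<lambda>t. csub (hA x y z t) us) = hA (csub x us) (csub y us) (csub z us)"
  "(\<lambda>t. csub (hB x y z t) us) = hB (csub x us) (csub y us) (csub z us)"
  "(\<lambda>t. csub (hL x t) us) = hL (csub x us)"
  "(\<lambda>t. csub (hUb x t) us) = hUb (csub x us)"
  "(\<lambda>t. csub (hR x y t) us) = hR (csub x us) (csub y us)"
  by (intro ext; simp add: hA_def hB_def hL_def hUb_def hR_def hpath_def csub_tn csub_empty csub_csub)+

lemma sep_Un: "sep rk A (B \<union> C) \<longleftrightarrow> sep rk A B \<and> sep rk A C" "sep rk (A \<union> B) C \<longleftrightarrow> sep rk A C \<and> sep rk B C"
  by (auto simp: sep_def)

lemma fits4: "sep rk A B \<Longrightarrow> sep rk A C \<Longrightarrow> sep rk A D \<Longrightarrow> sep rk B C \<Longrightarrow> sep rk B D \<Longrightarrow> sep rk C D \<Longrightarrow>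
    fits (\<lambda>_. 0) rk [A, B, C, D]"
  by (auto simp: fits_def sep_def less_Suc_eq)

lemma fits_rk1: "over rk A B \<Longrightarrow> over rk A C \<Longrightarrow> sep rk B C \<Longrightarrow> fits rk1 rk [A, B, C]"
  by (auto simp: fits_def sep_def over_def less_Suc_eq rk1_def)

lemma fits_rk2: "sep rk A B \<Longrightarrow> over rk A C \<Longrightarrow> over rk B C \<Longrightarrow> fits rk2 rk [A, B, C]"
  by (auto simp: fits_def sep_def over_def less_Suc_eq rk2_def)

context lifted
begin

lemmas path_rules = ob_lifted_I ob_lifted_ten path_lifted_id path_lifted_ab path_lifted_l path_lifted_rb path_lifted_R path_lifted_ten list.rel_intros

end

context little_2_cubes_algebra
begin

lemma lifted_const:
  assumes "set xs \<subseteq> topspace X"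
  shows "lifted X \<theta> (\<lambda>i t. xs ! i) {..<length xs}"
  using assms nth_mem by unfold_locales (auto simp: pathin_const)

lemma pure_\<pi>:
  assumes x: "set [x, y, z, w] \<subseteq> topspace X"
  shows "pcell_lift X (Wt (\<lambda>_. 0) {..<4}) (evl [x, y, z, w]) (S.\<pi> x y z w) (tn (tn (tn (lf 0) (lf 1)) (lf 2)) (lf 3))
    [hten (hA (lf 0) (lf 1) (lf 2)) (hid (lf 3)), hA (lf 0) (tn (lf 1) (lf 2)) (lf 3), hten (hid (lf 0)) (hA (lf 1) (lf 2) (lf 3))]
    [hA (tn (lf 0) (lf 1)) (lf 2) (lf 3), hA (lf 0) (lf 1) (tn (lf 2) (lf 3))]"
proof -
  interpret P: lifted X \<theta> "(\<lambda>_. 0)" "\<lambda>i t. [x, y, z, w] ! i" "{..<4}"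
    using lifted_const[OF x] by (simp add: eval_nat_numeral)
  have o: "P.ob_lifted x (lf 0)" "P.ob_lifted y (lf 1)" "P.ob_lifted z (lf 2)" "P.ob_lifted w (lf 3)"
    using x by (auto simp: P.ob_lifted_def evl_lf)
  have d: "dom (tn (tn (tn (lf 0) (lf 1)) (lf 2)) (lf 3)) = {..<4}" by auto
  have "P.pcell_lifted (S.\<pi> x y z w) (tn (tn (tn (lf 0) (lf 1)) (lf 2)) (lf 3))
    [hten (hA (lf 0) (lf 1) (lf 2)) (hid (lf 3)), hA (lf 0) (tn (lf 1) (lf 2)) (lf 3), hten (hid (lf 0)) (hA (lf 1) (lf 2) (lf 3))]
    [hA (tn (lf 0) (lf 1)) (lf 2) (lf 3), hA (lf 0) (lf 1) (tn (lf 2) (lf 3))]"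
    unfolding S.\<pi>_def MM_sel SS_sel sqPi_def
    by (rule P.pcell_lifted_some_square) (rule o P.path_rules d | simp add: sep_def over_def )+
  then show ?thesis unfolding P.pcell_lifted_def d by (rule conjunct2)
qed

lemma pure_\<mu>:
  assumes x: "set [x, y] \<subseteq> topspace X"
  shows "pcell_lift X (Wt (\<lambda>_. 0) {..<2}) (evl [x, y]) (S.\<mu> x y) (tn (lf 0) (lf 1))
    [hten (hUb (lf 0)) (hid (lf 1)), hA (lf 0) Map.empty (lf 1), hten (hid (lf 0)) (hL (lf 1))]
    []"
proof -
  interpret P: lifted X \<theta> "(\<lambda>_. 0)" "\<lambda>i t. [x, y] ! i" "{..<2}"
    using lifted_const[OF x] by (simp add: eval_nat_numeral)
  have o: "P.ob_lifted x (lf 0)" "P.ob_lifted y (lf 1)"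
    using x by (auto simp: P.ob_lifted_def evl_lf)
  have d: "dom (tn (lf 0) (lf 1)) = {..<2}" by auto
  have "P.pcell_lifted (S.\<mu> x y) (tn (lf 0) (lf 1))
    [hten (hUb (lf 0)) (hid (lf 1)), hA (lf 0) Map.empty (lf 1), hten (hid (lf 0)) (hL (lf 1))]
    []"
    unfolding S.\<mu>_def MM_sel SS_sel sqMu_def
    by (rule P.pcell_lifted_some_square) (rule o P.path_rules d | simp add: sep_def over_def )+
  then show ?thesis unfolding P.pcell_lifted_def d by (rule conjunct2)
qed

lemma pure_lam:
  assumes x: "set [x, y] \<subseteq> topspace X"
  shows "pcell_lift X (Wt (\<lambda>_. 0) {..<2}) (evl [x, y]) (S.lam x y) (tn (tn Map.empty (lf 0)) (lf 1))
    [hten (hL (lf 0)) (hid (lf 1))]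
    [hA Map.empty (lf 0) (lf 1), hL (tn (lf 0) (lf 1))]"
proof -
  interpret P: lifted X \<theta> "(\<lambda>_. 0)" "\<lambda>i t. [x, y] ! i" "{..<2}"
    using lifted_const[OF x] by (simp add: eval_nat_numeral)
  have o: "P.ob_lifted x (lf 0)" "P.ob_lifted y (lf 1)"
    using x by (auto simp: P.ob_lifted_def evl_lf)
  have d: "dom (tn (tn Map.empty (lf 0)) (lf 1)) = {..<2}" by auto
  have "P.pcell_lifted (S.lam x y) (tn (tn Map.empty (lf 0)) (lf 1))
    [hten (hL (lf 0)) (hid (lf 1))]
    [hA Map.empty (lf 0) (lf 1), hL (tn (lf 0) (lf 1))]"
    unfolding S.lam_def MM_sel SS_sel sqLam_def
    by (rule P.pcell_lifted_some_square) (rule o P.path_rules d | simp add: sep_def over_def )+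
  then show ?thesis unfolding P.pcell_lifted_def d by (rule conjunct2)
qed

lemma pure_rho:
  assumes x: "set [x, y] \<subseteq> topspace X"
  shows "pcell_lift X (Wt (\<lambda>_. 0) {..<2}) (evl [x, y]) (S.rho x y) (tn (lf 0) (lf 1))
    [hten (hid (lf 0)) (hUb (lf 1))]
    [hUb (tn (lf 0) (lf 1)), hA (lf 0) (lf 1) Map.empty]"
proof -
  interpret P: lifted X \<theta> "(\<lambda>_. 0)" "\<lambda>i t. [x, y] ! i" "{..<2}"
    using lifted_const[OF x] by (simp add: eval_nat_numeral)
  have o: "P.ob_lifted x (lf 0)" "P.ob_lifted y (lf 1)"
    using x by (auto simp: P.ob_lifted_def evl_lf)
  have d: "dom (tn (lf 0) (lf 1)) = {..<2}" by auto
  have "P.pcell_lifted (S.rho x y) (tn (lf 0) (lf 1))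
    [hten (hid (lf 0)) (hUb (lf 1))]
    [hUb (tn (lf 0) (lf 1)), hA (lf 0) (lf 1) Map.empty]"
    unfolding S.rho_def MM_sel SS_sel sqRho_def
    by (rule P.pcell_lifted_some_square) (rule o P.path_rules d | simp add: sep_def over_def )+
  then show ?thesis unfolding P.pcell_lifted_def d by (rule conjunct2)
qed

lemma pure_R1:
  assumes x: "set [x, y, z] \<subseteq> topspace X"
  shows "pcell_lift X (Wt rk1 {..<3}) (evl [x, y, z]) (S.R1 x y z) (tn (tn (lf 0) (lf 1)) (lf 2))
    [hten (hR (lf 0) (lf 1)) (hid (lf 2)), hA (lf 1) (lf 0) (lf 2), hten (hid (lf 1)) (hR (lf 0) (lf 2))]
    [hA (lf 0) (lf 1) (lf 2), hR (lf 0) (tn (lf 1) (lf 2)), hA (lf 1) (lf 2) (lf 0)]"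
proof -
  interpret P: lifted X \<theta> "rk1" "\<lambda>i t. [x, y, z] ! i" "{..<3}"
    using lifted_const[OF x] by (simp add: eval_nat_numeral)
  have o: "P.ob_lifted x (lf 0)" "P.ob_lifted y (lf 1)" "P.ob_lifted z (lf 2)"
    using x by (auto simp: P.ob_lifted_def evl_lf)
  have d: "dom (tn (tn (lf 0) (lf 1)) (lf 2)) = {..<3}" by auto
  have "P.pcell_lifted (S.R1 x y z) (tn (tn (lf 0) (lf 1)) (lf 2))
    [hten (hR (lf 0) (lf 1)) (hid (lf 2)), hA (lf 1) (lf 0) (lf 2), hten (hid (lf 1)) (hR (lf 0) (lf 2))]
    [hA (lf 0) (lf 1) (lf 2), hR (lf 0) (tn (lf 1) (lf 2)), hA (lf 1) (lf 2) (lf 0)]"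
    unfolding S.R1_def MM_sel SS_sel sqR1_def
    by (rule P.pcell_lifted_some_square) (rule o P.path_rules d | simp add: sep_def over_def rk1_def)+
  then show ?thesis unfolding P.pcell_lifted_def d by (rule conjunct2)
qed

lemma pure_R2:
  assumes x: "set [x, y, z] \<subseteq> topspace X"
  shows "pcell_lift X (Wt rk2 {..<3}) (evl [x, y, z]) (S.R2 x y z) (tn (lf 0) (tn (lf 1) (lf 2)))
    [hten (hid (lf 0)) (hR (lf 1) (lf 2)), hB (lf 0) (lf 2) (lf 1), hten (hR (lf 0) (lf 2)) (hid (lf 1))]
    [hB (lf 0) (lf 1) (lf 2), hR (tn (lf 0) (lf 1)) (lf 2), hB (lf 2) (lf 0) (lf 1)]"
proof -
  interpret P: lifted X \<theta> "rk2" "\<lambda>i t. [x, y, z] ! i" "{..<3}"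
    using lifted_const[OF x] by (simp add: eval_nat_numeral)
  have o: "P.ob_lifted x (lf 0)" "P.ob_lifted y (lf 1)" "P.ob_lifted z (lf 2)"
    using x by (auto simp: P.ob_lifted_def evl_lf)
  have d: "dom (tn (lf 0) (tn (lf 1) (lf 2))) = {..<3}" by auto
  have "P.pcell_lifted (S.R2 x y z) (tn (lf 0) (tn (lf 1) (lf 2)))
    [hten (hid (lf 0)) (hR (lf 1) (lf 2)), hB (lf 0) (lf 2) (lf 1), hten (hR (lf 0) (lf 2)) (hid (lf 1))]
    [hB (lf 0) (lf 1) (lf 2), hR (tn (lf 0) (lf 1)) (lf 2), hB (lf 2) (lf 0) (lf 1)]"
    unfolding S.R2_def MM_sel SS_sel sqR2_def
    by (rule P.pcell_lifted_some_square) (rule o P.path_rules d | simp add: sep_def over_def rk2_def)+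
  then show ?thesis unfolding P.pcell_lifted_def d by (rule conjunct2)
qed

end

context lifted
begin

lemma pcell_lifted_\<pi>:
  assumes u: "ob_lifted x u" "ob_lifted y v" "ob_lifted z u'" "ob_lifted w v'"
    and s: "sep rk (dom u) (dom v)" "sep rk (dom u) (dom u')" "sep rk (dom u) (dom v')" "sep rk (dom v) (dom u')" "sep rk (dom v) (dom v')" "sep rk (dom u') (dom v')"
  shows "pcell_lifted (S.\<pi> x y z w) (tn (tn (tn u v) u') v')
    [hten (hA u v u') (hid v'), hA u (tn v u') v', hten (hid u) (hA v u' v')]
    [hA (tn u v) u' v', hA u v (tn u' v')]"
proof -
  have us: "list_all2 ob_lifted [x, y, z, w] [u, v, u', v']" using u by simp
  have f: "fits (\<lambda>_. 0) rk (map dom [u, v, u', v'])" using fits4[OF s] by simp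
  have l: "csub (lf 0) [u, v, u', v'] = u" "csub (lf 1) [u, v, u', v'] = v" "csub (lf 2) [u, v, u', v'] = u'" "csub (lf 3) [u, v, u', v'] = v'"
    using csub_lf[OF f] by simp_all
  have "set [x, y, z, w] \<subseteq> topspace X" using u by (simp add: ob_lifted_topspace)
  note K = pure_\<pi>[OF this]
  have n: "4 = length [u, v, u', v']" by simp
  show ?thesis
    using pcell_lifted_csub[OF us f K[unfolded n]] by (simp only: list.map csub_hats csub_tn csub_empty l)
qed

lemma pcell_lifted_\<mu>:
  assumes u: "ob_lifted x u" "ob_lifted y v"
    and s: "sep rk (dom u) (dom v)"
  shows "pcell_lifted (S.\<mu> x y) (tn u v)
    [hten (hUb u) (hid v), hA u Map.empty v, hten (hid u) (hL v)]
    []"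
proof -
  have us: "list_all2 ob_lifted [x, y] [u, v]" using u by simp
  have f: "fits (\<lambda>_. 0) rk (map dom [u, v])" using fits2[OF s] by simp
  have l: "csub (lf 0) [u, v] = u" "csub (lf 1) [u, v] = v"
    using csub_lf[OF f] by simp_all
  have "set [x, y] \<subseteq> topspace X" using u by (simp add: ob_lifted_topspace)
  note K = pure_\<mu>[OF this]
  have n: "2 = length [u, v]" by simp
  show ?thesis
    using pcell_lifted_csub[OF us f K[unfolded n]] by (simp only: list.map csub_hats csub_tn csub_empty l)
qed

lemma pcell_lifted_lam:
  assumes u: "ob_lifted x u" "ob_lifted y v"
    and s: "sep rk (dom u) (dom v)"
  shows "pcell_lifted (S.lam x y) (tn (tn Map.empty u) v)
    [hten (hL u) (hid v)]
    [hA Map.empty u v, hL (tn u v)]"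
proof -
  have us: "list_all2 ob_lifted [x, y] [u, v]" using u by simp
  have f: "fits (\<lambda>_. 0) rk (map dom [u, v])" using fits2[OF s] by simp
  have l: "csub (lf 0) [u, v] = u" "csub (lf 1) [u, v] = v"
    using csub_lf[OF f] by simp_all
  have "set [x, y] \<subseteq> topspace X" using u by (simp add: ob_lifted_topspace)
  note K = pure_lam[OF this]
  have n: "2 = length [u, v]" by simp
  show ?thesis
    using pcell_lifted_csub[OF us f K[unfolded n]] by (simp only: list.map csub_hats csub_tn csub_empty l)
qed

lemma pcell_lifted_rho:
  assumes u: "ob_lifted x u" "ob_lifted y v"
    and s: "sep rk (dom u) (dom v)"
  shows "pcell_lifted (S.rho x y) (tn u v)
    [hten (hid u) (hUb v)]
    [hUb (tn u v), hA u v Map.empty]"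
proof -
  have us: "list_all2 ob_lifted [x, y] [u, v]" using u by simp
  have f: "fits (\<lambda>_. 0) rk (map dom [u, v])" using fits2[OF s] by simp
  have l: "csub (lf 0) [u, v] = u" "csub (lf 1) [u, v] = v"
    using csub_lf[OF f] by simp_all
  have "set [x, y] \<subseteq> topspace X" using u by (simp add: ob_lifted_topspace)
  note K = pure_rho[OF this]
  have n: "2 = length [u, v]" by simp
  show ?thesis
    using pcell_lifted_csub[OF us f K[unfolded n]] by (simp only: list.map csub_hats csub_tn csub_empty l)
qed

lemma pcell_lifted_R1:
  assumes u: "ob_lifted x u" "ob_lifted y v" "ob_lifted z u'"
    and s: "over rk (dom u) (dom v)" "over rk (dom u) (dom u')" "sep rk (dom v) (dom u')"
  shows "pcell_lifted (S.R1 x y z) (tn (tn u v) u')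
    [hten (hR u v) (hid u'), hA v u u', hten (hid v) (hR u u')]
    [hA u v u', hR u (tn v u'), hA v u' u]"
proof -
  have us: "list_all2 ob_lifted [x, y, z] [u, v, u']" using u by simp
  have f: "fits rk1 rk (map dom [u, v, u'])" using fits_rk1[OF s] by simp
  have l: "csub (lf 0) [u, v, u'] = u" "csub (lf 1) [u, v, u'] = v" "csub (lf 2) [u, v, u'] = u'"
    using csub_lf[OF f] by simp_all
  have "set [x, y, z] \<subseteq> topspace X" using u by (simp add: ob_lifted_topspace)
  note K = pure_R1[OF this]
  have n: "3 = length [u, v, u']" by simp
  show ?thesis
    using pcell_lifted_csub[OF us f K[unfolded n]] by (simp only: list.map csub_hats csub_tn csub_empty l)
qed

lemma pcell_lifted_R2:
  assumes u: "ob_lifted x u" "ob_lifted y v" "ob_lifted z u'"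
    and s: "sep rk (dom u) (dom v)" "over rk (dom u) (dom u')" "over rk (dom v) (dom u')"
  shows "pcell_lifted (S.R2 x y z) (tn u (tn v u'))
    [hten (hid u) (hR v u'), hB u u' v, hten (hR u u') (hid v)]
    [hB u v u', hR (tn u v) u', hB u' u v]"
proof -
  have us: "list_all2 ob_lifted [x, y, z] [u, v, u']" using u by simp
  have f: "fits rk2 rk (map dom [u, v, u'])" using fits_rk2[OF s] by simp
  have l: "csub (lf 0) [u, v, u'] = u" "csub (lf 1) [u, v, u'] = v" "csub (lf 2) [u, v, u'] = u'"
    using csub_lf[OF f] by simp_all
  have "set [x, y, z] \<subseteq> topspace X" using u by (simp add: ob_lifted_topspace)
  note K = pure_R2[OF this]
  have n: "3 = length [u, v, u']" by simp
  show ?thesis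
    using pcell_lifted_csub[OF us f K[unfolded n]] by (simp only: list.map csub_hats csub_tn csub_empty l)
qed

lemmas cell_rules = pcell_lifted_inv pcell_lifted_lwh pcell_lifted_rwh pcell_lifted_\<eta> pcell_lifted_\<epsilon> pcell_lifted_\<pi>

lemma
  assumes u: "ob_lifted x u" "ob_lifted y v" "ob_lifted z u'" "ob_lifted w v'"
    and s: "sep rk (dom u) (dom v)" "sep rk (dom u) (dom u')" "sep rk (dom u) (dom v')"
      "sep rk (dom v) (dom u')" "sep rk (dom v) (dom v')" "sep rk (dom u') (dom v')"
  shows pcell_lifted_\<pi>1: "pcell_lifted (S.\<pi>1 x y z w) (tn u (tn v (tn u' v')))
      [hten (hid u) (hB v u' v'), hB u (tn v u') v', hten (hB u v u') (hid v')] [hB u v (tn u' v'), hB (tn u v) u' v']"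
    and pcell_lifted_\<pi>2: "pcell_lifted (S.\<pi>2 x y z w) (tn (tn u v) (tn u' v'))
      [hB (tn u v) u' v', hten (hA u v u') (hid v')] [hA u v (tn u' v'), hten (hid u) (hB v u' v'), hB u (tn v u') v']"
    and pcell_lifted_\<pi>3: "pcell_lifted (S.\<pi>3 x y z w) (tn (tn u v) (tn u' v'))
      [hA u v (tn u' v'), hten (hid u) (hB v u' v')] [hB (tn u v) u' v', hten (hA u v u') (hid v'), hA u (tn v u') v']"
    and pcell_lifted_\<pi>4: "pcell_lifted (S.\<pi>4 x y z w) (tn (tn u (tn v u')) v')
      [hten (hB u v u') (hid v'), hA (tn u v) u' v'] [hA u (tn v u') v', hten (hid u) (hA v u' v'), hB u v (tn u' v')]"
proof -
  show "pcell_lifted (S.\<pi>1 x y z w) (tn u (tn v (tn u' v')))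
      [hten (hid u) (hB v u' v'), hB u (tn v u') v', hten (hB u v u') (hid v')] [hB u v (tn u' v'), hB (tn u v) u' v']"
    unfolding S.\<pi>1_def
    by (rule pcell_lifted_paste) (rule u path_rules steps_lifted_Nil steps_lifted_Cons cell_rules | simp add: sep_Un s)+
  show "pcell_lifted (S.\<pi>2 x y z w) (tn (tn u v) (tn u' v'))
      [hB (tn u v) u' v', hten (hA u v u') (hid v')] [hA u v (tn u' v'), hten (hid u) (hB v u' v'), hB u (tn v u') v']"
    unfolding S.\<pi>2_def
    by (rule pcell_lifted_paste) (rule u path_rules steps_lifted_Nil steps_lifted_Cons cell_rules | simp add: sep_Un s)+
  show "pcell_lifted (S.\<pi>3 x y z w) (tn (tn u v) (tn u' v'))
      [hA u v (tn u' v'), hten (hid u) (hB v u' v')] [hB (tn u v) u' v', hten (hA u v u') (hid v'), hA u (tn v u') v']"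
    unfolding S.\<pi>3_def
    by (rule pcell_lifted_paste) (rule u path_rules steps_lifted_Nil steps_lifted_Cons cell_rules | simp add: sep_Un s)+
  show "pcell_lifted (S.\<pi>4 x y z w) (tn (tn u (tn v u')) v')
      [hten (hB u v u') (hid v'), hA (tn u v) u' v'] [hA u (tn v u') v', hten (hid u) (hA v u' v'), hB u v (tn u' v')]"
    unfolding S.\<pi>4_def
    by (rule pcell_lifted_paste) (rule u path_rules steps_lifted_Nil steps_lifted_Cons cell_rules | simp add: sep_Un s)+
qed

end

context lifted
begin

lemmas all_rules = path_rules steps_lifted_Nil steps_lifted_Cons pcell_lifted_paste pcell_lifted_inv pcell_lifted_lwh pcell_lifted_rwh pcell_lifted_tenp pcell_lifted_sl pcell_lifted_fuse_l pcell_lifted_fuse_r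
  pcell_lifted_nat_ab pcell_lifted_nat_l pcell_lifted_nat_rb pcell_lifted_nat_R pcell_lifted_\<eta> pcell_lifted_\<epsilon> pcell_lifted_\<pi> pcell_lifted_\<mu> pcell_lifted_lam pcell_lifted_rho pcell_lifted_R1 pcell_lifted_R2 pcell_lifted_\<pi>1 pcell_lifted_\<pi>2 pcell_lifted_\<pi>3 pcell_lifted_\<pi>4

lemma
  assumes i: "i \<in> S" and f: "f = \<phi> i" "f \<in> extensional I1"
  shows path_lifted_leaf: "path_lifted f (leaf i)" and ob_lifted_leaf: "ob_lifted (f 0) (lf i)" "ob_lifted (f 1) (leaf i 1)"
proof -
  have e: "ev \<phi> (leaf i t) = \<phi> i t" if "t \<in> I1" for t
    by (rule ev_leaf) (use pathin_topspace[OF \<phi>[OF i] that] in simp)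
  show path_lifted: "path_lifted f (leaf i)"
  proof (rule path_liftedI)
    show "pathin (Wt rk {i}) (leaf i)"
      unfolding pathin_def continuous_map_Wt
    proof (intro conjI ballI)
      show "continuous_map (top_of_set I1) euclidean (\<lambda>t. the (leaf i t j))" if "j \<in> {i}" for j
        using that by (auto simp: leaf_def intro!: continuous_intros)
    qed (auto simp: valid_leaf)
    show "f = push (ev \<phi>) (leaf i)"
      using f e by (auto simp: push_def fun_eq_iff extensional_def)
  qed (use i in simp)
  show "ob_lifted (f 0) (lf i)" "ob_lifted (f 1) (leaf i 1)"
    using path_lifted_at[OF path_lifted, of 0] path_lifted_at[OF path_lifted, of 1] by simp_all
qed

end

context little_2_cubes_algebra
begin

lemma pcell_sel:
  "org (S.\<pi> x y z w) = F0 (Tensor MM) (F0 (Tensor MM) (F0 (Tensor MM) (x, y), z), w)"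
  "top_path (S.\<pi> x y z w) = [F1 (Tensor MM) (S.a x y z, Id1 (Pi2 X) w), S.a x (F0 (Tensor MM) (y, z)) w,
     F1 (Tensor MM) (Id1 (Pi2 X) x, S.a y z w)]"
  "org (S.\<mu> x y) = F0 (Tensor MM) (x, y)"
  "top_path (S.\<mu> x y) = [F1 (Tensor MM) (S.rb x, Id1 (Pi2 X) y), S.a x (Unit MM) y, F1 (Tensor MM) (Id1 (Pi2 X) x, S.l y)]"
  "org (S.lam x y) = F0 (Tensor MM) (F0 (Tensor MM) (Unit MM, x), y)"
  "top_path (S.lam x y) = [F1 (Tensor MM) (S.l x, Id1 (Pi2 X) y)]"
  "org (S.rho x y) = F0 (Tensor MM) (x, y)"
  "top_path (S.rho x y) = [F1 (Tensor MM) (Id1 (Pi2 X) x, S.rb y)]"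
  "org (S.R1 x y z) = F0 (Tensor MM) (F0 (Tensor MM) (x, y), z)"
  "top_path (S.R1 x y z) = [F1 (Tensor MM) (S.R x y, Id1 (Pi2 X) z), S.a y x z, F1 (Tensor MM) (Id1 (Pi2 X) y, S.R x z)]"
  "org (S.R2 x y z) = F0 (Tensor MM) (x, F0 (Tensor MM) (y, z))"
  "top_path (S.R2 x y z) = [F1 (Tensor MM) (Id1 (Pi2 X) x, S.R y z), S.b x z y, F1 (Tensor MM) (S.R x z, Id1 (Pi2 X) y)]"
  by (simp_all add: S.\<pi>_def S.\<mu>_def S.lam_def S.rho_def S.R1_def S.R2_def del: Pi2_simps)

lemma slides_simps: "slides [] f = []" "slides [s] f = [(0, s f)]" "slides [s, s'] f = [(1, s' f), (0, s f)]"
  "slides [s, s', s''] f = [(2, s'' f), (1, s' f), (0, s f)]"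
  by (simp_all add: slides_def)

lemma lifted_paths: "set fs \<subseteq> paths X \<Longrightarrow> lifted X \<theta> (\<lambda>i. fs ! i) {..<length fs}"
  using nth_mem by unfold_locales (auto simp: paths_def)

lemma Src_Trg_Pi2: "Src (Pi2 X) f = f 0" "Trg (Pi2 X) f = f 1" by simp_all

lemma pi_modification:
  "inv_modification S.B4 BB
      (\<lambda>(f, g, h, k). S.ten1 f (S.ten1 g (S.ten1 h k)))
      [\<lambda>(f, g, h, k). S.tenp (S.nat_a f g h) (S.sl k),
       \<lambda>(f, g, h, k). S.nat_a f (S.ten1 g h) k,
       \<lambda>(f, g, h, k). S.tenp (S.sl f) (S.nat_a g h k)]
      [\<lambda>(f, g, h, k). S.nat_a (S.ten1 f g) h k,
       \<lambda>(f, g, h, k). S.nat_a f g (S.ten1 h k)]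
      (\<lambda>(x, y, z, w). S.\<pi> x y z w)"
  unfolding inv_modification_def Let_def slides_simps
proof (intro conjI ballI, unfold split_paired_all prod_bicat_simps prod.case, goal_cases)
  case (1 x y z w)
  then have x: "set [x, y, z, w] \<subseteq> topspace X" by simp
  interpret P: lifted X \<theta> "\<lambda>i. i" "\<lambda>i t. [x, y, z, w] ! i" "{..<4}"
    using lifted_const[of "[x, y, z, w]"] x by (simp add: eval_nat_numeral)
  have o: "P.ob_lifted x (lf 0)" "P.ob_lifted y (lf 1)" "P.ob_lifted z (lf 2)" "P.ob_lifted w (lf 3)"
    using x by (simp_all add: P.ob_lifted_def evl_lf)
  show ?case by (rule P.pcell_lifted_iso) (rule o P.all_rules | simp add: sep_def over_def)+
next
  case (2 f g h k)
  then have f: "set [f, g, h, k] \<subseteq> paths X" by simp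
  then have e: "f \<in> extensional I1" "g \<in> extensional I1" "h \<in> extensional I1" "k \<in> extensional I1" by (simp_all add: paths_def)
  interpret P: lifted X \<theta> "\<lambda>i. i" "\<lambda>i. [f, g, h, k] ! i" "{..<4}"
    using lifted_paths[of "[f, g, h, k]"] f by (simp add: eval_nat_numeral)
  have o: "P.path_lifted f (leaf 0)" "P.ob_lifted (f 0) (lf 0)" "P.ob_lifted (f 1) (leaf 0 1)" "P.path_lifted g (leaf 1)" "P.ob_lifted (g 0) (lf 1)" "P.ob_lifted (g 1) (leaf 1 1)" "P.path_lifted h (leaf 2)" "P.ob_lifted (h 0) (lf 2)" "P.ob_lifted (h 1) (leaf 2 1)" "P.path_lifted k (leaf 3)" "P.ob_lifted (k 0) (lf 3)" "P.ob_lifted (k 1) (leaf 3 1)"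
    by (rule P.path_lifted_leaf P.ob_lifted_leaf; use e in simp)+
  show ?case
    unfolding pcell_sel append_Cons append_Nil Src_Trg_Pi2
    by (rule P.pcell_lifted_unique) (rule o P.all_rules | simp add: sep_def over_def)+
qed

lemma mu_modification:
  "inv_modification (Pi2 X \<times>\<^sub>b Pi2 X) BB
      (\<lambda>(f, g). S.ten1 f g)
      [\<lambda>(f, g). S.tenp (S.nat_rb f) (S.sl g),
       \<lambda>(f, g). S.nat_a f (S.id1 S.I) g,
       \<lambda>(f, g). S.tenp (S.sl f) (S.nat_l g)]
      []
      (\<lambda>(x, y). S.\<mu> x y)"
  unfolding inv_modification_def Let_def slides_simps
proof (intro conjI ballI, unfold split_paired_all prod_bicat_simps prod.case, goal_cases)
  case (1 x y)
  then have x: "set [x, y] \<subseteq> topspace X" by simp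
  interpret P: lifted X \<theta> "\<lambda>i. i" "\<lambda>i t. [x, y] ! i" "{..<2}"
    using lifted_const[of "[x, y]"] x by (simp add: eval_nat_numeral)
  have o: "P.ob_lifted x (lf 0)" "P.ob_lifted y (lf 1)"
    using x by (simp_all add: P.ob_lifted_def evl_lf)
  show ?case by (rule P.pcell_lifted_iso) (rule o P.all_rules | simp add: sep_def over_def)+
next
  case (2 f g)
  then have f: "set [f, g] \<subseteq> paths X" by simp
  then have e: "f \<in> extensional I1" "g \<in> extensional I1" by (simp_all add: paths_def)
  interpret P: lifted X \<theta> "\<lambda>i. i" "\<lambda>i. [f, g] ! i" "{..<2}"
    using lifted_paths[of "[f, g]"] f by (simp add: eval_nat_numeral)
  have o: "P.path_lifted f (leaf 0)" "P.ob_lifted (f 0) (lf 0)" "P.ob_lifted (f 1) (leaf 0 1)" "P.path_lifted g (leaf 1)" "P.ob_lifted (g 0) (lf 1)" "P.ob_lifted (g 1) (leaf 1 1)"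
    by (rule P.path_lifted_leaf P.ob_lifted_leaf; use e in simp)+
  show ?case
    unfolding pcell_sel append_Cons append_Nil Src_Trg_Pi2
    by (rule P.pcell_lifted_unique) (rule o P.all_rules | simp add: sep_def over_def)+
qed

lemma lambda_modification:
  "inv_modification (Pi2 X \<times>\<^sub>b Pi2 X) BB
      (\<lambda>(f, g). S.ten1 f g)
      [\<lambda>(f, g). S.tenp (S.nat_l f) (S.sl g)]
      [\<lambda>(f, g). S.nat_a (S.id1 S.I) f g,
       \<lambda>(f, g). S.nat_l (S.ten1 f g)]
      (\<lambda>(x, y). S.lam x y)"
  unfolding inv_modification_def Let_def slides_simps
proof (intro conjI ballI, unfold split_paired_all prod_bicat_simps prod.case, goal_cases)
  case (1 x y)
  then have x: "set [x, y] \<subseteq> topspace X" by simp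
  interpret P: lifted X \<theta> "\<lambda>i. i" "\<lambda>i t. [x, y] ! i" "{..<2}"
    using lifted_const[of "[x, y]"] x by (simp add: eval_nat_numeral)
  have o: "P.ob_lifted x (lf 0)" "P.ob_lifted y (lf 1)"
    using x by (simp_all add: P.ob_lifted_def evl_lf)
  show ?case by (rule P.pcell_lifted_iso) (rule o P.all_rules | simp add: sep_def over_def)+
next
  case (2 f g)
  then have f: "set [f, g] \<subseteq> paths X" by simp
  then have e: "f \<in> extensional I1" "g \<in> extensional I1" by (simp_all add: paths_def)
  interpret P: lifted X \<theta> "\<lambda>i. i" "\<lambda>i. [f, g] ! i" "{..<2}"
    using lifted_paths[of "[f, g]"] f by (simp add: eval_nat_numeral)
  have o: "P.path_lifted f (leaf 0)" "P.ob_lifted (f 0) (lf 0)" "P.ob_lifted (f 1) (leaf 0 1)" "P.path_lifted g (leaf 1)" "P.ob_lifted (g 0) (lf 1)" "P.ob_lifted (g 1) (leaf 1 1)"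
    by (rule P.path_lifted_leaf P.ob_lifted_leaf; use e in simp)+
  show ?case
    unfolding pcell_sel append_Cons append_Nil Src_Trg_Pi2
    by (rule P.pcell_lifted_unique) (rule o P.all_rules | simp add: sep_def over_def)+
qed

lemma rho_modification:
  "inv_modification (Pi2 X \<times>\<^sub>b Pi2 X) BB
      (\<lambda>(f, g). S.ten1 f (S.ten1 g (S.id1 S.I)))
      [\<lambda>(f, g). S.tenp (S.sl f) (S.nat_rb g)]
      [\<lambda>(f, g). S.nat_rb (S.ten1 f g),
       \<lambda>(f, g). S.nat_a f g (S.id1 S.I)]
      (\<lambda>(x, y). S.rho x y)"
  unfolding inv_modification_def Let_def slides_simps
proof (intro conjI ballI, unfold split_paired_all prod_bicat_simps prod.case, goal_cases)
  case (1 x y)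
  then have x: "set [x, y] \<subseteq> topspace X" by simp
  interpret P: lifted X \<theta> "\<lambda>i. i" "\<lambda>i t. [x, y] ! i" "{..<2}"
    using lifted_const[of "[x, y]"] x by (simp add: eval_nat_numeral)
  have o: "P.ob_lifted x (lf 0)" "P.ob_lifted y (lf 1)"
    using x by (simp_all add: P.ob_lifted_def evl_lf)
  show ?case by (rule P.pcell_lifted_iso) (rule o P.all_rules | simp add: sep_def over_def)+
next
  case (2 f g)
  then have f: "set [f, g] \<subseteq> paths X" by simp
  then have e: "f \<in> extensional I1" "g \<in> extensional I1" by (simp_all add: paths_def)
  interpret P: lifted X \<theta> "\<lambda>i. i" "\<lambda>i. [f, g] ! i" "{..<2}"
    using lifted_paths[of "[f, g]"] f by (simp add: eval_nat_numeral)
  have o: "P.path_lifted f (leaf 0)" "P.ob_lifted (f 0) (lf 0)" "P.ob_lifted (f 1) (leaf 0 1)" "P.path_lifted g (leaf 1)" "P.ob_lifted (g 0) (lf 1)" "P.ob_lifted (g 1) (leaf 1 1)"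
    by (rule P.path_lifted_leaf P.ob_lifted_leaf; use e in simp)+
  show ?case
    unfolding pcell_sel append_Cons append_Nil Src_Trg_Pi2
    by (rule P.pcell_lifted_unique) (rule o P.all_rules | simp add: sep_def over_def)+
qed

lemma R1_modification:
  "inv_modification S.B3 BB
      (\<lambda>(f, g, h). S.ten1 g (S.ten1 h f))
      [\<lambda>(f, g, h). S.tenp (S.nat_R f g) (S.sl h),
       \<lambda>(f, g, h). S.nat_a g f h,
       \<lambda>(f, g, h). S.tenp (S.sl g) (S.nat_R f h)]
      [\<lambda>(f, g, h). S.nat_a f g h,
       \<lambda>(f, g, h). S.nat_R f (S.ten1 g h),
       \<lambda>(f, g, h). S.nat_a g h f]
      (\<lambda>(x, y, z). S.R1 x y z)"
  unfolding inv_modification_def Let_def slides_simps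
proof (intro conjI ballI, unfold split_paired_all prod_bicat_simps prod.case, goal_cases)
  case (1 x y z)
  then have x: "set [x, y, z] \<subseteq> topspace X" by simp
  interpret P: lifted X \<theta> "\<lambda>i. i" "\<lambda>i t. [x, y, z] ! i" "{..<3}"
    using lifted_const[of "[x, y, z]"] x by (simp add: eval_nat_numeral)
  have o: "P.ob_lifted x (lf 0)" "P.ob_lifted y (lf 1)" "P.ob_lifted z (lf 2)"
    using x by (simp_all add: P.ob_lifted_def evl_lf)
  show ?case by (rule P.pcell_lifted_iso) (rule o P.all_rules | simp add: sep_def over_def)+
next
  case (2 f g h)
  then have f: "set [f, g, h] \<subseteq> paths X" by simp
  then have e: "f \<in> extensional I1" "g \<in> extensional I1" "h \<in> extensional I1" by (simp_all add: paths_def)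
  interpret P: lifted X \<theta> "\<lambda>i. i" "\<lambda>i. [f, g, h] ! i" "{..<3}"
    using lifted_paths[of "[f, g, h]"] f by (simp add: eval_nat_numeral)
  have o: "P.path_lifted f (leaf 0)" "P.ob_lifted (f 0) (lf 0)" "P.ob_lifted (f 1) (leaf 0 1)" "P.path_lifted g (leaf 1)" "P.ob_lifted (g 0) (lf 1)" "P.ob_lifted (g 1) (leaf 1 1)" "P.path_lifted h (leaf 2)" "P.ob_lifted (h 0) (lf 2)" "P.ob_lifted (h 1) (leaf 2 1)"
    by (rule P.path_lifted_leaf P.ob_lifted_leaf; use e in simp)+
  show ?case
    unfolding pcell_sel append_Cons append_Nil Src_Trg_Pi2
    by (rule P.pcell_lifted_unique) (rule o P.all_rules | simp add: sep_def over_def)+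
qed

lemma R2_modification:
  "inv_modification S.B3 BB
      (\<lambda>(f, g, h). S.ten1 (S.ten1 h f) g)
      [\<lambda>(f, g, h). S.tenp (S.sl f) (S.nat_R g h),
       \<lambda>(f, g, h). S.nat_b f h g,
       \<lambda>(f, g, h). S.tenp (S.nat_R f h) (S.sl g)]
      [\<lambda>(f, g, h). S.nat_b f g h,
       \<lambda>(f, g, h). S.nat_R (S.ten1 f g) h,
       \<lambda>(f, g, h). S.nat_b h f g]
      (\<lambda>(x, y, z). S.R2 x y z)"
  unfolding inv_modification_def Let_def slides_simps
proof (intro conjI ballI, unfold split_paired_all prod_bicat_simps prod.case, goal_cases)
  case (1 x y z)
  then have x: "set [x, y, z] \<subseteq> topspace X" by simp
  interpret P: lifted X \<theta> "\<lambda>i. i" "\<lambda>i t. [x, y, z] ! i" "{..<3}"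
    using lifted_const[of "[x, y, z]"] x by (simp add: eval_nat_numeral)
  have o: "P.ob_lifted x (lf 0)" "P.ob_lifted y (lf 1)" "P.ob_lifted z (lf 2)"
    using x by (simp_all add: P.ob_lifted_def evl_lf)
  show ?case by (rule P.pcell_lifted_iso) (rule o P.all_rules | simp add: sep_def over_def)+
next
  case (2 f g h)
  then have f: "set [f, g, h] \<subseteq> paths X" by simp
  then have e: "f \<in> extensional I1" "g \<in> extensional I1" "h \<in> extensional I1" by (simp_all add: paths_def)
  interpret P: lifted X \<theta> "\<lambda>i. i" "\<lambda>i. [f, g, h] ! i" "{..<3}"
    using lifted_paths[of "[f, g, h]"] f by (simp add: eval_nat_numeral)
  have o: "P.path_lifted f (leaf 0)" "P.ob_lifted (f 0) (lf 0)" "P.ob_lifted (f 1) (leaf 0 1)" "P.path_lifted g (leaf 1)" "P.ob_lifted (g 0) (lf 1)" "P.ob_lifted (g 1) (leaf 1 1)" "P.path_lifted h (leaf 2)" "P.ob_lifted (h 0) (lf 2)" "P.ob_lifted (h 1) (leaf 2 1)"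
    by (rule P.path_lifted_leaf P.ob_lifted_leaf; use e in simp)+
  show ?case
    unfolding pcell_sel append_Cons append_Nil Src_Trg_Pi2
    by (rule P.pcell_lifted_unique) (rule o P.all_rules | simp add: sep_def over_def)+
qed

lemma monoidal: "monoidal_bicategory BB MM"
proof (intro monoidal_bicategory.intro monoidal_bicategory_axioms.intro, goal_cases)
  case 1 show ?case by (rule bicategory_Pi2)
next
  case 2 show ?case by (rule strict_pf.pseudofunctor[OF strict_Tensor bicat(2) bicategory_Pi2])
next
  case 3 show ?case using Unit_in by simp
next
  case 4 show ?case unfolding MM_sel by (rule homotopy_pf.adjoint_equivalence[OF homotopy_A])
next
  case 5 show ?case unfolding MM_sel by (rule homotopy_pf.adjoint_equivalence[OF homotopy_L])
next
  case 6 show ?case unfolding MM_sel by (rule homotopy_pf.adjoint_equivalence[OF homotopy_U])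
next
  case 7 show ?case by (rule pi_modification)
next
  case 8 show ?case by (rule mu_modification)
next
  case 9 show ?case by (rule lambda_modification)
next
  case 10 show ?case by (rule rho_modification)
next
  case (11 x y z w v)
  then have x: "set [x, y, z, w, v] \<subseteq> topspace X" by simp
  interpret P: lifted X \<theta> "\<lambda>i. i" "\<lambda>i t. [x, y, z, w, v] ! i" "{..<5}"
    using lifted_const[of "[x, y, z, w, v]"] x by (simp add: eval_nat_numeral)
  have o: "P.ob_lifted x (lf 0)" "P.ob_lifted y (lf 1)" "P.ob_lifted z (lf 2)" "P.ob_lifted w (lf 3)" "P.ob_lifted v (lf 4)"
    using x by (simp_all add: P.ob_lifted_def evl_lf)
  show ?case
    unfolding Let_def by (rule P.pcell_lifted_unique) (rule o P.all_rules | simp add: sep_def over_def)+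
next
  case (12 x y z)
  then have x: "set [x, y, z] \<subseteq> topspace X" by simp
  interpret P: lifted X \<theta> "\<lambda>i. i" "\<lambda>i t. [x, y, z] ! i" "{..<3}"
    using lifted_const[of "[x, y, z]"] x by (simp add: eval_nat_numeral)
  have o: "P.ob_lifted x (lf 0)" "P.ob_lifted y (lf 1)" "P.ob_lifted z (lf 2)"
    using x by (simp_all add: P.ob_lifted_def evl_lf)
  show ?case
    unfolding Let_def by (rule P.pcell_lifted_unique) (rule o P.all_rules | simp add: sep_def over_def)+
next
  case (13 x y z)
  then have x: "set [x, y, z] \<subseteq> topspace X" by simp
  interpret P: lifted X \<theta> "\<lambda>i. i" "\<lambda>i t. [x, y, z] ! i" "{..<3}"
    using lifted_const[of "[x, y, z]"] x by (simp add: eval_nat_numeral)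
  have o: "P.ob_lifted x (lf 0)" "P.ob_lifted y (lf 1)" "P.ob_lifted z (lf 2)"
    using x by (simp_all add: P.ob_lifted_def evl_lf)
  show ?case
    unfolding Let_def by (rule P.pcell_lifted_unique) (rule o P.all_rules | simp add: sep_def over_def)+
qed

lemma braided: "braided_monoidal_bicategory BB MM SS"
proof (intro braided_monoidal_bicategory.intro braided_monoidal_bicategory_axioms.intro monoidal, goal_cases)
  case 1 show ?case unfolding SS_sel by (rule homotopy_pf.adjoint_equivalence[OF homotopy_R])
next
  case 2 show ?case by (rule R1_modification)
next
  case 3 show ?case by (rule R2_modification)
next
  case (4 A B C D)
  then have x: "set [A, B, C, D] \<subseteq> topspace X" by simp
  interpret P: lifted X \<theta> "\<lambda>i. i" "\<lambda>i t. [A, B, C, D] ! i" "{..<4}"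
    using lifted_const[of "[A, B, C, D]"] x by (simp add: eval_nat_numeral)
  have o: "P.ob_lifted A (lf 0)" "P.ob_lifted B (lf 1)" "P.ob_lifted C (lf 2)" "P.ob_lifted D (lf 3)"
    using x by (simp_all add: P.ob_lifted_def evl_lf)
  show ?case
    unfolding Let_def by (rule P.pcell_lifted_unique) (rule o P.all_rules | simp add: sep_def over_def)+
next
  case (5 A B C D)
  then have x: "set [A, B, C, D] \<subseteq> topspace X" by simp
  interpret P: lifted X \<theta> "\<lambda>i. i" "\<lambda>i t. [A, B, C, D] ! i" "{..<4}"
    using lifted_const[of "[A, B, C, D]"] x by (simp add: eval_nat_numeral)
  have o: "P.ob_lifted A (lf 0)" "P.ob_lifted B (lf 1)" "P.ob_lifted C (lf 2)" "P.ob_lifted D (lf 3)"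
    using x by (simp_all add: P.ob_lifted_def evl_lf)
  show ?case
    unfolding Let_def by (rule P.pcell_lifted_unique) (rule o P.all_rules | simp add: sep_def over_def)+
next
  case (6 A B C D)
  then have x: "set [A, B, C, D] \<subseteq> topspace X" by simp
  interpret P: lifted X \<theta> "\<lambda>i. i" "\<lambda>i t. [A, B, C, D] ! i" "{..<4}"
    using lifted_const[of "[A, B, C, D]"] x by (simp add: eval_nat_numeral)
  have o: "P.ob_lifted A (lf 0)" "P.ob_lifted B (lf 1)" "P.ob_lifted C (lf 2)" "P.ob_lifted D (lf 3)"
    using x by (simp_all add: P.ob_lifted_def evl_lf)
  show ?case
    unfolding Let_def by (rule P.pcell_lifted_unique) (rule o P.all_rules | simp add: sep_def over_def)+
next
  case (7 A B C)
  then have x: "set [A, B, C] \<subseteq> topspace X" by simp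
  interpret P: lifted X \<theta> "\<lambda>i. i" "\<lambda>i t. [A, B, C] ! i" "{..<3}"
    using lifted_const[of "[A, B, C]"] x by (simp add: eval_nat_numeral)
  have o: "P.ob_lifted A (lf 0)" "P.ob_lifted B (lf 1)" "P.ob_lifted C (lf 2)"
    using x by (simp_all add: P.ob_lifted_def evl_lf)
  show ?case
    unfolding Let_def by (rule P.pcell_lifted_unique) (rule o P.all_rules | simp add: sep_def over_def)+
qed

end

theorem theorem15:
  fixes X :: "'a topology"
    and \<theta> :: "nat \<Rightarrow> (nat \<Rightarrow> cube) \<Rightarrow> (nat \<Rightarrow> 'a) \<Rightarrow> 'a"
  assumes "little_2_cubes_algebra X \<theta>"
  shows "\<exists>M S. braided_monoidal_bicategory (Pi2 X) M S"
  using little_2_cubes_algebra.braided[OF assms] by blast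

end
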